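(* In the setting described in the context, let $\rho_n\in C(\overline\Gamma)$ and consider the simple-layer potential $v_n(x)=\int_\Gamma\rho_n(\xi)q_n(\xi;x)\,d_\xi\Gamma$. For $t\in\Gamma$ with outer normal $N$ at $t$, let $B^\alpha_{Nt}[v_n(t)]_i$ and $B^\alpha_{Nt}[v_n(t)]_e$ denote the limiting values at $t$ of the conormal derivative $B^\alpha_{Nx}[v_n(x)]$ as $x$ approaches $t$ along the normal at $t$ from inside $\Omega$ and from outside $\Omega$, respectively. Then $$B^\alpha_{Nt}[v_n(t)]_i=\tfrac12\rho_n(t)+\int_\Gamma\rho_n(s)K_n(s;t)\,d_s\Gamma,\qquad B^\alpha_{Nt}[v_n(t)]_e=-\tfrac12\rho_n(t)+\int_\Gamma\rho_n(s)K_n(s;t)\,d_s\Gamma,$$ where $K_n(s;t)=B^\alpha_{Nt}[q_n(s;t)]$ for $s,t\in\Gamma$ (conormal derivative in $t$ along the normal at $t$).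
   Context: Let $m>2$ and $1\le n\le m$ be integers, $K=\{1,\dots,n\}$, $\alpha=(\alpha_1,\dots,\alpha_n)$ real with $0<2\alpha_k<1$, $\mathbb R_m^{n+}=\{x\in\mathbb R^m:x_1>0,\dots,x_n>0\}$. Lauricella's function: $F_A^{(n)}[a,b_1,\dots,b_n;c_1,\dots,c_n;y]=\sum_{m_1,\dots,m_n\ge0}\frac{(a)_{m_1+\dots+m_n}(b_1)_{m_1}\cdots(b_n)_{m_n}}{(c_1)_{m_1}\cdots(c_n)_{m_n}}\prod_k\frac{y_k^{m_k}}{m_k!}$. Put $\bar\alpha_n=\frac{m-2}{2}+\sum_{k=1}^n(1-\alpha_k)$, $\kappa_n=2^{2\bar\alpha_n-m}\frac{\Gamma(\bar\alpha_n)}{\pi^{m/2}}\prod_{k=1}^n\frac{\Gamma(1-\alpha_k)}{\Gamma(2-2\alpha_k)}$, $r^2=\sum_{i=1}^m(\xi_i-x_i)^2$, $r_k^2=(\xi_k+x_k)^2+\sum_{i\ne k}(\xi_i-x_i)^2$, $\sigma_k=1-r_k^2/r^2$, and $q_n(\xi;x)=\kappa_n r^{-2\bar\alpha_n}\prod_{k=1}^n(\xi_kx_k)^{1-2\alpha_k}F_A^{(n)}[\bar\alpha_n,1-\alpha_1,\dots,1-\alpha_n;2-2\alpha_1,\dots,2-2\alpha_n;\sigma_1,\dots,\sigma_n]$, a fundamental solution of $\sum_i u_{x_ix_i}+\sum_k\frac{2\alpha_k}{x_k}u_{x_k}=0$. Conormal derivative with respect to $x$ for a unit vector $N$: $B^\alpha_{Nx}[f]=\big(\prod_{k=1}^nx_k^{2\alpha_k}\big)\sum_{i=1}^m\frac{\partial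 f}{\partial x_i}\cos(N,x_i)$. $\Gamma$ is a surface in $\mathbb R_m^{n+}$ which together with the hyperplanes $x_1=0,\dots,x_n=0$ bounds a finite domain $\Omega\subset\mathbb R_m^{n+}$; $\Gamma$ is a Lyapunov surface: (i) definite normal at every point; (ii) constants $a,\kappa>0$ with angle between normals at $x,\xi\in\Gamma$ at most $a|x-\xi|^\kappa$; (iii) $\Gamma$ meets the hyperplanes $x_k=0$ at right angles. $N$ is the outer normal to $\Gamma$ with respect to $\Omega$.
   Formalization: The series for Lauricella's function F_A diverges at the arguments σ_k (unbounded below near ξ=x), so F_A in q_n is taken to be its Euler integral over [0,1]^n, the standard analytic continuation, which agrees with the series where that converges. *)

theory Defs
  imports "HOL-Analysis.Analysis"
begin

definition hausdorff_outer :: "real \<Rightarrow> ('a::metric_space) set \<Rightarrow> ennreal" where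
  "hausdorff_outer s A =
     (SUP \<delta>\<in>{0<..}. INF C\<in>{C :: nat \<Rightarrow> 'a set. A \<subseteq> (\<Union>i. C i) \<and>
                                 (\<forall>i. bounded (C i) \<and> diameter (C i) \<le> \<delta>)}.
        (\<Sum>i. ennreal (unit_ball_vol s * (diameter (C i) / 2) powr s)))"

definition hausdorff_measure :: "real \<Rightarrow> ('a::metric_space) measure" where
  "hausdorff_measure s = measure_of UNIV (sets borel) (hausdorff_outer s)"

definition surface_measure :: "(real^'m::finite) measure" where
  "surface_measure = hausdorff_measure (real CARD('m) - 1)"

text \<open>The defining series (for reference; converges for \<open>\<Sum>|y_k| < 1\<close>).\<close>
definition lauricella_FA_series ::
  "'i set \<Rightarrow> real \<Rightarrow> ('i \<Rightarrow> real) \<Rightarrow> ('i \<Rightarrow> real) \<Rightarrow> ('i \<Rightarrow> real) \<Rightarrow> real" where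
  "lauricella_FA_series K a b c y =
     infsum (\<lambda>\<mu>::'i \<Rightarrow> nat. pochhammer a (\<Sum>k\<in>K. \<mu> k) *
        (\<Prod>k\<in>K. pochhammer (b k) (\<mu> k) / pochhammer (c k) (\<mu> k) * y k ^ \<mu> k / fact (\<mu> k)))
       {\<mu>. \<forall>k. k \<notin> K \<longrightarrow> \<mu> k = 0}"

text \<open>Its (analytic continuation given by the) Euler integral representation, valid for
  \<open>c_k > b_k > 0\<close> and \<open>1 - \<Sum> y_k \<tau>_k > 0\<close> on the unit cube; it coincides with the series
  where the series converges, and it is the meaning of F_A at the arguments
  \<open>\<sigma>_k \<le> 0\<close> occurring in q_n.\<close>
definition lauricella_FA ::
  "'i set \<Rightarrow> real \<Rightarrow> ('i \<Rightarrow> real) \<Rightarrow> ('i \<Rightarrow> real) \<Rightarrow> ('i \<Rightarrow> real) \<Rightarrow> real" where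
  "lauricella_FA K a b c y =
     (\<Prod>k\<in>K. Gamma (c k) / (Gamma (b k) * Gamma (c k - b k))) *
     (\<integral>\<tau>. (\<Prod>k\<in>K. \<tau> k powr (b k - 1) * (1 - \<tau> k) powr (c k - b k - 1)) *
            (1 - (\<Sum>k\<in>K. y k * \<tau> k)) powr (- a)
        \<partial>(\<Pi>\<^sub>M k\<in>K. lebesgue_on {0..1}))"

definition orthant :: "'m set \<Rightarrow> (real^'m) set" where
  "orthant K = {x. \<forall>k\<in>K. 0 < x $ k}"

definition alpha_bar :: "'m::finite set \<Rightarrow> ('m \<Rightarrow> real) \<Rightarrow> real" where
  "alpha_bar K \<alpha> = (real CARD('m) - 2) / 2 + (\<Sum>k\<in>K. 1 - \<alpha> k)"

definition kappa_n :: "'m::finite set \<Rightarrow> ('m \<Rightarrow> real) \<Rightarrow> real" where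
  "kappa_n K \<alpha> = 2 powr (2 * alpha_bar K \<alpha> - real CARD('m)) * Gamma (alpha_bar K \<alpha>)
       / pi powr (real CARD('m) / 2) * (\<Prod>k\<in>K. Gamma (1 - \<alpha> k) / Gamma (2 - 2 * \<alpha> k))"

definition sigma_k :: "'m::finite \<Rightarrow> real^'m \<Rightarrow> real^'m \<Rightarrow> real" where
  "sigma_k k \<xi> x =
     1 - ((\<xi> $ k + x $ k)\<^sup>2 + (\<Sum>i\<in>UNIV - {k}. (\<xi> $ i - x $ i)\<^sup>2))
         / (\<Sum>i\<in>UNIV. (\<xi> $ i - x $ i)\<^sup>2)"

definition q_n :: "'m::finite set \<Rightarrow> ('m \<Rightarrow> real) \<Rightarrow> real^'m \<Rightarrow> real^'m \<Rightarrow> real" where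
  "q_n K \<alpha> \<xi> x =
     kappa_n K \<alpha> * (dist \<xi> x) powr (- 2 * alpha_bar K \<alpha>) *
     (\<Prod>k\<in>K. (\<xi> $ k * x $ k) powr (1 - 2 * \<alpha> k)) *
     lauricella_FA K (alpha_bar K \<alpha>) (\<lambda>k. 1 - \<alpha> k) (\<lambda>k. 2 - 2 * \<alpha> k)
        (\<lambda>k. sigma_k k \<xi> x)"

text \<open>\<open>B^\<alpha>_{N x}[f] = (\<Prod> x_k^{2\<alpha>_k}) \<Sum>_i f_{x_i} cos(N,x_i)\<close>, i.e. the weight times the
  derivative of f at x in the direction of the unit vector N.\<close>
definition conormal :: "'m::finite set \<Rightarrow> ('m \<Rightarrow> real) \<Rightarrow> real^'m \<Rightarrow> (real^'m \<Rightarrow> real) \<Rightarrow> real^'m \<Rightarrow> real" where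
  "conormal K \<alpha> N f x = (\<Prod>k\<in>K. (x $ k) powr (2 * \<alpha> k)) * deriv (\<lambda>h. f (x + h *\<^sub>R N)) 0"

definition simple_layer ::
  "'m::finite set \<Rightarrow> ('m \<Rightarrow> real) \<Rightarrow> (real^'m) set \<Rightarrow> (real^'m \<Rightarrow> real) \<Rightarrow> real^'m \<Rightarrow> real" where
  "simple_layer K \<alpha> \<Gamma> \<rho> x = (LINT \<xi>:\<Gamma>|surface_measure. \<rho> \<xi> * q_n K \<alpha> \<xi> x)"

definition kernel_K ::
  "'m::finite set \<Rightarrow> ('m \<Rightarrow> real) \<Rightarrow> (real^'m \<Rightarrow> real^'m) \<Rightarrow> real^'m \<Rightarrow> real^'m \<Rightarrow> real" where
  "kernel_K K \<alpha> N s t = conormal K \<alpha> (N t) (q_n K \<alpha> s) t"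

definition outer_unit_normal :: "(real^'m::finite) set \<Rightarrow> (real^'m) set \<Rightarrow> real^'m \<Rightarrow> real^'m \<Rightarrow> bool" where
  "outer_unit_normal \<Omega> \<Gamma> t \<nu> \<longleftrightarrow>
     norm \<nu> = 1 \<and>
     ((\<lambda>x. ((x - t) \<bullet> \<nu>) / norm (x - t)) \<longlongrightarrow> 0) (at t within \<Gamma>) \<and>
     (\<exists>\<delta>>0. \<forall>h. 0 < h \<and> h < \<delta> \<longrightarrow> t - h *\<^sub>R \<nu> \<in> \<Omega> \<and> t + h *\<^sub>R \<nu> \<notin> closure \<Omega>)"

end

theory Submission
  imports Defs
begin

text \<open>
  The Euler integral for \<open>F_A\<close> and the Gamma integral turn \<open>q_n\<close> into an integral of heat kernel type,
  \<open>C * \<integral> s powr (m/2 - 2) * exp (- s r\<^sup>2) * (\<Prod>k. F_k (\<xi>_k x_k, s)) ds\<close> over \<open>s > 0\<close>. Hence the weighted derivative of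
  \<open>q_n(\<xi>; x)\<close> in the direction \<open>\<nu> = N t\<close> is \<open>c(\<xi>, x) * ((\<xi> - x) \<bullet> \<nu>) / r^m\<close> plus a term of order \<open>r powr (2 - m)\<close>,
  where \<open>c\<close> is bounded and tends to \<open>\<Gamma>(m/2) / (2 \<pi> powr (m/2))\<close> on the diagonal.

  The Lyapunov condition makes \<open>\<Gamma>\<close> a graph over its tangent plane near \<open>t\<close>, with
  \<open>\<bar>(\<xi> - t) \<bullet> \<nu>\<bar> = O(\<bar>\<xi> - t\<bar> powr (1 + \<kappa>))\<close>. For \<open>x = t + h \<nu>\<close> write \<open>(\<xi> - x) \<bullet> \<nu> = (\<xi> - t) \<bullet> \<nu> - h\<close>. The first part
  passes to the limit by dominated convergence. The second part is a Poisson kernel, whose limit depends only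
  on the density of the surface measure at \<open>t\<close>: the area of \<open>\<Gamma>\<close> in a ball of radius \<open>r\<close> around \<open>t\<close> is
  asymptotic to the volume of an \<open>(m - 1)\<close>-dimensional ball of radius \<open>r\<close>. This rests on the equality
  of Hausdorff and Lebesgue measure in a hyperplane, and so on the isodiametric inequality, which is proved
  by Steiner symmetrization.
\<close>

section \<open>Hausdorff measure\<close>

text \<open>Writing the power in the Euler integral as a Gamma integral replaces a sum in its base
  by a product of exponentials. The cube integral then factors, and each analytic estimate concerns
  a function of one variable. The obstacle is uniformity: \<xi> may approach the hyperplanes while
  \<open>x\<close> stays near \<open>t\<close>. The weighted derivative produces only factors
  \<open>1 / x $ k\<close>, and the growth in \<open>s\<close> of all factors together is kept below
  \<open>exp (s * r\<^sup>2 / 2)\<close>, so that half of the Gaussian always survives. The surface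
  comes without a parametrization. Its area is compared with that of a flat disc only through the
  projection onto the tangent hyperplane, which does not increase distances and whose inverse nearly
  preserves them. This suffices because the layer-cake formula reduces the mass of the Poisson
  kernel to the areas of small balls around \<open>t\<close>. That mass tends to \<pi>^(m/2) /
  \<Gamma>(m/2), which turns the diagonal constant into 1/2; the sign is that of \<open>- h\<close>,
  hence the side of approach.\<close>

definition hausdorff_weight :: "real \<Rightarrow> ('a::metric_space) set \<Rightarrow> ennreal" where
  "hausdorff_weight s C = ennreal (unit_ball_vol s * (diameter C / 2) powr s)"

definition hausdorff_covers :: "real \<Rightarrow> ('a::metric_space) set \<Rightarrow> (nat \<Rightarrow> 'a set) set" where
  "hausdorff_covers \<delta> A = {C. A \<subseteq> (\<Union>i. C i) \<and> (\<forall>i. bounded (C i) \<and> diameter (C i) \<le> \<delta>)}"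

definition hausdorff_pre :: "real \<Rightarrow> real \<Rightarrow> ('a::metric_space) set \<Rightarrow> ennreal" where
  "hausdorff_pre s \<delta> A = (INF C\<in>hausdorff_covers \<delta> A. \<Sum>i. hausdorff_weight s (C i))"

lemma hausdorff_outer_eq: "hausdorff_outer s A = (SUP \<delta>\<in>{0<..}. hausdorff_pre s \<delta> A)"
  unfolding hausdorff_outer_def hausdorff_pre_def hausdorff_covers_def hausdorff_weight_def ..

lemma hausdorff_weight_empty [simp]: "hausdorff_weight s {} = 0"
  by (simp add: hausdorff_weight_def)

lemma hausdorff_pre_antimono: "\<delta> \<le> \<delta>' \<Longrightarrow> hausdorff_pre s \<delta>' A \<le> hausdorff_pre s \<delta> A"
  unfolding hausdorff_pre_def
  by (rule INF_superset_mono) (auto simp: hausdorff_covers_def intro: order_trans)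

lemma hausdorff_pre_le_outer: "0 < \<delta> \<Longrightarrow> hausdorff_pre s \<delta> A \<le> hausdorff_outer s A"
  unfolding hausdorff_outer_eq by (rule SUP_upper) simp

lemma hausdorff_outer_le: "(\<And>\<delta>. 0 < \<delta> \<Longrightarrow> hausdorff_pre s \<delta> A \<le> B) \<Longrightarrow> hausdorff_outer s A \<le> B"
  unfolding hausdorff_outer_eq by (rule SUP_least) simp

lemma hausdorff_pre_le: "C \<in> hausdorff_covers \<delta> A \<Longrightarrow> hausdorff_pre s \<delta> A \<le> (\<Sum>i. hausdorff_weight s (C i))"
  unfolding hausdorff_pre_def by (rule INF_lower)

lemma hausdorff_pre_mono: "A \<subseteq> B \<Longrightarrow> hausdorff_pre s \<delta> A \<le> hausdorff_pre s \<delta> B"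
  unfolding hausdorff_pre_def
  by (rule INF_superset_mono) (force simp: hausdorff_covers_def)+

lemma hausdorff_outer_mono: "A \<subseteq> B \<Longrightarrow> hausdorff_outer s A \<le> hausdorff_outer s B"
  unfolding hausdorff_outer_eq by (rule SUP_mono) (use hausdorff_pre_mono in blast)

lemma hausdorff_outer_empty [simp]: "hausdorff_outer s {} = 0"
proof -
  have "hausdorff_pre s \<delta> {} \<le> 0" if "0 < \<delta>" for \<delta>
    using hausdorff_pre_le[of "\<lambda>_. {}" \<delta> "{}" s] that by (auto simp: hausdorff_covers_def)
  then show ?thesis
    using hausdorff_outer_le[of s "{}" 0] by (metis le_zero_eq)
qed

text \<open>Covers that are optimal up to \<open>e * (1/2)^Suc n\<close> are merged into one
  sequence by \<open>prod_decode\<close>; the errors add up to \<open>e\<close>.\<close>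

lemma hausdorff_pre_countably_subadditive:
  "hausdorff_pre s \<delta> (\<Union>i. A i) \<le> (\<Sum>i. hausdorff_pre s \<delta> (A i))"
proof (rule ennreal_le_epsilon)
  fix e :: real assume e: "0 < e" and fin: "(\<Sum>n. hausdorff_pre s \<delta> (A n)) < top"
  have "hausdorff_pre s \<delta> (A n) < hausdorff_pre s \<delta> (A n) + e * (1/2)^Suc n" for n
    using fin e by (auto simp add: less_top dest!: ennreal_suminf_lessD)
  then have "\<exists>C. C \<in> hausdorff_covers \<delta> (A n) \<and>
      (\<Sum>i. hausdorff_weight s (C i)) < hausdorff_pre s \<delta> (A n) + e * (1/2)^Suc n" for n
    unfolding hausdorff_pre_def INF_less_iff by blast
  then obtain B where B: "\<And>n. B n \<in> hausdorff_covers \<delta> (A n)"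
    and Ble: "\<And>n. (\<Sum>i. hausdorff_weight s (B n i)) < hausdorff_pre s \<delta> (A n) + e * (1/2)^Suc n"
    by metis
  define C where "C = case_prod B o prod_decode"
  have "C \<in> hausdorff_covers \<delta> (\<Union>i. A i)"
    using B unfolding hausdorff_covers_def C_def
    by (auto simp: subset_eq split_def) (metis fst_conv snd_conv prod_encode_inverse)
  then have "hausdorff_pre s \<delta> (\<Union>i. A i) \<le> (\<Sum>i. hausdorff_weight s (C i))"
    by (rule hausdorff_pre_le)
  also have "\<dots> = (\<Sum>n. \<Sum>i. hausdorff_weight s (B n i))"
    unfolding C_def comp_def
    using suminf_ennreal_2dimen[of "\<lambda>m. \<Sum>i. hausdorff_weight s (B m i)" "\<lambda>(m,i). hausdorff_weight s (B m i)"]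
    by (simp add: split_def)
  also have "\<dots> \<le> (\<Sum>n. hausdorff_pre s \<delta> (A n) + e * (1/2) ^ Suc n)"
    by (intro suminf_le allI less_imp_le[OF Ble]) auto
  also have "... = (\<Sum>n. hausdorff_pre s \<delta> (A n)) + (\<Sum>n. ennreal e * ennreal ((1/2) ^ Suc n))"
    using e by (subst suminf_add[symmetric])
               (auto simp del: ennreal_suminf_cmult simp add: ennreal_mult[symmetric])
  also have "\<dots> = (\<Sum>n. hausdorff_pre s \<delta> (A n)) + e"
    unfolding ennreal_suminf_cmult
    by (subst suminf_ennreal_eq[OF zero_le_power power_half_series]) auto
  finally show "hausdorff_pre s \<delta> (\<Union>i. A i) \<le> (\<Sum>n. hausdorff_pre s \<delta> (A n)) + e" .
qed

lemma hausdorff_outer_countably_subadditive: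
  "hausdorff_outer s (\<Union>i. A i) \<le> (\<Sum>i. hausdorff_outer s (A i))"
proof (rule hausdorff_outer_le)
  fix \<delta> :: real assume "0 < \<delta>"
  then have "(\<Sum>i. hausdorff_pre s \<delta> (A i)) \<le> (\<Sum>i. hausdorff_outer s (A i))"
    by (intro suminf_le hausdorff_pre_le_outer) auto
  then show "hausdorff_pre s \<delta> (\<Union>i. A i) \<le> (\<Sum>i. hausdorff_outer s (A i))"
    using hausdorff_pre_countably_subadditive[of s \<delta> A] by (rule order_trans[rotated])
qed

lemma hausdorff_outer_Un_le: "hausdorff_outer s (A \<union> B) \<le> hausdorff_outer s A + hausdorff_outer s B"
proof -
  let ?F = "\<lambda>n::nat. if n = 0 then A else if n = 1 then B else {}"
  have "A \<union> B = (\<Union>i. ?F i)"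
    by (auto split: if_splits)
  then have "hausdorff_outer s (A \<union> B) \<le> (\<Sum>i. hausdorff_outer s (?F i))"
    by (metis hausdorff_outer_countably_subadditive)
  also have "\<dots> = (\<Sum>i\<in>{0,1}. hausdorff_outer s (?F i))"
    by (rule suminf_finite) auto
  finally show ?thesis by simp
qed

section \<open>Separated sets and the Caratheodory criterion\<close>

text \<open>A member of diameter at most \<open>\<delta> < d\<close> cannot meet both sets, so every
  cover splits into a cover of \<open>A\<close> and a cover of \<open>B\<close> that share no
  member.\<close>

lemma hausdorff_pre_separated:
  assumes d: "\<delta> < d" and sep: "\<And>x y. x \<in> A \<Longrightarrow> y \<in> B \<Longrightarrow> d \<le> dist x y"
  shows "hausdorff_pre s \<delta> A + hausdorff_pre s \<delta> B \<le> hausdorff_pre s \<delta> (A \<union> B)"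
  unfolding hausdorff_pre_def[of s \<delta> "A \<union> B"]
proof (rule INF_greatest)
  fix C :: "nat \<Rightarrow> 'a set" assume C: "C \<in> hausdorff_covers \<delta> (A \<union> B)"
  \<comment> \<open>Discarded members become \<open>{}\<close>, which weighs 0 because
    \<open>0 powr s = 0\<close> for every \<open>s\<close>.\<close>
  let ?CA = "\<lambda>i. if C i \<inter> A = {} then {} else C i"
  let ?CB = "\<lambda>i. if C i \<inter> B = {} then {} else C i"
  have pos: "0 \<le> \<delta>"
    using C diameter_ge_0 unfolding hausdorff_covers_def
    by (metis (mono_tags, lifting) mem_Collect_eq order_trans)
  have AB: "C i \<inter> A = {} \<or> C i \<inter> B = {}" for i
  proof (rule ccontr)
    assume "\<not> ?thesis"
    then obtain x y where xy: "x \<in> C i" "x \<in> A" "y \<in> C i" "y \<in> B" by auto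
    have "dist x y \<le> diameter (C i)"
      using C xy by (intro diameter_bounded_bound) (auto simp: hausdorff_covers_def)
    also have "\<dots> \<le> \<delta>" using C by (auto simp: hausdorff_covers_def)
    finally show False using sep[OF xy(2,4)] d by simp
  qed
  have 1: "?CA \<in> hausdorff_covers \<delta> A" and 2: "?CB \<in> hausdorff_covers \<delta> B"
    using C pos unfolding hausdorff_covers_def by (fastforce)+
  have "hausdorff_pre s \<delta> A + hausdorff_pre s \<delta> B
      \<le> (\<Sum>i. hausdorff_weight s (?CA i)) + (\<Sum>i. hausdorff_weight s (?CB i))"
    by (intro add_mono hausdorff_pre_le 1 2)
  also have "\<dots> = (\<Sum>i. hausdorff_weight s (?CA i) + hausdorff_weight s (?CB i))"
    by (rule suminf_add) auto
  also have "\<dots> \<le> (\<Sum>i. hausdorff_weight s (C i))"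
    using AB by (intro suminf_le) auto
  finally show "hausdorff_pre s \<delta> A + hausdorff_pre s \<delta> B \<le> (\<Sum>i. hausdorff_weight s (C i))" .
qed

text \<open>The two suprema run over independent scales. A common scale below both and below
  \<open>d\<close> only enlarges the premeasures, and there the separated case applies; the suprema
  are then taken one side at a time.\<close>

lemma hausdorff_outer_separated:
  assumes d: "0 < d" and sep: "\<And>x y. x \<in> A \<Longrightarrow> y \<in> B \<Longrightarrow> d \<le> dist x y"
  shows "hausdorff_outer s A + hausdorff_outer s B \<le> hausdorff_outer s (A \<union> B)"
proof -
  have *: "hausdorff_pre s \<delta> A + hausdorff_pre s \<delta>' B \<le> hausdorff_outer s (A \<union> B)"
    if "0 < \<delta>" "0 < \<delta>'" for \<delta> \<delta>'
  proof -
    define \<eta> where "\<eta> = min (d/2) (min \<delta> \<delta>')"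
    have \<eta>: "0 < \<eta>" "\<eta> < d" "\<eta> \<le> \<delta>" "\<eta> \<le> \<delta>'" using that d by (auto simp: \<eta>_def)
    have "hausdorff_pre s \<delta> A + hausdorff_pre s \<delta>' B \<le> hausdorff_pre s \<eta> A + hausdorff_pre s \<eta> B"
      by (intro add_mono hausdorff_pre_antimono \<eta>)
    also have "\<dots> \<le> hausdorff_pre s \<eta> (A \<union> B)"
      by (rule hausdorff_pre_separated[OF \<eta>(2) sep])
    also have "\<dots> \<le> hausdorff_outer s (A \<union> B)"
      by (rule hausdorff_pre_le_outer[OF \<eta>(1)])
    finally show ?thesis .
  qed
  have "hausdorff_outer s A + hausdorff_pre s \<delta>' B \<le> hausdorff_outer s (A \<union> B)" if "0 < \<delta>'" for \<delta>'
    unfolding hausdorff_outer_eq[of s A]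
    by (subst ennreal_SUP_add_left[symmetric]) (use * that in \<open>auto intro!: SUP_least\<close>)
  then have "hausdorff_pre s \<delta>' B + hausdorff_outer s A \<le> hausdorff_outer s (A \<union> B)" if "0 < \<delta>'" for \<delta>'
    using that by (simp add: add.commute)
  then have "hausdorff_outer s B + hausdorff_outer s A \<le> hausdorff_outer s (A \<union> B)"
    unfolding hausdorff_outer_eq[of s B]
    by (subst ennreal_SUP_add_left[symmetric]) (auto intro!: SUP_least)
  then show ?thesis by (simp add: add.commute)
qed

lemma hausdorff_outer_separated_sum:
  assumes d: "\<And>i j. i < j \<Longrightarrow> \<exists>d>0. \<forall>x\<in>R i. \<forall>y\<in>R j. d \<le> dist x y"
  shows "(\<Sum>i<n::nat. hausdorff_outer s (R i)) \<le> hausdorff_outer s (\<Union>i<n. R i)"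
proof (induction n)
  case (Suc n)
  have "\<forall>i\<in>{..<n}. \<exists>e. 0 < e \<and> (\<forall>x\<in>R i. \<forall>y\<in>R n. e \<le> dist x y)"
    using d by auto
  from bchoice[OF this]
  obtain e where e: "\<And>i. i < n \<Longrightarrow> 0 < e i \<and> (\<forall>x\<in>R i. \<forall>y\<in>R n. e i \<le> dist x y)"
    by auto
  \<comment> \<open>The \<open>1\<close> keeps the minimum defined for \<open>n = 0\<close>.\<close>
  define d where "d = Min (insert 1 (e ` {..<n}))"
  have "0 < d" using e by (auto simp: d_def)
  have d_le: "d \<le> e i" if "i < n" for i
    unfolding d_def by (rule Min_le) (use that in auto)
  have "(\<Sum>i<Suc n. hausdorff_outer s (R i)) \<le> hausdorff_outer s (\<Union>i<n. R i) + hausdorff_outer s (R n)"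
    using Suc by (simp add: add_mono)
  also have "\<dots> \<le> hausdorff_outer s ((\<Union>i<n. R i) \<union> R n)"
    by (rule hausdorff_outer_separated[OF \<open>0 < d\<close>]) (use d_le e in fastforce)
  also have "(\<Union>i<n. R i) \<union> R n = (\<Union>i<Suc n. R i)"
    by (auto simp: less_Suc_eq)
  finally show ?case .
qed simp

text \<open>The classical argument for metric outer measures. \<open>B n\<close> has positive
  distance from \<open>F\<close>, and the shells \<open>R n\<close> fill the rest of
  \<open>A - F\<close>. Shells two apart are separated, so the sums over the even and over the odd
  shells are each at most \<open>hausdorff_outer s A\<close>. Hence the series of shells converges,
  and its tails, which bound what \<open>B n\<close> misses, vanish.\<close>

lemma hausdorff_outer_caratheodory_closed:
  assumes F: "closed F"
  shows "hausdorff_outer s (A \<inter> F) + hausdorff_outer s (A - F) \<le> hausdorff_outer s A"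
\<comment> \<open>\<open>infdist x {}\<close> is 0 by convention, so the shells make sense only for
  nonempty \<open>F\<close>.\<close>
proof (cases "F = {} \<or> hausdorff_outer s A = top")
  case True then show ?thesis by auto
next
  case False
  let ?H = "hausdorff_outer s"
  from False have ne: "F \<noteq> {}" and fin: "?H A < top" by (auto simp: less_top)
  define B where "B n = {x\<in>A. 1 / real (n + 1) \<le> infdist x F}" for n
  define R where "R n = B (Suc n) - B n" for n
  have BA: "B n \<subseteq> A" for n by (auto simp: B_def)
  have RA: "R n \<subseteq> A" for n by (auto simp: R_def B_def)
  have Rsep: "\<exists>d>0. \<forall>x\<in>R i. \<forall>y\<in>R j. d \<le> dist x y" if "i + 2 \<le> j" for i j
  proof (intro exI conjI ballI)
    show "0 < 1 / real (i + 2) - 1 / real (i + 3)" by (simp add: divide_strict_left_mono)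
    fix x y assume x: "x \<in> R i" and y: "y \<in> R j"
    have 1: "1 / real (i + 2) \<le> infdist x F" using x by (auto simp: R_def B_def add.commute)
    have "infdist y F < 1 / real (j + 1)" using y by (auto simp: R_def B_def)
    also have "\<dots> \<le> 1 / real (i + 3)" using that by (intro divide_left_mono) auto
    finally have 2: "infdist y F < 1 / real (i + 3)" .
    have "infdist x F \<le> infdist y F + dist x y" by (rule infdist_triangle)
    then show "1 / real (i + 2) - 1 / real (i + 3) \<le> dist x y" using 1 2 by simp
  qed
  have even: "(\<Sum>i<n. ?H (R (2*i))) \<le> ?H A" for n
    by (rule order_trans[OF hausdorff_outer_separated_sum hausdorff_outer_mono])
       (use RA in \<open>auto intro!: Rsep\<close>)
  have odd: "(\<Sum>i<n. ?H (R (2*i+1))) \<le> ?H A" for n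
    by (rule order_trans[OF hausdorff_outer_separated_sum hausdorff_outer_mono])
       (use RA in \<open>auto intro!: Rsep\<close>)
  define a where "a n = enn2real (?H (R n))" for n
  have HR: "?H (R n) = ennreal (a n)" for n
    using hausdorff_outer_mono[OF RA, of s n] fin unfolding a_def
    by (simp add: le_less_trans)
  have a0: "0 \<le> a n" for n by (simp add: a_def)
  define M where "M = enn2real (?H A)"
  have HA: "?H A = ennreal M" using fin by (simp add: M_def)
  have M0: "0 \<le> M" by (simp add: M_def)
  have "(\<Sum>i<n. a i) \<le> 2 * M" for n
  proof -
    have "(\<Sum>i<n. a i) \<le> (\<Sum>i<2*n. a i)"
      by (rule sum_mono2) (auto simp: a0)
    also have "\<dots> = (\<Sum>i<n. a (2*i)) + (\<Sum>i<n. a (2*i+1))"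
      by (induction n) auto
    also have "\<dots> \<le> M + M"
    proof (rule add_mono)
      show "(\<Sum>i<n. a (2*i)) \<le> M"
        using even[of n] M0 by (simp add: HR HA a0 sum_nonneg)
      show "(\<Sum>i<n. a (2*i+1)) \<le> M"
        using odd[of n] M0 by (simp add: HR HA a0 sum_nonneg)
    qed
    finally show ?thesis by simp
  qed
  then have "summable a"
    by (intro summableI_nonneg_bounded[where x = "2*M"] a0)
  have tail: "(\<lambda>n. \<Sum>k. a (k + n)) \<longlonglongrightarrow> 0"
    by (rule suminf_exist_split2[OF \<open>summable a\<close>])
  have mainle: "?H (A \<inter> F) + ?H (A - F) \<le> ?H A + ennreal (\<Sum>k. a (k + n))" for n
  proof -
    have "A - F \<subseteq> B n \<union> (\<Union>k. R (k + n))"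
    proof
      fix x assume x: "x \<in> A - F"
      then have "0 < infdist x F"
        using F ne in_closed_iff_infdist_zero[OF F ne] infdist_nonneg[of x F] by (metis DiffD2 less_eq_real_def)
      then obtain k where "inverse (real (Suc k)) < infdist x F" using reals_Archimedean by blast
      then have ex: "x \<in> B k" using x by (auto simp: B_def inverse_eq_divide add.commute)
      define k0 where "k0 = (LEAST k. x \<in> B k)"
      have k0: "x \<in> B k0" using ex unfolding k0_def by (rule LeastI)
      show "x \<in> B n \<union> (\<Union>k. R (k + n))"
      proof (cases "k0 \<le> n")
        case True
        have "1 / real (n + 1) \<le> 1 / real (k0 + 1)" using True by (intro divide_left_mono) auto
        then have "x \<in> B n" using k0 by (auto simp: B_def)
        then show ?thesis by simp
      next
        case False
        then obtain j where j: "k0 = Suc j" "n \<le> j" by (cases k0) auto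
        have "x \<notin> B j" using not_less_Least[of j "\<lambda>k. x \<in> B k"] j(1) unfolding k0_def by auto
        then have "x \<in> R ((j - n) + n)" using k0 j by (auto simp: R_def)
        then show ?thesis by blast
      qed
    qed
    then have "?H (A - F) \<le> ?H (B n \<union> (\<Union>k. R (k + n)))" by (rule hausdorff_outer_mono)
    also have "\<dots> \<le> ?H (B n) + ?H (\<Union>k. R (k + n))" by (rule hausdorff_outer_Un_le)
    also have "\<dots> \<le> ?H (B n) + (\<Sum>k. ?H (R (k + n)))"
      by (intro add_left_mono hausdorff_outer_countably_subadditive)
    also have "(\<Sum>k. ?H (R (k + n))) = ennreal (\<Sum>k. a (k + n))"
      unfolding HR using \<open>summable a\<close>
      by (intro suminf_ennreal2) (auto simp: a0 summable_iff_shift)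
    finally have 1: "?H (A - F) \<le> ?H (B n) + ennreal (\<Sum>k. a (k + n))" .
    have "?H (A \<inter> F) + ?H (B n) \<le> ?H ((A \<inter> F) \<union> B n)"
    proof (rule hausdorff_outer_separated)
      show "0 < 1 / real (n + 1)" by simp
      fix x y assume "x \<in> A \<inter> F" "y \<in> B n"
      then show "1 / real (n + 1) \<le> dist x y"
        using infdist_le[of x F y] by (auto simp: B_def dist_commute)
    qed
    also have "\<dots> \<le> ?H A" using BA by (intro hausdorff_outer_mono) auto
    finally have 2: "?H (A \<inter> F) + ?H (B n) \<le> ?H A" .
    have "?H (A \<inter> F) + ?H (A - F) \<le> ?H (A \<inter> F) + (?H (B n) + ennreal (\<Sum>k. a (k + n)))"
      by (intro add_left_mono 1)
    also have "\<dots> \<le> ?H A + ennreal (\<Sum>k. a (k + n))"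
      using 2 by (simp add: add.assoc[symmetric] add_right_mono)
    finally show ?thesis .
  qed
  have "(\<lambda>n. ?H A + ennreal (\<Sum>k. a (k + n))) \<longlonglongrightarrow> ?H A + ennreal 0"
    by (intro tendsto_intros tendsto_ennrealI tail)
  then show ?thesis
    using mainle by (intro LIMSEQ_le_const[where X="\<lambda>n. ?H A + ennreal (\<Sum>k. a (k + n))"]) auto
qed

text \<open>\<open>measure_of\<close> returns the zero measure unless its set function is a measure
  on the generated sigma algebra. The Caratheodory sets contain the closed sets and hence all Borel
  sets, which excludes that default for \<open>hausdorff_measure\<close>.\<close>

lemma measure_space_hausdorff_outer:
  "measure_space UNIV (sets borel) (hausdorff_outer s :: ('a::metric_space) set \<Rightarrow> ennreal)"
proof -
  let ?L = "lambda_system UNIV UNIV (hausdorff_outer s :: 'a set \<Rightarrow> ennreal)"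
  interpret sigma_algebra "UNIV :: 'a set" UNIV
    using sigma_algebra_Pow[of "UNIV :: 'a set"] by simp
  have "outer_measure_space UNIV (hausdorff_outer s :: 'a set \<Rightarrow> ennreal)"
    by (simp add: outer_measure_space_def positive_def increasing_def countably_subadditive_def
        hausdorff_outer_mono hausdorff_outer_countably_subadditive)
  then have L: "measure_space UNIV ?L (hausdorff_outer s)"
    by (rule caratheodory_lemma)
  then have sa: "sigma_algebra UNIV ?L" by (simp add: measure_space_def)
  have "F \<in> ?L" if "closed F" for F
    unfolding lambda_system_eq
  proof (intro CollectI conjI ballI antisym UNIV_I)
    fix A :: "'a set"
    show "hausdorff_outer s (A \<inter> F) + hausdorff_outer s (A - F) \<le> hausdorff_outer s A"
      by (rule hausdorff_outer_caratheodory_closed[OF that])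
    show "hausdorff_outer s A \<le> hausdorff_outer s (A \<inter> F) + hausdorff_outer s (A - F)"
      using hausdorff_outer_Un_le[of s "A \<inter> F" "A - F"] by (simp add: Int_Diff_Un)
  qed
  then have "sigma_sets UNIV (Collect closed) \<subseteq> ?L"
    by (intro sigma_algebra.sigma_sets_subset[OF sa]) auto
  then have "sets borel \<subseteq> ?L"
    by (simp add: borel_eq_closed)
  then show ?thesis
    using sets.sigma_algebra_axioms[of "borel :: 'a measure"] by (intro measure_down[OF L]) auto
qed

lemma sets_hausdorff_measure [simp, measurable_cong]: "sets (hausdorff_measure s) = sets borel"
  unfolding hausdorff_measure_def by (simp add: sets_measure_of_conv) (metis sets.sigma_sets_eq space_borel)

lemma space_hausdorff_measure [simp]: "space (hausdorff_measure s) = UNIV"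
  unfolding hausdorff_measure_def by (simp add: space_measure_of_conv)

lemma emeasure_hausdorff_measure:
  "A \<in> sets borel \<Longrightarrow> emeasure (hausdorff_measure s) A = hausdorff_outer s A"
  using measure_space_hausdorff_outer[of s] unfolding hausdorff_measure_def
  by (intro emeasure_measure_of_sigma) (auto simp: measure_space_def)

text \<open>Covers at scale \<open>\<delta> / L\<close> are pushed forward to covers at scale
  \<open>\<delta>\<close>, and each weight grows at most by \<open>L powr s\<close>.\<close>

lemma hausdorff_outer_lipschitz_image_le:
  fixes f :: "'a::metric_space \<Rightarrow> 'b::metric_space"
  assumes L: "0 < L" and s: "0 \<le> s"
    and lip: "\<And>x y. x \<in> A \<Longrightarrow> y \<in> A \<Longrightarrow> dist (f x) (f y) \<le> L * dist x y"
  shows "hausdorff_outer s (f ` A) \<le> ennreal (L powr s) * hausdorff_outer s A"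
proof (rule hausdorff_outer_le)
  fix \<delta> :: real assume \<delta>: "0 < \<delta>"
  have dia: "bounded (f ` (D \<inter> A)) \<and> diameter (f ` (D \<inter> A)) \<le> L * diameter D" if "bounded D" for D
  proof -
    have *: "dist (f x) (f y) \<le> L * diameter D" if "x \<in> D \<inter> A" "y \<in> D \<inter> A" for x y
      using lip[of x y] diameter_bounded_bound[OF \<open>bounded D\<close>, of x y] that L
      by (smt (verit, best) IntD1 IntD2 mult_left_mono)
    have "bounded (f ` (D \<inter> A))"
      unfolding bounded_two_points using * by (intro exI[of _ "L * diameter D"]) auto
    moreover have "diameter (f ` (D \<inter> A)) \<le> L * diameter D"
    proof (cases "D \<inter> A = {}")
      case True
      then show ?thesis using L diameter_ge_0[OF \<open>bounded D\<close>] by simp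
    next
      case False
      then show ?thesis unfolding diameter_def[of "f ` (D \<inter> A)"]
        using * by (auto intro!: cSUP_least)
    qed
    ultimately show ?thesis ..
  qed
  have inv: "ennreal (L powr - s) * ennreal (L powr s) = 1" "ennreal (L powr s) * ennreal (L powr - s) = 1"
    using L by (simp_all flip: ennreal_mult powr_add)
  \<comment> \<open>The constant is moved to the left so that the right side is a bare infimum over
    covers; it is moved back afterwards.\<close>
  have "ennreal (L powr - s) * hausdorff_pre s \<delta> (f ` A) \<le> hausdorff_pre s (\<delta> / L) A"
    unfolding hausdorff_pre_def[of s "\<delta>/L"]
  proof (rule INF_greatest)
      fix C assume C: "C \<in> hausdorff_covers (\<delta> / L) A"
      let ?D = "\<lambda>i. f ` (C i \<inter> A)"
      have bC: "bounded (C i)" "diameter (C i) \<le> \<delta> / L" for i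
        using C by (auto simp: hausdorff_covers_def)
      have D: "?D \<in> hausdorff_covers \<delta> (f ` A)"
        unfolding hausdorff_covers_def
      proof (intro CollectI conjI allI)
        show "f ` A \<subseteq> (\<Union>i. ?D i)" using C by (fastforce simp: hausdorff_covers_def)
        fix i
        show "bounded (?D i)" using dia[OF bC(1)] by simp
        have "diameter (?D i) \<le> L * diameter (C i)" using dia[OF bC(1)] by simp
        also have "\<dots> \<le> L * (\<delta> / L)" using L bC(2) by (intro mult_left_mono) auto
        finally show "diameter (?D i) \<le> \<delta>" using L by simp
      qed
      have "hausdorff_weight s (?D i) \<le> ennreal (L powr s) * hausdorff_weight s (C i)" for i
      proof -
        have "(diameter (?D i) / 2) powr s \<le> (L * diameter (C i) / 2) powr s"
          using dia[OF bC(1), of i] diameter_ge_0[of "?D i"] s by (intro powr_mono2) auto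
        also have "\<dots> = L powr s * (diameter (C i) / 2) powr s"
          using L diameter_ge_0[OF bC(1), of i] by (simp flip: powr_mult)
        finally show ?thesis
          using s unfolding hausdorff_weight_def
          by (simp add: mult_left_mono mult.left_commute flip: ennreal_mult)
      qed
      then have "(\<Sum>i. hausdorff_weight s (?D i)) \<le> (\<Sum>i. ennreal (L powr s) * hausdorff_weight s (C i))"
        by (intro suminf_le) auto
      then have "hausdorff_pre s \<delta> (f ` A) \<le> ennreal (L powr s) * (\<Sum>i. hausdorff_weight s (C i))"
        using hausdorff_pre_le[OF D, of s] by simp
      from mult_left_mono[OF this, of "ennreal (L powr - s)"]
      show "ennreal (L powr - s) * hausdorff_pre s \<delta> (f ` A) \<le> (\<Sum>i. hausdorff_weight s (C i))"
        by (simp add: inv mult.assoc[symmetric] del: ennreal_suminf_cmult)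
  qed
  from mult_left_mono[OF this, of "ennreal (L powr s)"]
  have "hausdorff_pre s \<delta> (f ` A) \<le> ennreal (L powr s) * hausdorff_pre s (\<delta> / L) A"
    by (simp add: inv mult.assoc[symmetric])
  also have "\<dots> \<le> ennreal (L powr s) * hausdorff_outer s A"
    by (intro mult_left_mono hausdorff_pre_le_outer) (use L \<delta> in auto)
  finally show "hausdorff_pre s \<delta> (f ` A) \<le> ennreal (L powr s) * hausdorff_outer s A" .
qed

section \<open>The isodiametric inequality\<close>

lemma emeasure_lborel_sections:
  fixes A :: "'a::euclidean_space set"
  assumes A[measurable]: "A \<in> sets borel" and b: "b \<in> Basis"
  shows "emeasure lborel A =
    (\<integral>\<^sup>+f. emeasure lborel {s. (\<Sum>i\<in>Basis-{b}. f i *\<^sub>R i) + s *\<^sub>R b \<in> A} \<partial>(\<Pi>\<^sub>M i\<in>Basis-{b}. lborel))"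
proof -
  interpret product_sigma_finite "\<lambda>_::'a. lborel :: real measure" by standard
  have ins: "insert b (Basis - {b}) = (Basis :: 'a set)" using b by auto
  have m[measurable]: "(\<lambda>f. \<Sum>i\<in>Basis. f i *\<^sub>R i) \<in> borel_measurable (\<Pi>\<^sub>M i\<in>Basis. lborel)"
    by measurable
  have "emeasure lborel A = (\<integral>\<^sup>+x. indicator A x \<partial>lborel)" by simp
  also have "\<dots> = (\<integral>\<^sup>+f. indicator A (\<Sum>i\<in>Basis. f i *\<^sub>R i) \<partial>(\<Pi>\<^sub>M i\<in>Basis. lborel))"
    by (subst lborel_eq) (simp add: nn_integral_distr del: nn_integral_indicator)
  also have "\<dots> = (\<integral>\<^sup>+f. indicator A (\<Sum>i\<in>Basis. f i *\<^sub>R i) \<partial>(\<Pi>\<^sub>M i\<in>insert b (Basis-{b}). lborel))"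
    by (simp only: ins)
  also have "\<dots> = (\<integral>\<^sup>+f. (\<integral>\<^sup>+s. indicator A (\<Sum>i\<in>Basis. (f(b := s)) i *\<^sub>R i) \<partial>lborel) \<partial>(\<Pi>\<^sub>M i\<in>Basis-{b}. lborel))"
    by (rule product_nn_integral_insert) (auto simp: ins)
  also have "\<dots> = (\<integral>\<^sup>+f. emeasure lborel {s. (\<Sum>i\<in>Basis-{b}. f i *\<^sub>R i) + s *\<^sub>R b \<in> A} \<partial>(\<Pi>\<^sub>M i\<in>Basis-{b}. lborel))"
  proof (rule nn_integral_cong)
    fix f :: "'a \<Rightarrow> real"
    have eq: "(\<Sum>i\<in>Basis. (f(b := s)) i *\<^sub>R i) = (\<Sum>i\<in>Basis-{b}. f i *\<^sub>R i) + s *\<^sub>R b" for s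
      by (subst sum.remove[OF finite_Basis b]) (auto simp: add.commute intro!: sum.cong)
    have "(\<integral>\<^sup>+s. indicator A (\<Sum>i\<in>Basis. (f(b := s)) i *\<^sub>R i) \<partial>lborel) =
        (\<integral>\<^sup>+s. indicator {s. (\<Sum>i\<in>Basis-{b}. f i *\<^sub>R i) + s *\<^sub>R b \<in> A} s \<partial>lborel)"
      unfolding eq by (intro nn_integral_cong) (auto split: split_indicator)
    also have "\<dots> = emeasure lborel {s. (\<Sum>i\<in>Basis-{b}. f i *\<^sub>R i) + s *\<^sub>R b \<in> A}"
      by (rule nn_integral_indicator) measurable
    finally show "(\<integral>\<^sup>+s. indicator A (\<Sum>i\<in>Basis. (f(b := s)) i *\<^sub>R i) \<partial>lborel) =
      emeasure lborel {s. (\<Sum>i\<in>Basis-{b}. f i *\<^sub>R i) + s *\<^sub>R b \<in> A}" .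
  qed
  finally show ?thesis .
qed

text \<open>The points of \<open>A\<close> on the line through \<open>x\<close> in direction
  \<open>b\<close>, recorded by their \<open>b\<close>-coordinate rather than by their offset from
  \<open>x\<close>; hence all points of one line have the same fibre.\<close>

definition fibre :: "'a::euclidean_space set \<Rightarrow> 'a \<Rightarrow> 'a \<Rightarrow> real set" where
  "fibre A b x = {s. x + (s - x \<bullet> b) *\<^sub>R b \<in> A}"

text \<open>
  By the strict inequality, null fibres are dropped, so the fibres behind two points of the symmetrized
  set are nonempty.
\<close>
definition steiner :: "'a::euclidean_space set \<Rightarrow> 'a \<Rightarrow> 'a set" where
  "steiner A b = {x. ennreal (2 * \<bar>x \<bullet> b\<bar>) < emeasure lborel (fibre A b x)}"

lemma fibre_shift: "b \<in> Basis \<Longrightarrow> fibre A b (x + r *\<^sub>R b) = fibre A b x"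
  by (simp add: fibre_def inner_add_left algebra_simps)

lemma sets_steiner:
  fixes A :: "'a::euclidean_space set"
  assumes A[measurable]: "A \<in> sets borel"
  shows "steiner A b \<in> sets borel"
proof -
  have f[measurable]: "fibre A b x \<in> sets borel" for x
    unfolding fibre_def by measurable
  have "emeasure lborel (fibre A b x) = (\<integral>\<^sup>+s. indicator A (x + (s - x \<bullet> b) *\<^sub>R b) \<partial>lborel)" for x
  proof -
    have "emeasure lborel (fibre A b x) = (\<integral>\<^sup>+s. indicator (fibre A b x) s \<partial>lborel)" by simp
    also have "\<dots> = (\<integral>\<^sup>+s. indicator A (x + (s - x \<bullet> b) *\<^sub>R b) \<partial>lborel)"
      by (intro nn_integral_cong) (auto simp: fibre_def split: split_indicator)
    finally show ?thesis .
  qed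
  moreover have "(\<lambda>x. \<integral>\<^sup>+s. indicator A (x + (s - x \<bullet> b) *\<^sub>R b) \<partial>lborel) \<in> borel_measurable borel"
    by (rule lborel.borel_measurable_nn_integral) measurable
  ultimately have [measurable]: "(\<lambda>x. emeasure lborel (fibre A b x)) \<in> borel_measurable borel"
    by simp
  show ?thesis unfolding steiner_def by measurable
qed

lemma bounded_fibre:
  assumes A: "bounded A" and b: "b \<in> Basis"
  shows "bounded (fibre A b x)"
proof -
  have "fibre A b x \<subseteq> (\<lambda>y. y \<bullet> b) ` A"
  proof
    fix s assume s: "s \<in> fibre A b x"
    have "s = (x + (s - x \<bullet> b) *\<^sub>R b) \<bullet> b" using b by (simp add: inner_add_left)
    then show "s \<in> (\<lambda>y. y \<bullet> b) ` A" using s by (auto simp: fibre_def)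
  qed
  then show ?thesis
    using bounded_linear_image[OF A bounded_linear_inner_left] bounded_subset by blast
qed

lemma emeasure_lborel_le_Sup_Inf:
  assumes "bounded (P :: real set)" "P \<noteq> {}"
  shows "emeasure lborel P \<le> ennreal (Sup P - Inf P)"
proof -
  have b: "bdd_above P" "bdd_below P" using assms by (auto intro: bounded_imp_bdd_above bounded_imp_bdd_below)
  have "emeasure lborel P \<le> emeasure lborel {Inf P..Sup P}"
    using b by (intro emeasure_mono) (auto intro: cInf_lower cSup_upper)
  also have "\<dots> = ennreal (Sup P - Inf P)"
    using b assms by (simp add: cInf_le_cSup)
  finally show ?thesis .
qed

text \<open>Each section of \<open>steiner A b\<close> is an open interval around 0 whose length is
  the measure of the section of \<open>A\<close>, finite because \<open>A\<close> is bounded. Fubini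
  in direction \<open>b\<close> does the rest.\<close>

lemma emeasure_steiner:
  fixes A :: "'a::euclidean_space set"
  assumes A: "A \<in> sets borel" "bounded A" and b: "b \<in> Basis"
  shows "emeasure lborel (steiner A b) = emeasure lborel A"
proof -
  have "emeasure lborel {s. z + s *\<^sub>R b \<in> steiner A b} = emeasure lborel {s. z + s *\<^sub>R b \<in> A}"
    if z: "z \<bullet> b = 0" for z
  proof -
    define l where "l = emeasure lborel (fibre A b z)"
    have "l < top"
    proof (cases "fibre A b z = {}")
      case False
      show ?thesis unfolding l_def
        using emeasure_lborel_le_Sup_Inf[OF bounded_fibre[OF A(2) b] False]
        by (metis ennreal_less_top le_less_trans)
    qed (auto simp: l_def)
    then obtain l' where l': "l = ennreal l'" "0 \<le> l'" by (cases l) auto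
    have "{s. z + s *\<^sub>R b \<in> steiner A b} = {s. ennreal (2 * \<bar>s\<bar>) < l}"
      unfolding steiner_def using b z by (simp add: fibre_shift l_def inner_add_left)
    also have "\<dots> = {-l'/2<..<l'/2}"
      using l' by (auto simp: ennreal_less_iff)
    finally have "emeasure lborel {s. z + s *\<^sub>R b \<in> steiner A b} = l"
      using l' by simp
    then show ?thesis using z by (simp add: l_def fibre_def)
  qed
  moreover have "(\<Sum>i\<in>Basis-{b}. f i *\<^sub>R i) \<bullet> b = 0" for f
    using b by (auto simp: inner_sum_left inner_not_same_Basis intro!: sum.neutral)
  ultimately show ?thesis
    by (simp add: emeasure_lborel_sections[OF _ b] sets_steiner A)
qed

text \<open>The hulls of the two fibres are longer than \<open>2 * \<bar>x \<bullet> b\<bar>\<close>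
  and \<open>2 * \<bar>y \<bullet> b\<bar>\<close>. If all their points were closer than
  \<open>D\<close>, the two lengths would add up to at most \<open>2 * D\<close>, a contradiction.
  So \<open>A\<close> has points on the two lines whose \<open>b\<close>-coordinates are at least as
  far apart as those of \<open>x\<close> and \<open>y\<close>, and Pythagoras compares the
  distances.\<close>

lemma dist_steiner_le:
  fixes A :: "'a::euclidean_space set"
  assumes A: "bounded A" and b: "b \<in> Basis"
    and d: "\<And>x y. x \<in> A \<Longrightarrow> y \<in> A \<Longrightarrow> dist x y \<le> d"
    and x: "x \<in> steiner A b" and y: "y \<in> steiner A b"
  shows "dist x y \<le> d"
proof -
  define P where "P = fibre A b x"
  define Q where "Q = fibre A b y"
  define D where "D = \<bar>x \<bullet> b - y \<bullet> b\<bar>"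
  have P: "ennreal (2 * \<bar>x \<bullet> b\<bar>) < emeasure lborel P" and Q: "ennreal (2 * \<bar>y \<bullet> b\<bar>) < emeasure lborel Q"
    using x y by (auto simp: steiner_def P_def Q_def)
  have ne: "P \<noteq> {}" "Q \<noteq> {}" using P Q by auto
  have bd: "bounded P" "bounded Q" using bounded_fibre[OF A b] by (auto simp: P_def Q_def)
  have "ennreal (2 * \<bar>x \<bullet> b\<bar>) < ennreal (Sup P - Inf P)" "ennreal (2 * \<bar>y \<bullet> b\<bar>) < ennreal (Sup Q - Inf Q)"
    using P Q emeasure_lborel_le_Sup_Inf[OF bd(1) ne(1)] emeasure_lborel_le_Sup_Inf[OF bd(2) ne(2)]
    by (auto intro: less_le_trans)
  then have len: "2 * \<bar>x \<bullet> b\<bar> < Sup P - Inf P" "2 * \<bar>y \<bullet> b\<bar> < Sup Q - Inf Q"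
    by (auto simp: ennreal_less_iff)
  have "\<exists>p\<in>P. \<exists>q\<in>Q. D \<le> \<bar>p - q\<bar>"
  proof (rule ccontr)
    assume "\<not> ?thesis"
    then have *: "\<bar>p - q\<bar> < D" if "p \<in> P" "q \<in> Q" for p q using that by force
    have "Sup P \<le> D + Inf Q"
    proof (rule cSup_least[OF ne(1)])
      fix p assume p: "p \<in> P"
      have "p - D \<le> Inf Q" by (rule cInf_greatest[OF ne(2)]) (use *[OF p] in fastforce)
      then show "p \<le> D + Inf Q" by simp
    qed
    moreover have "Sup Q \<le> D + Inf P"
    proof (rule cSup_least[OF ne(2)])
      fix q assume q: "q \<in> Q"
      have "q - D \<le> Inf P" by (rule cInf_greatest[OF ne(1)]) (use *[OF _ q] in fastforce)
      then show "q \<le> D + Inf P" by simp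
    qed
    ultimately show False using len by (simp add: D_def)
  qed
  then obtain p q where pq: "p \<in> P" "q \<in> Q" "D \<le> \<bar>p - q\<bar>" by blast
  define z where "z = (x - y) - (x \<bullet> b - y \<bullet> b) *\<^sub>R b"
  have z: "z \<bullet> b = 0" using b by (simp add: z_def inner_diff_left)
  have pyth: "(norm (z + r *\<^sub>R b))\<^sup>2 = (norm z)\<^sup>2 + r\<^sup>2" for r
    using z b unfolding power2_norm_eq_inner
    by (simp add: inner_add_left inner_add_right inner_commute power2_eq_square)
  have "(dist x y)\<^sup>2 = (norm z)\<^sup>2 + (x \<bullet> b - y \<bullet> b)\<^sup>2"
    unfolding dist_norm pyth[symmetric] by (simp add: z_def)
  also have "\<dots> \<le> (norm z)\<^sup>2 + (p - q)\<^sup>2"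
    using pq(3) by (simp add: D_def abs_le_square_iff)
  also have "\<dots> = (dist (x + (p - x \<bullet> b) *\<^sub>R b) (y + (q - y \<bullet> b) *\<^sub>R b))\<^sup>2"
    unfolding dist_norm pyth[symmetric] by (simp add: z_def algebra_simps)
  finally have "dist x y \<le> dist (x + (p - x \<bullet> b) *\<^sub>R b) (y + (q - y \<bullet> b) *\<^sub>R b)"
    by (rule power2_le_imp_le) simp
  also have "\<dots> \<le> d"
    using pq by (intro d) (auto simp: P_def Q_def fibre_def)
  finally show ?thesis .
qed

abbreviation reflect_in :: "'a::euclidean_space \<Rightarrow> 'a \<Rightarrow> 'a" where
  "reflect_in b x \<equiv> x - (2 * (x \<bullet> b)) *\<^sub>R b"

lemma steiner_reflect_self:
  assumes b: "b \<in> Basis" and x: "x \<in> steiner A b"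
  shows "reflect_in b x \<in> steiner A b"
  using x b fibre_shift[OF b, of A x "- (2 * (x \<bullet> b))"]
  by (simp add: steiner_def inner_diff_left)

text \<open>As \<open>b\<close> and \<open>c\<close> are orthogonal, the fibre over a reflected
  point is the original fibre. A later symmetrization therefore keeps the symmetries gained
  earlier.\<close>

lemma steiner_reflect:
  assumes b: "b \<in> Basis" and c: "c \<in> Basis" "c \<noteq> b"
    and A: "\<And>x. x \<in> A \<Longrightarrow> reflect_in c x \<in> A" and x: "x \<in> steiner A b"
  shows "reflect_in c x \<in> steiner A b"
proof -
  have bc: "b \<bullet> c = 0" "c \<bullet> b = 0" using b c by (auto simp: inner_not_same_Basis)
  have eq: "reflect_in c x + (s - reflect_in c x \<bullet> b) *\<^sub>R b = reflect_in c (x + (s - x \<bullet> b) *\<^sub>R b)" for s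
    by (simp add: inner_add_left inner_diff_left bc algebra_simps)
  have invol: "reflect_in c (reflect_in c y) = y" for y
    using c(1) by (simp add: inner_diff_left)
  have "fibre A b (reflect_in c x) = fibre A b x"
    unfolding fibre_def eq using A invol by (metis)
  then show ?thesis
    using x bc by (simp add: steiner_def inner_diff_left)
qed

lemma symmetrized_set_exists:
  fixes A B :: "'a::euclidean_space set"
  assumes "finite B" "B \<subseteq> Basis" "A \<in> sets borel" "bounded A"
    and "\<And>x y. x \<in> A \<Longrightarrow> y \<in> A \<Longrightarrow> dist x y \<le> d"
  shows "\<exists>S. S \<in> sets borel \<and> bounded S \<and> emeasure lborel S = emeasure lborel A \<and>
    (\<forall>x\<in>S. \<forall>y\<in>S. dist x y \<le> d) \<and> (\<forall>b\<in>B. \<forall>x\<in>S. reflect_in b x \<in> S)"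
  using assms(1,2)
proof (induction B)
  case empty
  show ?case by (rule exI[of _ A]) (use assms(3-) in auto)
next
  case (insert b B)
  then obtain S where S: "S \<in> sets borel" "bounded S" "emeasure lborel S = emeasure lborel A"
    "\<And>x y. x \<in> S \<Longrightarrow> y \<in> S \<Longrightarrow> dist x y \<le> d" "\<And>b x. b \<in> B \<Longrightarrow> x \<in> S \<Longrightarrow> reflect_in b x \<in> S"
    by auto
  have b: "b \<in> Basis" using insert by simp
  have d: "dist x y \<le> d" if "x \<in> steiner S b" "y \<in> steiner S b" for x y
    using dist_steiner_le[OF S(2) b S(4) that] by simp
  show ?case
  proof (intro exI[of _ "steiner S b"] conjI ballI)
    show "steiner S b \<in> sets borel" by (rule sets_steiner[OF S(1)])
    show "bounded (steiner S b)" unfolding bounded_two_points using d by blast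
    show "emeasure lborel (steiner S b) = emeasure lborel A"
      using emeasure_steiner[OF S(1,2) b] S(3) by simp
  next
    fix c x assume c: "c \<in> insert b B" and x: "x \<in> steiner S b"
    show "reflect_in c x \<in> steiner S b"
    proof (cases "c = b")
      case True then show ?thesis using steiner_reflect_self[OF b x] by simp
    next
      case False
      then show ?thesis using steiner_reflect[OF b _ False S(5) x] c insert by auto
    qed
  qed (use d in auto)
qed

text \<open>The reflections in all basis directions compose to the map from \<open>x\<close> to
  \<open>- x\<close>. For the symmetrized set this gives \<open>2 * norm x \<le> diameter A\<close>,
  so it lies in a ball of half the diameter.\<close>

theorem isodiametric:
  fixes A :: "'a::euclidean_space set"
  assumes A: "A \<in> sets borel" "bounded A"
  shows "emeasure lborel A \<le> ennreal (unit_ball_vol (DIM('a)) * (diameter A / 2) ^ DIM('a))"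
proof -
  obtain S where S: "S \<in> sets borel" "emeasure lborel S = emeasure lborel A"
    "\<And>x y. x \<in> S \<Longrightarrow> y \<in> S \<Longrightarrow> dist x y \<le> diameter A" "\<And>b x. b \<in> Basis \<Longrightarrow> (x::'a) \<in> S \<Longrightarrow> reflect_in b x \<in> S"
    using symmetrized_set_exists[OF finite_Basis subset_refl A diameter_bounded_bound[OF A(2)]]
    by metis
  have neg: "x - (\<Sum>b\<in>B. (2 * (x \<bullet> b)) *\<^sub>R b) \<in> S" if "finite B" "B \<subseteq> Basis" "x \<in> S" for x B
    using that
  proof (induction B)
    case (insert b B)
    define y where "y = x - (\<Sum>b\<in>B. (2 * (x \<bullet> b)) *\<^sub>R b)"
    have y: "y \<in> S" using insert by (simp add: y_def)
    have "(\<Sum>c\<in>B. (2 * (x \<bullet> c)) *\<^sub>R c) \<bullet> b = 0"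
      using insert by (auto simp: inner_sum_left intro!: sum.neutral inner_not_same_Basis)
    then have "y \<bullet> b = x \<bullet> b" by (simp add: y_def inner_diff_left)
    moreover have "reflect_in b y \<in> S" using S(4) insert y by auto
    ultimately show ?case using insert by (simp add: y_def algebra_simps)
  qed simp
  have "- x \<in> S" if "x \<in> S" for x
  proof -
    have "(\<Sum>b\<in>Basis. (2 * (x \<bullet> b)) *\<^sub>R b) = 2 *\<^sub>R x"
      by (simp flip: scaleR_scaleR scaleR_sum_right add: euclidean_representation)
    then show ?thesis using neg[OF finite_Basis subset_refl that] by (simp add: scaleR_2)
  qed
  then have "2 * norm x \<le> diameter A" if "x \<in> S" for x
    using S(3)[OF that, of "-x"] that by (simp add: dist_norm norm_minus_commute flip: scaleR_2)
  then have "S \<subseteq> cball 0 (diameter A / 2)" by fastforce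
  then have "emeasure lborel A \<le> emeasure lborel (cball 0 (diameter A / 2) :: 'a set)"
    unfolding S(2)[symmetric] by (intro emeasure_mono) auto
  also have "\<dots> = ennreal (unit_ball_vol (DIM('a)) * (diameter A / 2) ^ DIM('a))"
    using diameter_ge_0[OF A(2)] by (intro emeasure_cball) simp
  finally show ?thesis .
qed

section \<open>Hausdorff and Lebesgue measure in full dimension\<close>

lemma hausdorff_weight_DIM:
  fixes C :: "'a::euclidean_space set"
  assumes "bounded C"
  shows "hausdorff_weight (real DIM('a)) C = ennreal (unit_ball_vol (DIM('a)) * (diameter C / 2) ^ DIM('a))"
  using diameter_ge_0[OF assms] by (simp add: hausdorff_weight_def powr_realpow')

text \<open>Closing the members of a cover makes them Borel and keeps their diameters, and the
  isodiametric inequality bounds each closure by its weight. This works already at scale 1.\<close>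

lemma emeasure_lborel_le_hausdorff_outer:
  fixes A :: "'a::euclidean_space set"
  assumes "A \<in> sets borel"
  shows "emeasure lborel A \<le> hausdorff_outer DIM('a) A"
proof -
  have "emeasure lborel A \<le> hausdorff_pre DIM('a) 1 A"
    unfolding hausdorff_pre_def
  proof (rule INF_greatest)
    fix C assume C: "C \<in> hausdorff_covers 1 A"
    then have b: "bounded (C i)" for i by (auto simp: hausdorff_covers_def)
    have "A \<subseteq> (\<Union>i. closure (C i))"
      using C closure_subset unfolding hausdorff_covers_def by blast
    then have "emeasure lborel A \<le> emeasure lborel (\<Union>i. closure (C i))"
      by (intro emeasure_mono) auto
    also have "\<dots> \<le> (\<Sum>i. emeasure lborel (closure (C i)))"
      by (intro emeasure_subadditive_countably) auto
    also have "\<dots> \<le> (\<Sum>i. hausdorff_weight DIM('a) (C i))"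
      using isodiametric[of "closure (C _)"] b
      by (intro suminf_le) (auto simp: hausdorff_weight_DIM diameter_closure)
    finally show "emeasure lborel A \<le> (\<Sum>i. hausdorff_weight DIM('a) (C i))" .
  qed
  also have "\<dots> \<le> hausdorff_outer DIM('a) A"
    by (rule hausdorff_pre_le_outer) simp
  finally show ?thesis .
qed

text \<open>The balls of radius \<open>r i\<close> are disjoint inside \<open>U\<close>, and
  enlarging them by the factor \<open>c\<close> multiplies the weights by
  \<open>c ^ DIM('a)\<close>. It serves with \<open>c = 5\<close> for the Vitali covering lemma and
  with \<open>c = 1\<close> for the Vitali covering theorem.\<close>

lemma hausdorff_pre_balls_le:
  fixes a :: "'i \<Rightarrow> 'a::euclidean_space"
  assumes C: "countable C" and disj: "pairwise (\<lambda>i j. disjnt (ball (a i) (r i)) (ball (a j) (r j))) C"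
    and c: "0 < c" and r: "\<And>i. i \<in> C \<Longrightarrow> 0 < r i \<and> 2 * (c * r i) \<le> \<delta>"
    and sub: "\<And>i. i \<in> C \<Longrightarrow> ball (a i) (r i) \<subseteq> U" and U: "open U"
    and \<delta>: "0 < \<delta>"
  shows "hausdorff_pre DIM('a) \<delta> (\<Union>i\<in>C. ball (a i) (c * r i)) \<le> ennreal (c ^ DIM('a)) * emeasure lborel U"
proof (cases "C = {}")
  case True
  have "hausdorff_pre DIM('a) \<delta> ({} :: 'a set) \<le> 0"
    using hausdorff_pre_le_outer[OF \<delta>, of "DIM('a)" "{} :: 'a set"] by simp
  then show ?thesis using True by simp
next
  case False
  define J where "J = to_nat_on C ` C"
  define f where "f = from_nat_into C"
  have fC: "f n \<in> C" for n unfolding f_def by (rule from_nat_into[OF False])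
  have inj: "inj_on f J"
    unfolding J_def f_def using C by (auto simp: inj_on_def)
  have fJ: "f ` J = C" unfolding J_def f_def using C by (auto simp: image_iff)
  define D where "D n = (if n \<in> J then ball (a (f n)) (c * r (f n)) else {})" for n
  define E where "E n = (if n \<in> J then ball (a (f n)) (r (f n)) else {})" for n
  have "D \<in> hausdorff_covers \<delta> (\<Union>i\<in>C. ball (a i) (c * r i))"
    using r[OF fC] c \<delta> unfolding hausdorff_covers_def D_def fJ[symmetric]
    by (auto simp: less_imp_le)
  then have "hausdorff_pre DIM('a) \<delta> (\<Union>i\<in>C. ball (a i) (c * r i)) \<le> (\<Sum>n. hausdorff_weight DIM('a) (D n))"
    by (rule hausdorff_pre_le)
  also have "\<dots> = (\<Sum>n. ennreal (c ^ DIM('a)) * emeasure lborel (E n))"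
  proof (rule suminf_cong)
    fix n
    show "hausdorff_weight DIM('a) (D n) = ennreal (c ^ DIM('a)) * emeasure lborel (E n)"
    proof (cases "n \<in> J")
      case True
      have "0 < r (f n)" using r[OF fC] by blast
      moreover have "\<not> c * r (f n) < 0" using c \<open>0 < r (f n)\<close> by (simp add: not_less)
      ultimately show ?thesis using True c
        by (simp add: D_def E_def hausdorff_weight_DIM emeasure_ball power_mult_distrib mult.left_commute
            flip: ennreal_mult)
    qed (simp add: D_def E_def)
  qed
  also have "\<dots> = ennreal (c ^ DIM('a)) * (\<Sum>n. emeasure lborel (E n))"
    by simp
  also have "(\<Sum>n. emeasure lborel (E n)) = emeasure lborel (\<Union>n. E n)"
  proof (rule suminf_emeasure)
    show "disjoint_family E"
      unfolding disjoint_family_on_def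
    proof (intro ballI impI)
      fix i j :: nat assume "i \<noteq> j"
      then have "f i \<noteq> f j" if "i \<in> J" "j \<in> J" using inj that by (meson inj_onD)
      then show "E i \<inter> E j = {}"
        using disj fC[of i] fC[of j] unfolding E_def pairwise_def disjnt_def by simp
    qed
  qed (auto simp: E_def)
  also have "\<dots> \<le> emeasure lborel U"
    using sub fC U by (intro emeasure_mono) (auto simp: E_def split: if_splits)
  finally show ?thesis by (simp add: mult_left_mono)
qed

lemma hausdorff_outer_negligible:
  fixes N :: "'a::euclidean_space set"
  assumes N: "negligible N"
  shows "hausdorff_outer DIM('a) N = 0"
proof -
  have "hausdorff_pre DIM('a) \<delta> N \<le> 0 + ennreal e" if \<delta>: "0 < \<delta>" and e: "0 < e" for \<delta> e
  proof -
    \<comment> \<open>The five-fold enlargement of the Vitali balls costs the factor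
      \<open>5 ^ DIM('a)\<close>.\<close>
    define e' where "e' = e / 5 ^ DIM('a)"
    have e': "0 < e'" using e by (simp add: e'_def)
    have Nl: "N \<in> sets lebesgue" "emeasure lebesgue N = 0"
      using N by (auto simp: negligible_iff_null_sets)
    obtain T where T: "open T" "N \<subseteq> T" "T - N \<in> lmeasurable" "emeasure lebesgue (T - N) < ennreal e'"
      using sets_lebesgue_outer_open[OF Nl(1) e'] by metis
    have "emeasure lborel T = emeasure lebesgue T"
      using T(1) by simp
    also have "\<dots> \<le> emeasure lebesgue (T - N) + emeasure lebesgue N"
      using Nl T by (intro order_trans[OF emeasure_mono emeasure_subadditive]) auto
    also have "\<dots> \<le> ennreal e'" using T(4) Nl(2) by simp
    finally have eT: "emeasure lborel T \<le> ennreal e'" .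
    \<comment> \<open>Radius at most \<open>\<delta> / 10\<close> gives the five-fold balls diameter
      at most \<open>\<delta>\<close>.\<close>
    define K where "K = {(x, r::real). x \<in> N \<and> 0 < r \<and> r \<le> \<delta> / 10 \<and> ball x r \<subseteq> T}"
    have "N \<subseteq> (\<Union>i\<in>K. ball (fst i) (snd i))"
    proof
      fix x assume x: "x \<in> N"
      then obtain \<rho> where \<rho>: "0 < \<rho>" "ball x \<rho> \<subseteq> T"
        using T by (meson openE subsetD)
      have "(x, min \<rho> (\<delta> / 10)) \<in> K"
        using x \<rho> \<delta> by (auto simp: K_def)
      moreover have "x \<in> ball x (min \<rho> (\<delta> / 10))" using \<rho> \<delta> by simp
      ultimately show "x \<in> (\<Union>i\<in>K. ball (fst i) (snd i))"
        by (intro UN_I[of "(x, min \<rho> (\<delta> / 10))"]) auto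
    qed
    moreover have "0 < snd i \<and> snd i \<le> \<delta> / 10" if "i \<in> K" for i
      using that by (auto simp: K_def)
    ultimately obtain C where C: "countable C" "C \<subseteq> K"
      "pairwise (\<lambda>i j. disjnt (ball (fst i) (snd i)) (ball (fst j) (snd j))) C"
      "N \<subseteq> (\<Union>i\<in>C. ball (fst i) (5 * snd i))"
      by (rule Vitali_covering_lemma_balls)
    have "hausdorff_pre DIM('a) \<delta> N \<le> hausdorff_pre DIM('a) \<delta> (\<Union>i\<in>C. ball (fst i) (5 * snd i))"
      by (rule hausdorff_pre_mono[OF C(4)])
    also have "\<dots> \<le> ennreal (5 ^ DIM('a)) * emeasure lborel T"
    proof -
      have K: "0 < snd i" "10 * snd i \<le> \<delta>" "ball (fst i) (snd i) \<subseteq> T" if "i \<in> C" for i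
        using subsetD[OF C(2) that] by (simp_all add: K_def case_prod_unfold)
      show ?thesis
        using hausdorff_pre_balls_le[OF C(1,3), of 5 \<delta> T] K T(1) \<delta> by simp
    qed
    also have "\<dots> \<le> ennreal (5 ^ DIM('a)) * ennreal e'"
      by (intro mult_left_mono eT) simp
    also have "\<dots> = ennreal e" using e by (simp add: e'_def flip: ennreal_mult)
    finally show ?thesis by simp
  qed
  then have "hausdorff_pre DIM('a) \<delta> N \<le> 0" if "0 < \<delta>" for \<delta>
    using that by - (rule ennreal_le_epsilon, blast)
  then show ?thesis using hausdorff_outer_le[of "DIM('a)" N 0] by simp
qed

text \<open>For the upper bound, disjoint balls of small radius fill \<open>U\<close> up to a null
  set. The weight of a ball is exactly its Lebesgue measure, and null sets have Hausdorff measure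
  0.\<close>

theorem hausdorff_outer_open:
  fixes U :: "'a::euclidean_space set"
  assumes U: "open U"
  shows "hausdorff_outer DIM('a) U = emeasure lborel U"
proof (rule antisym)
  show "emeasure lborel U \<le> hausdorff_outer DIM('a) U"
    using U by (intro emeasure_lborel_le_hausdorff_outer) auto
  show "hausdorff_outer DIM('a) U \<le> emeasure lborel U"
  proof (rule hausdorff_outer_le)
    fix \<delta> :: real assume \<delta>: "0 < \<delta>"
    define K where "K = {(x, r::real). 0 < r \<and> r \<le> \<delta> / 2 \<and> ball x r \<subseteq> U}"
    have "\<exists>i. i \<in> K \<and> x \<in> ball (fst i) (snd i) \<and> snd i < d" if x: "x \<in> U" and d: "0 < d" for x d
    proof -
      obtain \<rho> where \<rho>: "0 < \<rho>" "ball x \<rho> \<subseteq> U"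
        using U x by (meson openE)
      have "(x, min \<rho> (min (\<delta> / 2) (d / 2))) \<in> K" using \<rho> \<delta> d by (auto simp: K_def)
      then show ?thesis using \<rho> \<delta> d by (intro exI[of _ "(x, min \<rho> (min (\<delta> / 2) (d / 2)))"]) auto
    qed
    then obtain C where C: "countable C" "C \<subseteq> K"
      "pairwise (\<lambda>i j. disjnt (ball (fst i) (snd i)) (ball (fst j) (snd j))) C"
      "negligible (U - (\<Union>i\<in>C. ball (fst i) (snd i)))"
      by (rule Vitali_covering_theorem_balls[of U K fst snd]) auto
    let ?B = "\<Union>i\<in>C. ball (fst i) (snd i)"
    let ?F = "\<lambda>n::nat. if n = 0 then ?B else if n = 1 then U - ?B else {}"
    have "U \<subseteq> (\<Union>i. ?F i)"
      by (auto split: if_splits)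
    then have "hausdorff_pre DIM('a) \<delta> U \<le> hausdorff_pre DIM('a) \<delta> (\<Union>i. ?F i)"
      by (rule hausdorff_pre_mono)
    also have "\<dots> \<le> (\<Sum>i. hausdorff_pre DIM('a) \<delta> (?F i))"
      by (rule hausdorff_pre_countably_subadditive)
    also have "\<dots> = (\<Sum>i\<in>{0,1}. hausdorff_pre DIM('a) \<delta> (?F i))"
      using hausdorff_pre_le_outer[OF \<delta>, of "DIM('a)" "{} :: 'a set"]
      by (intro suminf_finite) auto
    also have "\<dots> = hausdorff_pre DIM('a) \<delta> ?B + hausdorff_pre DIM('a) \<delta> (U - ?B)" by simp
    also have "hausdorff_pre DIM('a) \<delta> (U - ?B) = 0"
      using hausdorff_pre_le_outer[OF \<delta>, of "DIM('a)" "U - ?B"] hausdorff_outer_negligible[OF C(4)] by simp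
    also have "hausdorff_pre DIM('a) \<delta> ?B \<le> ennreal (1 ^ DIM('a)) * emeasure lborel U"
    proof -
      have K: "0 < snd i" "2 * snd i \<le> \<delta>" "ball (fst i) (snd i) \<subseteq> U" if "i \<in> C" for i
        using subsetD[OF C(2) that] by (simp_all add: K_def case_prod_unfold)
      show ?thesis
        using hausdorff_pre_balls_le[OF C(1,3), of 1 \<delta> U] K U \<delta> by simp
    qed
    finally show "hausdorff_pre DIM('a) \<delta> U \<le> emeasure lborel U" by simp
  qed
qed

section \<open>Discs in a hyperplane\<close>

text \<open>
  Indexes a Euclidean space of dimension one less than \<open>real^'a\<close>; the second disjunct only keeps the
  type nonempty when \<open>'a\<close> has a single element.
\<close>
typedef 'a punctured = "{x::'a. x \<noteq> undefined \<or> (\<forall>y::'a. y = undefined)}"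
  by (cases "\<forall>y::'a. y = undefined") blast+

instance punctured :: (finite) finite
proof
  show "finite (UNIV :: 'a punctured set)"
    unfolding type_definition.univ[OF type_definition_punctured] by simp
qed

lemma CARD_punctured:
  assumes "1 < CARD('a::finite)"
  shows "CARD('a punctured) = CARD('a) - 1"
proof -
  have "\<not> (\<forall>y::'a. y = undefined)"
  proof
    assume "\<forall>y::'a. y = undefined"
    then have "(UNIV :: 'a set) = {undefined}" by auto
    then have "CARD('a) = 1" by (metis card.empty card_insert_disjoint empty_iff finite.emptyI One_nat_def)
    then show False using assms by simp
  qed
  then have "{x::'a. x \<noteq> undefined \<or> (\<forall>y::'a. y = undefined)} = UNIV - {undefined}" by auto
  moreover have "CARD('a punctured) = card {x::'a. x \<noteq> undefined \<or> (\<forall>y::'a. y = undefined)}"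
    by (rule type_definition.card[OF type_definition_punctured])
  ultimately have "CARD('a punctured) = card (UNIV - {undefined :: 'a})" by simp
  then show ?thesis by (simp add: card_Diff_singleton)
qed

text \<open>Hausdorff measure refers only to diameters, so it is invariant under isometries. A
  linear isometry carries the hyperplane to \<open>real^'m punctured\<close>, where the disc is an
  open ball of full dimension.\<close>

lemma hausdorff_outer_hyperplane_disc:
  fixes \<nu> :: "real^'m::finite"
  assumes m: "1 < CARD('m)" and \<nu>: "\<nu> \<noteq> 0" and r: "0 \<le> r"
  shows "hausdorff_outer (real CARD('m) - 1) {y. \<nu> \<bullet> y = 0 \<and> norm y < r} =
    ennreal (unit_ball_vol (real CARD('m) - 1) * r ^ (CARD('m) - 1))"
proof -
  let ?S = "UNIV :: (real^'m punctured) set" and ?T = "{y. \<nu> \<bullet> y = 0}"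
  let ?n = "real CARD('m) - 1"
  have dimn: "DIM(real^'m punctured) = CARD('m) - 1" by (simp add: CARD_punctured[OF m])
  have n: "real DIM(real^'m punctured) = ?n" unfolding dimn using m by (simp add: of_nat_diff)
  have "dim ?S = dim ?T"
    using \<nu> unfolding dim_UNIV dimn by (simp add: dim_hyperplane)
  then obtain f g where fg: "linear f" "linear g" "f ` ?S = ?T" "g ` ?T = ?S"
    "\<And>x. x \<in> ?S \<Longrightarrow> norm (f x) = norm x" "\<And>x. x \<in> ?T \<Longrightarrow> norm (g x) = norm x"
    "\<And>x. x \<in> ?S \<Longrightarrow> g (f x) = x" "\<And>x. x \<in> ?T \<Longrightarrow> f (g x) = x"
    by (rule isometries_subspaces[OF subspace_UNIV subspace_hyperplane]) (rule that)
  have df: "dist (f x) (f y) = dist x y" for x y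
    using fg(5)[of "x - y"] by (simp add: dist_norm linear_diff[OF fg(1)])
  have dg: "dist (g x) (g y) = dist x y" if "x \<in> ?T" "y \<in> ?T" for x y
    using fg(6)[of "x - y"] that by (simp add: dist_norm linear_diff[OF fg(2)] inner_diff_right)
  let ?D = "{y. \<nu> \<bullet> y = 0 \<and> norm y < r}"
  have D: "?D = f ` ball 0 r"
  proof (intro equalityI subsetI)
    fix y assume y: "y \<in> ?D"
    then have "y = f (g y)" "g y \<in> ball 0 r" using fg(8,6) by auto
    then show "y \<in> f ` ball 0 r" by blast
  next
    fix y assume "y \<in> f ` ball 0 r"
    then obtain x where "y = f x" "norm x < r" by auto
    moreover have "f x \<in> ?T" using fg(3) by blast
    ultimately show "y \<in> ?D" using fg(5)[of x] by simp
  qed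
  have gD: "g ` ?D = ball 0 r" unfolding D image_image using fg(7) by simp
  have "hausdorff_outer ?n ?D \<le> ennreal (1 powr ?n) * hausdorff_outer ?n (ball 0 r :: (real^'m punctured) set)"
    unfolding D
    by (rule hausdorff_outer_lipschitz_image_le) (use m df in simp_all)
  moreover have "hausdorff_outer ?n (g ` ?D) \<le> ennreal (1 powr ?n) * hausdorff_outer ?n ?D"
    by (rule hausdorff_outer_lipschitz_image_le) (use m dg in simp_all)
  ultimately have "hausdorff_outer ?n ?D = hausdorff_outer ?n (ball 0 r :: (real^'m punctured) set)"
    unfolding gD by (auto intro: antisym)
  also have "\<dots> = emeasure lborel (ball 0 r :: (real^'m punctured) set)"
    using hausdorff_outer_open[of "ball 0 r :: (real^'m punctured) set"] unfolding n by simp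
  also have "\<dots> = ennreal (unit_ball_vol ?n * r ^ (CARD('m) - 1))"
    using emeasure_ball[OF r, of "0 :: real^'m punctured"] unfolding n unfolding dimn by simp
  finally show ?thesis .
qed

section \<open>Lyapunov surfaces\<close>

lemma convex_orthant: "convex (orthant K)"
proof -
  have "orthant K = (\<Inter>k\<in>K. {x. 0 < axis k 1 \<bullet> x})"
    by (auto simp: orthant_def inner_axis')
  then show ?thesis by (auto intro!: convex_INT convex_halfspace_gt)
qed

lemma open_orthant: "open (orthant K :: (real^'m::finite) set)"
proof -
  have "orthant K = (\<Inter>k\<in>K. {x :: real^'m. 0 < axis k 1 \<bullet> x})"
    by (auto simp: orthant_def inner_axis')
  then show ?thesis by (auto intro!: open_INT open_halfspace_gt)
qed

lemma connected_avoiding_frontier: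
  assumes "connected S" "S \<inter> frontier T = {}" "x \<in> S" "y \<in> S" "x \<in> T"
  shows "y \<in> T"
  using connected_Int_frontier[of S T] assms by blast

lemma norm_orthogonal_component:
  fixes x \<nu> :: "'a::real_inner"
  assumes "norm \<nu> = 1"
  shows "(norm (x - (x \<bullet> \<nu>) *\<^sub>R \<nu>))\<^sup>2 = (norm x)\<^sup>2 - (x \<bullet> \<nu>)\<^sup>2"
proof -
  have "\<nu> \<bullet> \<nu> = 1" using assms by (simp add: norm_eq_1)
  then show ?thesis
    unfolding power2_norm_eq_inner
    by (simp add: inner_diff_left inner_diff_right inner_commute power2_eq_square algebra_simps)
qed

text \<open>By Pythagoras the projection along \<open>\<nu>\<close> shrinks distances within
  \<open>G\<close> by no more than the factor \<open>sqrt (1 - \<theta>\<^sup>2)\<close>. So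
  \<open>G\<close> is the Lipschitz image of a part of the flat disc of radius
  \<open>r\<close>.\<close>

lemma hausdorff_outer_flat_le:
  fixes G :: "(real^'m::finite) set"
  assumes m: "1 < CARD('m)" and \<nu>: "norm \<nu> = 1" and \<theta>: "0 \<le> \<theta>" "\<theta> < 1"
    and flat: "\<And>x y. x \<in> G \<Longrightarrow> y \<in> G \<Longrightarrow> \<bar>(y - x) \<bullet> \<nu>\<bar> \<le> \<theta> * norm (y - x)"
    and G: "G \<subseteq> ball t r" and r: "0 \<le> r"
  shows "hausdorff_outer (real CARD('m) - 1) G \<le>
    ennreal ((1 / sqrt (1 - \<theta>\<^sup>2)) powr (real CARD('m) - 1)) *
    ennreal (unit_ball_vol (real CARD('m) - 1) * r ^ (CARD('m) - 1))"
proof -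
  let ?n = "real CARD('m) - 1"
  define P where "P y = (y - t) - ((y - t) \<bullet> \<nu>) *\<^sub>R \<nu>" for y
  have PP: "P x - P y = (x - y) - ((x - y) \<bullet> \<nu>) *\<^sub>R \<nu>" for x y
    by (simp add: P_def inner_diff_left algebra_simps)
  have \<theta>2: "0 < 1 - \<theta>\<^sup>2" using \<theta> by (simp add: power_less_one_iff abs_square_less_1)
  have bound: "dist x y \<le> 1 / sqrt (1 - \<theta>\<^sup>2) * dist (P x) (P y)" if "x \<in> G" "y \<in> G" for x y
  proof -
    have "((x - y) \<bullet> \<nu>)\<^sup>2 \<le> (\<theta> * norm (x - y))\<^sup>2"
      using flat[OF that(2,1)] \<theta> by (intro iffD1[OF abs_le_square_iff]) simp
    then have "(1 - \<theta>\<^sup>2) * (norm (x - y))\<^sup>2 \<le> (norm (P x - P y))\<^sup>2"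
      unfolding PP norm_orthogonal_component[OF \<nu>] by (simp add: power_mult_distrib algebra_simps)
    then have "(sqrt (1 - \<theta>\<^sup>2) * norm (x - y))\<^sup>2 \<le> (norm (P x - P y))\<^sup>2"
      using \<theta>2 by (simp add: power_mult_distrib)
    then have "sqrt (1 - \<theta>\<^sup>2) * norm (x - y) \<le> norm (P x - P y)"
      by (rule power2_le_imp_le) simp
    then show ?thesis using \<theta>2 by (simp add: dist_norm field_simps)
  qed
  have inj: "inj_on P G"
    using bound by (fastforce intro: inj_onI)
  have "hausdorff_outer ?n G = hausdorff_outer ?n (inv_into G P ` (P ` G))"
    using inj by (simp add: inv_into_image_cancel)
  also have "\<dots> \<le> ennreal ((1 / sqrt (1 - \<theta>\<^sup>2)) powr ?n) * hausdorff_outer ?n (P ` G)"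
  proof (rule hausdorff_outer_lipschitz_image_le)
    fix x y assume xy: "x \<in> P ` G" "y \<in> P ` G"
    show "dist (inv_into G P x) (inv_into G P y) \<le> 1 / sqrt (1 - \<theta>\<^sup>2) * dist x y"
      using bound[OF inv_into_into[OF xy(1)] inv_into_into[OF xy(2)]] xy by (simp add: f_inv_into_f)
  qed (use \<theta>2 m in auto)
  also have "hausdorff_outer ?n (P ` G) \<le> hausdorff_outer ?n {y. \<nu> \<bullet> y = 0 \<and> norm y < r}"
  proof (rule hausdorff_outer_mono, rule subsetI)
    fix z assume "z \<in> P ` G"
    then obtain y where y: "y \<in> G" "z = P y" by blast
    have "(norm z)\<^sup>2 \<le> (norm (y - t))\<^sup>2"
      unfolding y(2) P_def norm_orthogonal_component[OF \<nu>] by simp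
    then have "norm z \<le> norm (y - t)" by (rule power2_le_imp_le) simp
    moreover have "norm (y - t) < r" using y G by (auto simp: dist_norm norm_minus_commute)
    moreover have "\<nu> \<bullet> z = 0"
      using \<nu> by (simp add: y(2) P_def inner_diff_right inner_commute norm_eq_1)
    ultimately show "z \<in> {y. \<nu> \<bullet> y = 0 \<and> norm y < r}" by simp
  qed
  also have "\<dots> = ennreal (unit_ball_vol ?n * r ^ (CARD('m) - 1))"
    using \<nu> by (intro hausdorff_outer_hyperplane_disc m r) auto
  finally show ?thesis by (simp add: mult_left_mono)
qed

section \<open>Normals and chords of a Lyapunov surface\<close>

locale lyapunov_surface =
  fixes K :: "'m::finite set" and \<Omega> \<Gamma> :: "(real^'m) set" and N :: "real^'m \<Rightarrow> real^'m"
    and a \<kappa> :: real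
  assumes card_gt: "1 < CARD('m)"
    and open_dom: "open \<Omega>" and bounded_dom: "bounded \<Omega>"
    and Gamma_eq: "\<Gamma> = frontier \<Omega> \<inter> orthant K"
    and normal: "x \<in> \<Gamma> \<Longrightarrow> outer_unit_normal \<Omega> \<Gamma> x (N x)"
    and a_pos: "0 < a" and kappa_pos: "0 < \<kappa>"
    and lyapunov: "x \<in> \<Gamma> \<Longrightarrow> y \<in> \<Gamma> \<Longrightarrow> arccos (N x \<bullet> N y) \<le> a * dist x y powr \<kappa>"
begin

lemma norm_normal: "x \<in> \<Gamma> \<Longrightarrow> norm (N x) = 1"
  using normal by (simp add: outer_unit_normal_def)

lemma Gamma_orthant: "\<Gamma> \<subseteq> orthant K"
  by (simp add: Gamma_eq)

lemma Gamma_borel: "\<Gamma> \<in> sets borel"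
  unfolding Gamma_eq by (intro sets.Int borel_open open_orthant borel_closed frontier_closed)

lemma bounded_Gamma: "bounded \<Gamma>"
  using bounded_subset[OF bounded_closure[OF bounded_dom], of \<Gamma>] by (auto simp: Gamma_eq frontier_def)

text \<open>Unit vectors at angle \<phi> are \<open>2 * sin (\<phi> / 2)\<close> apart, which is at
  most \<phi>.\<close>

lemma norm_normal_diff_le:
  assumes x: "x \<in> \<Gamma>" and y: "y \<in> \<Gamma>"
  shows "norm (N x - N y) \<le> a * dist x y powr \<kappa>"
proof -
  define \<phi> where "\<phi> = arccos (N x \<bullet> N y)"
  have "\<bar>N x \<bullet> N y\<bar> \<le> 1"
    using Cauchy_Schwarz_ineq2[of "N x" "N y"] norm_normal x y by simp
  then have c: "cos \<phi> = N x \<bullet> N y" and \<phi>: "0 \<le> \<phi>"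
    unfolding \<phi>_def by (auto intro: cos_arccos_abs arccos_lbound simp: abs_le_iff)
  have "(norm (N x - N y))\<^sup>2 = 2 - 2 * cos \<phi>"
    using norm_normal[OF x] norm_normal[OF y] unfolding c power2_norm_eq_inner
    by (simp add: inner_diff_left inner_diff_right inner_commute norm_eq_1)
  also have "\<dots> = (2 * sin (\<phi> / 2))\<^sup>2"
    using cos_double_sin[of "\<phi> / 2"] by (simp add: power2_eq_square)
  also have "\<dots> \<le> \<phi>\<^sup>2"
    using abs_sin_x_le_abs_x[of "\<phi> / 2"] by (intro iffD1[OF abs_le_square_iff]) simp
  finally have "norm (N x - N y) \<le> \<phi>"
    using \<phi> by (rule power2_le_imp_le)
  then show ?thesis using lyapunov[OF x y] by (simp add: \<phi>_def)
qed

text \<open>The definition of the normal gives inside and outside only along one line. Tangency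
  keeps \<Gamma> near \<open>z\<close> away from all directions on the segment from
  \<open>N z\<close> to \<open>u\<close>. So the direction can be turned from \<open>N z\<close> to
  \<open>u\<close> without meeting the frontier, and connectedness carries the information
  over.\<close>

lemma normal_cone:
  assumes z: "z \<in> \<Gamma>" and u: "0 < u \<bullet> N z"
  shows "\<exists>\<eta>>0. \<forall>s. 0 < s \<and> s < \<eta> \<longrightarrow> z + s *\<^sub>R u \<notin> closure \<Omega> \<and> z - s *\<^sub>R u \<in> \<Omega>"
proof -
  \<comment> \<open>On the whole segment of directions \<open>c\<close> bounds the normal component
    from below and \<open>M\<close> the length from above, so the slope is at least
    \<open>c / M\<close>.\<close>
  define c where "c = min 1 (u \<bullet> N z)"
  define M where "M = max 1 (norm u)"
  have c: "0 < c" and M: "1 \<le> M" using u by (auto simp: c_def M_def)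
  have nz: "norm (N z) = 1" by (rule norm_normal[OF z])
  have seg: "c \<le> d \<bullet> N z" "norm d \<le> M" if "d \<in> closed_segment (N z) u" for d
  proof -
    have "convex {d. c \<le> N z \<bullet> d}" by (rule convex_halfspace_ge)
    moreover have "N z \<in> {d. c \<le> N z \<bullet> d}" "u \<in> {d. c \<le> N z \<bullet> d}"
      using nz by (auto simp: c_def inner_commute norm_eq_1)
    ultimately show "c \<le> d \<bullet> N z"
      using that closed_segment_subset by (metis (no_types, lifting) inner_commute mem_Collect_eq subsetD)
    have "N z \<in> cball 0 M" "u \<in> cball 0 M" using nz by (auto simp: M_def)
    then have "d \<in> cball 0 M" using that closed_segment_subset convex_cball by blast
    then show "norm d \<le> M" by simp
  qed
  from normal[OF z] obtain \<delta> where \<delta>: "0 < \<delta>"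
    "\<And>h. 0 < h \<Longrightarrow> h < \<delta> \<Longrightarrow> z - h *\<^sub>R N z \<in> \<Omega> \<and> z + h *\<^sub>R N z \<notin> closure \<Omega>"
    and lim: "((\<lambda>x. ((x - z) \<bullet> N z) / norm (x - z)) \<longlongrightarrow> 0) (at z within \<Gamma>)"
    unfolding outer_unit_normal_def by auto
  have "eventually (\<lambda>x. \<bar>((x - z) \<bullet> N z) / norm (x - z)\<bar> < c / M) (at z within \<Gamma>)"
    using tendstoD[OF lim, of "c / M"] c M by simp
  then obtain e where e: "0 < e" "\<And>x. x \<in> \<Gamma> \<Longrightarrow> x \<noteq> z \<Longrightarrow> dist x z < e \<Longrightarrow> \<bar>((x - z) \<bullet> N z) / norm (x - z)\<bar> < c / M"
    unfolding eventually_at by auto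
  obtain e2 where e2: "0 < e2" "ball z e2 \<subseteq> orthant K"
    using open_orthant z Gamma_orthant by (meson openE subsetD)
  define \<eta> where "\<eta> = min \<delta> (min e e2 / M)"
  \<comment> \<open>\<open>\<sigma> = 1\<close> treats the outer side and
    \<open>\<sigma> = - 1\<close> the inner side.\<close>
  have avoid: "(\<lambda>d. z + (\<sigma> * s) *\<^sub>R d) ` closed_segment (N z) u \<inter> frontier \<Omega> = {}"
    if s: "0 < s" "s < \<eta>" and \<sigma>: "\<bar>\<sigma>\<bar> = 1" for s \<sigma>
  proof (rule ccontr)
    assume "\<not> ?thesis"
    then obtain d where d: "d \<in> closed_segment (N z) u" "z + (\<sigma> * s) *\<^sub>R d \<in> frontier \<Omega>" by blast
    define w where "w = z + (\<sigma> * s) *\<^sub>R d"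
    have nw: "norm (w - z) = s * norm d" using s \<sigma> by (simp add: w_def abs_mult)
    have iw: "\<bar>(w - z) \<bullet> N z\<bar> = s * (d \<bullet> N z)"
      using s \<sigma> seg(1)[OF d(1)] c by (simp add: w_def abs_mult)
    have dn: "d \<noteq> 0" using seg(1)[OF d(1)] c by auto
    have "s * norm d \<le> s * M" using seg(2)[OF d(1)] s by simp
    also have "\<dots> < min e e2" using s M by (simp add: \<eta>_def field_simps)
    finally have dw: "norm (w - z) < min e e2" using nw by simp
    then have "w \<in> ball z e2" by (simp add: dist_norm norm_minus_commute)
    then have "w \<in> \<Gamma>" using d(2) e2(2) by (auto simp: Gamma_eq w_def)
    moreover have "w \<noteq> z" using dn s \<sigma> by (auto simp: w_def)
    ultimately have "\<bar>((w - z) \<bullet> N z) / norm (w - z)\<bar> < c / M"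
      using dw by (intro e(2)) (simp_all add: dist_norm)
    moreover have "\<bar>((w - z) \<bullet> N z) / norm (w - z)\<bar> = (d \<bullet> N z) / norm d"
      using s by (simp add: abs_divide iw nw)
    moreover have "c / M \<le> (d \<bullet> N z) / norm d"
      using seg[OF d(1)] c dn by (intro frac_le) auto
    ultimately show False by simp
  qed
  have conn: "connected ((\<lambda>d. z + (\<sigma> * s) *\<^sub>R d) ` closed_segment (N z) u)" for \<sigma> s
    by (intro connected_continuous_image continuous_intros) auto
  show ?thesis
  proof (intro exI[of _ \<eta>] conjI allI impI)
    show "0 < \<eta>" using \<delta> e e2 M by (auto simp: \<eta>_def)
    fix s assume "0 < s \<and> s < \<eta>"
    then have s: "0 < s" "s < \<eta>" "s < \<delta>" by (auto simp: \<eta>_def)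
    have "z + (- 1 * s) *\<^sub>R u \<in> \<Omega>"
    proof (rule connected_avoiding_frontier[OF conn avoid[OF s(1,2), of "- 1"] imageI imageI])
      show "z + (- 1 * s) *\<^sub>R N z \<in> \<Omega>" using \<delta>(2)[OF s(1,3)] by simp
    qed auto
    then show "z - s *\<^sub>R u \<in> \<Omega>" by simp
    have "z + (1 * s) *\<^sub>R u \<notin> frontier \<Omega>"
      using avoid[OF s(1,2), of 1] by (auto simp: disjoint_iff)
    moreover have "z + (1 * s) *\<^sub>R u \<notin> \<Omega>"
    proof
      assume "z + (1 * s) *\<^sub>R u \<in> \<Omega>"
      then have "z + (1 * s) *\<^sub>R N z \<in> \<Omega>"
        by (rule connected_avoiding_frontier[OF conn avoid[OF s(1,2), of 1] imageI imageI, rotated -1]) auto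
      then show False using \<delta>(2)[OF s(1,3)] closure_subset by auto
    qed
    ultimately show "z + s *\<^sub>R u \<notin> closure \<Omega>"
      using closure_Un_frontier[of \<Omega>] by auto
  qed
qed

text \<open>
  Moving in the direction \<open>u\<close>, every crossing of \<open>\<Gamma>\<close> leads from \<open>\<Omega>\<close> to the exterior, so two crossings
  cannot follow each other.
\<close>
lemma no_transversal_chord:
  assumes Q: "convex Q" "Q \<subseteq> orthant K" and x: "x \<in> \<Gamma>" "x \<in> Q" and y: "x + u \<in> \<Gamma>" "x + u \<in> Q"
    and u: "\<And>z. z \<in> \<Gamma> \<Longrightarrow> z \<in> Q \<Longrightarrow> 0 < u \<bullet> N z"
  shows False
proof -
  obtain \<eta> where \<eta>: "0 < \<eta>" "\<And>s. 0 < s \<Longrightarrow> s < \<eta> \<Longrightarrow> x + s *\<^sub>R u \<notin> closure \<Omega>"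
    using normal_cone[OF x(1) u[OF x]] by blast
  \<comment> \<open>Starting at \<open>b > 0\<close> skips \<open>x\<close>, which itself lies in
    \<open>closure \<Omega>\<close>. At \<open>b\<close> the chord is outside, and \<open>l\<close>
    below is the parameter of its first return.\<close>
  define b where "b = min (\<eta> / 2) (1 / 2)"
  have b: "0 < b" "b < \<eta>" "b < 1" using \<eta> by (auto simp: b_def)
  define T where "T = {s \<in> {b..1}. x + s *\<^sub>R u \<in> closure \<Omega>}"
  have "closed ({b..1} \<inter> (\<lambda>s. x + s *\<^sub>R u) -` closure \<Omega>)"
    by (intro continuous_closed_preimage continuous_intros) auto
  also have "{b..1} \<inter> (\<lambda>s. x + s *\<^sub>R u) -` closure \<Omega> = T" by (auto simp: T_def)
  finally have "closed T" .
  have "1 \<in> T" using y b by (simp add: T_def Gamma_eq frontier_def)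
  have bdd: "bdd_below T" by (rule bdd_belowI[of _ b]) (auto simp: T_def)
  define l where "l = Inf T"
  have lT: "l \<in> T" unfolding l_def using closed_contains_Inf[OF _ bdd \<open>closed T\<close>] \<open>1 \<in> T\<close> by blast
  have before: "x + s *\<^sub>R u \<notin> closure \<Omega>" if "b \<le> s" "s < l" for s
  proof
    assume "x + s *\<^sub>R u \<in> closure \<Omega>"
    then have "s \<in> T" using that lT by (auto simp: T_def)
    then have "l \<le> s" unfolding l_def by (rule cInf_lower[OF _ bdd])
    then show False using that by simp
  qed
  have lb: "b < l" using lT \<eta>(2)[of b] b by (auto simp: T_def less_le)
  define z where "z = x + l *\<^sub>R u"
  have zc: "z \<in> closure \<Omega>" using lT by (simp add: T_def z_def)
  have "z = (1 - l) *\<^sub>R x + l *\<^sub>R (x + u)" by (simp add: z_def algebra_simps)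
  moreover have "0 \<le> l" "l \<le> 1" using lT b by (auto simp: T_def)
  ultimately have zQ: "z \<in> Q" using Q(1) x y by (simp add: convex_alt)
  \<comment> \<open>Whether \<open>z\<close> is interior or a crossing of \<Gamma>, the chord is
    inside \<Omega> just before \<open>z\<close>; this contradicts \<open>before\<close>.\<close>
  have "\<exists>\<eta>>0. \<forall>s. 0 < s \<and> s < \<eta> \<longrightarrow> z - s *\<^sub>R u \<in> \<Omega>"
  proof (cases "z \<in> \<Omega>")
    case True
    have "isCont (\<lambda>s. z - s *\<^sub>R u) 0" by (intro continuous_intros)
    then have "eventually (\<lambda>s. z - s *\<^sub>R u \<in> \<Omega>) (at 0)"
      using True open_dom by (auto simp: isCont_def dest!: topological_tendstoD)
    then show ?thesis unfolding eventually_at by (auto simp: dist_real_def)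
  next
    case False
    then have "z \<in> \<Gamma>" using zc zQ Q(2) open_dom by (auto simp: Gamma_eq frontier_def interior_open)
    then show ?thesis using normal_cone[OF _ u[OF _ zQ]] by blast
  qed
  then obtain \<epsilon> where \<epsilon>: "0 < \<epsilon>" "\<And>s. 0 < s \<Longrightarrow> s < \<epsilon> \<Longrightarrow> z - s *\<^sub>R u \<in> \<Omega>" by blast
  define s where "s = min (\<epsilon> / 2) (l - b)"
  have s: "0 < s" "s < \<epsilon>" "s \<le> l - b" using \<epsilon> lb by (auto simp: s_def)
  have "x + (l - s) *\<^sub>R u \<in> \<Omega>" using \<epsilon>(2)[OF s(1,2)] by (simp add: z_def algebra_simps)
  then show False using before[of "l - s"] s closure_subset by auto
qed

text \<open>All normals over \<open>Q\<close> are within \<open>\<theta>\<close> of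
  \<open>\<nu>\<close>. A chord steeper than \<open>\<theta>\<close> against \<open>\<nu>\<close>
  would have a positive product with every one of them, which \<open>no_transversal_chord\<close>
  excludes.\<close>

lemma chord_flat:
  assumes Q: "convex Q" "Q \<subseteq> orthant K" and x: "x \<in> \<Gamma>" "x \<in> Q" and y: "y \<in> \<Gamma>" "y \<in> Q"
    and \<theta>: "\<And>z. z \<in> \<Gamma> \<Longrightarrow> z \<in> Q \<Longrightarrow> norm (N z - \<nu>) \<le> \<theta>"
  shows "\<bar>(y - x) \<bullet> \<nu>\<bar> \<le> \<theta> * norm (y - x)"
proof -
  have *: "(y - x) \<bullet> \<nu> \<le> \<theta> * norm (y - x)"
    if x: "x \<in> \<Gamma>" "x \<in> Q" and y: "y \<in> \<Gamma>" "y \<in> Q" for x y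
  proof (rule ccontr)
    assume less: "\<not> ?thesis"
    have "0 < (y - x) \<bullet> N z" if z: "z \<in> \<Gamma>" "z \<in> Q" for z
    proof -
      have "\<bar>(y - x) \<bullet> (N z - \<nu>)\<bar> \<le> norm (y - x) * norm (N z - \<nu>)" by (rule Cauchy_Schwarz_ineq2)
      also have "\<dots> \<le> norm (y - x) * \<theta>" by (intro mult_left_mono \<theta> z) simp
      finally have "\<bar>(y - x) \<bullet> (N z - \<nu>)\<bar> \<le> norm (y - x) * \<theta>" .
      then show ?thesis using less by (simp add: inner_diff_right mult.commute abs_le_iff)
    qed
    then show False using no_transversal_chord[OF Q x, of "y - x"] y by simp
  qed
  show ?thesis
    using *[OF x y] *[OF y x] by (simp add: abs_le_iff inner_diff_left norm_minus_commute)
qed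

lemma chord_flat_ball:
  assumes t: "t \<in> \<Gamma>" and x: "x \<in> \<Gamma>" "x \<in> ball t r" and y: "y \<in> \<Gamma>" "y \<in> ball t r"
  shows "\<bar>(y - x) \<bullet> N t\<bar> \<le> a * r powr \<kappa> * norm (y - x)"
proof (rule chord_flat[of "ball t r \<inter> orthant K"])
  show "convex (ball t r \<inter> orthant K)" by (intro convex_Int convex_ball convex_orthant)
  fix z assume z: "z \<in> \<Gamma>" "z \<in> ball t r \<inter> orthant K"
  have "norm (N z - N t) \<le> a * dist z t powr \<kappa>" by (rule norm_normal_diff_le[OF z(1) t])
  also have "\<dots> \<le> a * r powr \<kappa>"
    using z a_pos kappa_pos by (intro mult_left_mono powr_mono2) (auto simp: dist_commute)
  finally show "norm (N z - N t) \<le> a * r powr \<kappa>" .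
qed (use x y Gamma_orthant in auto)

text \<open>The factor 2 arises because the open ball of radius \<open>dist x t\<close> around
  \<open>t\<close> misses \<open>x\<close>; \<open>chord_flat_ball\<close> is applied with twice
  that radius.\<close>

lemma tangent_deviation:
  assumes t: "t \<in> \<Gamma>" and x: "x \<in> \<Gamma>"
  shows "\<bar>(x - t) \<bullet> N t\<bar> \<le> a * (2 * dist x t) powr \<kappa> * dist x t"
proof (cases "x = t")
  case False
  then show ?thesis
    using chord_flat_ball[OF t t _ x, of "2 * dist x t"] by (simp add: dist_norm norm_minus_commute)
qed simp

text \<open>Pieces of radius \<open>r\<close> have slope at most 1/2 and hence finite area, and
  compactness of \<open>closure \<Gamma>\<close> leaves finitely many of them. A centre may lie on a
  hyperplane, off \<Gamma>, so each piece is recentred at a point of its own with radius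
  \<open>2 * r\<close>.\<close>

lemma finite_area: "hausdorff_outer (real CARD('m) - 1) \<Gamma> < \<infinity>"
proof -
  let ?H = "hausdorff_outer (real CARD('m) - 1)"
  \<comment> \<open>The solution of \<open>a * (2 * r) powr \<kappa> = 1 / 2\<close>.\<close>
  define r where "r = (1 / (2 * a)) powr (1 / \<kappa>) / 2"
  have r: "0 < r" using a_pos by (simp add: r_def)
  have ar: "a * (2 * r) powr \<kappa> = 1 / 2"
    using a_pos kappa_pos by (simp add: r_def powr_powr)
  have piece: "?H (\<Gamma> \<inter> ball p r) < \<infinity>" for p
  proof (cases "\<Gamma> \<inter> ball p r = {}")
    case False
    then obtain t where t: "t \<in> \<Gamma>" "t \<in> ball p r" by auto
    have sub: "\<Gamma> \<inter> ball p r \<subseteq> ball t (2 * r)"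
    proof
      fix x assume "x \<in> \<Gamma> \<inter> ball p r"
      then show "x \<in> ball t (2 * r)"
        using t dist_triangle3[of t x p] by auto
    qed
    have "?H (\<Gamma> \<inter> ball p r) \<le>
       ennreal ((1 / sqrt (1 - (1/2)\<^sup>2)) powr (real CARD('m) - 1)) *
       ennreal (unit_ball_vol (real CARD('m) - 1) * (2 * r) ^ (CARD('m) - 1))"
    proof (rule hausdorff_outer_flat_le[OF card_gt norm_normal[OF t(1)] _ _ _ sub])
      fix x y assume "x \<in> \<Gamma> \<inter> ball p r" "y \<in> \<Gamma> \<inter> ball p r"
      then show "\<bar>(y - x) \<bullet> N t\<bar> \<le> 1 / 2 * norm (y - x)"
        using chord_flat_ball[OF t(1), of x "2 * r" y] sub by (simp only: ar) blast
    qed (use r in auto)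
    also have "\<dots> < \<infinity>" by (simp add: ennreal_mult_less_top)
    finally show ?thesis .
  qed simp
  have "compact (closure \<Gamma>)" using bounded_Gamma by (simp add: compact_eq_bounded_closed bounded_closure)
  then obtain D where D: "finite D" "closure \<Gamma> \<subseteq> (\<Union>p\<in>D. ball p r)"
  proof (rule compactE_image[of _ "closure \<Gamma>" "\<lambda>p. ball p r"])
    show "closure \<Gamma> \<subseteq> (\<Union>c\<in>closure \<Gamma>. ball c r)" using r by force
  qed auto
  have "?H (\<Union>p\<in>D. \<Gamma> \<inter> ball p r) < \<infinity>"
    using D(1)
  proof (induction D)
    case (insert p D)
    have "?H (\<Union>p\<in>insert p D. \<Gamma> \<inter> ball p r) \<le> ?H (\<Gamma> \<inter> ball p r) + ?H (\<Union>p\<in>D. \<Gamma> \<inter> ball p r)"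
      using hausdorff_outer_Un_le by simp
    also have "\<dots> < \<infinity>" using insert piece by (simp add: less_top[symmetric])
    finally show ?case .
  qed simp
  moreover have "\<Gamma> \<subseteq> (\<Union>p\<in>D. \<Gamma> \<inter> ball p r)" using D(2) closure_subset by fastforce
  ultimately show ?thesis using hausdorff_outer_mono le_less_trans by blast
qed

section \<open>The area density at a point\<close>

text \<open>The points \<open>y - s N\<close> and \<open>y + s N\<close>, seen from
  \<open>t\<close>, are inside and outside \<Omega>: horizontal moves from the normal line reach
  them without meeting the frontier. The vertical segment between them meets the frontier in a point
  that projects to \<open>y\<close>. Shrinking the disc by
  \<open>sqrt (1 - \<theta>\<^sup>2)\<close> keeps this point in \<open>ball t r\<close>.\<close>

lemma projection_covers_disc:
  assumes t: "t \<in> \<Gamma>" and r: "0 < r" and orth: "ball t (2 * r) \<subseteq> orthant K"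
    and \<delta>: "\<And>h. 0 < h \<Longrightarrow> h < r \<Longrightarrow> t - h *\<^sub>R N t \<in> \<Omega> \<and> t + h *\<^sub>R N t \<notin> closure \<Omega>"
    and \<theta>: "\<theta> = a * (2 * r) powr \<kappa>" "\<theta> < 1 / 2"
    and y: "N t \<bullet> y = 0" "norm y < r * sqrt (1 - \<theta>\<^sup>2)"
  shows "\<exists>\<xi>\<in>\<Gamma> \<inter> ball t r. (\<xi> - t) - ((\<xi> - t) \<bullet> N t) *\<^sub>R N t = y"
proof (cases "y = 0")
  case True
  then show ?thesis using t r by (intro bexI[of _ t]) auto
next
  case False
  \<comment> \<open>The height \<open>norm y\<close> suffices: a horizontal move by \<open>y\<close>
    stays within \<open>2 * s\<close> of \<open>t\<close>, where frontier points have height below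
    \<open>s\<close> because \<open>\<theta> < 1 / 2\<close>.\<close>
  define s where "s = norm y"
  have \<theta>0: "0 \<le> \<theta>" using a_pos by (simp add: \<theta>)
  have "\<theta>\<^sup>2 \<le> (1/2)\<^sup>2" using \<theta>0 \<theta>(2) by (intro power_mono) auto
  then have \<theta>2: "0 < 1 - \<theta>\<^sup>2" by (simp add: power2_eq_square)
  have "r * sqrt (1 - \<theta>\<^sup>2) \<le> r * 1" using r by (intro mult_left_mono) auto
  then have s: "0 < s" "s < r" using y(2) False by (auto simp: s_def)
  have nu: "norm (N t) = 1" by (rule norm_normal[OF t])
  then have nn: "N t \<bullet> N t = 1" by (simp add: norm_eq_1)
  have yn: "y \<bullet> N t = 0" using y(1) by (simp add: inner_commute)
  have flat: "\<bar>(x - t) \<bullet> N t\<bar> \<le> \<theta> * norm (x - t)" if "x \<in> frontier \<Omega>" "norm (x - t) < 2 * r" for x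
  proof -
    have "x \<in> ball t (2 * r)" using that by (simp add: dist_norm norm_minus_commute)
    then have "x \<in> \<Gamma>" using that orth by (auto simp: Gamma_eq)
    then show ?thesis
      using chord_flat_ball[OF t t _ \<open>x \<in> \<Gamma>\<close> \<open>x \<in> ball t (2 * r)\<close>] r by (simp add: \<theta>)
  qed
  have avoid: "closed_segment (t + (\<sigma> * s) *\<^sub>R N t) (t + (\<sigma> * s) *\<^sub>R N t + y) \<inter> frontier \<Omega> = {}"
    if \<sigma>: "\<bar>\<sigma>\<bar> = 1" for \<sigma>
  proof (rule ccontr)
    assume "\<not> ?thesis"
    then obtain w where w: "w \<in> closed_segment (t + (\<sigma> * s) *\<^sub>R N t) (t + (\<sigma> * s) *\<^sub>R N t + y)" "w \<in> frontier \<Omega>"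
      by blast
    then obtain l where l: "0 \<le> l" "l \<le> 1" "w = t + (\<sigma> * s) *\<^sub>R N t + l *\<^sub>R y"
      unfolding closed_segment_def by (auto simp: algebra_simps)
    have iw: "\<bar>(w - t) \<bullet> N t\<bar> = s"
      using yn s \<sigma> nn by (simp add: l inner_add_left abs_mult)
    have "norm (w - t) \<le> norm ((\<sigma> * s) *\<^sub>R N t) + norm (l *\<^sub>R y)"
      using norm_triangle_ineq[of "(\<sigma> * s) *\<^sub>R N t" "l *\<^sub>R y"] by (simp add: l(3))
    also have "\<dots> \<le> s + s"
      using l s \<sigma> nu by (simp add: abs_mult s_def[symmetric] mult_left_le_one_le)
    finally have nw: "norm (w - t) \<le> 2 * s" by simp
    have "s \<le> \<theta> * norm (w - t)" using flat[OF w(2)] iw nw s by simp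
    also have "\<dots> \<le> \<theta> * (2 * s)" using \<theta>0 nw by (intro mult_left_mono)
    also have "\<dots> < 1 / 2 * (2 * s)" using \<theta>(2) s by (intro mult_strict_right_mono) auto
    finally show False by simp
  qed
  have low: "t + (- 1 * s) *\<^sub>R N t + y \<in> \<Omega>"
    by (rule connected_avoiding_frontier[OF connected_segment avoid[of "- 1"], of "t + (- 1 * s) *\<^sub>R N t"])
       (use \<delta>[OF s] in auto)
  have high: "t + (1 * s) *\<^sub>R N t + y \<notin> \<Omega>"
  proof
    assume "t + (1 * s) *\<^sub>R N t + y \<in> \<Omega>"
    then have "t + (1 * s) *\<^sub>R N t \<in> \<Omega>"
      by (rule connected_avoiding_frontier[OF connected_segment avoid[of 1], rotated -1]) auto
    then show False using \<delta>[OF s] closure_subset by auto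
  qed
  have "closed_segment (t + (- 1 * s) *\<^sub>R N t + y) (t + (1 * s) *\<^sub>R N t + y) \<inter> frontier \<Omega> \<noteq> {}"
    using low high by (intro connected_Int_frontier) (auto simp: disjoint_iff)
  then obtain \<xi> where \<xi>: "\<xi> \<in> closed_segment (t + (- 1 * s) *\<^sub>R N t + y) (t + (1 * s) *\<^sub>R N t + y)" "\<xi> \<in> frontier \<Omega>"
    by blast
  then obtain u where u: "0 \<le> u" "u \<le> 1" "\<xi> = (1 - u) *\<^sub>R (t + (- 1 * s) *\<^sub>R N t + y) + u *\<^sub>R (t + (1 * s) *\<^sub>R N t + y)"
    unfolding closed_segment_def by blast
  define l where "l = (2 * u - 1) * s"
  have xi: "\<xi> - t = y + l *\<^sub>R N t"
    unfolding u(3) l_def by (simp add: algebra_simps flip: scaleR_2)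
  have "\<bar>2 * u - 1\<bar> * s \<le> 1 * s" using u s by (intro mult_right_mono) auto
  then have l: "\<bar>l\<bar> \<le> s" using s by (simp add: l_def abs_mult)
  have "norm (\<xi> - t) \<le> norm y + norm (l *\<^sub>R N t)" unfolding xi by (rule norm_triangle_ineq)
  also have "\<dots> \<le> 2 * s" using l nu by (simp add: s_def)
  finally have nxi: "norm (\<xi> - t) < 2 * r" using s by simp
  have proj: "(\<xi> - t) - ((\<xi> - t) \<bullet> N t) *\<^sub>R N t = y"
    using yn nn by (simp add: xi inner_add_left)
  have "((\<xi> - t) \<bullet> N t)\<^sup>2 \<le> (\<theta> * norm (\<xi> - t))\<^sup>2"
    using flat[OF \<xi>(2) nxi] \<theta>0 by (intro iffD1[OF abs_le_square_iff]) simp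
  then have "(1 - \<theta>\<^sup>2) * (norm (\<xi> - t))\<^sup>2 \<le> (norm y)\<^sup>2"
    unfolding proj[symmetric] norm_orthogonal_component[OF nu] by (simp add: power_mult_distrib algebra_simps)
  also have "\<dots> < (r * sqrt (1 - \<theta>\<^sup>2))\<^sup>2" using y(2) by (intro power_strict_mono) auto
  also have "\<dots> = (1 - \<theta>\<^sup>2) * r\<^sup>2" using \<theta>2 by (simp add: power_mult_distrib)
  finally have "(norm (\<xi> - t))\<^sup>2 < r\<^sup>2" using \<theta>2 by simp
  then have "norm (\<xi> - t) < r" by (rule power2_less_imp_less) (use r in simp)
  moreover have "\<xi> \<in> ball t (2 * r)" using nxi by (simp add: dist_norm norm_minus_commute)
  ultimately show ?thesis
    using \<xi>(2) orth proj by (intro bexI[of _ \<xi>]) (auto simp: Gamma_eq dist_norm norm_minus_commute)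
qed

text \<open>A squeeze. The inverse projection is Lipschitz with constant \<open>1 / q r\<close>,
  which bounds the area from above. The projection does not increase distances and covers the disc
  of radius \<open>r * q r\<close>, which bounds it from below. Finally \<open>q r\<close> tends to
  1.\<close>

lemma area_density:
  assumes t: "t \<in> \<Gamma>"
  shows "((\<lambda>r. enn2real (hausdorff_outer (real CARD('m) - 1) (\<Gamma> \<inter> ball t r)) / r ^ (CARD('m) - 1))
    \<longlongrightarrow> unit_ball_vol (real CARD('m) - 1)) (at_right 0)"
proof -
  let ?n = "real CARD('m) - 1" and ?k = "CARD('m) - 1"
  let ?H = "hausdorff_outer ?n" and ?V = "unit_ball_vol (real CARD('m) - 1)"
  define \<theta> where "\<theta> r = a * (2 * r) powr \<kappa>" for r
  define q where "q r = sqrt (1 - (\<theta> r)\<^sup>2)" for r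
  have n: "real ?k = ?n" using card_gt by (simp add: of_nat_diff)
  have V: "0 \<le> ?V" using card_gt by simp
  have "((\<lambda>r. (2 * r) powr \<kappa>) \<longlongrightarrow> 0) (at_right (0::real))"
    by (rule tendsto_eq_rhs[OF tendsto_powr'[where a = 0 and b = \<kappa>]])
       (use kappa_pos in \<open>auto intro!: tendsto_eq_intros eventually_at_rightI[of 0 1]\<close>)
  then have lim\<theta>: "(\<theta> \<longlongrightarrow> 0) (at_right 0)"
    unfolding \<theta>_def by (rule tendsto_mult_right_zero)
  have limq: "(q \<longlongrightarrow> 1) (at_right 0)"
    unfolding q_def by (rule tendsto_eq_rhs[OF tendsto_real_sqrt[OF tendsto_diff[OF tendsto_const tendsto_power[OF lim\<theta>]]]]) simp
  obtain e where e: "0 < e" "ball t e \<subseteq> orthant K"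
    using open_orthant t Gamma_orthant by (meson openE subsetD)
  from normal[OF t] obtain \<delta> where \<delta>: "0 < \<delta>"
    "\<And>h. 0 < h \<Longrightarrow> h < \<delta> \<Longrightarrow> t - h *\<^sub>R N t \<in> \<Omega> \<and> t + h *\<^sub>R N t \<notin> closure \<Omega>"
    unfolding outer_unit_normal_def by auto
  have ev1: "eventually (\<lambda>r. \<theta> r < 1 / 2) (at_right 0)"
    using order_tendstoD(2)[OF lim\<theta>, of "1/2"] by simp
  have ev2: "eventually (\<lambda>r. 0 < r \<and> r < min (e / 2) \<delta>) (at_right 0)"
    using e \<delta> by (intro eventually_at_rightI[of 0 "min (e / 2) \<delta>"]) auto
  have main: "eventually (\<lambda>r. ?V * (q r) ^ ?k \<le> enn2real (?H (\<Gamma> \<inter> ball t r)) / r ^ ?k \<and>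
      enn2real (?H (\<Gamma> \<inter> ball t r)) / r ^ ?k \<le> ?V * (1 / q r) ^ ?k) (at_right 0)"
    using ev1 ev2
  proof eventually_elim
    case (elim r)
    then have r: "0 < r" "2 * r < e" "r < \<delta>" and \<theta>r: "\<theta> r < 1 / 2" by auto
    have \<theta>0: "0 \<le> \<theta> r" using a_pos by (simp add: \<theta>_def)
    have "(\<theta> r)\<^sup>2 \<le> (1/2)\<^sup>2" using \<theta>0 \<theta>r by (intro power_mono) auto
    then have q: "0 < q r" by (simp add: q_def power2_eq_square)
    define G where "G = \<Gamma> \<inter> ball t r"
    have upper: "?H G \<le> ennreal ((1 / q r) powr ?n) * ennreal (?V * r ^ ?k)"
      unfolding q_def
    proof (rule hausdorff_outer_flat_le[OF card_gt norm_normal[OF t]])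
      fix x y assume "x \<in> G" "y \<in> G"
      then have "\<bar>(y - x) \<bullet> N t\<bar> \<le> a * r powr \<kappa> * norm (y - x)"
        by (intro chord_flat_ball t) (auto simp: G_def)
      also have "\<dots> \<le> \<theta> r * norm (y - x)"
        unfolding \<theta>_def using a_pos r kappa_pos by (intro mult_right_mono mult_left_mono powr_mono2) auto
      finally show "\<bar>(y - x) \<bullet> N t\<bar> \<le> \<theta> r * norm (y - x)" .
    qed (use \<theta>0 \<theta>r r in \<open>auto simp: G_def\<close>)
    have upper': "?H G \<le> ennreal (?V * (1 / q r) ^ ?k * r ^ ?k)"
    proof -
      have pw: "(1 / q r) powr ?n = (1 / q r) ^ ?k"
        unfolding n[symmetric] by (rule powr_realpow) (use q in simp)
      show ?thesis
        using upper q r V unfolding pw by (simp add: mult_ac flip: ennreal_mult)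
    qed
    define P where "P y = (y - t) - ((y - t) \<bullet> N t) *\<^sub>R N t" for y
    have "{y. N t \<bullet> y = 0 \<and> norm y < r * q r} \<subseteq> P ` G"
    proof
      fix y assume "y \<in> {y. N t \<bullet> y = 0 \<and> norm y < r * q r}"
      then have "\<exists>\<xi>\<in>\<Gamma> \<inter> ball t r. (\<xi> - t) - ((\<xi> - t) \<bullet> N t) *\<^sub>R N t = y"
        using r e \<delta> \<theta>r by (intro projection_covers_disc[OF t r(1), where \<theta> = "\<theta> r"]) (auto simp: \<theta>_def q_def)
      then show "y \<in> P ` G" by (auto simp: P_def G_def)
    qed
    then have "?H {y. N t \<bullet> y = 0 \<and> norm y < r * q r} \<le> ?H (P ` G)" by (rule hausdorff_outer_mono)
    also have "\<dots> \<le> ennreal (1 powr ?n) * ?H G"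
    proof (rule hausdorff_outer_lipschitz_image_le)
      fix x y
      have "(norm (P x - P y))\<^sup>2 \<le> (norm (x - y))\<^sup>2"
      proof -
        have "P x - P y = (x - y) - ((x - y) \<bullet> N t) *\<^sub>R N t"
          by (simp add: P_def inner_diff_left algebra_simps)
        then show ?thesis using norm_orthogonal_component[OF norm_normal[OF t], of "x - y"] by simp
      qed
      then show "dist (P x) (P y) \<le> 1 * dist x y"
        unfolding dist_norm by simp
    qed (use card_gt in auto)
    also have "?H {y. N t \<bullet> y = 0 \<and> norm y < r * q r} = ennreal (?V * (r * q r) ^ ?k)"
      using norm_normal[OF t] r q by (intro hausdorff_outer_hyperplane_disc card_gt) auto
    finally have lower: "ennreal (?V * (r * q r) ^ ?k) \<le> ?H G" by simp
    have "?H G < top" using upper' by (rule le_less_trans) simp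
    then obtain h where h: "?H G = ennreal h" "0 \<le> h" by (cases "?H G") auto
    have "?V * (r * q r) ^ ?k \<le> h" using lower h by simp
    moreover have "h \<le> ?V * (1 / q r) ^ ?k * r ^ ?k" using upper' h V r q by (simp add: ennreal_le_iff)
    ultimately show ?case using r h unfolding G_def[symmetric]
      by (simp add: power_mult_distrib field_simps)
  qed
  show ?thesis
  proof (rule tendsto_sandwich)
    show "((\<lambda>r. ?V * (q r) ^ ?k) \<longlongrightarrow> ?V) (at_right 0)"
      by (rule tendsto_eq_rhs[OF tendsto_mult[OF tendsto_const tendsto_power[OF limq]]]) simp
    show "((\<lambda>r. ?V * (1 / q r) ^ ?k) \<longlongrightarrow> ?V) (at_right 0)"
      by (rule tendsto_eq_rhs[OF tendsto_mult[OF tendsto_const tendsto_power[OF tendsto_divide[OF tendsto_const limq]]]]) auto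
  qed (use main in \<open>auto elim: eventually_mono\<close>)
qed

end

section \<open>The fundamental solution as a heat integral\<close>

text \<open>By the mean value inequality the bound on \<open>f'\<close> also bounds the difference
  quotients, and dominated convergence applies along every sequence.\<close>

lemma has_real_derivative_integral:
  fixes f f' :: "'a \<Rightarrow> real \<Rightarrow> real"
  assumes e: "0 < e"
    and int: "\<And>h. \<bar>h\<bar> < e \<Longrightarrow> integrable M (\<lambda>x. f x h)"
    and der: "\<And>x h. x \<in> space M \<Longrightarrow> \<bar>h\<bar> < e \<Longrightarrow> (f x has_real_derivative f' x h) (at h)"
    and bound: "\<And>x h. x \<in> space M \<Longrightarrow> \<bar>h\<bar> < e \<Longrightarrow> \<bar>f' x h\<bar> \<le> g x"
    and g: "integrable M g"
  shows "((\<lambda>h. \<integral>x. f x h \<partial>M) has_real_derivative (\<integral>x. f' x 0 \<partial>M)) (at 0)"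
proof -
  let ?Q = "\<lambda>h. ((\<integral>x. f x (0 + h) \<partial>M) - (\<integral>x. f x 0 \<partial>M)) / h"
  have "(?Q \<longlongrightarrow> (\<integral>x. f' x 0 \<partial>M)) (at 0)"
  proof (subst tendsto_at_iff_sequentially, intro allI impI)
    fix X :: "nat \<Rightarrow> real" assume X0: "\<forall>i. X i \<in> UNIV - {0}" and X: "X \<longlonglongrightarrow> 0"
    from tendstoD[OF X e] obtain n0 where n0: "\<And>n. n0 \<le> n \<Longrightarrow> \<bar>X n\<bar> < e"
      by (auto simp: eventually_sequentially)
    define Y where "Y n = X (n + n0)" for n
    have Y: "\<bar>Y n\<bar> < e" "Y n \<noteq> 0" for n using n0[of "n + n0"] X0 by (auto simp: Y_def)
    have Ylim: "Y \<longlonglongrightarrow> 0" unfolding Y_def using X by (rule LIMSEQ_ignore_initial_segment)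
    have i0: "integrable M (\<lambda>x. f x 0)" using int[of 0] e by simp
    define s where "s n x = (f x (Y n) - f x 0) / Y n" for n x
    have si: "integrable M (s n)" for n unfolding s_def
      by (intro integrable_divide_zero Bochner_Integration.integrable_diff int Y i0) 
    have lim: "(\<lambda>n. s n x) \<longlonglongrightarrow> f' x 0" if "x \<in> space M" for x
    proof -
      have "((\<lambda>h. (f x (0 + h) - f x 0) / h) \<longlongrightarrow> f' x 0) (at 0)"
        using der[OF that, of 0] e by (simp add: DERIV_def)
      then show ?thesis
        unfolding s_def using Y Ylim by (auto simp: tendsto_at_iff_sequentially comp_def)
    qed
    have sb: "\<bar>s n x\<bar> \<le> g x" if "x \<in> space M" for n x
    proof -
      have "norm (f x (Y n) - f x 0) \<le> g x * norm (Y n - 0)"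
      proof (rule field_differentiable_bound[of "{-e<..<e}"])
        fix h assume "h \<in> {-e<..<e}"
        then have h: "\<bar>h\<bar> < e" by auto
        show "(f x has_field_derivative f' x h) (at h within {-e<..<e})"
          using der[OF that h] by (rule has_field_derivative_at_within)
        show "norm (f' x h) \<le> g x" using bound[OF that h] by simp
      qed (use Y[of n] e in \<open>auto simp: abs_less_iff\<close>)
      then show ?thesis using Y[of n] by (simp add: s_def field_simps)
    qed
    have "(\<lambda>n. integral\<^sup>L M (s n)) \<longlonglongrightarrow> (\<integral>x. f' x 0 \<partial>M)"
    proof (rule integral_dominated_convergence[where w = g])
      show "(\<lambda>x. f' x 0) \<in> borel_measurable M"
        by (rule borel_measurable_LIMSEQ_real[OF lim borel_measurable_integrable[OF si]])
    qed (use si g lim sb in \<open>auto intro: borel_measurable_integrable\<close>)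
    moreover have "integral\<^sup>L M (s n) = ?Q (Y n)" for n
      unfolding s_def using int[OF Y(1)] i0 by simp
    ultimately have "(\<lambda>n. (?Q \<circ> X) (n + n0)) \<longlonglongrightarrow> (\<integral>x. f' x 0 \<partial>M)"
      by (simp add: Y_def comp_def)
    then show "(?Q \<circ> X) \<longlonglongrightarrow> (\<integral>x. f' x 0 \<partial>M)" by (rule LIMSEQ_offset)
  qed
  then show ?thesis by (simp add: DERIV_def)
qed

lemma gamma_laplace:
  assumes p: "0 < p" and c: "0 < (c::real)"
  shows "has_bochner_integral lborel (\<lambda>s. indicator {0<..} s * (s powr (p - 1) * exp (- (s * c)))) (Gamma p / c powr p)"
proof -
  let ?f = "\<lambda>u. indicator {0<..} u * (u powr (p - 1) * exp (- u)) :: real"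
  have "(\<integral>\<^sup>+u. ennreal (?f u) \<partial>lborel) = (\<integral>\<^sup>+u. ennreal (indicator {0..} u * u powr (p - 1) / exp u) \<partial>lborel)"
    by (intro nn_integral_cong) (auto simp: exp_minus field_simps split: split_indicator)
  also have "\<dots> = ennreal (Gamma p)" by (rule Gamma_conv_nn_integral_real[OF p, symmetric])
  finally have "has_bochner_integral lborel ?f (Gamma p)"
    using p by (intro has_bochner_integral_nn_integral) (auto simp: Gamma_real_pos less_imp_le)
  then have "has_bochner_integral lborel (\<lambda>x. ?f (0 + c * x)) (Gamma p /\<^sub>R \<bar>c\<bar>)"
    using c by (subst (asm) lborel_has_bochner_integral_real_affine_iff[of c _ _ 0]) auto
  then have "has_bochner_integral lborel (\<lambda>x. c powr (1 - p) * ?f (0 + c * x)) (c powr (1 - p) * (Gamma p /\<^sub>R \<bar>c\<bar>))"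
    by (intro has_bochner_integral_mult_right)
  moreover have "c powr (1 - p) * ?f (0 + c * s) = indicator {0<..} s * (s powr (p - 1) * exp (- (s * c)))" for s
  proof (cases "0 < s")
    case True
    have "c powr (1 - p) * (c * s) powr (p - 1) = (c powr (1 - p) * c powr (p - 1)) * s powr (p - 1)"
      using c True by (simp add: powr_mult)
    also have "c powr (1 - p) * c powr (p - 1) = 1" using c by (simp flip: powr_add)
    finally show ?thesis using c True by (simp add: mult.commute)
  qed (use c in \<open>auto simp: zero_less_mult_iff split: split_indicator\<close>)
  moreover have "c powr (1 - p) * (Gamma p /\<^sub>R \<bar>c\<bar>) = Gamma p / c powr p"
    using c by (simp add: powr_diff field_simps)
  ultimately show ?thesis by simp
qed

section \<open>Laplace transforms of beta densities\<close>

definition beta_laplace_ker :: "real \<Rightarrow> real \<Rightarrow> real \<Rightarrow> real \<Rightarrow> real" where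
  "beta_laplace_ker p a z \<tau> = indicator {0<..<1} \<tau> * (\<tau> powr p * (1 - \<tau>) powr (- a) * exp (- (z * \<tau>)))"

text \<open>For \<open>-1 < p\<close> and \<open>a < 1\<close> this is
  \<open>Beta (p + 1) (1 - a)\<close> times Kummer's confluent hypergeometric function 1F1(p + 1; p
  + 2 - a; - z).\<close>

definition beta_laplace :: "real \<Rightarrow> real \<Rightarrow> real \<Rightarrow> real" where
  "beta_laplace p a z = (\<integral>\<tau>. beta_laplace_ker p a z \<tau> \<partial>lborel)"

lemma beta_laplace_ker_measurable [measurable]: "beta_laplace_ker p a z \<in> borel_measurable borel"
  unfolding beta_laplace_ker_def by measurable

lemma beta_laplace_ker_nonneg: "0 \<le> beta_laplace_ker p a z \<tau>"
  by (simp add: beta_laplace_ker_def)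

lemma beta_laplace_ker_antimono: "z \<le> z' \<Longrightarrow> beta_laplace_ker p a z' \<tau> \<le> beta_laplace_ker p a z \<tau>"
  by (auto simp: beta_laplace_ker_def intro!: mult_left_mono mult_right_mono split: split_indicator)

lemma integrable_beta_laplace_ker:
  assumes "-1 < p" "a < 1" "0 \<le> z"
  shows "integrable lborel (beta_laplace_ker p a z)"
proof (rule Bochner_Integration.integrable_bound)
  show "integrable lborel (\<lambda>t. indicator {0..1} t *\<^sub>R (t powr ((p + 1) - 1) * (1 - t) powr ((1 - a) - 1)))"
    using integrable_Beta[of "p + 1" "1 - a"] assms unfolding set_integrable_def by auto
  show "AE t in lborel. norm (beta_laplace_ker p a z t) \<le> norm (indicator {0..1} t *\<^sub>R (t powr ((p + 1) - 1) * (1 - t) powr ((1 - a) - 1)))"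
    using assms by (intro AE_I2) (auto simp: beta_laplace_ker_def mult_left_le split: split_indicator)
qed simp

lemma beta_laplace_nonneg: "0 \<le> beta_laplace p a z"
  unfolding beta_laplace_def by (intro integral_nonneg_AE AE_I2 beta_laplace_ker_nonneg)

lemma beta_laplace_antimono:
  assumes "-1 < p" "a < 1" "0 \<le> z" "z \<le> z'"
  shows "beta_laplace p a z' \<le> beta_laplace p a z"
  unfolding beta_laplace_def using assms
  by (intro integral_mono integrable_beta_laplace_ker beta_laplace_ker_antimono) auto

lemma ennreal_beta_laplace:
  assumes "-1 < p" "a < 1" "0 \<le> z"
  shows "ennreal (beta_laplace p a z) = (\<integral>\<^sup>+\<tau>. ennreal (beta_laplace_ker p a z \<tau>) \<partial>lborel)"
  unfolding beta_laplace_def using integrable_beta_laplace_ker[OF assms]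
  by (intro nn_integral_eq_integral[symmetric]) (auto simp: beta_laplace_ker_nonneg)

lemma beta_laplace_ker_Suc: "beta_laplace_ker (p + 1) a z \<tau> = \<tau> * beta_laplace_ker p a z \<tau>"
  by (auto simp: beta_laplace_ker_def powr_add split: split_indicator)

lemma has_derivative_beta_laplace:
  assumes "-1 < p" "a < 1" "0 < z"
  shows "(beta_laplace p a has_real_derivative - beta_laplace (p + 1) a z) (at z)"
proof -
  have "((\<lambda>h. \<integral>\<tau>. beta_laplace_ker p a (z + h) \<tau> \<partial>lborel) has_real_derivative (\<integral>\<tau>. - beta_laplace_ker (p + 1) a (z + 0) \<tau> \<partial>lborel)) (at 0)"
  proof (rule has_real_derivative_integral[where g = "beta_laplace_ker p a 0"])
    show "0 < z" by fact
    fix h assume h: "\<bar>h\<bar> < z"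
    then have zh: "0 \<le> z + h" by auto
    show "integrable lborel (beta_laplace_ker p a (z + h))" using assms zh by (intro integrable_beta_laplace_ker)
    fix \<tau>
    show "((\<lambda>h. beta_laplace_ker p a (z + h) \<tau>) has_real_derivative - beta_laplace_ker (p + 1) a (z + h) \<tau>) (at h)"
      unfolding beta_laplace_ker_Suc unfolding beta_laplace_ker_def
      by (auto intro!: derivative_eq_intros simp: algebra_simps)
    have "\<bar>- beta_laplace_ker (p + 1) a (z + h) \<tau>\<bar> = \<bar>\<tau>\<bar> * beta_laplace_ker p a (z + h) \<tau>"
      unfolding beta_laplace_ker_Suc using beta_laplace_ker_nonneg[of p a "z + h" \<tau>] by (simp add: abs_mult)
    also have "\<dots> \<le> 1 * beta_laplace_ker p a (z + h) \<tau>"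
      by (cases "\<tau> \<in> {0<..<1}") (auto intro!: mult_right_mono beta_laplace_ker_nonneg simp: beta_laplace_ker_def)
    also have "\<dots> \<le> beta_laplace_ker p a 0 \<tau>" using beta_laplace_ker_antimono[OF zh, of p a \<tau>] by simp
    finally show "\<bar>- beta_laplace_ker (p + 1) a (z + h) \<tau>\<bar> \<le> beta_laplace_ker p a 0 \<tau>" .
  qed (use assms in \<open>auto intro: integrable_beta_laplace_ker\<close>)
  then have "((\<lambda>h. beta_laplace p a (h + z)) has_real_derivative - beta_laplace (p + 1) a z) (at 0)"
    by (simp add: beta_laplace_def add.commute)
  then show ?thesis using DERIV_shift[of "beta_laplace p a" _ 0 z] by simp
qed

lemma isCont_beta_laplace: "-1 < p \<Longrightarrow> a < 1 \<Longrightarrow> 0 < z \<Longrightarrow> isCont (beta_laplace p a) z"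
  using has_derivative_beta_laplace DERIV_isCont by blast

text \<open>A factor \<open>z * \<tau>\<close> is absorbed by
  \<open>u * exp (- u) \<le> exp (- (u / 2))\<close> at the price of halving the argument. In this
  way derivative terms are bounded by the undifferentiated function.\<close>

lemma mult_beta_laplace_Suc_le:
  assumes "-1 < p" "a < 1" "0 \<le> z"
  shows "z * beta_laplace (p + 1) a z \<le> beta_laplace p a (z / 2)"
proof -
  have "u * exp (- u) \<le> exp (- (u / 2))" for u :: real
  proof -
    have "u \<le> exp (u / 2)"
    proof (cases "0 \<le> u")
      case True
      have "(1 + u / 4)\<^sup>2 \<le> (exp (u / 4))\<^sup>2" using True by (intro power_mono) auto
      moreover have "u \<le> (1 + u / 4)\<^sup>2" using zero_le_power2[of "1 - u / 4"] by (simp add: power2_eq_square algebra_simps)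
      moreover have "(exp (u / 4))\<^sup>2 = exp (u / 2)" by (simp flip: exp_double)
      ultimately show ?thesis by linarith
    next
      case False
      then show ?thesis using exp_gt_zero[of "u / 2"] by linarith
    qed
    then have "u * exp (- u) \<le> exp (u / 2) * exp (- u)" by (intro mult_right_mono) auto
    then show ?thesis by (simp flip: exp_add)
  qed
  then have *: "(z * \<tau>) * exp (- (z * \<tau>)) \<le> exp (- (z / 2 * \<tau>))" for \<tau>
    using mult.commute[of \<tau> "z/2"] by (metis times_divide_eq_left)
  have "z * beta_laplace_ker (p + 1) a z \<tau> \<le> beta_laplace_ker p a (z / 2) \<tau>" for \<tau>
  proof (cases "\<tau> \<in> {0<..<1}")
    case True
    have "\<tau> powr p * (1 - \<tau>) powr - a * ((z * \<tau>) * exp (- (z * \<tau>))) \<le> \<tau> powr p * (1 - \<tau>) powr - a * exp (- (z / 2 * \<tau>))"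
      by (intro mult_left_mono *) auto
    then show ?thesis unfolding beta_laplace_ker_Suc unfolding beta_laplace_ker_def using True by (simp add: mult_ac)
  qed (simp add: beta_laplace_ker_def)
  then have "(\<integral>\<tau>. z * beta_laplace_ker (p + 1) a z \<tau> \<partial>lborel) \<le> (\<integral>\<tau>. beta_laplace_ker p a (z / 2) \<tau> \<partial>lborel)"
    using assms by (intro integral_mono integrable_mult_right integrable_beta_laplace_ker) auto
  then show ?thesis by (simp add: beta_laplace_def)
qed

text \<open>From \<open>1 = (1 - \<tau>) + \<tau>\<close>. In the use below the first part has no
  singularity at \<open>\<tau> = 1\<close> and carries the asymptotics for large \<open>z\<close>;
  the second gains the factor \<open>\<tau>\<close> and is of lower order.\<close>

lemma beta_laplace_split:
  assumes "-1 < p" "a < 1" "0 \<le> z"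
  shows "beta_laplace p a z = beta_laplace p (a - 1) z + beta_laplace (p + 1) a z"
proof -
  have "beta_laplace_ker p a z \<tau> = beta_laplace_ker p (a - 1) z \<tau> + beta_laplace_ker (p + 1) a z \<tau>" for \<tau>
  proof (cases "\<tau> \<in> {0<..<1}")
    case True
    have "(1 - \<tau>) powr (- (a - 1)) = (1 - \<tau>) * (1 - \<tau>) powr (- a)"
      using True powr_add[of "1 - \<tau>" 1 "- a"] by (simp add: add.commute)
    then show ?thesis using True unfolding beta_laplace_ker_Suc unfolding beta_laplace_ker_def by (simp only:) (simp add: algebra_simps)
  qed (simp add: beta_laplace_ker_def)
  then have "beta_laplace p a z = (\<integral>\<tau>. beta_laplace_ker p (a - 1) z \<tau> + beta_laplace_ker (p + 1) a z \<tau> \<partial>lborel)"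
    unfolding beta_laplace_def by (intro Bochner_Integration.integral_cong) auto
  also have "\<dots> = beta_laplace p (a - 1) z + beta_laplace (p + 1) a z"
    unfolding beta_laplace_def using assms
    by (intro Bochner_Integration.integral_add integrable_beta_laplace_ker) auto
  finally show ?thesis .
qed

text \<open>The substitution \<open>u = z * \<tau>\<close> frees the exponential from
  \<open>z\<close>, which remains only in a cutoff and in the factor at the far endpoint.\<close>

lemma beta_laplace_rescale:
  assumes z: "0 < z"
  shows "z powr (p + 1) * beta_laplace p a z =
    (\<integral>u. indicator {0<..} u * (indicator {..<z} u * (u powr p * (1 - u / z) powr (- a) * exp (- u))) \<partial>lborel)"
proof -
  have "beta_laplace p a z = (1 / z) * (\<integral>u. beta_laplace_ker p a z (u / z) \<partial>lborel)"
    unfolding beta_laplace_def using lborel_integral_real_affine[of "1 / z" "beta_laplace_ker p a z" 0] z by simp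
  then have "z powr (p + 1) * beta_laplace p a z = (\<integral>u. z powr p * beta_laplace_ker p a z (u / z) \<partial>lborel)"
    using z by (simp add: powr_add)
  moreover have "z powr p * beta_laplace_ker p a z (u / z) =
      indicator {0<..} u * (indicator {..<z} u * (u powr p * (1 - u / z) powr (- a) * exp (- u)))" for u
    using z by (auto simp: beta_laplace_ker_def powr_divide field_simps split: split_indicator)
  ultimately show ?thesis by simp
qed

definition beta_laplace_bound :: "real \<Rightarrow> real" where
  "beta_laplace_bound a = Gamma (1 - a) + beta_laplace (- a) a 0"

lemma powr_mult_beta_laplace_regular_le:
  assumes "0 < a" "a < 1" "0 < z"
  shows "z powr (1 - a) * beta_laplace (- a) (a - 1) z \<le> Gamma (1 - a)"
proof -
  have G: "has_bochner_integral lborel (\<lambda>s. indicator {0<..} s * (s powr ((1 - a) - 1) * exp (- (s * 1)))) (Gamma (1 - a) / 1 powr (1 - a))"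
    using assms by (intro gamma_laplace) auto
  have "z powr (1 - a) * beta_laplace (- a) (a - 1) z = (\<integral>u. indicator {0<..} u * (indicator {..<z} u * (u powr (- a) * (1 - u / z) powr (- (a - 1)) * exp (- u))) \<partial>lborel)"
    using beta_laplace_rescale[OF assms(3), of "- a" "a - 1"] by simp
  also have "\<dots> \<le> (\<integral>s. indicator {0<..} s * (s powr ((1 - a) - 1) * exp (- (s * 1))) \<partial>lborel)"
  proof (rule integral_mono_AE')
    show "integrable lborel (\<lambda>s. indicator {0<..} s * (s powr ((1 - a) - 1) * exp (- (s * 1))) :: real)"
      using G by (simp add: has_bochner_integral_iff)
    show "AE u in lborel. indicator {0<..} u * (indicator {..<z} u * (u powr (- a) * (1 - u / z) powr (- (a - 1)) * exp (- u))) \<le> indicator {0<..} u * (u powr ((1 - a) - 1) * exp (- (u * 1)))"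
      using assms by (intro AE_I2) (auto simp: powr_le1 mult_left_le split: split_indicator)
    show "AE u in lborel. 0 \<le> indicator {0<..} u * (u powr ((1 - a) - 1) * exp (- (u * 1)))"
      by (intro AE_I2) (auto split: split_indicator)
  qed
  also have "\<dots> = Gamma (1 - a)" using G by (simp add: has_bochner_integral_iff)
  finally show ?thesis .
qed

lemma powr_mult_beta_laplace_le:
  assumes a: "0 < a" "a < 1" and z: "0 < z"
  shows "z powr (1 - a) * beta_laplace (- a) a z \<le> beta_laplace_bound a"
proof (cases "z \<le> 1")
  case True
  have "z powr (1 - a) * beta_laplace (- a) a z \<le> 1 * beta_laplace (- a) a 0"
    using a z True by (intro mult_mono powr_le1 beta_laplace_antimono beta_laplace_nonneg) auto
  moreover have "0 < Gamma (1 - a)" using a by (intro Gamma_real_pos) simp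
  ultimately show ?thesis unfolding beta_laplace_bound_def by linarith
next
  case False
  have "z powr (1 - a) * beta_laplace (- a + 1) a z \<le> z powr 1 * beta_laplace (- a + 1) a z"
    using False a by (intro mult_right_mono powr_mono beta_laplace_nonneg) auto
  also have "\<dots> \<le> beta_laplace (- a) a (z / 2)"
    using mult_beta_laplace_Suc_le[of "- a" a z] a z by simp
  also have "\<dots> \<le> beta_laplace (- a) a 0" using a z by (intro beta_laplace_antimono) auto
  finally show ?thesis
    using powr_mult_beta_laplace_regular_le[OF a z] a z
    by (simp add: beta_laplace_bound_def beta_laplace_split[of "- a" a z] distrib_left)
qed

text \<open>In the rescaled regular part \<open>(1 - u / z) powr (1 - a)\<close> is at most 1 and
  tends to 1, so dominated convergence gives the Gamma integral. The other part of
  \<open>beta_laplace_split\<close> is of order \<open>z powr (- a)\<close>.\<close>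

lemma powr_mult_beta_laplace_tendsto:
  assumes a: "0 < a" "a < 1"
  shows "((\<lambda>z. z powr (1 - a) * beta_laplace (- a) a z) \<longlongrightarrow> Gamma (1 - a)) at_top"
proof -
  have G: "has_bochner_integral lborel (\<lambda>s. indicator {0<..} s * (s powr ((1 - a) - 1) * exp (- (s * 1)))) (Gamma (1 - a) / 1 powr (1 - a))"
    using a by (intro gamma_laplace) auto
  let ?s = "\<lambda>z u. indicator {0<..} u * (indicator {..<z} u * (u powr (- a) * (1 - u / z) powr (- (a - 1)) * exp (- u))) :: real"
  have "((\<lambda>z. \<integral>u. ?s z u \<partial>lborel) \<longlongrightarrow> (\<integral>s. indicator {0<..} s * (s powr ((1 - a) - 1) * exp (- (s * 1))) \<partial>lborel)) at_top"
  proof (rule integral_dominated_convergence_at_top[where w = "\<lambda>s. indicator {0<..} s * (s powr ((1 - a) - 1) * exp (- (s * 1)))"])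
    show "integrable lborel (\<lambda>s. indicator {0<..} s * (s powr ((1 - a) - 1) * exp (- (s * 1))) :: real)"
      using G by (simp add: has_bochner_integral_iff)
    show "\<forall>\<^sub>F z in at_top. AE u in lborel. norm (?s z u) \<le> indicator {0<..} u * (u powr ((1 - a) - 1) * exp (- (u * 1)))"
      using eventually_gt_at_top[of 0]
      by eventually_elim (use a in \<open>auto intro!: AE_I2 simp: powr_le1 mult_left_le split: split_indicator\<close>)
    show "AE u in lborel. ((\<lambda>z. ?s z u) \<longlongrightarrow> indicator {0<..} u * (u powr ((1 - a) - 1) * exp (- (u * 1)))) at_top"
    proof (intro AE_I2)
      fix u :: real
      show "((\<lambda>z. ?s z u) \<longlongrightarrow> indicator {0<..} u * (u powr ((1 - a) - 1) * exp (- (u * 1)))) at_top"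
      proof (cases "0 < u")
        case True
        have "((\<lambda>z. u powr (- a) * (1 - u / z) powr (- (a - 1)) * exp (- u)) \<longlongrightarrow> u powr (- a) * (1 - 0) powr (- (a - 1)) * exp (- u)) at_top"
          by (intro tendsto_intros tendsto_divide_0[OF tendsto_const] filterlim_at_top_imp_at_infinity filterlim_ident) auto
        moreover have "\<forall>\<^sub>F z in at_top. u powr (- a) * (1 - u / z) powr (- (a - 1)) * exp (- u) = ?s z u"
          using eventually_gt_at_top[of u] by eventually_elim (use True in auto)
        ultimately have "((\<lambda>z. ?s z u) \<longlongrightarrow> u powr (- a) * (1 - 0) powr (- (a - 1)) * exp (- u)) at_top"
          by (rule Lim_transform_eventually)
        then show ?thesis using True by simp
      qed simp
    qed
  qed auto
  then have 1: "((\<lambda>z. \<integral>u. ?s z u \<partial>lborel) \<longlongrightarrow> Gamma (1 - a)) at_top"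
    using G by (simp add: has_bochner_integral_iff)
  have 2: "((\<lambda>z. z powr (1 - a) * beta_laplace (- a + 1) a z) \<longlongrightarrow> 0) at_top"
  proof (rule tendsto_sandwich[where f = "\<lambda>_. 0" and h = "\<lambda>z. beta_laplace (- a) a 0 * z powr (- a)"])
    show "((\<lambda>z. beta_laplace (- a) a 0 * z powr (- a)) \<longlongrightarrow> 0) at_top"
      using a by (intro tendsto_mult_right_zero tendsto_neg_powr filterlim_ident) auto
    show "\<forall>\<^sub>F z in at_top. z powr (1 - a) * beta_laplace (- a + 1) a z \<le> beta_laplace (- a) a 0 * z powr (- a)"
      using eventually_gt_at_top[of 0]
    proof eventually_elim
      case (elim z)
      have "z powr (1 - a) * beta_laplace (- a + 1) a z = z powr (- a) * (z * beta_laplace (- a + 1) a z)"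
        using elim powr_add[of z "- a" 1] by (simp add: mult_ac)
      also have "\<dots> \<le> z powr (- a) * beta_laplace (- a) a (z / 2)"
        using mult_beta_laplace_Suc_le[of "- a" a z] a elim by (intro mult_left_mono) auto
      also have "\<dots> \<le> z powr (- a) * beta_laplace (- a) a 0"
        using a elim by (intro mult_left_mono beta_laplace_antimono) auto
      finally show ?case by (simp add: mult.commute)
    qed
    show "\<forall>\<^sub>F z in at_top. 0 \<le> z powr (1 - a) * beta_laplace (- a + 1) a z"
      by (simp add: beta_laplace_nonneg)
  qed auto
  have "((\<lambda>z. (\<integral>u. ?s z u \<partial>lborel) + z powr (1 - a) * beta_laplace (- a + 1) a z) \<longlongrightarrow> Gamma (1 - a) + 0) at_top"
    by (intro tendsto_add 1 2)
  moreover have "\<forall>\<^sub>F z in at_top. (\<integral>u. ?s z u \<partial>lborel) + z powr (1 - a) * beta_laplace (- a + 1) a z = z powr (1 - a) * beta_laplace (- a) a z"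
    using eventually_gt_at_top[of 0]
  proof eventually_elim
    case (elim z)
    then show ?case
      using beta_laplace_rescale[OF elim, of "- a" "a - 1"] beta_laplace_split[of "- a" a z] a
      by (simp add: algebra_simps)
  qed
  ultimately show ?thesis by (auto intro: Lim_transform_eventually)
qed

lemma beta_laplace_measurable [measurable]: "beta_laplace p a \<in> borel_measurable borel"
proof -
  have "(\<lambda>(z, \<tau>). beta_laplace_ker p a z \<tau>) \<in> borel_measurable (borel \<Otimes>\<^sub>M lborel)"
    unfolding beta_laplace_ker_def by measurable
  then have "(\<lambda>z. \<integral>\<tau>. beta_laplace_ker p a z \<tau> \<partial>lborel) \<in> borel_measurable borel"
    by (rule lborel.borel_measurable_lebesgue_integral)
  then show ?thesis by (simp add: beta_laplace_def[abs_def])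
qed

section \<open>One-dimensional heat factors\<close>

text \<open>For positive \<open>y\<close> and \<open>s\<close> this is a constant times
  \<open>sqrt s * y powr (1/2 - a) * exp (- 2 * s * y)\<close> times the modified Bessel function I
  of order \<open>1/2 - a\<close> at \<open>2 * s * y\<close>. With \<open>y = \<xi> * x\<close> and
  the Gaussian \<open>exp (- s * (\<xi> - x)\<^sup>2)\<close> it is, up to a constant and a power of
  \<open>s\<close>, the heat kernel of u'' + (2 a / x) u' with zero boundary values, where
  \<open>s\<close> stands for 1 / (4 time).\<close>

definition heat_factor :: "real \<Rightarrow> real \<Rightarrow> real \<Rightarrow> real" where
  "heat_factor a y s = y powr (1 - 2 * a) * s powr (1 - a) * beta_laplace (- a) a (4 * s * y)"

text \<open>This is \<open>y\<close> times the derivative of \<open>heat_factor a y s\<close> with respect to \<open>y\<close>.\<close>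
definition heat_factor_deriv :: "real \<Rightarrow> real \<Rightarrow> real \<Rightarrow> real" where
  "heat_factor_deriv a y s = (1 - 2 * a) * heat_factor a y s -
     y powr (1 - 2 * a) * s powr (1 - a) * (4 * s * y * beta_laplace (1 - a) a (4 * s * y))"

lemma heat_factor_measurable [measurable (raw)]:
  assumes [measurable]: "f \<in> borel_measurable M" "g \<in> borel_measurable M"
  shows "(\<lambda>x. heat_factor a (f x) (g x)) \<in> borel_measurable M"
  unfolding heat_factor_def by measurable

lemma heat_factor_deriv_measurable [measurable (raw)]:
  assumes [measurable]: "f \<in> borel_measurable M" "g \<in> borel_measurable M"
  shows "(\<lambda>x. heat_factor_deriv a (f x) (g x)) \<in> borel_measurable M"
  unfolding heat_factor_deriv_def by measurable

lemma heat_factor_nonneg: "0 \<le> heat_factor a y s"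
  by (simp add: heat_factor_def beta_laplace_nonneg)

lemma heat_factor_eq:
  assumes "0 < y" "0 < s"
  shows "heat_factor a y s = 4 powr (a - 1) * y powr (- a) * ((4 * s * y) powr (1 - a) * beta_laplace (- a) a (4 * s * y))"
proof -
  have "4 powr (a - 1) * y powr (- a) * (4 * s * y) powr (1 - a) =
      (4 powr (a - 1) * 4 powr (1 - a)) * (y powr (- a) * y powr (1 - a)) * s powr (1 - a)"
    using assms by (simp add: powr_mult)
  also have "\<dots> = y powr (1 - 2 * a) * s powr (1 - a)"
    using assms by (simp flip: powr_add)
  finally show ?thesis by (simp add: heat_factor_def mult.assoc[symmetric])
qed

text \<open>Uniform in \<open>s\<close> but singular at \<open>y = 0\<close>. Its counterpart
  \<open>heat_factor_le_powr\<close> is harmless at \<open>y = 0\<close> when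
  \<open>2 * a < 1\<close>, but grows with \<open>s\<close>.\<close>

lemma heat_factor_le:
  assumes a: "0 < a" "a < 1" and y: "0 < y" and s: "0 < s"
  shows "heat_factor a y s \<le> beta_laplace_bound a * y powr (- a)"
proof -
  have B: "0 \<le> beta_laplace_bound a"
    unfolding beta_laplace_bound_def using a by (intro add_nonneg_nonneg beta_laplace_nonneg) (auto intro: less_imp_le Gamma_real_pos)
  have "heat_factor a y s \<le> 4 powr (a - 1) * y powr (- a) * beta_laplace_bound a"
    unfolding heat_factor_eq[OF y s]
    using powr_mult_beta_laplace_le[OF a, of "4 * s * y"] y s by (intro mult_left_mono) auto
  also have "\<dots> \<le> 1 * y powr (- a) * beta_laplace_bound a"
    using a B powr_mono[of "a - 1" 0 "4::real"] by (intro mult_right_mono) auto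
  finally show ?thesis by (simp add: mult.commute)
qed

lemma heat_factor_le_powr:
  assumes a: "0 < a" "a < 1" and y: "0 < y" and s: "0 < s"
  shows "heat_factor a y s \<le> beta_laplace (- a) a 0 * y powr (1 - 2 * a) * s powr (1 - a)"
proof -
  have "heat_factor a y s \<le> y powr (1 - 2 * a) * s powr (1 - a) * beta_laplace (- a) a 0"
    unfolding heat_factor_def using a y s by (intro mult_left_mono beta_laplace_antimono) auto
  then show ?thesis by (simp add: mult_ac)
qed

text \<open>The halved argument comes from \<open>mult_beta_laplace_Suc_le\<close>; reading it as a
  heat factor at \<open>s / 2\<close> costs \<open>2 powr (1 - a)\<close>, at most 2.\<close>

lemma heat_factor_deriv_abs_le:
  assumes a: "0 < a" "2 * a < 1" and y: "0 < y" and s: "0 < s"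
  shows "\<bar>heat_factor_deriv a y s\<bar> \<le> heat_factor a y s + 2 * heat_factor a y (s / 2)"
proof -
  have "\<bar>heat_factor_deriv a y s\<bar> \<le> \<bar>(1 - 2 * a) * heat_factor a y s\<bar> +
      \<bar>y powr (1 - 2 * a) * s powr (1 - a) * (4 * s * y * beta_laplace (1 - a) a (4 * s * y))\<bar>"
    unfolding heat_factor_deriv_def by (rule abs_triangle_ineq4)
  also have "\<bar>(1 - 2 * a) * heat_factor a y s\<bar> \<le> 1 * heat_factor a y s"
    unfolding abs_mult abs_of_nonneg[OF heat_factor_nonneg]
    using a by (intro mult_right_mono heat_factor_nonneg) auto
  also have "\<bar>y powr (1 - 2 * a) * s powr (1 - a) * (4 * s * y * beta_laplace (1 - a) a (4 * s * y))\<bar>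
      = y powr (1 - 2 * a) * s powr (1 - a) * (4 * s * y * beta_laplace (- a + 1) a (4 * s * y))"
    using y s beta_laplace_nonneg[of "1 - a" a "4 * s * y"] by (simp add: abs_mult)
  also have "\<dots> \<le> y powr (1 - 2 * a) * s powr (1 - a) * beta_laplace (- a) a (4 * s * y / 2)"
    using a y s by (intro mult_left_mono mult_beta_laplace_Suc_le) auto
  also have "\<dots> = 2 powr (1 - a) * heat_factor a y (s / 2)"
    using s by (simp add: heat_factor_def powr_divide mult.assoc)
  also have "\<dots> \<le> 2 * heat_factor a y (s / 2)"
    using a powr_mono[of "1 - a" 1 "2::real"] heat_factor_nonneg by (intro mult_right_mono) auto
  finally show ?thesis by simp
qed

lemma has_derivative_heat_factor:
  assumes a: "0 < a" "2 * a < 1" and y: "0 < y" and s: "0 < s"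
  shows "((\<lambda>y. heat_factor a y s) has_real_derivative heat_factor_deriv a y s / y) (at y)"
proof -
  have "(beta_laplace (- a) a has_real_derivative - beta_laplace (- a + 1) a (4 * s * y)) (at (4 * s * y))"
    using a y s by (intro has_derivative_beta_laplace) auto
  then have 1: "((\<lambda>y. beta_laplace (- a) a (4 * s * y)) has_real_derivative - beta_laplace (- a + 1) a (4 * s * y) * (4 * s)) (at y)"
    by (rule DERIV_chain2) (auto intro!: derivative_eq_intros)
  have 2: "((\<lambda>y. y powr (1 - 2 * a)) has_real_derivative (1 - 2 * a) * y powr (1 - 2 * a) / y) (at y)"
    by (rule DERIV_cong[OF has_real_derivative_powr[OF y]]) (use y powr_diff[of y "1 - 2 * a" 1] in simp)
  show ?thesis unfolding heat_factor_def
    by (rule DERIV_cong[OF DERIV_mult[OF DERIV_cmult_right[OF 2] 1]])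
       (use y in \<open>simp add: heat_factor_deriv_def heat_factor_def field_simps\<close>)
qed

lemma isCont_heat_factor:
  assumes "0 < a" "2 * a < 1" "0 < y" "0 < s"
  shows "isCont (\<lambda>y. heat_factor a y s) y"
  using has_derivative_heat_factor[OF assms] by (rule DERIV_isCont)

lemma isCont_heat_factor_deriv:
  assumes "0 < a" "2 * a < 1" "0 < y" "0 < s"
  shows "isCont (\<lambda>y. heat_factor_deriv a y s) y"
proof -
  have "isCont (\<lambda>y. beta_laplace (1 - a) a (4 * s * y)) y"
    using assms by (intro isCont_o2[OF _ isCont_beta_laplace] continuous_intros) auto
  then show ?thesis unfolding heat_factor_deriv_def
    using assms by (intro continuous_intros isCont_heat_factor) auto
qed

lemma heat_factor_tendsto:
  assumes a: "0 < a" "2 * a < 1" and y: "(y \<longlongrightarrow> y0) F" "0 < y0" and s: "filterlim s at_top F"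
  shows "((\<lambda>i. heat_factor a (y i) (s i)) \<longlongrightarrow> 4 powr (a - 1) * y0 powr (- a) * Gamma (1 - a)) F"
proof -
  have z: "filterlim (\<lambda>i. 4 * s i * y i) at_top F"
    by (rule filterlim_at_top_mult_tendsto_pos[OF y filterlim_tendsto_pos_mult_at_top[OF tendsto_const _ s]]) simp
  have "((\<lambda>i. 4 powr (a - 1) * y i powr (- a) * ((4 * s i * y i) powr (1 - a) * beta_laplace (- a) a (4 * s i * y i)))
      \<longlongrightarrow> 4 powr (a - 1) * y0 powr (- a) * Gamma (1 - a)) F"
    using a y by (intro tendsto_intros filterlim_compose[OF powr_mult_beta_laplace_tendsto z]) auto
  moreover have "eventually (\<lambda>i. 0 < y i) F" using order_tendstoD(1)[OF y] .
  moreover have "eventually (\<lambda>i. 0 < s i) F" using s by (simp add: filterlim_at_top_dense)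
  ultimately show ?thesis
    by (elim Lim_transform_eventually) (erule (1) eventually_elim2, simp add: heat_factor_eq)
qed

section \<open>From the Euler integral to the heat integral\<close>

text \<open>Collects \<open>kappa_n\<close>, the Euler prefactors, where c_k - b_k equals b_k, and
  the 1/\<Gamma> of the Laplace representation of the power.\<close>

definition kernel_const :: "'m::finite set \<Rightarrow> ('m \<Rightarrow> real) \<Rightarrow> real" where
  "kernel_const K \<alpha> = kappa_n K \<alpha> *
     (\<Prod>k\<in>K. Gamma (2 - 2 * \<alpha> k) / (Gamma (1 - \<alpha> k) * Gamma (1 - \<alpha> k))) / Gamma (alpha_bar K \<alpha>)"

definition heat_prod :: "'m::finite set \<Rightarrow> ('m \<Rightarrow> real) \<Rightarrow> real^'m \<Rightarrow> real^'m \<Rightarrow> real \<Rightarrow> real" where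
  "heat_prod K \<alpha> \<xi> x s = (\<Prod>k\<in>K. heat_factor (\<alpha> k) (\<xi> $ k * x $ k) s)"

text \<open>The squared distances of \<xi> from \<open>x\<close> and from its mirror image in the
  k-th hyperplane differ by \<open>4 * (\<xi> $ k * x $ k)\<close>. In the orthant \<sigma>_k is
  therefore negative, and the base of the Euler power stays positive on the cube.\<close>

lemma sigma_k_eq:
  fixes \<xi> x :: "real^'m::finite"
  assumes "\<xi> \<noteq> x"
  shows "sigma_k k \<xi> x = - (4 * (\<xi> $ k * x $ k)) / (dist \<xi> x)\<^sup>2"
proof -
  have d: "(dist \<xi> x)\<^sup>2 = (\<Sum>i\<in>UNIV. (\<xi> $ i - x $ i)\<^sup>2)"
    unfolding dist_vec_def L2_set_def by (simp add: dist_real_def sum_nonneg)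
  have "(\<Sum>i\<in>UNIV. (\<xi> $ i - x $ i)\<^sup>2) = (\<xi> $ k - x $ k)\<^sup>2 + (\<Sum>i\<in>UNIV - {k}. (\<xi> $ i - x $ i)\<^sup>2)"
    by (rule sum.remove) auto
  then have "(\<xi> $ k + x $ k)\<^sup>2 + (\<Sum>i\<in>UNIV - {k}. (\<xi> $ i - x $ i)\<^sup>2) = (dist \<xi> x)\<^sup>2 + 4 * (\<xi> $ k * x $ k)"
    unfolding d by (simp add: power2_eq_square algebra_simps)
  then have "sigma_k k \<xi> x = 1 - ((dist \<xi> x)\<^sup>2 + 4 * (\<xi> $ k * x $ k)) / (dist \<xi> x)\<^sup>2"
    unfolding sigma_k_def d[symmetric] by simp
  then show ?thesis using assms by (simp add: field_simps)
qed

lemma sigma_finite_lebesgue_unit: "sigma_finite_measure (lebesgue_on {0..1::real})"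
proof -
  have "finite_measure (lebesgue_on {0..1::real})"
    by (rule finite_measureI) (simp add: emeasure_restrict_space)
  then show ?thesis by (simp add: finite_measure.axioms(1) finite_measure_def)
qed

text \<open>Links the \<open>lebesgue_on\<close> of \<open>lauricella_FA\<close> to the
  \<open>lborel\<close> of \<open>beta_laplace\<close>.\<close>

lemma nn_integral_lebesgue_unit:
  assumes [measurable]: "f \<in> borel_measurable borel" and "\<And>t. t \<notin> {0..1} \<Longrightarrow> f t = 0"
  shows "(\<integral>\<^sup>+t. f t \<partial>lebesgue_on {0..1::real}) = (\<integral>\<^sup>+t. f t \<partial>lborel)"
proof -
  have "(\<integral>\<^sup>+t. f t \<partial>lebesgue_on {0..1::real}) = (\<integral>\<^sup>+t. f t * indicator {0..1} t \<partial>lebesgue)"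
    by (subst nn_integral_restrict_space) auto
  also have "\<dots> = (\<integral>\<^sup>+t. f t \<partial>lebesgue)"
    using assms(2) by (intro nn_integral_cong) (auto split: split_indicator)
  also have "\<dots> = (\<integral>\<^sup>+t. f t \<partial>lborel)"
    by (rule nn_integral_completion)
  finally show ?thesis .
qed

lemma powr_minus_eq_nn_integral:
  assumes A: "0 < A" and c: "0 < (c::real)"
  shows "ennreal (c powr (- A)) =
    (\<integral>\<^sup>+s. ennreal (indicator {0<..} s * (s powr (A - 1) * exp (- (s * c))) / Gamma A) \<partial>lborel)"
proof -
  have G: "0 < Gamma A" using A by (rule Gamma_real_pos)
  have "has_bochner_integral lborel (\<lambda>s. indicator {0<..} s * (s powr (A - 1) * exp (- (s * c))) / Gamma A)
      (Gamma A / c powr A / Gamma A)"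
    by (intro has_bochner_integral_divide_zero gamma_laplace A c)
  then have "(\<integral>\<^sup>+s. ennreal (indicator {0<..} s * (s powr (A - 1) * exp (- (s * c))) / Gamma A) \<partial>lborel) =
      ennreal (Gamma A / c powr A / Gamma A)"
    using G by (subst nn_integral_eq_integral) (auto simp: has_bochner_integral_iff)
  then show ?thesis using G by (simp add: powr_minus_divide)
qed

text \<open>As a Gamma integral the power becomes \<open>exp (- s R)\<close> times one exponential
  for each coordinate. After exchanging the integrals the cube integral is a product of
  one-dimensional ones. Nonnegative integrals make the exchange a case of Tonelli.\<close>

lemma nn_integral_cube_laplace:
  fixes K :: "'m::finite set" and \<alpha> y :: "'m \<Rightarrow> real"
  assumes \<alpha>: "\<And>k. k \<in> K \<Longrightarrow> 0 < \<alpha> k \<and> \<alpha> k < 1" and y: "\<And>k. k \<in> K \<Longrightarrow> 0 < y k"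
    and A: "0 < A" and R: "0 < R"
  shows "(\<integral>\<^sup>+\<tau>. ennreal ((\<Prod>k\<in>K. \<tau> k powr (- \<alpha> k) * (1 - \<tau> k) powr (- \<alpha> k)) *
        (R + (\<Sum>k\<in>K. 4 * y k * \<tau> k)) powr (- A)) \<partial>(\<Pi>\<^sub>M k\<in>K. lebesgue_on {0..1})) =
    (\<integral>\<^sup>+s. ennreal (indicator {0<..} s * (s powr (A - 1) * exp (- (s * R))) / Gamma A *
        (\<Prod>k\<in>K. beta_laplace (- \<alpha> k) (\<alpha> k) (4 * s * y k))) \<partial>lborel)"
proof -
  let ?M = "\<Pi>\<^sub>M k\<in>K. lebesgue_on {0..1::real}"
  interpret P: product_sigma_finite "\<lambda>_::'m. lebesgue_on {0..1::real}"
    unfolding product_sigma_finite_def using sigma_finite_lebesgue_unit by simp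
  have sf: "sigma_finite_measure ?M" by (rule P.sigma_finite) simp
  interpret Q: pair_sigma_finite ?M lborel
    unfolding pair_sigma_finite_def using sf sigma_finite_lborel by simp
  have id: "(\<lambda>t. t) \<in> borel_measurable (lebesgue_on {0..1::real})"
    by (rule measurable_restrict_space1) (auto intro: measurable_completion)
  have comp: "(\<lambda>\<tau>. \<tau> k) \<in> borel_measurable ?M" if "k \<in> K" for k
    using measurable_compose[OF measurable_component_singleton[OF that] id] by simp
  define g where "g s = indicator {0<..} s * (s powr (A - 1) * exp (- (s * R))) / Gamma A" for s :: real
  have g0: "0 \<le> g s" for s using Gamma_real_pos[OF A] by (auto simp: g_def)
  have gm[measurable]: "g \<in> borel_measurable borel" unfolding g_def by measurable
  define b where "b s k t = beta_laplace_ker (- \<alpha> k) (\<alpha> k) (4 * s * y k) t" for s k t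
  have b0: "0 \<le> b s k t" for s k t by (simp add: b_def beta_laplace_ker_nonneg)
  have bm[measurable]: "(\<lambda>t. b s k t) \<in> borel_measurable borel" for s k unfolding b_def by measurable
  have bz: "b s k t = 0" if "t \<notin> {0..1}" for s k t using that by (auto simp: b_def beta_laplace_ker_def)
  have bm2: "(\<lambda>t. ennreal (b s k t)) \<in> borel_measurable (lebesgue_on {0..1})" for s k
    using measurable_compose[OF id bm] by simp
  have "(\<integral>\<^sup>+\<tau>. ennreal ((\<Prod>k\<in>K. \<tau> k powr (- \<alpha> k) * (1 - \<tau> k) powr (- \<alpha> k)) *
        (R + (\<Sum>k\<in>K. 4 * y k * \<tau> k)) powr (- A)) \<partial>?M) =
     (\<integral>\<^sup>+\<tau>. (\<integral>\<^sup>+s. ennreal (g s * (\<Prod>k\<in>K. b s k (\<tau> k))) \<partial>lborel) \<partial>?M)"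
  proof (rule nn_integral_cong)
    fix \<tau> assume "\<tau> \<in> space ?M"
    then have \<tau>: "0 \<le> \<tau> k" "\<tau> k \<le> 1" if "k \<in> K" for k
      using that by (auto simp: space_PiM PiE_def Pi_def space_restrict_space)
    define c where "c = R + (\<Sum>k\<in>K. 4 * y k * \<tau> k)"
    define p where "p = (\<Prod>k\<in>K. \<tau> k powr (- \<alpha> k) * (1 - \<tau> k) powr (- \<alpha> k))"
    have p0: "0 \<le> p" unfolding p_def by (intro prod_nonneg) auto
    have c: "0 < c" unfolding c_def using R y \<tau> by (intro add_pos_nonneg sum_nonneg) (auto simp: less_imp_le)
    \<comment> \<open>At the ends of the interval both sides are 0, because
      \<open>0 powr x = 0\<close> for every exponent.\<close>
    have bb: "b s k (\<tau> k) = \<tau> k powr (- \<alpha> k) * (1 - \<tau> k) powr (- \<alpha> k) * exp (- (s * (4 * y k * \<tau> k)))" if "k \<in> K" for s k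
      using \<tau>[OF that] by (cases "\<tau> k = 0 \<or> \<tau> k = 1") (auto simp: b_def beta_laplace_ker_def mult_ac)
    have prod: "(\<Prod>k\<in>K. b s k (\<tau> k)) = p * exp (- (s * (\<Sum>k\<in>K. 4 * y k * \<tau> k)))" for s
    proof -
      have "(\<Prod>k\<in>K. b s k (\<tau> k)) = (\<Prod>k\<in>K. \<tau> k powr (- \<alpha> k) * (1 - \<tau> k) powr (- \<alpha> k) * exp (- (s * (4 * y k * \<tau> k))))"
        by (rule prod.cong) (auto simp: bb)
      also have "\<dots> = p * (\<Prod>k\<in>K. exp (- (s * (4 * y k * \<tau> k))))" by (simp add: p_def prod.distrib)
      also have "(\<Prod>k\<in>K. exp (- (s * (4 * y k * \<tau> k)))) = exp (- (s * (\<Sum>k\<in>K. 4 * y k * \<tau> k)))"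
        by (simp add: sum_negf sum_distrib_left flip: exp_sum)
      finally show ?thesis .
    qed
    have "ennreal (p * c powr (- A)) = ennreal p * ennreal (c powr (- A))" using p0 by (simp add: ennreal_mult)
    also have "\<dots> = (\<integral>\<^sup>+s. ennreal p * ennreal (indicator {0<..} s * (s powr (A - 1) * exp (- (s * c))) / Gamma A) \<partial>lborel)"
      unfolding powr_minus_eq_nn_integral[OF A c] by (rule nn_integral_cmult[symmetric]) measurable
    also have "\<dots> = (\<integral>\<^sup>+s. ennreal (g s * (\<Prod>k\<in>K. b s k (\<tau> k))) \<partial>lborel)"
    proof (rule nn_integral_cong)
      fix s :: real
      have "exp (- (s * c)) = exp (- (s * R)) * exp (- (s * (\<Sum>k\<in>K. 4 * y k * \<tau> k)))"
        by (simp add: c_def distrib_left flip: exp_add)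
      then show "ennreal p * ennreal (indicator {0<..} s * (s powr (A - 1) * exp (- (s * c))) / Gamma A) =
         ennreal (g s * (\<Prod>k\<in>K. b s k (\<tau> k)))"
        unfolding prod g_def using p0 by (simp add: mult_ac flip: ennreal_mult')
    qed
    finally show "ennreal ((\<Prod>k\<in>K. \<tau> k powr (- \<alpha> k) * (1 - \<tau> k) powr (- \<alpha> k)) *
        (R + (\<Sum>k\<in>K. 4 * y k * \<tau> k)) powr (- A)) = (\<integral>\<^sup>+s. ennreal (g s * (\<Prod>k\<in>K. b s k (\<tau> k))) \<partial>lborel)"
      by (simp only: p_def c_def)
  qed
  also have "\<dots> = (\<integral>\<^sup>+s. (\<integral>\<^sup>+\<tau>. ennreal (g s * (\<Prod>k\<in>K. b s k (\<tau> k))) \<partial>?M) \<partial>lborel)"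
  proof (rule Q.Fubini'[symmetric])
    have "(\<lambda>z. b (snd z) k (fst z k)) \<in> borel_measurable (?M \<Otimes>\<^sub>M lborel)" if k: "k \<in> K" for k
    proof -
      have [measurable]: "(\<lambda>z. fst z k) \<in> borel_measurable (?M \<Otimes>\<^sub>M lborel)"
        by (rule measurable_compose[OF measurable_fst comp[OF k]])
      show ?thesis unfolding b_def beta_laplace_ker_def by measurable
    qed
    then have [measurable]: "(\<lambda>z. \<Prod>k\<in>K. b (snd z) k (fst z k)) \<in> borel_measurable (?M \<Otimes>\<^sub>M lborel)"
      by (rule borel_measurable_prod)
    show "(\<lambda>(\<tau>, s). ennreal (g s * (\<Prod>k\<in>K. b s k (\<tau> k)))) \<in> borel_measurable (?M \<Otimes>\<^sub>M lborel)"
      unfolding case_prod_beta by measurable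
  qed
  also have "\<dots> = (\<integral>\<^sup>+s. ennreal (g s * (\<Prod>k\<in>K. beta_laplace (- \<alpha> k) (\<alpha> k) (4 * s * y k))) \<partial>lborel)"
  proof (rule nn_integral_cong)
    fix s :: real
    show "(\<integral>\<^sup>+\<tau>. ennreal (g s * (\<Prod>k\<in>K. b s k (\<tau> k))) \<partial>?M) = ennreal (g s * (\<Prod>k\<in>K. beta_laplace (- \<alpha> k) (\<alpha> k) (4 * s * y k)))"
    proof (cases "0 < s")
      case True
      have "(\<integral>\<^sup>+\<tau>. ennreal (g s * (\<Prod>k\<in>K. b s k (\<tau> k))) \<partial>?M) = (\<integral>\<^sup>+\<tau>. ennreal (g s) * (\<Prod>k\<in>K. ennreal (b s k (\<tau> k))) \<partial>?M)"
        using g0 b0 by (intro nn_integral_cong) (simp add: ennreal_mult prod_ennreal prod_nonneg)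
      also have "\<dots> = ennreal (g s) * (\<integral>\<^sup>+\<tau>. (\<Prod>k\<in>K. ennreal (b s k (\<tau> k))) \<partial>?M)"
        by (rule nn_integral_cmult) (auto intro!: borel_measurable_prod_ennreal measurable_compose[OF comp])
      also have "(\<integral>\<^sup>+\<tau>. (\<Prod>k\<in>K. ennreal (b s k (\<tau> k))) \<partial>?M) = (\<Prod>k\<in>K. \<integral>\<^sup>+t. ennreal (b s k t) \<partial>lebesgue_on {0..1})"
        by (rule P.product_nn_integral_prod) (auto simp: bm2)
      also have "\<dots> = (\<Prod>k\<in>K. ennreal (beta_laplace (- \<alpha> k) (\<alpha> k) (4 * s * y k)))"
      proof (rule prod.cong)
        fix k assume k: "k \<in> K"
        have "(\<integral>\<^sup>+t. ennreal (b s k t) \<partial>lebesgue_on {0..1}) = (\<integral>\<^sup>+t. ennreal (b s k t) \<partial>lborel)"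
          by (rule nn_integral_lebesgue_unit) (auto simp: bz)
        also have "\<dots> = ennreal (beta_laplace (- \<alpha> k) (\<alpha> k) (4 * s * y k))"
          unfolding b_def using \<alpha>[OF k] y[OF k] True by (intro ennreal_beta_laplace[symmetric]) auto
        finally show "(\<integral>\<^sup>+t. ennreal (b s k t) \<partial>lebesgue_on {0..1}) = ennreal (beta_laplace (- \<alpha> k) (\<alpha> k) (4 * s * y k))" .
      qed simp
      also have "ennreal (g s) * \<dots> = ennreal (g s * (\<Prod>k\<in>K. beta_laplace (- \<alpha> k) (\<alpha> k) (4 * s * y k)))"
        using g0 by (simp add: ennreal_mult prod_ennreal prod_nonneg beta_laplace_nonneg)
      finally show ?thesis .
    qed (simp add: g_def)
  qed
  finally show ?thesis by (simp only: g_def)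
qed

locale lauricella_kernel =
  fixes K :: "'m::finite set" and \<alpha> :: "'m \<Rightarrow> real"
  assumes card_gt2: "2 < CARD('m)" and K_nonempty: "K \<noteq> {}"
    and alpha: "k \<in> K \<Longrightarrow> 0 < \<alpha> k \<and> 2 * \<alpha> k < 1"
begin

lemma alpha_bar_pos: "0 < alpha_bar K \<alpha>"
  unfolding alpha_bar_def
proof (rule add_pos_nonneg)
  show "0 \<le> (\<Sum>k\<in>K. 1 - \<alpha> k)" using alpha by (intro sum_nonneg) fastforce
qed (use card_gt2 in simp)

text \<open>The factor \<open>R powr A\<close>, obtained by clearing the denominator of \<sigma>_k,
  cancels the power of the distance in \<open>q_n\<close>; the remaining factors are distributed
  over the heat factors.\<close>

lemma q_n_heat:
  assumes \<xi>: "\<xi> \<in> orthant K" and x: "x \<in> orthant K" and ne: "\<xi> \<noteq> x"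
  shows "q_n K \<alpha> \<xi> x = kernel_const K \<alpha> *
    (\<integral>s. indicator {0<..} s * (s powr (real CARD('m) / 2 - 2) * exp (- (s * (dist \<xi> x)\<^sup>2)) * heat_prod K \<alpha> \<xi> x s) \<partial>lborel)"
proof -
  let ?M = "\<Pi>\<^sub>M k\<in>K. lebesgue_on {0..1::real}"
  define A where "A = alpha_bar K \<alpha>"
  define R where "R = (dist \<xi> x)\<^sup>2"
  define y where "y k = \<xi> $ k * x $ k" for k
  have A: "0 < A" unfolding A_def by (rule alpha_bar_pos)
  have R: "0 < R" using ne by (simp add: R_def)
  have y: "0 < y k" if "k \<in> K" for k using \<xi> x that by (auto simp: orthant_def y_def)
  define P where "P = (\<Prod>k\<in>K. y k powr (1 - 2 * \<alpha> k))"
  have P: "0 \<le> P" unfolding P_def by (intro prod_nonneg) auto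
  let ?L = "\<integral>\<tau>. (\<Prod>k\<in>K. \<tau> k powr ((1 - \<alpha> k) - 1) * (1 - \<tau> k) powr ((2 - 2 * \<alpha> k) - (1 - \<alpha> k) - 1)) *
            (1 - (\<Sum>k\<in>K. sigma_k k \<xi> x * \<tau> k)) powr (- A) \<partial>?M"
  let ?f = "\<lambda>\<tau>. (\<Prod>k\<in>K. \<tau> k powr (- \<alpha> k) * (1 - \<tau> k) powr (- \<alpha> k)) * (R + (\<Sum>k\<in>K. 4 * y k * \<tau> k)) powr (- A)"
  have L: "?L = (\<integral>\<tau>. R powr A * ?f \<tau> \<partial>?M)"
  proof (rule Bochner_Integration.integral_cong[OF refl])
    fix \<tau> assume "\<tau> \<in> space ?M"
    then have \<tau>: "0 \<le> \<tau> k" if "k \<in> K" for k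
      using that by (auto simp: space_PiM PiE_def Pi_def space_restrict_space)
    have c: "0 < R + (\<Sum>k\<in>K. 4 * y k * \<tau> k)" using R y \<tau> by (intro add_pos_nonneg sum_nonneg) (auto simp: less_imp_le)
    have "1 - (\<Sum>k\<in>K. sigma_k k \<xi> x * \<tau> k) = (R + (\<Sum>k\<in>K. 4 * y k * \<tau> k)) / R"
      using R by (simp add: sigma_k_eq[OF ne] y_def R_def[symmetric] sum_divide_distrib[symmetric] sum_negf add_divide_distrib)
    moreover have "((R + (\<Sum>k\<in>K. 4 * y k * \<tau> k)) / R) powr (- A) = R powr A * (R + (\<Sum>k\<in>K. 4 * y k * \<tau> k)) powr (- A)"
      using c R by (simp add: powr_divide powr_minus field_simps)
    ultimately have "(1 - (\<Sum>k\<in>K. sigma_k k \<xi> x * \<tau> k)) powr (- A) = R powr A * (R + (\<Sum>k\<in>K. 4 * y k * \<tau> k)) powr (- A)"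
      by (simp only:)
    moreover have "(\<Prod>k\<in>K. \<tau> k powr ((1 - \<alpha> k) - 1) * (1 - \<tau> k) powr ((2 - 2 * \<alpha> k) - (1 - \<alpha> k) - 1)) = (\<Prod>k\<in>K. \<tau> k powr (- \<alpha> k) * (1 - \<tau> k) powr (- \<alpha> k))"
      by (rule prod.cong) auto
    ultimately show "(\<Prod>k\<in>K. \<tau> k powr ((1 - \<alpha> k) - 1) * (1 - \<tau> k) powr ((2 - 2 * \<alpha> k) - (1 - \<alpha> k) - 1)) *
            (1 - (\<Sum>k\<in>K. sigma_k k \<xi> x * \<tau> k)) powr (- A) = R powr A * ?f \<tau>"
      by (simp add: mult_ac)
  qed
  have id: "(\<lambda>t. t) \<in> borel_measurable (lebesgue_on {0..1::real})"
    by (rule measurable_restrict_space1) (auto intro: measurable_completion)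
  have comp: "(\<lambda>\<tau>. \<tau> k) \<in> borel_measurable ?M" if "k \<in> K" for k
    using measurable_compose[OF measurable_component_singleton[OF that] id] by simp
  have fm: "?f \<in> borel_measurable ?M"
    by (intro borel_measurable_times borel_measurable_prod powr_real_measurable borel_measurable_add borel_measurable_sum
        borel_measurable_diff borel_measurable_const comp)
  have "(\<integral>\<tau>. ?f \<tau> \<partial>?M) = enn2real (\<integral>\<^sup>+\<tau>. ennreal (?f \<tau>) \<partial>?M)"
    using fm by (intro integral_eq_nn_integral) (auto intro!: AE_I2 mult_nonneg_nonneg prod_nonneg)
  also have "\<dots> = enn2real (\<integral>\<^sup>+s. ennreal (indicator {0<..} s * (s powr (A - 1) * exp (- (s * R))) / Gamma A *
        (\<Prod>k\<in>K. beta_laplace (- \<alpha> k) (\<alpha> k) (4 * s * y k))) \<partial>lborel)"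
    using alpha y A R by (subst nn_integral_cube_laplace) fastforce+
  also have "\<dots> = (\<integral>s. indicator {0<..} s * (s powr (A - 1) * exp (- (s * R))) / Gamma A *
        (\<Prod>k\<in>K. beta_laplace (- \<alpha> k) (\<alpha> k) (4 * s * y k)) \<partial>lborel)"
    using Gamma_real_pos[OF A]
    by (intro integral_eq_nn_integral[symmetric]) (auto intro!: AE_I2 mult_nonneg_nonneg prod_nonneg beta_laplace_nonneg divide_nonneg_pos)
  finally have I: "(\<integral>\<tau>. ?f \<tau> \<partial>?M) = (\<integral>s. indicator {0<..} s * (s powr (A - 1) * exp (- (s * R))) / Gamma A *
        (\<Prod>k\<in>K. beta_laplace (- \<alpha> k) (\<alpha> k) (4 * s * y k)) \<partial>lborel)" .
  have "P * (\<integral>\<tau>. ?f \<tau> \<partial>?M) = (\<integral>s. P * (indicator {0<..} s * (s powr (A - 1) * exp (- (s * R))) / Gamma A *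
        (\<Prod>k\<in>K. beta_laplace (- \<alpha> k) (\<alpha> k) (4 * s * y k))) \<partial>lborel)"
    unfolding I by simp
  also have "\<dots> = (\<integral>s. 1 / Gamma A * (indicator {0<..} s * (s powr (real CARD('m) / 2 - 2) * exp (- (s * R)) * heat_prod K \<alpha> \<xi> x s)) \<partial>lborel)"
  proof (rule Bochner_Integration.integral_cong[OF refl])
    fix s :: real
    show "P * (indicator {0<..} s * (s powr (A - 1) * exp (- (s * R))) / Gamma A *
        (\<Prod>k\<in>K. beta_laplace (- \<alpha> k) (\<alpha> k) (4 * s * y k))) =
      1 / Gamma A * (indicator {0<..} s * (s powr (real CARD('m) / 2 - 2) * exp (- (s * R)) * heat_prod K \<alpha> \<xi> x s))"
    proof (cases "0 < s")
      case True
      \<comment> \<open>\<open>alpha_bar\<close> supplies one power \<open>1 - \<alpha> k\<close> of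
        \<open>s\<close> for each heat factor; what remains is the exponent
        \<open>m / 2 - 2\<close>.\<close>
      have "s powr (A - 1) = s powr (real CARD('m) / 2 - 2) * (\<Prod>k\<in>K. s powr (1 - \<alpha> k))"
      proof -
        have e: "A - 1 = (real CARD('m) / 2 - 2) + (\<Sum>k\<in>K. 1 - \<alpha> k)"
          by (simp add: A_def alpha_bar_def field_simps)
        have "(\<Prod>k\<in>K. s powr (1 - \<alpha> k)) = s powr (\<Sum>k\<in>K. 1 - \<alpha> k)"
          using True by (intro powr_sum[symmetric]) simp
        then show ?thesis unfolding e powr_add by (simp only:)
      qed
      moreover have "heat_prod K \<alpha> \<xi> x s = P * (\<Prod>k\<in>K. s powr (1 - \<alpha> k)) * (\<Prod>k\<in>K. beta_laplace (- \<alpha> k) (\<alpha> k) (4 * s * y k))"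
        by (simp add: heat_prod_def heat_factor_def P_def y_def prod.distrib)
      ultimately show ?thesis by (simp add: mult_ac)
    qed simp
  qed
  finally have PI: "P * (\<integral>\<tau>. ?f \<tau> \<partial>?M) = (1 / Gamma A) * (\<integral>s. indicator {0<..} s * (s powr (real CARD('m) / 2 - 2) * exp (- (s * R)) * heat_prod K \<alpha> \<xi> x s) \<partial>lborel)"
    by simp
  have RA: "(dist \<xi> x) powr (- 2 * A) * R powr A = 1"
  proof -
    have "R powr A = (dist \<xi> x) powr (2 * A)"
    proof -
      have "R = (dist \<xi> x) powr 2" using ne unfolding R_def by (intro powr_numeral[symmetric]) simp
      then show ?thesis by (simp only: powr_powr)
    qed
    then show ?thesis using ne by (simp flip: powr_add)
  qed
  have e: "2 - 2 * \<alpha> k - (1 - \<alpha> k) = 1 - \<alpha> k" for k by simp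
  have "q_n K \<alpha> \<xi> x = kappa_n K \<alpha> * (dist \<xi> x) powr (- 2 * A) * P *
      ((\<Prod>k\<in>K. Gamma (2 - 2 * \<alpha> k) / (Gamma (1 - \<alpha> k) * Gamma ((2 - 2 * \<alpha> k) - (1 - \<alpha> k)))) * ?L)"
    unfolding q_n_def lauricella_FA_def A_def P_def y_def by (rule refl)
  also have "\<dots> = kappa_n K \<alpha> * ((dist \<xi> x) powr (- 2 * A) * R powr A) *
      (\<Prod>k\<in>K. Gamma (2 - 2 * \<alpha> k) / (Gamma (1 - \<alpha> k) * Gamma (1 - \<alpha> k))) * (P * (\<integral>\<tau>. ?f \<tau> \<partial>?M))"
    unfolding L unfolding e integral_mult_right_zero by (simp only: mult_ac)
  also have "\<dots> = kernel_const K \<alpha> * (\<integral>s. indicator {0<..} s * (s powr (real CARD('m) / 2 - 2) * exp (- (s * R)) * heat_prod K \<alpha> \<xi> x s) \<partial>lborel)"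
    unfolding RA PI unfolding kernel_const_def A_def by (simp only: mult_1_right times_divide_eq_left times_divide_eq_right mult.assoc mult_1_left)
  finally show ?thesis by (simp only: R_def)
qed

end

section \<open>Derivative and uniform bounds of the heat product\<close>

text \<open>The derivative of \<open>heat_prod\<close> in \<open>x\<close> along
  \<open>\<nu>\<close>. Since \<open>heat_factor_deriv\<close> carries the extra factor
  \<open>y\<close>, the coordinate of \<xi> cancels and only \<open>\<nu> $ j / x $ j\<close>
  remains, which is bounded for \<open>x\<close> near \<open>t\<close> however close \<xi> is to the
  hyperplane.\<close>

definition heat_prod_deriv :: "'m::finite set \<Rightarrow> ('m \<Rightarrow> real) \<Rightarrow> real^'m \<Rightarrow> real^'m \<Rightarrow> real^'m \<Rightarrow> real \<Rightarrow> real" where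
  "heat_prod_deriv K \<alpha> \<nu> \<xi> x s =
     (\<Sum>j\<in>K. \<nu> $ j / x $ j * heat_factor_deriv (\<alpha> j) (\<xi> $ j * x $ j) s *
        (\<Prod>k\<in>K - {j}. heat_factor (\<alpha> k) (\<xi> $ k * x $ k) s))"

lemma borel_measurable_component:
  fixes f :: "'a \<Rightarrow> real^'m::finite"
  assumes "f \<in> borel_measurable M"
  shows "(\<lambda>z. f z $ k) \<in> borel_measurable M"
  using assms by (rule borel_measurable_continuous_on[OF continuous_on_component[OF continuous_on_id]])

lemma heat_prod_measurable [measurable (raw)]:
  assumes [measurable]: "f \<in> borel_measurable M" "g \<in> borel_measurable M"
  shows "(\<lambda>z. heat_prod K \<alpha> (f z) x (g z)) \<in> borel_measurable M"
  unfolding heat_prod_def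
  by (intro borel_measurable_prod heat_factor_measurable borel_measurable_times borel_measurable_component assms) auto

lemma heat_prod_deriv_measurable [measurable (raw)]:
  assumes [measurable]: "f \<in> borel_measurable M" "g \<in> borel_measurable M"
  shows "(\<lambda>z. heat_prod_deriv K \<alpha> \<nu> (f z) x (g z)) \<in> borel_measurable M"
  unfolding heat_prod_deriv_def
  by (intro borel_measurable_prod borel_measurable_sum heat_factor_measurable heat_factor_deriv_measurable
      borel_measurable_times borel_measurable_component assms) auto

lemma heat_prod_nonneg: "0 \<le> heat_prod K \<alpha> \<xi> x s"
  unfolding heat_prod_def by (intro prod_nonneg heat_factor_nonneg)

definition heat_integral :: "real \<Rightarrow> (real \<Rightarrow> real) \<Rightarrow> real \<Rightarrow> real" where
  "heat_integral p f R = (\<integral>s. indicator {0<..} s * (s powr p * exp (- (s * R)) * f s) \<partial>lborel)"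

locale lauricella_kernel_at = lauricella_kernel +
  fixes t :: "real^'m" and \<epsilon> M :: real
  assumes eps_pos: "0 < \<epsilon>" and t_ge: "k \<in> K \<Longrightarrow> 2 * \<epsilon> \<le> t $ k" and M_ge: "norm t + \<epsilon> \<le> M"
begin

text \<open>The radius leaves a gap of \<open>\<epsilon> / 2\<close> between these points and all
  points at distance at least \<open>\<epsilon>\<close> from \<open>t\<close>.\<close>

definition near :: "(real^'m) set" where "near = ball t (\<epsilon> / 2)"

lemma open_near: "open near" by (simp add: near_def)

lemma t_near: "t \<in> near" using eps_pos by (simp add: near_def)

lemma near_ge:
  assumes "x \<in> near" "k \<in> K"
  shows "\<epsilon> \<le> x $ k"
proof -
  have "\<bar>(x - t) $ k\<bar> \<le> norm (x - t)" by (rule component_le_norm_cart)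
  also have "\<dots> < \<epsilon> / 2" using assms by (simp add: near_def dist_norm norm_minus_commute)
  finally have "\<bar>x $ k - t $ k\<bar> < \<epsilon> / 2" by simp
  then show ?thesis using t_ge[OF assms(2)] eps_pos by linarith
qed

lemma near_orthant: "near \<subseteq> orthant K"
  using near_ge eps_pos by (force simp: orthant_def)

lemma near_le:
  assumes "x \<in> near"
  shows "norm x \<le> M"
proof -
  have "norm x \<le> norm t + norm (x - t)" using norm_triangle_ineq[of t "x - t"] by simp
  also have "norm (x - t) < \<epsilon> / 2" using assms by (simp add: near_def dist_norm norm_minus_commute)
  finally show ?thesis using M_ge eps_pos by simp
qed

lemma M_pos: "0 < M"
  using M_ge eps_pos norm_ge_zero[of t] by linarith

definition points :: "(real^'m) set" where "points = orthant K \<inter> cball 0 M"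

lemma near_points: "near \<subseteq> points"
  using near_orthant near_le by (auto simp: points_def)

lemma points_component:
  assumes "\<xi> \<in> points" "k \<in> K"
  shows "0 < \<xi> $ k" "\<xi> $ k \<le> M"
  using assms component_le_norm_cart[of \<xi> k] by (auto simp: points_def orthant_def)

text \<open>
  Near \<open>t\<close> the factor is bounded; away from \<open>t\<close>, where \<open>\<xi>\<close> may approach a hyperplane \<open>\<xi> $ k = 0\<close>,
  it grows at most linearly in \<open>s\<close>, which the exponential absorbs.
\<close>
lemma heat_factor_bound_single:
  assumes k: "k \<in> K"
  shows "\<exists>A\<ge>0. \<forall>s>0. \<forall>\<xi>\<in>points. \<forall>x\<in>near.
    heat_factor (\<alpha> k) (\<xi> $ k * x $ k) s \<le> A * exp (s * (dist \<xi> x)\<^sup>2 / (2 * real (card K)))"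
proof -
  let ?n = "real (card K)" and ?a = "\<alpha> k"
  have n: "0 < ?n" using K_nonempty by (simp add: card_gt_0_iff)
  have a: "0 < ?a" "?a < 1" "2 * ?a < 1" using alpha[OF k] by auto
  \<comment> \<open>At distance at least \<open>\<epsilon> / 2\<close> the permitted exponent
    \<open>s * (dist \<xi> x)\<^sup>2 / (2 * n)\<close> is at least \<open>c * s\<close>.\<close>
  define c where "c = \<epsilon>\<^sup>2 / (8 * ?n)"
  have c: "0 < c" using eps_pos n by (simp add: c_def)
  define C where "C = max 1 (1 / c)"
  have growth: "1 + s \<le> C * exp (c * s)" if "0 < s" for s
  proof -
    have "1 + s \<le> C * (1 + c * s)"
    proof -
      have "s = (1 / c) * (c * s)" using c by simp
      also have "\<dots> \<le> C * (c * s)" using c that by (intro mult_right_mono) (auto simp: C_def)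
      finally have "s \<le> C * (c * s)" .
      moreover have "1 \<le> C" by (simp add: C_def)
      ultimately show ?thesis by (simp add: distrib_left)
    qed
    also have "\<dots> \<le> C * exp (c * s)" by (intro mult_left_mono exp_ge_add_one_self) (auto simp: C_def)
    finally show ?thesis .
  qed
  have B: "0 \<le> beta_laplace_bound ?a"
    unfolding beta_laplace_bound_def using a by (intro add_nonneg_nonneg beta_laplace_nonneg) (auto intro: less_imp_le Gamma_real_pos)
  define A1 where "A1 = beta_laplace_bound ?a * (\<epsilon>\<^sup>2) powr (- ?a)"
  define A2 where "A2 = beta_laplace (- ?a) ?a 0 * (M\<^sup>2) powr (1 - 2 * ?a)"
  have A1: "0 \<le> A1" and A2: "0 \<le> A2" using B by (auto simp: A1_def A2_def beta_laplace_nonneg)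
  have C: "0 \<le> C" by (simp add: C_def)
  show ?thesis
  proof (intro exI[of _ "A1 + A2 * C"] conjI allI ballI impI)
    show "0 \<le> A1 + A2 * C" using A1 A2 C by simp
    fix s :: real and \<xi> x assume s: "0 < s" and \<xi>: "\<xi> \<in> points" and x: "x \<in> near"
    define y where "y = \<xi> $ k * x $ k"
    define e where "e = exp (s * (dist \<xi> x)\<^sup>2 / (2 * ?n))"
    have e1: "1 \<le> e" using s n by (simp add: e_def)
    have xk: "\<epsilon> \<le> x $ k" "x $ k \<le> M" using near_ge[OF x k] points_component[of x k] x near_points k by auto
    have \<xi>k: "0 < \<xi> $ k" "\<xi> $ k \<le> M" using points_component[OF \<xi> k] by auto
    have y: "0 < y" using xk \<xi>k eps_pos by (simp add: y_def)
    have "heat_factor ?a y s \<le> (A1 + A2 * C) * e"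
    proof (cases "dist \<xi> t < \<epsilon>")
      case True
      have "\<bar>(\<xi> - t) $ k\<bar> \<le> norm (\<xi> - t)" by (rule component_le_norm_cart)
      then have "\<epsilon> \<le> \<xi> $ k" using True t_ge[OF k] by (simp add: dist_norm)
      then have ye: "\<epsilon>\<^sup>2 \<le> y" using xk eps_pos unfolding y_def power2_eq_square by (intro mult_mono) auto
      have "heat_factor ?a y s \<le> beta_laplace_bound ?a * y powr (- ?a)" by (rule heat_factor_le[OF a(1,2) y s])
      also have "\<dots> \<le> A1" unfolding A1_def
        using a ye eps_pos B by (intro mult_left_mono powr_mono2') auto
      also have "\<dots> \<le> (A1 + A2 * C) * 1" using A2 C by simp
      also have "\<dots> \<le> (A1 + A2 * C) * e" using e1 A1 A2 C by (intro mult_left_mono) auto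
      finally show ?thesis .
    next
      case False
      have "dist x t < \<epsilon> / 2" using x by (simp add: near_def dist_commute)
      then have "\<epsilon> / 2 \<le> dist \<xi> x" using False dist_triangle[of \<xi> t x] by linarith
      then have "(\<epsilon> / 2)\<^sup>2 \<le> (dist \<xi> x)\<^sup>2" using eps_pos by (intro power_mono) auto
      then have "\<epsilon>\<^sup>2 / 4 \<le> (dist \<xi> x)\<^sup>2" by (simp add: power_divide)
      then have "\<epsilon>\<^sup>2 / 4 / (2 * ?n) \<le> (dist \<xi> x)\<^sup>2 / (2 * ?n)" using n by (intro divide_right_mono) auto
      then have "c * s \<le> (dist \<xi> x)\<^sup>2 / (2 * ?n) * s"
        using s by (intro mult_right_mono) (auto simp: c_def)
      then have ce: "exp (c * s) \<le> e" by (simp add: e_def mult.commute)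
      have yM: "y \<le> M\<^sup>2" using xk \<xi>k M_pos eps_pos unfolding y_def power2_eq_square by (intro mult_mono) auto
      have s1: "s powr (1 - ?a) \<le> 1 + s"
      proof (cases "s \<le> 1")
        case True then show ?thesis using s a powr_le1[of "1 - ?a" s] by simp
      next
        case False then show ?thesis using s a powr_mono[of "1 - ?a" 1 s] by simp
      qed
      have "heat_factor ?a y s \<le> beta_laplace (- ?a) ?a 0 * y powr (1 - 2 * ?a) * s powr (1 - ?a)"
        by (rule heat_factor_le_powr[OF a(1,2) y s])
      also have "\<dots> \<le> A2 * (1 + s)"
        unfolding A2_def using s1 yM y a
        by (intro mult_mono mult_left_mono powr_mono2 mult_nonneg_nonneg beta_laplace_nonneg) auto
      also have "\<dots> \<le> A2 * (C * e)"
        using growth[OF s] mult_left_mono[OF ce C] A2 by (intro mult_left_mono) auto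
      also have "\<dots> \<le> (A1 + A2 * C) * e" using A1 e1 by (simp add: algebra_simps)
      finally show ?thesis .
    qed
    then show "heat_factor (\<alpha> k) (\<xi> $ k * x $ k) s \<le> (A1 + A2 * C) * exp (s * (dist \<xi> x)\<^sup>2 / (2 * ?n))"
      by (simp add: y_def e_def)
  qed
qed

lemma heat_factor_bounds:
  "\<exists>A\<ge>0. \<forall>k\<in>K. \<forall>s>0. \<forall>\<xi>\<in>points. \<forall>x\<in>near.
    heat_factor (\<alpha> k) (\<xi> $ k * x $ k) s \<le> A * exp (s * (dist \<xi> x)\<^sup>2 / (2 * real (card K))) \<and>
    \<bar>heat_factor_deriv (\<alpha> k) (\<xi> $ k * x $ k) s\<bar> \<le> A * exp (s * (dist \<xi> x)\<^sup>2 / (2 * real (card K)))"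
proof -
  have "\<forall>k\<in>K. \<exists>A. 0 \<le> A \<and> (\<forall>s>0. \<forall>\<xi>\<in>points. \<forall>x\<in>near.
    heat_factor (\<alpha> k) (\<xi> $ k * x $ k) s \<le> A * exp (s * (dist \<xi> x)\<^sup>2 / (2 * real (card K))))"
    using heat_factor_bound_single by blast
  from bchoice[OF this] obtain A where A0: "\<And>k. k \<in> K \<Longrightarrow> 0 \<le> A k" and A: "\<And>k s \<xi> x. k \<in> K \<Longrightarrow> 0 < s \<Longrightarrow> \<xi> \<in> points \<Longrightarrow> x \<in> near \<Longrightarrow>
      heat_factor (\<alpha> k) (\<xi> $ k * x $ k) s \<le> A k * exp (s * (dist \<xi> x)\<^sup>2 / (2 * real (card K)))"
    by blast
  define S where "S = (\<Sum>k\<in>K. A k)"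
  have S0: "0 \<le> S" unfolding S_def by (intro sum_nonneg A0)
  have AS: "A k \<le> S" if "k \<in> K" for k
    unfolding S_def by (rule member_le_sum) (use that A0 in auto)
  show ?thesis
  \<comment> \<open>One copy of \<open>S\<close> for the value at \<open>s\<close> and two for the
    value at \<open>s / 2\<close> in \<open>heat_factor_deriv_abs_le\<close>.\<close>
  proof (intro exI[of _ "3 * S"] conjI ballI allI impI)
    show "0 \<le> 3 * S" using S0 by simp
    fix k s \<xi> x assume k: "k \<in> K" and s: "0 < (s::real)" and \<xi>: "\<xi> \<in> points" and x: "x \<in> near"
    let ?e = "\<lambda>s. exp (s * (dist \<xi> x)\<^sup>2 / (2 * real (card K)))" and ?y = "\<xi> $ k * x $ k"
    have le: "heat_factor (\<alpha> k) ?y u \<le> S * ?e s" if u: "0 < u" "u \<le> s" for u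
    proof -
      have "heat_factor (\<alpha> k) ?y u \<le> A k * ?e u" by (rule A[OF k u(1) \<xi> x])
      also have "\<dots> \<le> S * ?e s"
        using AS[OF k] S0 u by (intro mult_mono) (auto intro!: divide_right_mono mult_right_mono)
      finally show ?thesis .
    qed
    show "heat_factor (\<alpha> k) ?y s \<le> 3 * S * ?e s"
      using order_trans[OF le[of s], of "3 * S * ?e s"] s S0 by simp
    have y: "0 < ?y" using points_component[OF \<xi> k] points_component[of x k] x near_points k by auto
    have "\<bar>heat_factor_deriv (\<alpha> k) ?y s\<bar> \<le> heat_factor (\<alpha> k) ?y s + 2 * heat_factor (\<alpha> k) ?y (s / 2)"
      using alpha[OF k] y s by (intro heat_factor_deriv_abs_le) auto
    also have "\<dots> \<le> S * ?e s + 2 * (S * ?e s)" using s by (intro add_mono mult_left_mono le) auto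
    finally show "\<bar>heat_factor_deriv (\<alpha> k) ?y s\<bar> \<le> 3 * S * ?e s" by simp
  qed
qed

text \<open>Each of the \<open>card K\<close> factors may grow with exponent
  \<open>s r\<^sup>2 / (2 * card K)\<close>, so that the product uses up exactly half of the
  Gaussian \<open>exp (- s r\<^sup>2)\<close>.\<close>

lemma heat_prod_bounds:
  "\<exists>A\<ge>0. \<forall>\<nu> s \<xi> x. norm \<nu> = 1 \<longrightarrow> 0 < s \<longrightarrow> \<xi> \<in> points \<longrightarrow> x \<in> near \<longrightarrow>
    heat_prod K \<alpha> \<xi> x s \<le> A * exp (s * (dist \<xi> x)\<^sup>2 / 2) \<and>
    \<bar>heat_prod_deriv K \<alpha> \<nu> \<xi> x s\<bar> \<le> A * exp (s * (dist \<xi> x)\<^sup>2 / 2)"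
proof -
  let ?n = "card K"
  have n: "0 < ?n" using K_nonempty by (simp add: card_gt_0_iff)
  obtain A where A0: "0 \<le> A" and A: "\<And>k s \<xi> x. k \<in> K \<Longrightarrow> 0 < s \<Longrightarrow> \<xi> \<in> points \<Longrightarrow> x \<in> near \<Longrightarrow>
      heat_factor (\<alpha> k) (\<xi> $ k * x $ k) s \<le> A * exp (s * (dist \<xi> x)\<^sup>2 / (2 * real ?n)) \<and>
      \<bar>heat_factor_deriv (\<alpha> k) (\<xi> $ k * x $ k) s\<bar> \<le> A * exp (s * (dist \<xi> x)\<^sup>2 / (2 * real ?n))"
    using heat_factor_bounds by blast
  show ?thesis
  proof (intro exI[of _ "A ^ ?n * (1 + real ?n / \<epsilon>)"] conjI allI impI)
    show "0 \<le> A ^ ?n * (1 + real ?n / \<epsilon>)" using A0 eps_pos by simp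
    fix \<nu> :: "real^'m" and s :: real and \<xi> x
    assume \<nu>: "norm \<nu> = 1" and s: "0 < s" and \<xi>: "\<xi> \<in> points" and x: "x \<in> near"
    define e where "e = A * exp (s * (dist \<xi> x)\<^sup>2 / (2 * real ?n))"
    define F where "F k = heat_factor (\<alpha> k) (\<xi> $ k * x $ k) s" for k
    define G where "G k = heat_factor_deriv (\<alpha> k) (\<xi> $ k * x $ k) s" for k
    have F: "0 \<le> F k" for k by (simp add: F_def heat_factor_nonneg)
    have FG: "F k \<le> e" "\<bar>G k\<bar> \<le> e" if "k \<in> K" for k using A[OF that s \<xi> x] by (auto simp: F_def G_def e_def)
    have e0: "0 \<le> e" using A0 by (simp add: e_def)
    have en: "e ^ ?n = A ^ ?n * exp (s * (dist \<xi> x)\<^sup>2 / 2)"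
      using K_nonempty by (simp add: e_def power_mult_distrib flip: exp_of_nat_mult)
    have en0: "0 \<le> e ^ ?n" using e0 by simp
    have "heat_prod K \<alpha> \<xi> x s \<le> (\<Prod>k\<in>K. e)"
      unfolding heat_prod_def F_def[symmetric] by (intro prod_mono) (auto simp: F FG)
    also have "\<dots> = e ^ ?n * 1" by simp
    also have "\<dots> \<le> e ^ ?n * (1 + real ?n / \<epsilon>)" using en0 eps_pos by (intro mult_left_mono) auto
    finally show "heat_prod K \<alpha> \<xi> x s \<le> A ^ ?n * (1 + real ?n / \<epsilon>) * exp (s * (dist \<xi> x)\<^sup>2 / 2)"
      by (simp add: en mult_ac)
    have summand: "\<bar>\<nu> $ j / x $ j * G j * (\<Prod>k\<in>K - {j}. F k)\<bar> \<le> (1 / \<epsilon>) * e ^ ?n" if j: "j \<in> K" for j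
    proof -
      have "\<bar>\<nu> $ j / x $ j\<bar> \<le> 1 / \<epsilon>"
        using component_le_norm_cart[of \<nu> j] near_ge[OF x j] \<nu> eps_pos unfolding abs_divide by (intro frac_le) auto
      moreover have "(\<Prod>k\<in>K - {j}. F k) \<le> e ^ (?n - 1)"
      proof -
        have "(\<Prod>k\<in>K - {j}. F k) \<le> (\<Prod>k\<in>K - {j}. e)" by (intro prod_mono) (auto simp: F FG)
        then show ?thesis using j by (simp add: card_Diff_singleton)
      qed
      moreover have "0 \<le> (\<Prod>k\<in>K - {j}. F k)" by (intro prod_nonneg F)
      ultimately have "\<bar>\<nu> $ j / x $ j\<bar> * \<bar>G j\<bar> * (\<Prod>k\<in>K - {j}. F k) \<le> (1 / \<epsilon>) * e * e ^ (?n - 1)"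
        using FG(2)[OF j] eps_pos e0 by (intro mult_mono) auto
      moreover have "e * e ^ (?n - 1) = e ^ ?n" using n by (cases "?n") auto
      ultimately show ?thesis using \<open>0 \<le> (\<Prod>k\<in>K - {j}. F k)\<close> by (simp add: abs_mult mult.assoc)
    qed
    have "\<bar>heat_prod_deriv K \<alpha> \<nu> \<xi> x s\<bar> \<le> (\<Sum>j\<in>K. \<bar>\<nu> $ j / x $ j * G j * (\<Prod>k\<in>K - {j}. F k)\<bar>)"
      unfolding heat_prod_deriv_def F_def G_def by (rule sum_abs)
    also have "\<dots> \<le> (\<Sum>j\<in>K. (1 / \<epsilon>) * e ^ ?n)" by (intro sum_mono summand)
    also have "\<dots> = e ^ ?n * (real ?n / \<epsilon>)" by simp
    also have "\<dots> \<le> e ^ ?n * (1 + real ?n / \<epsilon>)" using en0 eps_pos by (intro mult_left_mono) auto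
    finally show "\<bar>heat_prod_deriv K \<alpha> \<nu> \<xi> x s\<bar> \<le> A ^ ?n * (1 + real ?n / \<epsilon>) * exp (s * (dist \<xi> x)\<^sup>2 / 2)"
      by (simp add: en mult_ac)
  qed
qed

definition prod_bound :: real where
  "prod_bound = (SOME A. 0 \<le> A \<and> (\<forall>\<nu> s \<xi> x. norm \<nu> = 1 \<longrightarrow> 0 < s \<longrightarrow> \<xi> \<in> points \<longrightarrow> x \<in> near \<longrightarrow>
    heat_prod K \<alpha> \<xi> x s \<le> A * exp (s * (dist \<xi> x)\<^sup>2 / 2) \<and>
    \<bar>heat_prod_deriv K \<alpha> \<nu> \<xi> x s\<bar> \<le> A * exp (s * (dist \<xi> x)\<^sup>2 / 2)))"

lemma prod_bound_nonneg: "0 \<le> prod_bound"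
  and heat_prod_le: "0 < s \<Longrightarrow> \<xi> \<in> points \<Longrightarrow> x \<in> near \<Longrightarrow> heat_prod K \<alpha> \<xi> x s \<le> prod_bound * exp (s * (dist \<xi> x)\<^sup>2 / 2)"
  and heat_prod_deriv_le: "norm \<nu> = 1 \<Longrightarrow> 0 < s \<Longrightarrow> \<xi> \<in> points \<Longrightarrow> x \<in> near \<Longrightarrow>
    \<bar>heat_prod_deriv K \<alpha> \<nu> \<xi> x s\<bar> \<le> prod_bound * exp (s * (dist \<xi> x)\<^sup>2 / 2)"
proof -
  have *: "0 \<le> prod_bound \<and> (\<forall>\<nu> s \<xi> x. norm \<nu> = 1 \<longrightarrow> 0 < s \<longrightarrow> \<xi> \<in> points \<longrightarrow> x \<in> near \<longrightarrow>
    heat_prod K \<alpha> \<xi> x s \<le> prod_bound * exp (s * (dist \<xi> x)\<^sup>2 / 2) \<and>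
    \<bar>heat_prod_deriv K \<alpha> \<nu> \<xi> x s\<bar> \<le> prod_bound * exp (s * (dist \<xi> x)\<^sup>2 / 2))"
    unfolding prod_bound_def by (rule someI_ex) (use heat_prod_bounds in blast)
  show "0 \<le> prod_bound" using * by blast
  obtain e :: "real^'m" where e: "norm e = 1" using vector_choose_size[of 1] by auto
  show "heat_prod K \<alpha> \<xi> x s \<le> prod_bound * exp (s * (dist \<xi> x)\<^sup>2 / 2)" if "0 < s" "\<xi> \<in> points" "x \<in> near"
    using * that e by blast
  show "\<bar>heat_prod_deriv K \<alpha> \<nu> \<xi> x s\<bar> \<le> prod_bound * exp (s * (dist \<xi> x)\<^sup>2 / 2)"
    if "norm \<nu> = 1" "0 < s" "\<xi> \<in> points" "x \<in> near" using * that by blast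
qed

end

section \<open>Heat integrals: bounds, limits and scaling\<close>

text \<open>Half of the exponential is spent on the growth of \<open>f\<close>; the other half
  leaves a Gamma integral at rate \<open>R / 2\<close>.\<close>

lemma heat_integral_bound:
  assumes p: "-1 < p" and R: "0 < R" and [measurable]: "f \<in> borel_measurable borel"
    and f: "\<And>s. 0 < s \<Longrightarrow> \<bar>f s\<bar> \<le> A * exp (s * R / 2)"
  shows "integrable lborel (\<lambda>s. indicator {0<..} s * (s powr p * exp (- (s * R)) * f s))"
    and "\<bar>heat_integral p f R\<bar> \<le> A * (Gamma (p + 1) / (R / 2) powr (p + 1))"
proof -
  have G: "has_bochner_integral lborel (\<lambda>s. A * (indicator {0<..} s * (s powr (p + 1 - 1) * exp (- (s * (R / 2)))))) (A * (Gamma (p + 1) / (R / 2) powr (p + 1)))"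
    using p R by (intro has_bochner_integral_mult_right gamma_laplace) auto
  have le: "\<bar>indicator {0<..} s * (s powr p * exp (- (s * R)) * f s)\<bar> \<le> A * (indicator {0<..} s * (s powr (p + 1 - 1) * exp (- (s * (R / 2)))))" for s
  proof (cases "0 < s")
    case True
    have "\<bar>s powr p * exp (- (s * R)) * f s\<bar> \<le> s powr p * exp (- (s * R)) * (A * exp (s * R / 2))"
      using f[OF True] by (simp add: abs_mult mult_left_mono)
    also have "\<dots> = A * (s powr p * (exp (- (s * R)) * exp (s * R / 2)))" by (simp add: mult_ac)
    also have "exp (- (s * R)) * exp (s * R / 2) = exp (- (s * (R / 2)))" by (simp flip: exp_add)
    finally show ?thesis using True by simp
  qed simp
  show int: "integrable lborel (\<lambda>s. indicator {0<..} s * (s powr p * exp (- (s * R)) * f s))"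
  proof (rule Bochner_Integration.integrable_bound[OF integrable.intros[OF G]])
    show "AE s in lborel. norm (indicator {0<..} s * (s powr p * exp (- (s * R)) * f s)) \<le>
        norm (A * (indicator {0<..} s * (s powr (p + 1 - 1) * exp (- (s * (R / 2))))))"
      unfolding real_norm_def by (intro AE_I2 order_trans[OF le abs_ge_self])
  qed measurable
  have "\<bar>heat_integral p f R\<bar> \<le> (\<integral>s. \<bar>indicator {0<..} s * (s powr p * exp (- (s * R)) * f s)\<bar> \<partial>lborel)"
    unfolding heat_integral_def by (rule integral_abs_bound)
  also have "\<dots> \<le> (\<integral>s. A * (indicator {0<..} s * (s powr (p + 1 - 1) * exp (- (s * (R / 2))))) \<partial>lborel)"
    by (intro integral_mono integrable_abs int integrable.intros[OF G] le)
  also have "\<dots> = A * (Gamma (p + 1) / (R / 2) powr (p + 1))"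
    using G by (rule has_bochner_integral_integral_eq)
  finally show "\<bar>heat_integral p f R\<bar> \<le> A * (Gamma (p + 1) / (R / 2) powr (p + 1))" .
qed

lemma heat_integral_tendsto:
  assumes p: "-1 < p" and R: "R \<longlonglongrightarrow> R0" "0 < R0"
    and meas [measurable]: "\<And>n. f n \<in> borel_measurable borel" "g \<in> borel_measurable borel"
    and bound: "eventually (\<lambda>n. \<forall>s>0. \<bar>f n s\<bar> \<le> A * exp (s * R n / 2)) sequentially" and A: "0 \<le> A"
    and lim: "\<And>s. 0 < s \<Longrightarrow> (\<lambda>n. f n s) \<longlonglongrightarrow> g s"
  shows "(\<lambda>n. heat_integral p (f n) (R n)) \<longlonglongrightarrow> heat_integral p g R0"
proof -
  have "eventually (\<lambda>n. R0 / 2 < R n) sequentially"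
    using order_tendstoD(1)[OF R(1), of "R0 / 2"] R(2) by simp
  from eventually_conj[OF this bound] obtain n0 where n0: "\<And>n. n0 \<le> n \<Longrightarrow> R0 / 2 < R n \<and> (\<forall>s>0. \<bar>f n s\<bar> \<le> A * exp (s * R n / 2))"
    by (auto simp: eventually_sequentially)
  \<comment> \<open>Eventually \<open>R n\<close> exceeds \<open>R0 / 2\<close>, and half of that
    rate is spent on \<open>f n\<close>, hence \<open>R0 / 4\<close>.\<close>
  have G: "integrable lborel (\<lambda>s. A * (indicator {0<..} s * (s powr (p + 1 - 1) * exp (- (s * (R0 / 4))))))"
    using p R by (intro integrable_mult_right integrable.intros[OF gamma_laplace]) auto
  have "(\<lambda>n. heat_integral p (f (n + n0)) (R (n + n0))) \<longlonglongrightarrow> heat_integral p g R0"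
    unfolding heat_integral_def
  proof (rule integral_dominated_convergence[OF _ _ G])
    show "AE s in lborel. (\<lambda>n. indicator {0<..} s * (s powr p * exp (- (s * R (n + n0))) * f (n + n0) s))
        \<longlonglongrightarrow> indicator {0<..} s * (s powr p * exp (- (s * R0)) * g s)"
    proof (intro AE_I2)
      fix s :: real
      show "(\<lambda>n. indicator {0<..} s * (s powr p * exp (- (s * R (n + n0))) * f (n + n0) s))
        \<longlonglongrightarrow> indicator {0<..} s * (s powr p * exp (- (s * R0)) * g s)"
      proof (cases "0 < s")
        case True
        show ?thesis
          by (intro tendsto_intros LIMSEQ_ignore_initial_segment R lim True)
      qed simp
    qed
    fix n
    show "AE s in lborel. norm (indicator {0<..} s * (s powr p * exp (- (s * R (n + n0))) * f (n + n0) s)) \<le>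
      A * (indicator {0<..} s * (s powr (p + 1 - 1) * exp (- (s * (R0 / 4)))))"
    proof (intro AE_I2)
      fix s :: real
      show "norm (indicator {0<..} s * (s powr p * exp (- (s * R (n + n0))) * f (n + n0) s)) \<le>
        A * (indicator {0<..} s * (s powr (p + 1 - 1) * exp (- (s * (R0 / 4)))))"
      proof (cases "0 < s")
        case True
        let ?R = "R (n + n0)"
        have n: "R0 / 2 < ?R" "\<bar>f (n + n0) s\<bar> \<le> A * exp (s * ?R / 2)" using n0[of "n + n0"] True by auto
        have "\<bar>s powr p * exp (- (s * ?R)) * f (n + n0) s\<bar> \<le> s powr p * exp (- (s * ?R)) * (A * exp (s * ?R / 2))"
          using n(2) by (simp add: abs_mult mult_left_mono)
        also have "\<dots> = A * (s powr p * (exp (- (s * ?R)) * exp (s * ?R / 2)))" by (simp add: mult_ac)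
        also have "exp (- (s * ?R)) * exp (s * ?R / 2) = exp (- (s * (?R / 2)))" by (simp flip: exp_add)
        also have "A * (s powr p * exp (- (s * (?R / 2)))) \<le> A * (s powr p * exp (- (s * (R0 / 4))))"
          using A n(1) True by (intro mult_left_mono) auto
        finally show ?thesis using True by simp
      qed simp
    qed
  qed measurable
  then show ?thesis by (rule LIMSEQ_offset)
qed

lemma heat_integral_rescale:
  assumes R: "0 < R"
  shows "R powr (p + 1) * heat_integral p f R = (\<integral>u. indicator {0<..} u * (u powr p * exp (- u) * f (u / R)) \<partial>lborel)"
proof -
  have "heat_integral p f R = (1 / R) * (\<integral>u. indicator {0<..} (u / R) * ((u / R) powr p * exp (- (u / R * R)) * f (u / R)) \<partial>lborel)"
    unfolding heat_integral_def
    using lborel_integral_real_affine[of "1 / R" "\<lambda>s. indicator {0<..} s * (s powr p * exp (- (s * R)) * f s)" 0] R by simp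
  then have "R powr (p + 1) * heat_integral p f R =
      (\<integral>u. R powr p * (indicator {0<..} (u / R) * ((u / R) powr p * exp (- (u / R * R)) * f (u / R))) \<partial>lborel)"
    using R by (simp add: powr_add)
  moreover have "R powr p * (indicator {0<..} (u / R) * ((u / R) powr p * exp (- (u / R * R)) * f (u / R))) =
      indicator {0<..} u * (u powr p * exp (- u) * f (u / R))" for u
    using R by (auto simp: powr_divide zero_less_divide_iff split: split_indicator)
  ultimately show ?thesis by (simp only:)
qed

lemma has_derivative_heat_prod:
  assumes \<alpha>: "\<And>k. k \<in> K \<Longrightarrow> 0 < \<alpha> k \<and> 2 * \<alpha> k < 1" and \<xi>: "\<xi> \<in> orthant K" and x: "x + h *\<^sub>R \<nu> \<in> orthant K" and s: "0 < s"
  shows "((\<lambda>h. heat_prod K \<alpha> \<xi> (x + h *\<^sub>R \<nu>) s) has_real_derivative heat_prod_deriv K \<alpha> \<nu> \<xi> (x + h *\<^sub>R \<nu>) s) (at h)"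
  unfolding heat_prod_def heat_prod_deriv_def
proof (rule has_field_derivative_prod)
  fix k assume k: "k \<in> K"
  define X where "X h = (x + h *\<^sub>R \<nu>) $ k" for h
  have X: "0 < X h" using x k by (auto simp: orthant_def X_def)
  have \<xi>k: "0 < \<xi> $ k" using \<xi> k by (auto simp: orthant_def)
  have dX: "((\<lambda>h. \<xi> $ k * X h) has_real_derivative \<xi> $ k * \<nu> $ k) (at h)"
    unfolding X_def by (auto intro!: derivative_eq_intros)
  have "((\<lambda>y. heat_factor (\<alpha> k) y s) has_real_derivative heat_factor_deriv (\<alpha> k) (\<xi> $ k * X h) s / (\<xi> $ k * X h)) (at (\<xi> $ k * X h))"
    using \<alpha>[OF k] X \<xi>k s by (intro has_derivative_heat_factor) auto
  from DERIV_chain2[OF this dX]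
  show "((\<lambda>h. heat_factor (\<alpha> k) (\<xi> $ k * (x + h *\<^sub>R \<nu>) $ k) s) has_real_derivative
      \<nu> $ k / (x + h *\<^sub>R \<nu>) $ k * heat_factor_deriv (\<alpha> k) (\<xi> $ k * (x + h *\<^sub>R \<nu>) $ k) s) (at h)"
    unfolding X_def[symmetric] using \<xi>k X by (simp add: field_simps)
qed

section \<open>The derivative of the kernel and its behaviour at the diagonal\<close>

context lauricella_kernel_at
begin

lemma half_dim_gt: "1 < real CARD('m) / 2" using card_gt2 by simp

text \<open>The value of the derivative of \<open>q_n\<close> along \<open>\<nu>\<close> for \<xi>
  different from \<open>x\<close>. Differentiating the Gaussian gives the first term, with one more
  power of \<open>s\<close>; differentiating the heat product gives the second.\<close>

definition kernel_grad :: "real^'m \<Rightarrow> real^'m \<Rightarrow> real^'m \<Rightarrow> real" where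
  "kernel_grad \<nu> \<xi> x = kernel_const K \<alpha> *
    (2 * ((\<xi> - x) \<bullet> \<nu>) * heat_integral (real CARD('m) / 2 - 1) (heat_prod K \<alpha> \<xi> x) ((dist \<xi> x)\<^sup>2) +
     heat_integral (real CARD('m) / 2 - 2) (heat_prod_deriv K \<alpha> \<nu> \<xi> x) ((dist \<xi> x)\<^sup>2))"

lemma heat_prod_meas: "heat_prod K \<alpha> \<xi> x \<in> borel_measurable borel"
  using heat_prod_measurable[of "\<lambda>_. \<xi>" borel "\<lambda>s. s" K \<alpha> x] by simp

lemma heat_prod_deriv_meas: "heat_prod_deriv K \<alpha> \<nu> \<xi> x \<in> borel_measurable borel"
  using heat_prod_deriv_measurable[of "\<lambda>_. \<xi>" borel "\<lambda>s. s" K \<alpha> \<nu> x] by simp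

lemma heat_prod_abs_le:
  "0 < s \<Longrightarrow> \<xi> \<in> points \<Longrightarrow> x \<in> near \<Longrightarrow> \<bar>heat_prod K \<alpha> \<xi> x s\<bar> \<le> prod_bound * exp (s * (dist \<xi> x)\<^sup>2 / 2)"
  using heat_prod_le heat_prod_nonneg[of K \<alpha> \<xi> x s] by (simp add: abs_of_nonneg)

lemma q_n_has_derivative:
  assumes \<nu>: "norm \<nu> = 1" and \<xi>: "\<xi> \<in> points" and x: "x \<in> near" and ne: "\<xi> \<noteq> x"
  shows "((\<lambda>h. q_n K \<alpha> \<xi> (x + h *\<^sub>R \<nu>)) has_real_derivative kernel_grad \<nu> \<xi> x) (at 0)"
proof -
  define r where "r = dist \<xi> x"
  have r: "0 < r" using ne by (simp add: r_def)
  obtain d where d: "0 < d" "ball x d \<subseteq> near" using open_near x by (meson openE)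
  \<comment> \<open>Keeps the moving point inside \<open>near\<close> and at distance at least
    \<open>r / 2\<close> from \<xi>.\<close>
  define e where "e = min d (r / 2)"
  have e: "0 < e" using d r by (simp add: e_def)
  define X where "X h = x + h *\<^sub>R \<nu>" for h
  have dX: "dist (X h) x = \<bar>h\<bar>" for h using \<nu> by (simp add: X_def dist_norm)
  have X: "X h \<in> near" "r / 2 \<le> dist \<xi> (X h)" "dist \<xi> (X h) \<le> 2 * M" if "\<bar>h\<bar> < e" for h
  proof -
    show near: "X h \<in> near" using that d dX[of h] by (auto simp: e_def dist_commute subset_eq)
    show "r / 2 \<le> dist \<xi> (X h)" using that dX[of h] dist_triangle[of \<xi> x "X h"] by (simp add: e_def r_def)
    have "norm \<xi> \<le> M" using \<xi> by (simp add: points_def)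
    then show "dist \<xi> (X h) \<le> 2 * M" using near_le[OF near] norm_triangle_ineq4[of \<xi> "X h"] by (simp add: dist_norm)
  qed
  have \<xi>o: "\<xi> \<in> orthant K" using \<xi> by (simp add: points_def)
  let ?f = "\<lambda>s h. indicator {0<..} s * (s powr (real CARD('m) / 2 - 2) * exp (- (s * (dist \<xi> (X h))\<^sup>2)) * heat_prod K \<alpha> \<xi> (X h) s) :: real"
  let ?f' = "\<lambda>s h. 2 * ((\<xi> - X h) \<bullet> \<nu>) * (indicator {0<..} s * (s powr (real CARD('m) / 2 - 1) * exp (- (s * (dist \<xi> (X h))\<^sup>2)) * heat_prod K \<alpha> \<xi> (X h) s))
     + indicator {0<..} s * (s powr (real CARD('m) / 2 - 2) * exp (- (s * (dist \<xi> (X h))\<^sup>2)) * heat_prod_deriv K \<alpha> \<nu> \<xi> (X h) s) :: real"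
  \<comment> \<open>Here \<open>2 * M\<close> bounds the inner product, and the rate
    \<open>r\<^sup>2 / 8\<close> is half of the least squared distance
    \<open>(r / 2)\<^sup>2\<close>.\<close>
  let ?g = "\<lambda>s. 2 * (2 * M) * prod_bound * (indicator {0<..} s * (s powr (real CARD('m) / 2 - 1) * exp (- (s * (r\<^sup>2 / 8)))))
     + prod_bound * (indicator {0<..} s * (s powr (real CARD('m) / 2 - 1 - 1) * exp (- (s * (r\<^sup>2 / 8))))) :: real"
  have int: "integrable lborel (\<lambda>s. ?f s h)" if "\<bar>h\<bar> < e" for h
    using X[OF that] r half_dim_gt \<xi>
    by (intro heat_integral_bound(1)[where A = prod_bound] heat_prod_meas heat_prod_abs_le) auto
  have der: "((\<lambda>h. \<integral>s. ?f s h \<partial>lborel) has_real_derivative (\<integral>s. ?f' s 0 \<partial>lborel)) (at 0)"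
  proof (rule has_real_derivative_integral[OF e, where f = ?f and f' = ?f' and g = ?g])
    show "integrable lborel ?g"
      using half_dim_gt r by (intro Bochner_Integration.integrable_add integrable_mult_right integrable.intros[OF gamma_laplace]) auto
    fix h assume h: "\<bar>h\<bar> < e"
    show "integrable lborel (\<lambda>s. ?f s h)" by (rule int[OF h])
    fix s :: real
    show "((\<lambda>h. ?f s h) has_real_derivative ?f' s h) (at h)"
    proof (cases "0 < s")
      case True
      have Xo: "x + h *\<^sub>R \<nu> \<in> orthant K" using X(1)[OF h] near_orthant by (auto simp: X_def)
      have "(dist \<xi> (X h))\<^sup>2 = (x - \<xi>) \<bullet> (x - \<xi>) + 2 * h * ((x - \<xi>) \<bullet> \<nu>) + h * h * (\<nu> \<bullet> \<nu>)" for h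
        unfolding X_def dist_norm power2_norm_eq_inner
        by (simp add: inner_add_left inner_add_right inner_diff_left inner_diff_right inner_commute algebra_simps)
      moreover have "((\<lambda>h. (x - \<xi>) \<bullet> (x - \<xi>) + 2 * h * ((x - \<xi>) \<bullet> \<nu>) + h * h * (\<nu> \<bullet> \<nu>)) has_real_derivative 2 * ((x - \<xi>) \<bullet> \<nu>) + 2 * h * (\<nu> \<bullet> \<nu>)) (at h)"
        by (auto intro!: derivative_eq_intros)
      moreover have "2 * ((x - \<xi>) \<bullet> \<nu>) + 2 * h * (\<nu> \<bullet> \<nu>) = - 2 * ((\<xi> - X h) \<bullet> \<nu>)"
        by (simp add: X_def inner_add_left inner_diff_left algebra_simps)
      ultimately have dd: "((\<lambda>h. (dist \<xi> (X h))\<^sup>2) has_real_derivative - 2 * ((\<xi> - X h) \<bullet> \<nu>)) (at h)" by simp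
      have dE: "((\<lambda>h. exp (- (s * (dist \<xi> (X h))\<^sup>2))) has_real_derivative exp (- (s * (dist \<xi> (X h))\<^sup>2)) * (2 * s * ((\<xi> - X h) \<bullet> \<nu>))) (at h)"
        by (rule DERIV_cong[OF DERIV_fun_exp[OF DERIV_minus[OF DERIV_cmult[OF dd]]]]) simp
      have dP: "((\<lambda>h. heat_prod K \<alpha> \<xi> (X h) s) has_real_derivative heat_prod_deriv K \<alpha> \<nu> \<xi> (X h) s) (at h)"
        unfolding X_def using has_derivative_heat_prod[OF alpha \<xi>o Xo True] by simp
      have sp: "s powr (real CARD('m) / 2 - 2) * s = s powr (real CARD('m) / 2 - 1)"
        using True powr_add[of s "real CARD('m) / 2 - 2" 1] by simp
      have "((\<lambda>h. s powr (real CARD('m) / 2 - 2) * (exp (- (s * (dist \<xi> (X h))\<^sup>2)) * heat_prod K \<alpha> \<xi> (X h) s)) has_real_derivative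
         s powr (real CARD('m) / 2 - 2) * (exp (- (s * (dist \<xi> (X h))\<^sup>2)) * (2 * s * ((\<xi> - X h) \<bullet> \<nu>)) * heat_prod K \<alpha> \<xi> (X h) s
           + heat_prod_deriv K \<alpha> \<nu> \<xi> (X h) s * exp (- (s * (dist \<xi> (X h))\<^sup>2)))) (at h)"
        by (rule DERIV_cmult[OF DERIV_mult[OF dE dP]])
      then show ?thesis using True by (simp add: algebra_simps flip: sp)
    qed simp
    show "\<bar>?f' s h\<bar> \<le> ?g s"
    proof (cases "0 < s")
      case True
      define D where "D = (dist \<xi> (X h))\<^sup>2"
      have "(r / 2)\<^sup>2 \<le> D" unfolding D_def using X(2)[OF h] r by (intro power_mono) auto
      then have D: "r\<^sup>2 / 8 \<le> D / 2" by (simp add: power_divide)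
      have ex: "exp (- (s * D)) * (prod_bound * exp (s * D / 2)) \<le> prod_bound * exp (- (s * (r\<^sup>2 / 8)))"
      proof -
        have "exp (- (s * D)) * exp (s * D / 2) = exp (- (s * (D / 2)))" by (simp flip: exp_add)
        also have "\<dots> \<le> exp (- (s * (r\<^sup>2 / 8)))" using D True by simp
        finally have "prod_bound * (exp (- (s * D)) * exp (s * D / 2)) \<le> prod_bound * exp (- (s * (r\<^sup>2 / 8)))"
          by (intro mult_left_mono prod_bound_nonneg)
        then show ?thesis unfolding mult.left_commute[of "exp (- (s * D))"] .
      qed
      have P: "\<bar>exp (- (s * D)) * heat_prod K \<alpha> \<xi> (X h) s\<bar> \<le> prod_bound * exp (- (s * (r\<^sup>2 / 8)))"
        using heat_prod_abs_le[OF True \<xi> X(1)[OF h]] order_trans[OF mult_left_mono ex]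
        by (simp add: abs_mult D_def)
      have Q: "\<bar>exp (- (s * D)) * heat_prod_deriv K \<alpha> \<nu> \<xi> (X h) s\<bar> \<le> prod_bound * exp (- (s * (r\<^sup>2 / 8)))"
        using heat_prod_deriv_le[OF \<nu> True \<xi> X(1)[OF h]] order_trans[OF mult_left_mono ex]
        by (simp add: abs_mult D_def)
      have ip: "\<bar>(\<xi> - X h) \<bullet> \<nu>\<bar> \<le> 2 * M"
        using Cauchy_Schwarz_ineq2[of "\<xi> - X h" \<nu>] X(3)[OF h] \<nu> by (simp add: dist_norm)
      have "?f' s h = 2 * ((\<xi> - X h) \<bullet> \<nu>) * (s powr (real CARD('m) / 2 - 1) * (exp (- (s * D)) * heat_prod K \<alpha> \<xi> (X h) s))
          + s powr (real CARD('m) / 2 - 2) * (exp (- (s * D)) * heat_prod_deriv K \<alpha> \<nu> \<xi> (X h) s)"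
        using True by (simp add: D_def mult.assoc)
      also have "\<bar>\<dots>\<bar> \<le> \<bar>2 * ((\<xi> - X h) \<bullet> \<nu>) * (s powr (real CARD('m) / 2 - 1) * (exp (- (s * D)) * heat_prod K \<alpha> \<xi> (X h) s))\<bar>
          + \<bar>s powr (real CARD('m) / 2 - 2) * (exp (- (s * D)) * heat_prod_deriv K \<alpha> \<nu> \<xi> (X h) s)\<bar>" by (rule abs_triangle_ineq)
      also have "\<dots> = 2 * \<bar>(\<xi> - X h) \<bullet> \<nu>\<bar> * (s powr (real CARD('m) / 2 - 1) * \<bar>exp (- (s * D)) * heat_prod K \<alpha> \<xi> (X h) s\<bar>)
          + s powr (real CARD('m) / 2 - 2) * \<bar>exp (- (s * D)) * heat_prod_deriv K \<alpha> \<nu> \<xi> (X h) s\<bar>" by (simp add: abs_mult)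
      also have "\<dots> \<le> 2 * (2 * M) * (s powr (real CARD('m) / 2 - 1) * (prod_bound * exp (- (s * (r\<^sup>2 / 8)))))
          + s powr (real CARD('m) / 2 - 2) * (prod_bound * exp (- (s * (r\<^sup>2 / 8))))"
        using P Q ip M_pos by (intro add_mono mult_mono) auto
      also have "\<dots> = ?g s" using True by (simp add: mult_ac)
      finally show ?thesis .
    qed simp
  qed
  have X0: "X 0 = x" by (simp add: X_def)
  have I1: "integrable lborel (\<lambda>s. indicator {0<..} s * (s powr (real CARD('m) / 2 - 1) * exp (- (s * (dist \<xi> (X 0))\<^sup>2)) * heat_prod K \<alpha> \<xi> (X 0) s))"
    using X[of 0] e r half_dim_gt \<xi>
    by (intro heat_integral_bound(1)[where A = prod_bound] heat_prod_meas heat_prod_abs_le) auto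
  have I2: "integrable lborel (\<lambda>s. indicator {0<..} s * (s powr (real CARD('m) / 2 - 2) * exp (- (s * (dist \<xi> (X 0))\<^sup>2)) * heat_prod_deriv K \<alpha> \<nu> \<xi> (X 0) s))"
    using X[of 0] e r half_dim_gt \<xi> \<nu>
    by (intro heat_integral_bound(1)[where A = prod_bound] heat_prod_deriv_meas heat_prod_deriv_le) auto
  have "(\<integral>s. ?f' s 0 \<partial>lborel) = 2 * ((\<xi> - x) \<bullet> \<nu>) * heat_integral (real CARD('m) / 2 - 1) (heat_prod K \<alpha> \<xi> x) ((dist \<xi> x)\<^sup>2) +
     heat_integral (real CARD('m) / 2 - 2) (heat_prod_deriv K \<alpha> \<nu> \<xi> x) ((dist \<xi> x)\<^sup>2)"
    unfolding heat_integral_def using I1 I2 unfolding X0 by simp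
  then have "((\<lambda>h. kernel_const K \<alpha> * (\<integral>s. ?f s h \<partial>lborel)) has_real_derivative kernel_grad \<nu> \<xi> x) (at 0)"
    unfolding kernel_grad_def using DERIV_cmult[OF der, of "kernel_const K \<alpha>"] by simp
  moreover have "\<forall>\<^sub>F h in nhds 0. kernel_const K \<alpha> * (\<integral>s. ?f s h \<partial>lborel) = q_n K \<alpha> \<xi> (x + h *\<^sub>R \<nu>)"
  proof -
    have "\<forall>\<^sub>F h in nhds 0. dist h (0::real) < e" unfolding eventually_nhds_metric using e by blast
    then show ?thesis
    proof eventually_elim
      case (elim h)
      then have h: "\<bar>h\<bar> < e" by simp
      have "X h \<in> orthant K" using X(1)[OF h] near_orthant by blast
      moreover have "\<xi> \<noteq> X h" using X(2)[OF h] r by auto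
      ultimately show ?case using q_n_heat[OF \<xi>o] by (simp add: X_def)
    qed
  qed
  ultimately show ?thesis
    by (simp only: DERIV_cong_ev[OF refl _ refl])
qed

abbreviation kernel_main :: "real^'m \<Rightarrow> real^'m \<Rightarrow> real" where
  "kernel_main \<xi> x \<equiv> heat_integral (real CARD('m) / 2 - 1) (heat_prod K \<alpha> \<xi> x) ((dist \<xi> x)\<^sup>2)"

abbreviation kernel_rest :: "real^'m \<Rightarrow> real^'m \<Rightarrow> real^'m \<Rightarrow> real" where
  "kernel_rest \<nu> \<xi> x \<equiv> heat_integral (real CARD('m) / 2 - 2) (heat_prod_deriv K \<alpha> \<nu> \<xi> x) ((dist \<xi> x)\<^sup>2)"

text \<open>A heat integral of index \<open>p\<close> is of order \<open>R powr (- p - 1)\<close>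
  with \<open>R = r\<^sup>2\<close>. The second part is thus two powers of \<open>r\<close> milder
  than the first and, by itself, integrable over a surface of dimension m - 1.\<close>

lemma kernel_parts_bound:
  "\<exists>B\<ge>0. \<forall>\<nu> \<xi> x. norm \<nu> = 1 \<longrightarrow> \<xi> \<in> points \<longrightarrow> x \<in> near \<longrightarrow> \<xi> \<noteq> x \<longrightarrow>
     \<bar>kernel_main \<xi> x\<bar> \<le> B * dist \<xi> x powr (- real CARD('m)) \<and>
     \<bar>kernel_rest \<nu> \<xi> x\<bar> \<le> B * dist \<xi> x powr (2 - real CARD('m))"
proof -
  let ?m = "real CARD('m)"
  have pw: "1 / (r\<^sup>2 / 2) powr p = 2 powr p * r powr (- (2 * p))" if "0 < r" for r p :: real
  proof -
    have "(r\<^sup>2 / 2) powr p = (r powr 2) powr p / 2 powr p" using that by (simp add: powr_divide)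
    also have "(r powr 2) powr p = r powr (2 * p)" by (rule powr_powr)
    finally show ?thesis by (simp only: powr_minus) (simp add: field_simps)
  qed
  define B1 where "B1 = prod_bound * Gamma (?m / 2) * 2 powr (?m / 2)"
  define B2 where "B2 = prod_bound * Gamma (?m / 2 - 1) * 2 powr (?m / 2 - 1)"
  have B: "0 \<le> B1" "0 \<le> B2"
    using half_dim_gt Gamma_real_pos[of "?m / 2"] Gamma_real_pos[of "?m / 2 - 1"] prod_bound_nonneg
    by (auto simp: B1_def B2_def less_imp_le)
  show ?thesis
  proof (intro exI[of _ "B1 + B2"] conjI allI impI)
    show "0 \<le> B1 + B2" using B by simp
    fix \<nu> \<xi> x :: "real^'m"
    assume \<nu>: "norm \<nu> = 1" and \<xi>: "\<xi> \<in> points" and x: "x \<in> near" and ne: "\<xi> \<noteq> x"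
    define r where "r = dist \<xi> x"
    have r: "0 < r" using ne by (simp add: r_def)
    have "\<bar>kernel_main \<xi> x\<bar> \<le> prod_bound * (Gamma (?m / 2 - 1 + 1) / ((dist \<xi> x)\<^sup>2 / 2) powr (?m / 2 - 1 + 1))"
      using r half_dim_gt \<xi> x
      by (intro heat_integral_bound(2) heat_prod_meas heat_prod_abs_le) (auto simp: r_def)
    also have "\<dots> = prod_bound * Gamma (?m / 2) * (1 / (r\<^sup>2 / 2) powr (?m / 2))" by (simp add: r_def)
    also have "\<dots> = B1 * r powr (- ?m)" unfolding pw[OF r] by (simp add: B1_def)
    also have "\<dots> \<le> (B1 + B2) * r powr (- ?m)" using B by (intro mult_right_mono) auto
    finally show "\<bar>kernel_main \<xi> x\<bar> \<le> (B1 + B2) * dist \<xi> x powr (- ?m)" by (simp add: r_def)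
    have "\<bar>kernel_rest \<nu> \<xi> x\<bar> \<le> prod_bound * (Gamma (?m / 2 - 2 + 1) / ((dist \<xi> x)\<^sup>2 / 2) powr (?m / 2 - 2 + 1))"
      using r half_dim_gt \<xi> x \<nu>
      by (intro heat_integral_bound(2) heat_prod_deriv_meas heat_prod_deriv_le) (auto simp: r_def)
    also have "\<dots> = prod_bound * Gamma (?m / 2 - 1) * (1 / (r\<^sup>2 / 2) powr (?m / 2 - 1))" by (simp add: r_def)
    also have "\<dots> = B2 * r powr (2 - ?m)" unfolding pw[OF r] by (simp add: B2_def algebra_simps)
    also have "\<dots> \<le> (B1 + B2) * r powr (2 - ?m)" using B by (intro mult_right_mono) auto
    finally show "\<bar>kernel_rest \<nu> \<xi> x\<bar> \<le> (B1 + B2) * dist \<xi> x powr (2 - ?m)" by (simp add: r_def)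
  qed
qed

lemma eventually_near: "u \<longlonglongrightarrow> t \<Longrightarrow> eventually (\<lambda>n. u n \<in> near) sequentially"
  using open_near t_near by (rule topological_tendstoD[rotated 1])

lemma kernel_main_tendsto:
  assumes \<xi>: "\<xi> \<in> points" "\<xi> \<noteq> t" and u: "u \<longlonglongrightarrow> t"
  shows "(\<lambda>n. kernel_main \<xi> (u n)) \<longlonglongrightarrow> kernel_main \<xi> t"
proof (rule heat_integral_tendsto[OF _ _ _ heat_prod_meas heat_prod_meas _ prod_bound_nonneg])
  show "(\<lambda>n. (dist \<xi> (u n))\<^sup>2) \<longlonglongrightarrow> (dist \<xi> t)\<^sup>2" by (intro tendsto_intros u)
  show "\<forall>\<^sub>F n in sequentially. \<forall>s>0. \<bar>heat_prod K \<alpha> \<xi> (u n) s\<bar> \<le> prod_bound * exp (s * (dist \<xi> (u n))\<^sup>2 / 2)"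
    using eventually_near[OF u] by eventually_elim (use heat_prod_abs_le \<xi> in blast)
  fix s :: real assume s: "0 < s"
  show "(\<lambda>n. heat_prod K \<alpha> \<xi> (u n) s) \<longlonglongrightarrow> heat_prod K \<alpha> \<xi> t s"
    unfolding heat_prod_def
  proof (rule tendsto_prod)
    fix k assume k: "k \<in> K"
    have "0 < \<xi> $ k * t $ k" using points_component[OF \<xi>(1) k] t_ge[OF k] eps_pos by (intro mult_pos_pos) linarith+
    then show "(\<lambda>n. heat_factor (\<alpha> k) (\<xi> $ k * u n $ k) s) \<longlonglongrightarrow> heat_factor (\<alpha> k) (\<xi> $ k * t $ k) s"
      using alpha[OF k] s by (intro isCont_tendsto_compose[OF isCont_heat_factor] tendsto_intros u) auto
  qed
qed (use half_dim_gt \<xi> in auto)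

lemma kernel_rest_tendsto:
  assumes \<nu>: "norm \<nu> = 1" and \<xi>: "\<xi> \<in> points" "\<xi> \<noteq> t" and u: "u \<longlonglongrightarrow> t"
  shows "(\<lambda>n. kernel_rest \<nu> \<xi> (u n)) \<longlonglongrightarrow> kernel_rest \<nu> \<xi> t"
proof (rule heat_integral_tendsto[OF _ _ _ heat_prod_deriv_meas heat_prod_deriv_meas _ prod_bound_nonneg])
  show "(\<lambda>n. (dist \<xi> (u n))\<^sup>2) \<longlonglongrightarrow> (dist \<xi> t)\<^sup>2" by (intro tendsto_intros u)
  show "\<forall>\<^sub>F n in sequentially. \<forall>s>0. \<bar>heat_prod_deriv K \<alpha> \<nu> \<xi> (u n) s\<bar> \<le> prod_bound * exp (s * (dist \<xi> (u n))\<^sup>2 / 2)"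
    using eventually_near[OF u] by eventually_elim (use heat_prod_deriv_le \<xi> \<nu> in blast)
  fix s :: real assume s: "0 < s"
  have pos: "0 < \<xi> $ k * t $ k" "t $ k \<noteq> 0" if k: "k \<in> K" for k
  proof -
    have "0 < t $ k" using t_ge[OF k] eps_pos by linarith
    then show "0 < \<xi> $ k * t $ k" "t $ k \<noteq> 0" using points_component[OF \<xi>(1) k] by auto
  qed
  show "(\<lambda>n. heat_prod_deriv K \<alpha> \<nu> \<xi> (u n) s) \<longlonglongrightarrow> heat_prod_deriv K \<alpha> \<nu> \<xi> t s"
    unfolding heat_prod_deriv_def
    using alpha s pos
    by (intro tendsto_sum tendsto_mult tendsto_prod tendsto_divide tendsto_const tendsto_vec_nth u
        isCont_tendsto_compose[OF isCont_heat_factor] isCont_tendsto_compose[OF isCont_heat_factor_deriv]) auto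
qed (use half_dim_gt \<xi> in auto)

text \<open>After the substitution \<open>u = s * r\<^sup>2\<close> the power of \<open>r\<close> is
  gone and each heat factor is taken at \<open>s = u / r\<^sup>2\<close>, which tends to infinity.
  There it approaches its limit, and \<open>prod_bound\<close> provides the dominating function. The
  two points may tend to \<open>t\<close> in any way.\<close>

lemma kernel_main_diagonal:
  assumes \<xi>: "\<xi> \<longlonglongrightarrow> t" and x: "x \<longlonglongrightarrow> t" and ne: "\<And>n. \<xi> n \<noteq> x n"
  shows "(\<lambda>n. dist (\<xi> n) (x n) ^ CARD('m) * kernel_main (\<xi> n) (x n)) \<longlonglongrightarrow>
    Gamma (real CARD('m) / 2) * (\<Prod>k\<in>K. 4 powr (\<alpha> k - 1) * (t $ k * t $ k) powr (- \<alpha> k) * Gamma (1 - \<alpha> k))"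
proof -
  let ?p = "real CARD('m) / 2 - 1"
  define L where "L = (\<Prod>k\<in>K. 4 powr (\<alpha> k - 1) * (t $ k * t $ k) powr (- \<alpha> k) * Gamma (1 - \<alpha> k))"
  define R where "R n = (dist (\<xi> n) (x n))\<^sup>2" for n
  have R: "0 < R n" for n using ne by (simp add: R_def)
  have "(\<lambda>n. dist (\<xi> n) (x n)) \<longlonglongrightarrow> dist t t" by (intro tendsto_dist \<xi> x)
  then have R0: "R \<longlonglongrightarrow> 0" unfolding R_def using tendsto_power[of _ "0::real" _ 2] by fastforce
  obtain n0 where n0: "\<And>n. n0 \<le> n \<Longrightarrow> \<xi> n \<in> near \<and> x n \<in> near"
    using eventually_conj[OF eventually_near[OF \<xi>] eventually_near[OF x]] by (auto simp: eventually_sequentially)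
  let ?h = "\<lambda>n u. heat_prod K \<alpha> (\<xi> n) (x n) (u / R n)"
  have G: "has_bochner_integral lborel (\<lambda>u. indicator {0<..} u * (u powr (?p + 1 - 1) * exp (- (u * (1 / 2))))) (Gamma (?p + 1) / (1 / 2) powr (?p + 1))"
    using half_dim_gt by (intro gamma_laplace) auto
  have G1: "has_bochner_integral lborel (\<lambda>u. indicator {0<..} u * (u powr (?p + 1 - 1) * exp (- (u * 1)))) (Gamma (?p + 1) / 1 powr (?p + 1))"
    using half_dim_gt by (intro gamma_laplace) auto
  have "(\<lambda>n. \<integral>u. indicator {0<..} u * (u powr ?p * exp (- u) * ?h (n + n0) u) \<partial>lborel) \<longlonglongrightarrow>
      (\<integral>u. indicator {0<..} u * (u powr ?p * exp (- u) * L) \<partial>lborel)"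
  proof (rule integral_dominated_convergence[where w = "\<lambda>u. prod_bound * (indicator {0<..} u * (u powr (?p + 1 - 1) * exp (- (u * (1 / 2)))))"])
    show "integrable lborel (\<lambda>u. prod_bound * (indicator {0<..} u * (u powr (?p + 1 - 1) * exp (- (u * (1 / 2))))))"
      by (intro integrable_mult_right integrable.intros[OF G])
    show "AE u in lborel. (\<lambda>n. indicator {0<..} u * (u powr ?p * exp (- u) * ?h (n + n0) u)) \<longlonglongrightarrow> indicator {0<..} u * (u powr ?p * exp (- u) * L)"
    proof (intro AE_I2)
      fix u :: real
      show "(\<lambda>n. indicator {0<..} u * (u powr ?p * exp (- u) * ?h (n + n0) u)) \<longlonglongrightarrow> indicator {0<..} u * (u powr ?p * exp (- u) * L)"
      proof (cases "0 < u")
        case True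
        have "filterlim R (at_right 0) sequentially"
          using R0 R by (intro tendsto_imp_filterlim_at_right) auto
        then have "filterlim (\<lambda>n. inverse (R n)) at_top sequentially"
          by (rule filterlim_compose[OF filterlim_inverse_at_top_right])
        then have "filterlim (\<lambda>n. u * inverse (R n)) at_top sequentially"
          using True by (intro filterlim_tendsto_pos_mult_at_top[OF tendsto_const])
        then have s: "filterlim (\<lambda>n. u / R n) at_top sequentially" by (simp add: divide_inverse)
        have "(\<lambda>n. ?h n u) \<longlonglongrightarrow> L"
          unfolding heat_prod_def L_def
        proof (rule tendsto_prod)
          fix k assume k: "k \<in> K"
          have "0 < t $ k" using t_ge[OF k] eps_pos by linarith
          then show "(\<lambda>n. heat_factor (\<alpha> k) (\<xi> n $ k * x n $ k) (u / R n)) \<longlonglongrightarrow> 4 powr (\<alpha> k - 1) * (t $ k * t $ k) powr (- \<alpha> k) * Gamma (1 - \<alpha> k)"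
            using alpha[OF k] by (intro heat_factor_tendsto s tendsto_mult tendsto_vec_nth \<xi> x) auto
        qed
        then have "(\<lambda>n. ?h (n + n0) u) \<longlonglongrightarrow> L" by (rule LIMSEQ_ignore_initial_segment)
        then show ?thesis by (intro tendsto_intros)
      qed simp
    qed
    fix n
    show "AE u in lborel. norm (indicator {0<..} u * (u powr ?p * exp (- u) * ?h (n + n0) u)) \<le> prod_bound * (indicator {0<..} u * (u powr (?p + 1 - 1) * exp (- (u * (1 / 2)))))"
    proof (intro AE_I2)
      fix u :: real
      show "norm (indicator {0<..} u * (u powr ?p * exp (- u) * ?h (n + n0) u)) \<le> prod_bound * (indicator {0<..} u * (u powr (?p + 1 - 1) * exp (- (u * (1 / 2)))))"
      proof (cases "0 < u")
        case True
        have "\<bar>?h (n + n0) u\<bar> \<le> prod_bound * exp (u / R (n + n0) * (dist (\<xi> (n + n0)) (x (n + n0)))\<^sup>2 / 2)"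
          using n0[of "n + n0"] near_points True R[of "n + n0"] by (intro heat_prod_abs_le) auto
        also have "u / R (n + n0) * (dist (\<xi> (n + n0)) (x (n + n0)))\<^sup>2 = u"
          using R[of "n + n0"] by (simp add: R_def)
        finally have "u powr ?p * exp (- u) * \<bar>?h (n + n0) u\<bar> \<le> u powr ?p * exp (- u) * (prod_bound * exp (u / 2))"
          by (intro mult_left_mono) auto
        also have "\<dots> = prod_bound * (u powr ?p * (exp (- u) * exp (u / 2)))" by (simp add: mult_ac)
        also have "exp (- u) * exp (u / 2) = exp (- (u * (1 / 2)))" by (simp flip: exp_add)
        finally show ?thesis using True by (simp add: abs_mult)
      qed simp
    qed
  next
    show "(\<lambda>u. indicator {0<..} u * (u powr ?p * exp (- u) * ?h (n + n0) u)) \<in> borel_measurable lborel" for n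
      using measurable_compose[OF _ heat_prod_meas, of "\<lambda>u. u / R (n + n0)" lborel "\<xi> (n + n0)" "x (n + n0)"]
      by measurable
  qed measurable
  also have "(\<integral>u. indicator {0<..} u * (u powr ?p * exp (- u) * L) \<partial>lborel) = Gamma (real CARD('m) / 2) * L"
  proof -
    have "(\<integral>u. indicator {0<..} u * (u powr ?p * exp (- u) * L) \<partial>lborel) = (\<integral>u. L * (indicator {0<..} u * (u powr (?p + 1 - 1) * exp (- (u * 1)))) \<partial>lborel)"
      by (intro Bochner_Integration.integral_cong) (auto simp: mult_ac)
    also have "\<dots> = L * (Gamma (?p + 1) / 1 powr (?p + 1))"
      unfolding integral_mult_right_zero using has_bochner_integral_integral_eq[OF G1] by simp
    finally show ?thesis by (simp add: mult.commute)
  qed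
  finally have "(\<lambda>n. \<integral>u. indicator {0<..} u * (u powr ?p * exp (- u) * ?h n u) \<partial>lborel) \<longlonglongrightarrow> Gamma (real CARD('m) / 2) * L"
    by (rule LIMSEQ_offset)
  moreover have "(\<integral>u. indicator {0<..} u * (u powr ?p * exp (- u) * ?h n u) \<partial>lborel) = dist (\<xi> n) (x n) ^ CARD('m) * kernel_main (\<xi> n) (x n)" for n
  proof -
    define r where "r = dist (\<xi> n) (x n)"
    have r: "0 < r" using ne by (simp add: r_def)
    have "R n powr (?p + 1) = (r powr 2) powr (?p + 1)" using r by (simp add: R_def r_def)
    also have "\<dots> = r powr (real CARD('m))" unfolding powr_powr by simp
    also have "\<dots> = r ^ CARD('m)" using r by (rule powr_realpow)
    finally show ?thesis using heat_integral_rescale[OF R[of n], of ?p "heat_prod K \<alpha> (\<xi> n) (x n)"]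
      unfolding R_def r_def by simp
  qed
  ultimately show ?thesis unfolding L_def by simp
qed

text \<open>The Gamma functions of \<open>kappa_n\<close>, of the Euler prefactors and of the limits
  cancel, and the weight cancels the powers of \<open>x\<close>. What is left for each
  \<open>k\<close> is \<open>4 powr (\<alpha> k - 1)\<close>, and their product reduces the power of
  2 in \<open>kappa_n\<close> to 1/4.\<close>

lemma kernel_constant:
  assumes x: "x \<in> orthant K"
  shows "2 * kernel_const K \<alpha> * (\<Prod>k\<in>K. (x $ k) powr (2 * \<alpha> k)) *
     (Gamma (real CARD('m) / 2) * (\<Prod>k\<in>K. 4 powr (\<alpha> k - 1) * (x $ k * x $ k) powr (- \<alpha> k) * Gamma (1 - \<alpha> k))) =
    Gamma (real CARD('m) / 2) / (2 * pi powr (real CARD('m) / 2))"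
proof -
  let ?m = "real CARD('m)" and ?A = "alpha_bar K \<alpha>"
  have cancel: "Gamma (1 - \<alpha> k) / Gamma (2 - 2 * \<alpha> k) * (Gamma (2 - 2 * \<alpha> k) / (Gamma (1 - \<alpha> k) * Gamma (1 - \<alpha> k))) *
      (x $ k) powr (2 * \<alpha> k) * (4 powr (\<alpha> k - 1) * (x $ k * x $ k) powr (- \<alpha> k) * Gamma (1 - \<alpha> k)) = 4 powr (\<alpha> k - 1)"
    if k: "k \<in> K" for k
  proof -
    have g: "0 < Gamma (1 - \<alpha> k)" "0 < Gamma (2 - 2 * \<alpha> k)" using alpha[OF k] by (auto intro!: Gamma_real_pos)
    have xk: "0 < x $ k" using x k by (auto simp: orthant_def)
    have "(x $ k) powr (2 * \<alpha> k) * (x $ k * x $ k) powr (- \<alpha> k) = 1"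
      using xk by (simp add: powr_mult flip: powr_add)
    then show ?thesis using g by (simp add: field_simps)
  qed
  have "(\<Prod>k\<in>K. Gamma (1 - \<alpha> k) / Gamma (2 - 2 * \<alpha> k)) * (\<Prod>k\<in>K. Gamma (2 - 2 * \<alpha> k) / (Gamma (1 - \<alpha> k) * Gamma (1 - \<alpha> k))) *
      (\<Prod>k\<in>K. (x $ k) powr (2 * \<alpha> k)) * (\<Prod>k\<in>K. 4 powr (\<alpha> k - 1) * (x $ k * x $ k) powr (- \<alpha> k) * Gamma (1 - \<alpha> k))
      = (\<Prod>k\<in>K. 4 powr (\<alpha> k - 1))"
    unfolding prod.distrib[symmetric] by (rule prod.cong) (use cancel in auto)
  also have "\<dots> = 4 powr (\<Sum>k\<in>K. \<alpha> k - 1)" by (rule powr_sum[symmetric]) simp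
  also have "\<dots> = (2 powr 2) powr (\<Sum>k\<in>K. \<alpha> k - 1)" by simp
  also have "\<dots> = 2 powr (2 * (\<Sum>k\<in>K. \<alpha> k - 1))" by (rule powr_powr)
  finally have P: "(\<Prod>k\<in>K. Gamma (1 - \<alpha> k) / Gamma (2 - 2 * \<alpha> k)) * (\<Prod>k\<in>K. Gamma (2 - 2 * \<alpha> k) / (Gamma (1 - \<alpha> k) * Gamma (1 - \<alpha> k))) *
      (\<Prod>k\<in>K. (x $ k) powr (2 * \<alpha> k)) * (\<Prod>k\<in>K. 4 powr (\<alpha> k - 1) * (x $ k * x $ k) powr (- \<alpha> k) * Gamma (1 - \<alpha> k))
      = 2 powr (2 * (\<Sum>k\<in>K. \<alpha> k - 1))" .
  have e: "(2 * ?A - ?m) + 2 * (\<Sum>k\<in>K. \<alpha> k - 1) = - 2"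
    by (simp add: alpha_bar_def sum_subtractf field_simps)
  have "2 powr (2 * ?A - ?m) * 2 powr (2 * (\<Sum>k\<in>K. \<alpha> k - 1)) = 2 powr (- 2 :: real)"
    unfolding powr_add[symmetric] e ..
  then have two: "2 powr (2 * ?A - ?m) * 2 powr (2 * (\<Sum>k\<in>K. \<alpha> k - 1)) = 1 / 4"
    by (simp add: powr_minus_divide)
  have GA: "0 < Gamma ?A" by (rule Gamma_real_pos[OF alpha_bar_pos])
  have "2 * kernel_const K \<alpha> * (\<Prod>k\<in>K. (x $ k) powr (2 * \<alpha> k)) *
     (Gamma (?m / 2) * (\<Prod>k\<in>K. 4 powr (\<alpha> k - 1) * (x $ k * x $ k) powr (- \<alpha> k) * Gamma (1 - \<alpha> k))) =
     2 * Gamma (?m / 2) / pi powr (?m / 2) * (2 powr (2 * ?A - ?m) *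
     ((\<Prod>k\<in>K. Gamma (1 - \<alpha> k) / Gamma (2 - 2 * \<alpha> k)) * (\<Prod>k\<in>K. Gamma (2 - 2 * \<alpha> k) / (Gamma (1 - \<alpha> k) * Gamma (1 - \<alpha> k))) *
      (\<Prod>k\<in>K. (x $ k) powr (2 * \<alpha> k)) * (\<Prod>k\<in>K. 4 powr (\<alpha> k - 1) * (x $ k * x $ k) powr (- \<alpha> k) * Gamma (1 - \<alpha> k))))
     * (Gamma ?A / Gamma ?A)"
    unfolding kernel_const_def kappa_n_def by (simp only: times_divide_eq_left times_divide_eq_right divide_divide_eq_left mult_ac)
  also have "\<dots> = Gamma (?m / 2) / (2 * pi powr (?m / 2))"
    unfolding P two using GA by simp
  finally show ?thesis .
qed

end

section \<open>Integrals over measures with a density at a point\<close>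

text \<open>Tonelli for the region \<open>Q \<xi> < q\<close>: the integral of a function of
  \<open>Q\<close> that is a tail integral depends on \<open>\<mu>\<close> only through the measures
  of the sublevel sets.\<close>

lemma layer_cake:
  fixes Q :: "'a \<Rightarrow> real" and \<psi> :: "real \<Rightarrow> ennreal"
  assumes "sigma_finite_measure \<mu>" and [measurable]: "Q \<in> borel_measurable \<mu>" "\<psi> \<in> borel_measurable borel"
  shows "(\<integral>\<^sup>+\<xi>. (\<integral>\<^sup>+q. \<psi> q * indicator {Q \<xi><..} q \<partial>lborel) \<partial>\<mu>) =
    (\<integral>\<^sup>+q. \<psi> q * emeasure \<mu> {\<xi>\<in>space \<mu>. Q \<xi> < q} \<partial>lborel)"
proof -
  interpret pair_sigma_finite \<mu> lborel
    unfolding pair_sigma_finite_def using assms(1) sigma_finite_lborel by simp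
  have "(\<integral>\<^sup>+\<xi>. (\<integral>\<^sup>+q. \<psi> q * indicator {Q \<xi><..} q \<partial>lborel) \<partial>\<mu>) =
      (\<integral>\<^sup>+\<xi>. (\<integral>\<^sup>+q. \<psi> q * indicator {\<xi>\<in>space \<mu>. Q \<xi> < q} \<xi> \<partial>lborel) \<partial>\<mu>)"
    by (intro nn_integral_cong) (auto split: split_indicator)
  also have "\<dots> = (\<integral>\<^sup>+q. (\<integral>\<^sup>+\<xi>. \<psi> q * indicator {\<xi>\<in>space \<mu>. Q \<xi> < q} \<xi> \<partial>\<mu>) \<partial>lborel)"
  proof (rule Fubini'[symmetric])
    have "(\<lambda>z. \<psi> (snd z) * indicator {z \<in> space (\<mu> \<Otimes>\<^sub>M lborel). Q (fst z) < snd z} z) \<in> borel_measurable (\<mu> \<Otimes>\<^sub>M lborel)"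
      by measurable
    also have "?this \<longleftrightarrow> (\<lambda>(\<xi>, q). \<psi> q * indicator {\<xi>\<in>space \<mu>. Q \<xi> < q} \<xi>) \<in> borel_measurable (\<mu> \<Otimes>\<^sub>M lborel)"
      by (intro measurable_cong) (auto simp: space_pair_measure split: split_indicator)
    finally show "(\<lambda>(\<xi>, q). \<psi> q * indicator {\<xi>\<in>space \<mu>. Q \<xi> < q} \<xi>) \<in> borel_measurable (\<mu> \<Otimes>\<^sub>M lborel)" .
  qed
  also have "\<dots> = (\<integral>\<^sup>+q. \<psi> q * emeasure \<mu> {\<xi>\<in>space \<mu>. Q \<xi> < q} \<partial>lborel)"
    by (intro nn_integral_cong nn_integral_cmult_indicator) measurable
  finally show ?thesis .
qed

text \<open>Writes a negative power as a tail integral, the form that \<open>layer_cake\<close>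
  expects.\<close>

lemma nn_integral_powr_tail:
  fixes p b c :: real
  assumes p: "0 < p" and b: "0 < b + c"
  shows "(\<integral>\<^sup>+q. ennreal (p * (q + c) powr (- p - 1)) * indicator {b<..} q \<partial>lborel) = ennreal ((b + c) powr (- p))"
proof -
  have "(\<integral>\<^sup>+q. ennreal (p * (q + c) powr (- p - 1)) * indicator {b<..} q \<partial>lborel) =
      (\<integral>\<^sup>+q. ennreal (p * (q + c) powr (- p - 1)) * indicator {b..} q \<partial>lborel)"
  proof (rule nn_integral_cong_AE)
    show "AE q in lborel. ennreal (p * (q + c) powr (- p - 1)) * indicator {b<..} q = ennreal (p * (q + c) powr (- p - 1)) * indicator {b..} q"
      using AE_lborel_singleton[of b] by eventually_elim (auto split: split_indicator)
  qed
  also have "\<dots> = ennreal (0 - (- ((b + c) powr (- p))))"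
  proof (rule nn_integral_FTC_atLeast[where F = "\<lambda>q. - ((q + c) powr (- p))"])
    fix q assume "b \<le> q"
    then have "0 < q + c" using b by simp
    then show "DERIV (\<lambda>q. - ((q + c) powr (- p))) q :> p * (q + c) powr (- p - 1)"
      by (auto intro!: DERIV_cong[OF DERIV_minus[OF DERIV_chain2[OF has_real_derivative_powr]]] derivative_eq_intros)
  next
    have "filterlim (\<lambda>q. c + q) at_top at_top" by (rule filterlim_tendsto_add_at_top[OF tendsto_const filterlim_ident])
    then have "((\<lambda>q. (c + q) powr (- p)) \<longlongrightarrow> 0) at_top" using p by (intro tendsto_neg_powr) auto
    then show "((\<lambda>q. - ((q + c) powr (- p))) \<longlongrightarrow> 0) at_top"
      using tendsto_minus[of _ 0] by (simp add: add.commute)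
  qed (use p in auto)
  finally show ?thesis by simp
qed

text \<open>The beta integral of the second kind, by writing \<open>(1 + v) powr (- (a + b))\<close>
  as a Gamma integral and exchanging the order.\<close>

lemma integral_beta_half_line:
  fixes a b :: real
  assumes a: "0 < a" and b: "0 < b"
  shows "has_bochner_integral lborel (\<lambda>v. indicator {0<..} v * (v powr (a - 1) * (1 + v) powr (- (a + b)))) (Gamma a * Gamma b / Gamma (a + b))"
proof -
  have G: "0 < Gamma (a + b)" "0 < Gamma a" "0 < Gamma b" using a b by (auto intro!: Gamma_real_pos)
  let ?g = "\<lambda>v s. indicator {0<..} v * v powr (a - 1) * (indicator {0<..} s * (s powr (a + b - 1) * exp (- (s * (1 + v))))) / Gamma (a + b) :: real"
  have gl: "(\<integral>\<^sup>+s. ennreal (indicator {0<..} s * (s powr (p - 1) * exp (- (s * c)))) \<partial>lborel) = ennreal (Gamma p / c powr p)"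
    if "0 < p" "0 < c" for p c :: real
    using gamma_laplace[OF that] by (subst nn_integral_eq_integral) (auto simp: has_bochner_integral_iff)
  have "(\<integral>\<^sup>+v. ennreal (indicator {0<..} v * (v powr (a - 1) * (1 + v) powr (- (a + b)))) \<partial>lborel) =
      (\<integral>\<^sup>+v. (\<integral>\<^sup>+s. ennreal (?g v s) \<partial>lborel) \<partial>lborel)"
  proof (rule nn_integral_cong)
    fix v :: real
    show "ennreal (indicator {0<..} v * (v powr (a - 1) * (1 + v) powr (- (a + b)))) = (\<integral>\<^sup>+s. ennreal (?g v s) \<partial>lborel)"
    proof (cases "0 < v")
      case True
      have "(\<integral>\<^sup>+s. ennreal (?g v s) \<partial>lborel) = (\<integral>\<^sup>+s. ennreal (v powr (a - 1) / Gamma (a + b)) * ennreal (indicator {0<..} s * (s powr (a + b - 1) * exp (- (s * (1 + v))))) \<partial>lborel)"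
        using True G by (intro nn_integral_cong) (simp flip: ennreal_mult)
      also have "\<dots> = ennreal (v powr (a - 1) / Gamma (a + b)) * ennreal (Gamma (a + b) / (1 + v) powr (a + b))"
        using a b True by (subst nn_integral_cmult) (auto simp: gl)
      also have "\<dots> = ennreal (v powr (a - 1) * (1 + v) powr (- (a + b)))"
        using G True unfolding powr_minus_divide by (simp flip: ennreal_mult)
      finally show ?thesis using True by simp
    qed simp
  qed
  also have "\<dots> = (\<integral>\<^sup>+s. (\<integral>\<^sup>+v. ennreal (?g v s) \<partial>lborel) \<partial>lborel)"
    by (rule lborel_pair.Fubini'[symmetric]) measurable
  also have "\<dots> = (\<integral>\<^sup>+s. ennreal (Gamma a / Gamma (a + b)) * ennreal (indicator {0<..} s * (s powr (b - 1) * exp (- (s * 1)))) \<partial>lborel)"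
  proof (rule nn_integral_cong)
    fix s :: real
    show "(\<integral>\<^sup>+v. ennreal (?g v s) \<partial>lborel) = ennreal (Gamma a / Gamma (a + b)) * ennreal (indicator {0<..} s * (s powr (b - 1) * exp (- (s * 1))))"
    proof (cases "0 < s")
      case True
      have gv: "?g v s = (s powr (a + b - 1) * exp (- s) / Gamma (a + b)) * (indicator {0<..} v * (v powr (a - 1) * exp (- (v * s))))" for v
      proof -
        have e: "exp (- (s * (1 + v))) = exp (- s) * exp (- (v * s))"
          by (simp add: distrib_left mult.commute flip: exp_add)
        show ?thesis unfolding e using True by (simp add: mult_ac)
      qed
      have "(\<integral>\<^sup>+v. ennreal (?g v s) \<partial>lborel) = (\<integral>\<^sup>+v. ennreal (s powr (a + b - 1) * exp (- s) / Gamma (a + b)) * ennreal (indicator {0<..} v * (v powr (a - 1) * exp (- (v * s)))) \<partial>lborel)"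
        unfolding gv using G by (intro nn_integral_cong ennreal_mult) auto
      also have "\<dots> = ennreal (s powr (a + b - 1) * exp (- s) / Gamma (a + b)) * ennreal (Gamma a / s powr a)"
        using a True by (subst nn_integral_cmult) (auto simp: gl)
      also have "\<dots> = ennreal (s powr (a + b - 1) * exp (- s) / Gamma (a + b) * (Gamma a / s powr a))"
        using G by (simp flip: ennreal_mult)
      also have "s powr (a + b - 1) * exp (- s) / Gamma (a + b) * (Gamma a / s powr a) = Gamma a / Gamma (a + b) * (s powr (b - 1) * exp (- s))"
        using True powr_add[of s a "b - 1"] by (simp add: add_diff_eq)
      finally show ?thesis using True G by (simp flip: ennreal_mult)
    qed simp
  qed
  also have "\<dots> = ennreal (Gamma a / Gamma (a + b)) * ennreal (Gamma b / 1 powr b)"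
    using b by (subst nn_integral_cmult) (auto simp: gl simp del: mult_1_right)
  also have "\<dots> = ennreal (Gamma a * Gamma b / Gamma (a + b))" using G by (simp flip: ennreal_mult)
  finally show ?thesis
    using G by (intro has_bochner_integral_nn_integral) (auto intro!: AE_I2)
qed

text \<open>In the application \<open>Q\<close> is the squared distance to the point of density.\<close>
locale density_at_point = finite_measure \<mu> for \<mu> :: "'a measure" +
  fixes Q :: "'a \<Rightarrow> real" and k :: nat and V :: real
  assumes k_pos: "0 < k" and Q_meas [measurable]: "Q \<in> borel_measurable \<mu>" and Q_nonneg: "\<xi> \<in> space \<mu> \<Longrightarrow> 0 \<le> Q \<xi>"
    and V_nonneg: "0 \<le> V"
    and density: "((\<lambda>r. measure \<mu> {\<xi>\<in>space \<mu>. Q \<xi> < r\<^sup>2} / r ^ k) \<longlongrightarrow> V) (at_right 0)"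
begin

definition vol :: "real \<Rightarrow> real" where "vol q = measure \<mu> {\<xi>\<in>space \<mu>. Q \<xi> < q}"

lemma vol_nonneg: "0 \<le> vol q" by (simp add: vol_def)

lemma emeasure_vol: "emeasure \<mu> {\<xi>\<in>space \<mu>. Q \<xi> < q} = ennreal (vol q)"
  by (simp add: vol_def emeasure_eq_measure)

lemma vol_mono: "mono vol"
  unfolding vol_def by (intro monoI finite_measure_mono) auto

lemma vol_measurable [measurable]: "vol \<in> borel_measurable borel"
  by (rule borel_measurable_mono[OF vol_mono])

lemma vol_nonpos: "q \<le> 0 \<Longrightarrow> vol q = 0"
proof -
  assume "q \<le> 0"
  then have "{\<xi>\<in>space \<mu>. Q \<xi> < q} = {}" using Q_nonneg by force
  then show "vol q = 0" unfolding vol_def by (simp only: measure_empty)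
qed

lemma vol_density: "((\<lambda>q. vol q / q powr (real k / 2)) \<longlongrightarrow> V) (at_right 0)"
proof -
  have "((\<lambda>q. sqrt q) \<longlongrightarrow> 0) (at_right 0)" by (auto intro!: tendsto_eq_intros)
  then have "filterlim (\<lambda>q. sqrt q) (at_right 0) (at_right 0)"
    by (rule tendsto_imp_filterlim_at_right) (auto simp: eventually_at_filter)
  from filterlim_compose[OF density this]
  have "((\<lambda>q. measure \<mu> {\<xi>\<in>space \<mu>. Q \<xi> < (sqrt q)\<^sup>2} / sqrt q ^ k) \<longlongrightarrow> V) (at_right 0)" .
  moreover have "\<forall>\<^sub>F q in at_right 0. measure \<mu> {\<xi>\<in>space \<mu>. Q \<xi> < (sqrt q)\<^sup>2} / sqrt q ^ k = vol q / q powr (real k / 2)"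
    unfolding eventually_at_filter
  proof (intro always_eventually allI impI)
    fix q :: real assume "q \<noteq> 0" "q \<in> {0<..}"
    then have q: "0 < q" by simp
    have "sqrt q ^ k = (q powr (1/2)) powr real k" using q by (simp add: powr_half_sqrt powr_realpow)
    also have "\<dots> = q powr (real k / 2)" unfolding powr_powr by simp
    finally show "measure \<mu> {\<xi>\<in>space \<mu>. Q \<xi> < (sqrt q)\<^sup>2} / sqrt q ^ k = vol q / q powr (real k / 2)"
      using q by (simp add: vol_def)
  qed
  ultimately show ?thesis by (rule Lim_transform_eventually)
qed

text \<open>The density limit gives the bound for small \<open>q\<close>; for large \<open>q\<close>
  the total mass is finite.\<close>

lemma vol_le: "\<exists>C\<ge>0. \<forall>q>0. vol q \<le> C * q powr (real k / 2)"
proof -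
  have "\<forall>\<^sub>F q in at_right 0. vol q / q powr (real k / 2) < V + 1"
    by (rule order_tendstoD(2)[OF vol_density]) simp
  then obtain d where d: "0 < d" "\<And>q. 0 < q \<Longrightarrow> q < d \<Longrightarrow> vol q / q powr (real k / 2) < V + 1"
    by (auto simp: eventually_at_right_field)
  define C where "C = (V + 1) + measure \<mu> (space \<mu>) / d powr (real k / 2)"
  show ?thesis
  proof (intro exI[of _ C] conjI allI impI)
    show "0 \<le> C" using V_nonneg by (simp add: C_def)
    fix q :: real assume q: "0 < q"
    show "vol q \<le> C * q powr (real k / 2)"
    proof (cases "q < d")
      case True
      have "vol q \<le> (V + 1) * q powr (real k / 2)" using d(2)[OF q True] q by (simp add: field_simps)
      also have "\<dots> \<le> C * q powr (real k / 2)" by (intro mult_right_mono) (auto simp: C_def)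
      finally show ?thesis .
    next
      case False
      have "vol q \<le> measure \<mu> (space \<mu>)" unfolding vol_def by (rule finite_measure_mono) auto
      also have "\<dots> = measure \<mu> (space \<mu>) / d powr (real k / 2) * d powr (real k / 2)" using d by simp
      also have "\<dots> \<le> C * q powr (real k / 2)"
        using False d V_nonneg by (intro mult_mono powr_mono2) (auto simp: C_def)
      finally show ?thesis .
    qed
  qed
qed

text \<open>By the layer-cake formula the integral is that of
  \<open>q powr (- p - 1) * vol q\<close>, up to a factor. It converges at 0 since
  \<open>vol q\<close> is of order \<open>q powr (k / 2)\<close>, and at infinity since
  \<open>vol\<close> is bounded.\<close>

lemma integrable_powr:
  assumes p: "0 < p" "p < real k / 2"
  shows "integrable \<mu> (\<lambda>\<xi>. Q \<xi> powr (- p))"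
proof -
  obtain C where C: "0 \<le> C" "\<And>q. 0 < q \<Longrightarrow> vol q \<le> C * q powr (real k / 2)" using vol_le by blast
  let ?\<psi> = "\<lambda>q. ennreal (p * (q + 0) powr (- p - 1)) * indicator {0<..} q"
  have "(\<integral>\<^sup>+\<xi>. ennreal (Q \<xi> powr (- p)) \<partial>\<mu>) \<le> (\<integral>\<^sup>+\<xi>. (\<integral>\<^sup>+q. ?\<psi> q * indicator {Q \<xi><..} q \<partial>lborel) \<partial>\<mu>)"
  proof (rule nn_integral_mono)
    fix \<xi> assume \<xi>: "\<xi> \<in> space \<mu>"
    show "ennreal (Q \<xi> powr (- p)) \<le> (\<integral>\<^sup>+q. ?\<psi> q * indicator {Q \<xi><..} q \<partial>lborel)"
    \<comment> \<open>Here the left side is 0, by \<open>0 powr x = 0\<close>, while the tail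
      integral diverges; hence an inequality instead of an equation.\<close>
    proof (cases "Q \<xi> = 0")
      case False
      then have Q: "0 < Q \<xi>" using Q_nonneg[OF \<xi>] by simp
      have "ennreal (Q \<xi> powr (- p)) = (\<integral>\<^sup>+q. ennreal (p * (q + 0) powr (- p - 1)) * indicator {Q \<xi><..} q \<partial>lborel)"
        using nn_integral_powr_tail[of p "Q \<xi>" 0] p Q by simp
      also have "\<dots> = (\<integral>\<^sup>+q. ?\<psi> q * indicator {Q \<xi><..} q \<partial>lborel)"
        using Q by (intro nn_integral_cong) (auto split: split_indicator)
      finally show ?thesis by simp
    qed simp
  qed
  also have "\<dots> = (\<integral>\<^sup>+q. ?\<psi> q * ennreal (vol q) \<partial>lborel)"
    by (subst layer_cake) (auto simp: emeasure_vol sigma_finite_measure_axioms)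
  \<comment> \<open>For \<open>q \<le> 1\<close> the bound \<open>1 \<le> exp 1 * exp (- q)\<close>
    turns the power into a Gamma integrand; the second term covers \<open>q > 1\<close>.\<close>
  also have "\<dots> \<le> (\<integral>\<^sup>+q. ennreal (p * C * exp 1) * ennreal (indicator {0<..} q * (q powr ((real k / 2 - p) - 1) * exp (- (q * 1)))) +
       ennreal (measure \<mu> (space \<mu>)) * (ennreal (p * (q + 0) powr (- p - 1)) * indicator {1<..} q) \<partial>lborel)"
  proof (rule nn_integral_mono)
    fix q :: real
    show "?\<psi> q * ennreal (vol q) \<le> ennreal (p * C * exp 1) * ennreal (indicator {0<..} q * (q powr ((real k / 2 - p) - 1) * exp (- (q * 1)))) +
       ennreal (measure \<mu> (space \<mu>)) * (ennreal (p * (q + 0) powr (- p - 1)) * indicator {1<..} q)"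
    proof (cases "0 < q")
      case True
      show ?thesis
      proof (cases "q \<le> 1")
        case le: True
        have "p * q powr (- p - 1) * vol q \<le> p * q powr (- p - 1) * (C * q powr (real k / 2))"
          using C True p by (intro mult_left_mono) auto
        also have "\<dots> = p * C * (q powr (- p - 1) * q powr (real k / 2))" by simp
        also have "q powr (- p - 1) * q powr (real k / 2) = q powr ((real k / 2 - p) - 1)"
          unfolding powr_add[symmetric] by (simp add: algebra_simps)
        also have "p * C * q powr ((real k / 2 - p) - 1) \<le> p * C * exp 1 * (q powr ((real k / 2 - p) - 1) * exp (- q))"
        proof -
          have "1 \<le> exp 1 * exp (- q)" using le by (simp flip: exp_add)
          then have "p * C * q powr ((real k / 2 - p) - 1) * 1 \<le> p * C * q powr ((real k / 2 - p) - 1) * (exp 1 * exp (- q))"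
            using p C by (intro mult_left_mono) auto
          then show ?thesis by (simp add: mult_ac)
        qed
        finally show ?thesis using True le p C vol_nonneg[of q]
          by (auto simp flip: ennreal_mult intro!: order_trans[OF ennreal_leI])
      next
        case False
        have "vol q \<le> measure \<mu> (space \<mu>)" unfolding vol_def by (rule finite_measure_mono) auto
        then have "?\<psi> q * ennreal (vol q) \<le> ennreal (measure \<mu> (space \<mu>)) * (ennreal (p * (q + 0) powr (- p - 1)) * indicator {1<..} q)"
          using False by (simp add: mult.commute mult_right_mono ennreal_leI)
        then show ?thesis by (rule order_trans) simp
      qed
    qed simp
  qed
  also have "\<dots> = ennreal (p * C * exp 1) * ennreal (Gamma (real k / 2 - p) / 1 powr (real k / 2 - p)) + ennreal (measure \<mu> (space \<mu>)) * ennreal ((1 + 0) powr (- p))"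
  proof -
    have "(\<integral>\<^sup>+q. ennreal (indicator {0<..} q * (q powr ((real k / 2 - p) - 1) * exp (- (q * 1)))) \<partial>lborel) = ennreal (Gamma (real k / 2 - p) / 1 powr (real k / 2 - p))"
      using gamma_laplace[of "real k / 2 - p" 1] p by (subst nn_integral_eq_integral) (auto simp: has_bochner_integral_iff)
    moreover have "(\<integral>\<^sup>+q. ennreal (p * (q + 0) powr (- p - 1)) * indicator {1<..} q \<partial>lborel) = ennreal ((1 + 0) powr (- p))"
      using p by (intro nn_integral_powr_tail) auto
    ultimately show ?thesis
      by (subst nn_integral_add) (auto simp: nn_integral_cmult)
  qed
  also have "\<dots> < \<infinity>" by (simp add: ennreal_mult_less_top)
  finally have "(\<integral>\<^sup>+\<xi>. ennreal (Q \<xi> powr (- p)) \<partial>\<mu>) < \<infinity>" .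
  then show ?thesis by (intro integrableI_nonneg) auto
qed

section \<open>The Poisson kernel as an approximate identity\<close>

abbreviation expo :: real where "expo \<equiv> (real k + 1) / 2"

text \<open>The limiting mass of \<open>h * (Q \<xi> + h\<^sup>2) powr (- expo)\<close>; for
  \<open>V\<close> the volume of the unit ball it is the classical Poisson constant.\<close>

definition poisson_const :: real where
  "poisson_const = V * Gamma (real k / 2 + 1) * Gamma (1 / 2) / Gamma expo"

text \<open>The layer-cake formula followed by \<open>q = h\<^sup>2 * v\<close>. All powers of
  \<open>h\<close> combine with \<open>vol\<close>, so that \<open>h\<close> survives only inside
  the density quotient.\<close>

lemma poisson_mass_eq:
  assumes h: "0 < h"
  shows "(\<integral>\<xi>. h * (Q \<xi> + h\<^sup>2) powr (- expo) \<partial>\<mu>) =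
    (\<integral>v. expo * (indicator {0<..} v * (v powr ((real k / 2 + 1) - 1) * (1 + v) powr (- ((real k / 2 + 1) + 1 / 2)))) *
       (vol (h\<^sup>2 * v) / (h\<^sup>2 * v) powr (real k / 2)) \<partial>lborel)"
proof -
  have p: "0 < expo" by simp
  have "(\<integral>\<^sup>+\<xi>. ennreal ((Q \<xi> + h\<^sup>2) powr (- expo)) \<partial>\<mu>) = (\<integral>\<^sup>+\<xi>. (\<integral>\<^sup>+q. ennreal (expo * (q + h\<^sup>2) powr (- expo - 1)) * indicator {Q \<xi><..} q \<partial>lborel) \<partial>\<mu>)"
  proof (rule nn_integral_cong)
    fix \<xi> assume "\<xi> \<in> space \<mu>"
    then have "0 < Q \<xi> + h\<^sup>2" using Q_nonneg[of \<xi>] h by (simp add: add_nonneg_pos)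
    then show "ennreal ((Q \<xi> + h\<^sup>2) powr (- expo)) = (\<integral>\<^sup>+q. ennreal (expo * (q + h\<^sup>2) powr (- expo - 1)) * indicator {Q \<xi><..} q \<partial>lborel)"
      by (rule nn_integral_powr_tail[OF p, symmetric])
  qed
  also have "\<dots> = (\<integral>\<^sup>+q. ennreal (expo * (q + h\<^sup>2) powr (- expo - 1)) * ennreal (vol q) \<partial>lborel)"
    by (subst layer_cake) (auto simp: emeasure_vol sigma_finite_measure_axioms)
  also have "\<dots> = (\<integral>\<^sup>+q. ennreal (expo * (q + h\<^sup>2) powr (- expo - 1) * vol q) \<partial>lborel)"
    by (intro nn_integral_cong ennreal_mult[symmetric]) (auto simp: vol_nonneg)
  finally have "(\<integral>\<xi>. (Q \<xi> + h\<^sup>2) powr (- expo) \<partial>\<mu>) = (\<integral>q. expo * (q + h\<^sup>2) powr (- expo - 1) * vol q \<partial>lborel)"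
    using p vol_nonneg by (subst (1 2) integral_eq_nn_integral) (auto intro!: AE_I2 mult_nonneg_nonneg)
  also have "\<dots> = h\<^sup>2 * (\<integral>v. expo * (0 + h\<^sup>2 * v + h\<^sup>2) powr (- expo - 1) * vol (0 + h\<^sup>2 * v) \<partial>lborel)"
    using lborel_integral_real_affine[of "h\<^sup>2" "\<lambda>q. expo * (q + h\<^sup>2) powr (- expo - 1) * vol q" 0] h by simp
  finally have "(\<integral>\<xi>. h * (Q \<xi> + h\<^sup>2) powr (- expo) \<partial>\<mu>) = (\<integral>v. h * h\<^sup>2 * (expo * (0 + h\<^sup>2 * v + h\<^sup>2) powr (- expo - 1) * vol (0 + h\<^sup>2 * v)) \<partial>lborel)"
    by (simp only: integral_mult_right_zero mult.assoc)
  also have "\<dots> = (\<integral>v. expo * (indicator {0<..} v * (v powr ((real k / 2 + 1) - 1) * (1 + v) powr (- ((real k / 2 + 1) + 1 / 2)))) *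
       (vol (h\<^sup>2 * v) / (h\<^sup>2 * v) powr (real k / 2)) \<partial>lborel)"
  proof (rule Bochner_Integration.integral_cong[OF refl])
    fix v :: real
    show "h * h\<^sup>2 * (expo * (0 + h\<^sup>2 * v + h\<^sup>2) powr (- expo - 1) * vol (0 + h\<^sup>2 * v)) =
      expo * (indicator {0<..} v * (v powr ((real k / 2 + 1) - 1) * (1 + v) powr (- ((real k / 2 + 1) + 1 / 2)))) *
       (vol (h\<^sup>2 * v) / (h\<^sup>2 * v) powr (real k / 2))"
    proof (cases "0 < v")
      case True
      have h2: "(h\<^sup>2) powr a = h powr (2 * a)" for a
      proof -
        have "h\<^sup>2 = h powr 2" using h by simp
        then show ?thesis by (simp only: powr_powr)
      qed
      have e2: "2 * (- expo - 1) = - real k - 3" by (simp add: algebra_simps)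
      have "0 + h\<^sup>2 * v + h\<^sup>2 = h\<^sup>2 * (1 + v)" by (simp add: algebra_simps)
      then have 1: "(0 + h\<^sup>2 * v + h\<^sup>2) powr (- expo - 1) = h powr (- real k - 3) * (1 + v) powr (- expo - 1)"
        by (simp only: powr_mult h2 e2)
      have 2: "(h\<^sup>2 * v) powr (real k / 2) = h powr real k * v powr (real k / 2)"
        by (simp only: powr_mult h2) simp
      have "h * h\<^sup>2 = h powr 3" using h by (simp add: power3_eq_cube power2_eq_square)
      then have "h * h\<^sup>2 * h powr (- real k - 3) = h powr (3 + (- real k - 3))"
        by (simp only: powr_add)
      also have "3 + (- real k - 3) = - real k" by simp
      finally have 3: "h * h\<^sup>2 * h powr (- real k - 3) = 1 / h powr real k"
        by (simp only: powr_minus_divide)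
      have e: "- expo - 1 = - ((real k / 2 + 1) + 1 / 2)" by (simp add: field_simps)
      have "h * h\<^sup>2 * (expo * (0 + h\<^sup>2 * v + h\<^sup>2) powr (- expo - 1) * vol (0 + h\<^sup>2 * v)) =
          (h * h\<^sup>2 * h powr (- real k - 3)) * (expo * (1 + v) powr (- ((real k / 2 + 1) + 1 / 2)) * vol (h\<^sup>2 * v))"
        unfolding 1 unfolding e by simp
      also have "\<dots> = expo * (v powr (real k / 2) * (1 + v) powr (- ((real k / 2 + 1) + 1 / 2))) *
          (vol (h\<^sup>2 * v) / (h powr real k * v powr (real k / 2)))"
        unfolding 3 using True by simp
      finally show ?thesis unfolding 2 using True by simp
    next
      case False
      then have "vol (h\<^sup>2 * v) = 0" by (intro vol_nonpos) (simp add: mult_nonneg_nonpos)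
      then show ?thesis by simp
    qed
  qed
  finally show ?thesis .
qed

text \<open>The density quotient is bounded and tends to \<open>V\<close> for each fixed
  \<open>v\<close>, so dominated convergence leaves \<open>V\<close> times a beta integral. The
  factor \<open>expo\<close> disappears through \<Gamma>(x + 1) = x \<Gamma>(x).\<close>

lemma poisson_mass_tendsto:
  "((\<lambda>h. \<integral>\<xi>. h * (Q \<xi> + h\<^sup>2) powr (- expo) \<partial>\<mu>) \<longlongrightarrow> poisson_const) (at_right 0)"
proof (subst tendsto_at_iff_sequentially, intro allI impI)
  fix X :: "nat \<Rightarrow> real" assume X0: "\<forall>i. X i \<in> {0<..} - {0}" and X: "X \<longlonglongrightarrow> 0"
  have Xpos: "0 < X n" for n using X0 by auto
  obtain C where C: "0 \<le> C" "\<And>q. 0 < q \<Longrightarrow> vol q \<le> C * q powr (real k / 2)" using vol_le by blast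
  let ?b = "\<lambda>v. indicator {0<..} v * (v powr ((real k / 2 + 1) - 1) * (1 + v) powr (- ((real k / 2 + 1) + 1 / 2))) :: real"
  let ?q = "\<lambda>h v. vol (h\<^sup>2 * v) / (h\<^sup>2 * v) powr (real k / 2)"
  have B: "has_bochner_integral lborel ?b (Gamma (real k / 2 + 1) * Gamma (1 / 2) / Gamma ((real k / 2 + 1) + 1 / 2))"
    by (rule integral_beta_half_line) auto
  have "(\<lambda>n. \<integral>v. expo * ?b v * ?q (X n) v \<partial>lborel) \<longlonglongrightarrow> (\<integral>v. expo * ?b v * V \<partial>lborel)"
  proof (rule integral_dominated_convergence[where w = "\<lambda>v. expo * ?b v * C"])
    show "integrable lborel (\<lambda>v. expo * ?b v * C)"
      by (intro integrable_mult_left integrable_mult_right integrable.intros[OF B])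
    show "AE v in lborel. (\<lambda>n. expo * ?b v * ?q (X n) v) \<longlonglongrightarrow> expo * ?b v * V"
    proof (intro AE_I2)
      fix v :: real
      show "(\<lambda>n. expo * ?b v * ?q (X n) v) \<longlonglongrightarrow> expo * ?b v * V"
      proof (cases "0 < v")
        case True
        have "(\<lambda>n. (X n)\<^sup>2 * v) \<longlonglongrightarrow> 0" by (rule tendsto_eq_rhs[OF tendsto_mult[OF tendsto_power[OF X] tendsto_const]]) simp
        then have "filterlim (\<lambda>n. (X n)\<^sup>2 * v) (at_right 0) sequentially"
          using Xpos True by (intro tendsto_imp_filterlim_at_right always_eventually allI mult_pos_pos zero_less_power)
        from filterlim_compose[OF vol_density this] show ?thesis by (intro tendsto_intros)
      qed simp
    qed
    fix n
    show "AE v in lborel. norm (expo * ?b v * ?q (X n) v) \<le> expo * ?b v * C"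
    proof (intro AE_I2)
      fix v :: real
      show "norm (expo * ?b v * ?q (X n) v) \<le> expo * ?b v * C"
      proof (cases "0 < v")
        case True
        have q: "0 < (X n)\<^sup>2 * v" using Xpos[of n] True by simp
        have "\<bar>?q (X n) v\<bar> \<le> C" using C(2)[OF q] C(1) q vol_nonneg by (simp add: divide_le_eq)
        moreover have "0 \<le> expo * ?b v" by simp
        ultimately show ?thesis unfolding real_norm_def abs_mult[of "expo * ?b v"] by (simp only: abs_of_nonneg mult_left_mono)
      qed simp
    qed
  qed measurable
  also have "(\<integral>v. expo * ?b v * V \<partial>lborel) = poisson_const"
  proof -
    have g: "Gamma ((real k / 2 + 1) + 1 / 2) = expo * Gamma expo"
    proof -
      have e: "(real k / 2 + 1) + 1 / 2 = expo + 1" by (simp add: field_simps)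
      show ?thesis unfolding e by (rule Gamma_plus1) (auto dest!: nonpos_Ints_nonpos)
    qed
    have "(\<integral>v. expo * ?b v * V \<partial>lborel) = expo * (\<integral>v. ?b v \<partial>lborel) * V"
      by (simp only: integral_mult_right_zero integral_mult_left_zero)
    also have "(\<integral>v. ?b v \<partial>lborel) = Gamma (real k / 2 + 1) * Gamma (1 / 2) / (expo * Gamma expo)"
      using has_bochner_integral_integral_eq[OF B] unfolding g .
    also have "expo * \<dots> * V = poisson_const"
      unfolding poisson_const_def by (simp add: mult_ac)
    finally show ?thesis .
  qed
  finally show "((\<lambda>h. \<integral>\<xi>. h * (Q \<xi> + h\<^sup>2) powr (- expo) \<partial>\<mu>) \<circ> X) \<longlonglongrightarrow> poisson_const"
    by (simp only: comp_def poisson_mass_eq[OF Xpos])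
qed

lemma poisson_kernel_le:
  assumes "\<xi> \<in> space \<mu>" "0 < h"
  shows "(Q \<xi> + h\<^sup>2) powr (- expo) \<le> (h\<^sup>2) powr (- expo)"
  using assms Q_nonneg[OF assms(1)] by (intro powr_mono2') auto

text \<open>\<open>F\<close> may depend on \<open>h\<close> and is only required to have a joint
  limit as \<open>Q \<xi>\<close> and \<open>h\<close> tend to 0. Near the point the bounded kernel
  mass is used; away from it the kernel is at most \<open>h\<close> times a constant.\<close>

lemma approximate_identity:
  assumes h1: "0 < h1"
    and meas: "\<And>h. 0 < h \<Longrightarrow> h < h1 \<Longrightarrow> (\<lambda>\<xi>. F \<xi> h) \<in> borel_measurable \<mu>"
    and bound: "\<And>\<xi> h. \<xi> \<in> space \<mu> \<Longrightarrow> 0 < h \<Longrightarrow> h < h1 \<Longrightarrow> \<bar>F \<xi> h\<bar> \<le> B"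
    and lim: "\<And>\<epsilon>. 0 < \<epsilon> \<Longrightarrow> \<exists>\<delta>>0. \<forall>\<xi>\<in>space \<mu>. \<forall>h. Q \<xi> < \<delta> \<longrightarrow> 0 < h \<longrightarrow> h < \<delta> \<longrightarrow> \<bar>F \<xi> h - f0\<bar> < \<epsilon>"
  shows "((\<lambda>h. \<integral>\<xi>. h * (Q \<xi> + h\<^sup>2) powr (- expo) * F \<xi> h \<partial>\<mu>) \<longlongrightarrow> poisson_const * f0) (at_right 0)"
proof -
  let ?P = "\<lambda>h \<xi>. h * (Q \<xi> + h\<^sup>2) powr (- expo)"
  define T where "T = measure \<mu> (space \<mu>)"
  have Pint: "integrable \<mu> (?P h)" if "0 < h" for h
    by (rule integrable_const_bound[where B = "h * (h\<^sup>2) powr (- expo)"])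
       (use that poisson_kernel_le in \<open>auto intro!: AE_I2 mult_left_mono simp: abs_mult\<close>)
  have PFint: "integrable \<mu> (\<lambda>\<xi>. ?P h \<xi> * F \<xi> h)" if h: "0 < h" "h < h1" for h
  proof (rule Bochner_Integration.integrable_bound[OF integrable_mult_left[OF Pint[OF h(1)], of B]])
    show "(\<lambda>\<xi>. ?P h \<xi> * F \<xi> h) \<in> borel_measurable \<mu>" using meas[OF h] by measurable
    show "AE \<xi> in \<mu>. norm (?P h \<xi> * F \<xi> h) \<le> norm (?P h \<xi> * B)"
      using bound[OF _ h] h by (intro AE_I2) (auto simp: abs_mult intro!: mult_left_mono order_trans[OF _ abs_ge_self])
  qed
  have diff: "((\<lambda>h. (\<integral>\<xi>. ?P h \<xi> * F \<xi> h \<partial>\<mu>) - (\<integral>\<xi>. ?P h \<xi> \<partial>\<mu>) * f0) \<longlongrightarrow> 0) (at_right 0)"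
  proof (rule tendstoI)
    fix \<epsilon> :: real assume \<epsilon>: "0 < \<epsilon>"
    \<comment> \<open>Eventually exceeds the mass of the kernel, and is positive whatever the
      constant is.\<close>
    define c where "c = \<bar>poisson_const\<bar> + 1"
    have c: "0 < c" by (simp add: c_def)
    from lim[of "\<epsilon> / (2 * c)"] \<epsilon> c obtain \<delta> where \<delta>: "0 < \<delta>"
      "\<And>\<xi> h. \<xi> \<in> space \<mu> \<Longrightarrow> Q \<xi> < \<delta> \<Longrightarrow> 0 < h \<Longrightarrow> h < \<delta> \<Longrightarrow> \<bar>F \<xi> h - f0\<bar> < \<epsilon> / (2 * c)" by auto
    define D where "D = \<delta> powr (- expo) * (\<bar>B\<bar> + \<bar>f0\<bar>)"
    have D: "0 \<le> D" by (simp add: D_def)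
    have "((\<lambda>h. h * (D * T)) \<longlongrightarrow> 0) (at_right 0)" by (auto intro!: tendsto_eq_intros)
    then have ev1: "\<forall>\<^sub>F h in at_right 0. h * (D * T) < \<epsilon> / 2" using \<epsilon> by (intro order_tendstoD(2)) auto
    have ev2: "\<forall>\<^sub>F h in at_right 0. (\<integral>\<xi>. ?P h \<xi> \<partial>\<mu>) < c"
      by (rule order_tendstoD(2)[OF poisson_mass_tendsto]) (simp add: c_def abs_if)
    have ev3: "\<forall>\<^sub>F h in at_right 0. 0 < h \<and> h < min h1 \<delta>"
      using h1 \<delta>(1) by (intro eventually_at_rightI[of 0 "min h1 \<delta>"]) auto
    show "\<forall>\<^sub>F h in at_right 0. dist ((\<integral>\<xi>. ?P h \<xi> * F \<xi> h \<partial>\<mu>) - (\<integral>\<xi>. ?P h \<xi> \<partial>\<mu>) * f0) 0 < \<epsilon>"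
      using ev1 ev2 ev3
    proof eventually_elim
      case (elim h)
      then have h: "0 < h" "h < h1" "h < \<delta>" by auto
      have eq: "(\<integral>\<xi>. ?P h \<xi> * F \<xi> h \<partial>\<mu>) - (\<integral>\<xi>. ?P h \<xi> \<partial>\<mu>) * f0 = (\<integral>\<xi>. ?P h \<xi> * F \<xi> h - ?P h \<xi> * f0 \<partial>\<mu>)"
        using PFint[OF h(1,2)] Pint[OF h(1)] by (simp add: Bochner_Integration.integral_diff)
      have le: "\<bar>?P h \<xi> * F \<xi> h - ?P h \<xi> * f0\<bar> \<le> ?P h \<xi> * (\<epsilon> / (2 * c)) + h * D" if \<xi>: "\<xi> \<in> space \<mu>" for \<xi>
      proof -
        have P0: "0 \<le> ?P h \<xi>" using h by simp
        have "\<bar>?P h \<xi> * F \<xi> h - ?P h \<xi> * f0\<bar> = ?P h \<xi> * \<bar>F \<xi> h - f0\<bar>"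
          unfolding right_diff_distrib[symmetric] abs_mult[of "?P h \<xi>"] abs_of_nonneg[OF P0] ..
        also have "\<dots> \<le> ?P h \<xi> * (\<epsilon> / (2 * c)) + h * D"
        proof (cases "Q \<xi> < \<delta>")
          case True
          have "?P h \<xi> * \<bar>F \<xi> h - f0\<bar> \<le> ?P h \<xi> * (\<epsilon> / (2 * c))"
            using \<delta>(2)[OF \<xi> True h(1,3)] P0 by (intro mult_left_mono) auto
          then show ?thesis using h D by (simp add: add_increasing2)
        next
          case False
          have "(Q \<xi> + h\<^sup>2) powr (- expo) \<le> \<delta> powr (- expo)"
            using False \<delta>(1) h by (intro powr_mono2') (auto simp: add_increasing2)
          moreover have "\<bar>F \<xi> h - f0\<bar> \<le> \<bar>B\<bar> + \<bar>f0\<bar>" using bound[OF \<xi> h(1,2)] by linarith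
          ultimately have "(Q \<xi> + h\<^sup>2) powr (- expo) * \<bar>F \<xi> h - f0\<bar> \<le> D"
            unfolding D_def by (intro mult_mono) auto
          then have "?P h \<xi> * \<bar>F \<xi> h - f0\<bar> \<le> h * D"
            using h by (simp add: mult.assoc)
          moreover have "0 \<le> ?P h \<xi> * (\<epsilon> / (2 * c))" using \<epsilon> c by (intro mult_nonneg_nonneg[OF P0]) auto
          ultimately show ?thesis by linarith
        qed
        finally show ?thesis .
      qed
      have "\<bar>\<integral>\<xi>. ?P h \<xi> * F \<xi> h - ?P h \<xi> * f0 \<partial>\<mu>\<bar> \<le> (\<integral>\<xi>. \<bar>?P h \<xi> * F \<xi> h - ?P h \<xi> * f0\<bar> \<partial>\<mu>)"
        by (rule integral_abs_bound)
      also have "\<dots> \<le> (\<integral>\<xi>. ?P h \<xi> * (\<epsilon> / (2 * c)) + h * D \<partial>\<mu>)"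
        by (intro integral_mono integrable_abs Bochner_Integration.integrable_diff Bochner_Integration.integrable_add
            integrable_mult_left PFint Pint h le) auto
      also have "\<dots> = (\<integral>\<xi>. ?P h \<xi> \<partial>\<mu>) * (\<epsilon> / (2 * c)) + h * (D * T)"
        using Pint[OF h(1)] by (subst Bochner_Integration.integral_add) (auto simp: T_def)
      also have "\<dots> < c * (\<epsilon> / (2 * c)) + \<epsilon> / 2"
        using elim \<epsilon> c by (intro add_strict_mono mult_strict_right_mono) auto
      also have "\<dots> = \<epsilon>" using c by simp
      finally show ?case unfolding eq by simp
    qed
  qed
  have "((\<lambda>h. ((\<integral>\<xi>. ?P h \<xi> * F \<xi> h \<partial>\<mu>) - (\<integral>\<xi>. ?P h \<xi> \<partial>\<mu>) * f0) + (\<integral>\<xi>. ?P h \<xi> \<partial>\<mu>) * f0) \<longlongrightarrow> 0 + poisson_const * f0) (at_right 0)"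
    by (intro tendsto_intros diff poisson_mass_tendsto)
  then show ?thesis by simp
qed

end

section \<open>The jump relation\<close>

text \<open>The set itself is a cover by sets of diameter 0, and \<open>0 powr s = 0\<close> even
  for \<open>s = 0\<close>.\<close>

lemma hausdorff_outer_singleton: "hausdorff_outer s {x} = 0"
proof -
  have "hausdorff_pre s \<delta> {x} \<le> 0" if "0 < \<delta>" for \<delta>
    using hausdorff_pre_le[of "\<lambda>_. {x}" \<delta> "{x}" s] that
    by (simp add: hausdorff_covers_def hausdorff_weight_def)
  then show ?thesis
    using hausdorff_outer_le[of s "{x}" 0] by (metis le_zero_eq)
qed

lemma borel_measurable_heat_integral:
  assumes "(\<lambda>z. f (fst z) (snd z)) \<in> borel_measurable (borel \<Otimes>\<^sub>M borel)" and [measurable]: "R \<in> borel_measurable borel"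
  shows "(\<lambda>\<xi>. heat_integral p (f \<xi>) (R \<xi>)) \<in> borel_measurable borel"
proof -
  have "(\<lambda>z. f (fst z) (snd z)) \<in> borel_measurable (borel \<Otimes>\<^sub>M lborel)"
    using assms(1) by (simp cong: measurable_cong_sets)
  then have "(\<lambda>(\<xi>, s). indicator {0<..} s * (s powr p * exp (- (s * R \<xi>)) * f \<xi> s)) \<in> borel_measurable (borel \<Otimes>\<^sub>M lborel)"
    unfolding case_prod_beta by measurable
  then show ?thesis
    unfolding heat_integral_def by (rule lborel.borel_measurable_lebesgue_integral)
qed

section \<open>The surface measure and distances to the surface\<close>

locale surface_layer = lyapunov_surface K \<Omega> \<Gamma> N a \<kappa> + lauricella_kernel_at K \<alpha> t \<epsilon> M
  for K :: "'m::finite set" and \<Omega> \<Gamma> N a \<kappa> \<alpha> t \<epsilon> M +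
  fixes \<rho> :: "real^'m \<Rightarrow> real"
  assumes t_Gamma: "t \<in> \<Gamma>" and Gamma_M: "\<Gamma> \<subseteq> cball 0 M"
    and rho_cont: "continuous_on (closure \<Gamma>) \<rho>"
begin

definition \<mu> :: "(real^'m) measure" where "\<mu> = restrict_space surface_measure \<Gamma>"

lemma sets_surface: "sets (surface_measure :: (real^'m) measure) = sets borel"
  by (simp add: surface_measure_def)

lemma space_mu [simp]: "space \<mu> = \<Gamma>"
  by (simp add: \<mu>_def space_restrict_space surface_measure_def)

lemma emeasure_mu: "A \<in> sets borel \<Longrightarrow> A \<subseteq> \<Gamma> \<Longrightarrow> emeasure \<mu> A = hausdorff_outer (real CARD('m) - 1) A"
  unfolding \<mu>_def using Gamma_borel
  by (subst emeasure_restrict_space) (auto simp: sets_surface surface_measure_def emeasure_hausdorff_measure)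

lemma set_integral_mu: "(LINT \<xi>:\<Gamma>|surface_measure. f \<xi>) = (\<integral>\<xi>. f \<xi> \<partial>\<mu>)" for f :: "real^'m \<Rightarrow> real"
  unfolding \<mu>_def set_lebesgue_integral_def using Gamma_borel
  by (subst integral_restrict_space) (auto simp: sets_surface surface_measure_def)

lemma measurable_mu: "f \<in> borel_measurable borel \<Longrightarrow> f \<in> borel_measurable \<mu>"
  unfolding \<mu>_def by (intro measurable_restrict_space1) (simp add: surface_measure_def cong: measurable_cong_sets)

lemma Gamma_points: "\<Gamma> \<subseteq> points"
  using Gamma_orthant Gamma_M by (auto simp: points_def)

lemma rho_measurable [measurable]: "\<rho> \<in> borel_measurable \<mu>"
proof -
  have "sets \<mu> = sets (restrict_space borel \<Gamma>)"
    unfolding \<mu>_def by (rule sets_restrict_space_cong[OF sets_surface])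
  moreover have "\<rho> \<in> borel_measurable (restrict_space borel \<Gamma>)"
    using rho_cont closure_subset by (intro borel_measurable_continuous_on_restrict) (blast intro: continuous_on_subset)
  ultimately show ?thesis by (simp cong: measurable_cong_sets)
qed

lemma rho_bounded: "\<exists>B\<ge>0. \<forall>\<xi>\<in>\<Gamma>. \<bar>\<rho> \<xi>\<bar> \<le> B"
proof -
  have "compact (closure \<Gamma>)" using bounded_Gamma by (simp add: compact_eq_bounded_closed bounded_closure)
  then have "bounded (\<rho> ` closure \<Gamma>)" using rho_cont compact_continuous_image compact_imp_bounded by blast
  then obtain B where "\<forall>y\<in>\<rho> ` closure \<Gamma>. norm y \<le> B" by (auto simp: bounded_iff)
  then have "\<forall>\<xi>\<in>\<Gamma>. \<bar>\<rho> \<xi>\<bar> \<le> B" using closure_subset[of \<Gamma>] by auto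
  then show ?thesis by (intro exI[of _ "max B 0"]) auto
qed

lemma norm_Nt: "norm (N t) = 1" by (rule norm_normal[OF t_Gamma])

lemma sets_t: "{t} \<in> sets \<mu>"
  unfolding \<mu>_def using t_Gamma Gamma_borel by (subst sets_restrict_space_iff) (auto simp: sets_surface)

lemma null_t: "AE \<xi> in \<mu>. \<xi> \<noteq> t"
proof (rule AE_I')
  have "emeasure \<mu> {t} = 0" using t_Gamma by (subst emeasure_mu) (auto simp: hausdorff_outer_singleton)
  then show "{t} \<in> null_sets \<mu>" using sets_t by (rule null_setsI)
qed auto

lemma density_mu: "density_at_point \<mu> (\<lambda>\<xi>. (dist \<xi> t)\<^sup>2) (CARD('m) - 1) (unit_ball_vol (real CARD('m) - 1))"
proof -
  have fin: "finite_measure \<mu>"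
    using emeasure_mu[OF Gamma_borel subset_refl] finite_area by (intro finite_measureI) auto
  show ?thesis
  proof (rule density_at_point.intro[OF fin], unfold_locales)
    show "0 < CARD('m) - 1" using card_gt by simp
    show "(\<lambda>\<xi>. (dist \<xi> t)\<^sup>2) \<in> borel_measurable \<mu>" by (intro measurable_mu) measurable
    show "0 \<le> unit_ball_vol (real CARD('m) - 1)" using card_gt by simp
    have "\<forall>\<^sub>F r in at_right 0. enn2real (hausdorff_outer (real CARD('m) - 1) (\<Gamma> \<inter> ball t r)) / r ^ (CARD('m) - 1) =
        measure \<mu> {\<xi> \<in> space \<mu>. (dist \<xi> t)\<^sup>2 < r\<^sup>2} / r ^ (CARD('m) - 1)"
      unfolding eventually_at_filter
    proof (intro always_eventually allI impI)
      fix r :: real assume "r \<noteq> 0" "r \<in> {0<..}"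
      then have r: "0 < r" by simp
      have "{\<xi> \<in> space \<mu>. (dist \<xi> t)\<^sup>2 < r\<^sup>2} = \<Gamma> \<inter> ball t r"
      proof -
        have "(dist \<xi> t)\<^sup>2 < r\<^sup>2 \<longleftrightarrow> dist t \<xi> < r" for \<xi>
          using r power_strict_mono[of "dist \<xi> t" r 2] power2_less_imp_less[of "dist \<xi> t" r]
          by (auto simp: dist_commute)
        then have "{\<xi> \<in> space \<mu>. (dist \<xi> t)\<^sup>2 < r\<^sup>2} = {\<xi> \<in> \<Gamma>. dist t \<xi> < r}"
          by (simp only: space_mu)
        then show ?thesis unfolding ball_def by blast
      qed
      moreover have "emeasure \<mu> (\<Gamma> \<inter> ball t r) = hausdorff_outer (real CARD('m) - 1) (\<Gamma> \<inter> ball t r)"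
        using Gamma_borel by (intro emeasure_mu) auto
      ultimately show "enn2real (hausdorff_outer (real CARD('m) - 1) (\<Gamma> \<inter> ball t r)) / r ^ (CARD('m) - 1) =
        measure \<mu> {\<xi> \<in> space \<mu>. (dist \<xi> t)\<^sup>2 < r\<^sup>2} / r ^ (CARD('m) - 1)"
        by (simp add: measure_def)
    qed
    then show "((\<lambda>r. measure \<mu> {\<xi> \<in> space \<mu>. (dist \<xi> t)\<^sup>2 < r\<^sup>2} / r ^ (CARD('m) - 1)) \<longlongrightarrow> unit_ball_vol (real CARD('m) - 1)) (at_right 0)"
      by (rule Lim_transform_eventually[OF area_density[OF t_Gamma]])
  qed simp
qed

sublocale density: density_at_point \<mu> "\<lambda>\<xi>. (dist \<xi> t)\<^sup>2" "CARD('m) - 1" "unit_ball_vol (real CARD('m) - 1)"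
  by (rule density_mu)

lemma real_k: "real (CARD('m) - 1) = real CARD('m) - 1"
  using card_gt by (simp add: of_nat_diff)

text \<open>The Gamma function in the volume of the unit ball cancels the one from the beta
  integral, and \<open>Gamma (1 / 2)\<close> is the missing root of \<pi>. The result is half the
  reciprocal of the constant in \<open>kernel_constant\<close>.\<close>

lemma poisson_const_eq: "density.poisson_const = pi powr (real CARD('m) / 2) / Gamma (real CARD('m) / 2)"
proof -
  let ?m = "real CARD('m)"
  have g: "0 < Gamma ((?m - 1) / 2 + 1)" using card_gt by (intro Gamma_real_pos add_nonneg_pos) auto
  have "density.poisson_const = pi powr ((?m - 1) / 2) / Gamma ((?m - 1) / 2 + 1) * Gamma ((?m - 1) / 2 + 1) * sqrt pi / Gamma (?m / 2)"
    unfolding density.poisson_const_def unfolding real_k unit_ball_vol_def Gamma_one_half_real by simp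
  also have "\<dots> = (pi powr ((?m - 1) / 2) * pi powr (1 / 2)) / Gamma (?m / 2)"
    using g by (simp add: powr_half_sqrt)
  also have "pi powr ((?m - 1) / 2) * pi powr (1 / 2) = pi powr (?m / 2)"
    unfolding powr_add[symmetric] by (simp add: field_simps)
  finally show ?thesis .
qed

text \<open>Off the surface the distance from \<xi> controls both \<open>dist \<xi> t\<close> and
  the height. Near \<open>t\<close> flatness with slope 1/2 makes the mixed term of the squared
  distance at most half of the sum of the two squares. Far from \<open>t\<close> the height is small
  against \<open>dist \<xi> t\<close>.\<close>

lemma separation:
  "\<exists>h1>0. \<forall>h. \<bar>h\<bar> < h1 \<longrightarrow> t + h *\<^sub>R N t \<in> near \<and>
     (\<forall>\<xi>\<in>\<Gamma>. dist \<xi> t \<le> 2 * dist \<xi> (t + h *\<^sub>R N t) \<and> \<bar>h\<bar> \<le> 2 * dist \<xi> (t + h *\<^sub>R N t))"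
proof -
  \<comment> \<open>The radius at which the bound \<open>a * (2 * \<delta>) powr \<kappa>\<close> on
    the slope is 1/2.\<close>
  define \<delta> where "\<delta> = (1 / (2 * a)) powr (1 / \<kappa>) / 2"
  have \<delta>: "0 < \<delta>" using a_pos by (simp add: \<delta>_def)
  have a\<delta>: "a * (2 * \<delta>) powr \<kappa> = 1 / 2" using a_pos kappa_pos by (simp add: \<delta>_def powr_powr)
  show ?thesis
  proof (intro exI[of _ "min (\<delta> / 2) (\<epsilon> / 2)"] conjI allI impI ballI)
    show "0 < min (\<delta> / 2) (\<epsilon> / 2)" using \<delta> eps_pos by simp
    fix h assume h: "\<bar>h\<bar> < min (\<delta> / 2) (\<epsilon> / 2)"
    show "t + h *\<^sub>R N t \<in> near" using h norm_Nt by (simp add: near_def dist_norm)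
    fix \<xi> assume \<xi>: "\<xi> \<in> \<Gamma>"
    define R where "R = dist \<xi> t"
    define r where "r = dist \<xi> (t + h *\<^sub>R N t)"
    have "R \<le> 2 * r \<and> \<bar>h\<bar> \<le> 2 * r"
    proof (cases "R < \<delta>")
      case True
      have R0: "0 \<le> R" by (simp add: R_def)
      have "\<bar>(\<xi> - t) \<bullet> N t\<bar> \<le> a * (2 * R) powr \<kappa> * R" unfolding R_def by (rule tangent_deviation[OF t_Gamma \<xi>])
      also have "\<dots> \<le> a * (2 * \<delta>) powr \<kappa> * R"
        using True R0 a_pos kappa_pos by (intro mult_right_mono mult_left_mono powr_mono2) auto
      finally have dev: "\<bar>(\<xi> - t) \<bullet> N t\<bar> \<le> R / 2" using a\<delta> by simp
      have r2: "r\<^sup>2 = R\<^sup>2 - 2 * h * ((\<xi> - t) \<bullet> N t) + h\<^sup>2"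
      proof -
        have "\<xi> - (t + h *\<^sub>R N t) = (\<xi> - t) - h *\<^sub>R N t" by simp
        then show ?thesis unfolding r_def R_def dist_norm power2_norm_eq_inner
          using norm_Nt by (simp add: inner_diff_left inner_diff_right inner_commute norm_eq_1 power2_eq_square algebra_simps)
      qed
      have "2 * h * ((\<xi> - t) \<bullet> N t) \<le> 2 * (\<bar>h\<bar> * \<bar>(\<xi> - t) \<bullet> N t\<bar>)"
        using abs_ge_self[of "h * ((\<xi> - t) \<bullet> N t)"] by (simp add: abs_mult)
      also have "\<dots> \<le> 2 * (\<bar>h\<bar> * (R / 2))" using dev by (intro mult_left_mono) auto
      also have "\<dots> \<le> (R\<^sup>2 + h\<^sup>2) / 2"
        using sum_squares_bound[of "\<bar>h\<bar>" R] by simp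
      finally have half: "(R\<^sup>2 + h\<^sup>2) / 2 \<le> r\<^sup>2" unfolding r2 by (simp add: field_simps)
      have lin: "A \<le> 4 * C \<and> B \<le> 4 * C" if "(A + B) / 2 \<le> C" "0 \<le> A" "0 \<le> B" for A B C :: real
        using that by auto
      have "R\<^sup>2 \<le> (2 * r)\<^sup>2" "\<bar>h\<bar>\<^sup>2 \<le> (2 * r)\<^sup>2"
        using lin[OF half zero_le_power2 zero_le_power2] by (simp_all add: power_mult_distrib)
      moreover have "0 \<le> 2 * r" by (simp add: r_def)
      ultimately show ?thesis using power2_le_imp_le by blast
    next
      case False
      have "dist t (t + h *\<^sub>R N t) = \<bar>h\<bar>" using norm_Nt by (simp add: dist_norm)
      then have "R \<le> r + \<bar>h\<bar>" unfolding R_def r_def using dist_triangle2[of \<xi> t "t + h *\<^sub>R N t"] by simp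
      then show ?thesis using False h \<delta> by auto
    qed
    then show "dist \<xi> t \<le> 2 * dist \<xi> (t + h *\<^sub>R N t)" "\<bar>h\<bar> \<le> 2 * dist \<xi> (t + h *\<^sub>R N t)"
      by (auto simp: R_def r_def)
  qed
qed

lemma kernel_main_measurable: "(\<lambda>\<xi>. kernel_main \<xi> x) \<in> borel_measurable borel"
  by (rule borel_measurable_heat_integral) measurable

lemma kernel_rest_measurable: "(\<lambda>\<xi>. kernel_rest \<nu> \<xi> x) \<in> borel_measurable borel"
  by (rule borel_measurable_heat_integral) measurable

lemma kernel_grad_measurable: "(\<lambda>\<xi>. kernel_grad \<nu> \<xi> x) \<in> borel_measurable \<mu>"
  unfolding kernel_grad_def
  by (intro measurable_mu borel_measurable_times borel_measurable_add borel_measurable_const kernel_main_measurable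
      kernel_rest_measurable borel_measurable_inner borel_measurable_diff) measurable

definition weight :: "real^'m \<Rightarrow> real" where "weight x = (\<Prod>k\<in>K. (x $ k) powr (2 * \<alpha> k))"

lemma weight_tendsto: "u \<longlonglongrightarrow> t \<Longrightarrow> (\<lambda>n. weight (u n)) \<longlonglongrightarrow> weight t"
proof -
  assume u: "u \<longlonglongrightarrow> t"
  have "t $ k \<noteq> 0" if "k \<in> K" for k using t_ge[OF that] eps_pos by auto
  then show "(\<lambda>n. weight (u n)) \<longlonglongrightarrow> weight t"
    unfolding weight_def by (intro tendsto_prod tendsto_powr tendsto_vec_nth u tendsto_const) auto
qed

lemma weight_bound: "\<exists>B\<ge>0. \<forall>x\<in>near. \<bar>weight x\<bar> \<le> B"
proof (intro exI[of _ "\<Prod>k\<in>K. M powr (2 * \<alpha> k)"] conjI ballI)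
  show "0 \<le> (\<Prod>k\<in>K. M powr (2 * \<alpha> k))" by (intro prod_nonneg) auto
  fix x assume x: "x \<in> near"
  have xk: "0 < x $ k" "x $ k \<le> M" if "k \<in> K" for k using points_component[of x k] x near_points that by auto
  have "\<bar>weight x\<bar> = weight x" unfolding weight_def by (intro abs_of_nonneg prod_nonneg) auto
  also have "\<dots> \<le> (\<Prod>k\<in>K. M powr (2 * \<alpha> k))"
    unfolding weight_def
  proof (rule prod_mono)
    fix k assume k: "k \<in> K"
    show "0 \<le> x $ k powr (2 * \<alpha> k) \<and> x $ k powr (2 * \<alpha> k) \<le> M powr (2 * \<alpha> k)"
      using xk[OF k] alpha[OF k] by (simp add: powr_mono2)
  qed
  finally show "\<bar>weight x\<bar> \<le> (\<Prod>k\<in>K. M powr (2 * \<alpha> k))" .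
qed

definition sep :: real where
  "sep = (SOME h1. 0 < h1 \<and> (\<forall>h. \<bar>h\<bar> < h1 \<longrightarrow> t + h *\<^sub>R N t \<in> near \<and>
     (\<forall>\<xi>\<in>\<Gamma>. dist \<xi> t \<le> 2 * dist \<xi> (t + h *\<^sub>R N t) \<and> \<bar>h\<bar> \<le> 2 * dist \<xi> (t + h *\<^sub>R N t))))"

lemma sep_pos: "0 < sep"
  and sep_near: "\<bar>h\<bar> < sep \<Longrightarrow> t + h *\<^sub>R N t \<in> near"
  and sep_dist: "\<bar>h\<bar> < sep \<Longrightarrow> \<xi> \<in> \<Gamma> \<Longrightarrow> dist \<xi> t \<le> 2 * dist \<xi> (t + h *\<^sub>R N t)"
  and sep_height: "\<bar>h\<bar> < sep \<Longrightarrow> \<xi> \<in> \<Gamma> \<Longrightarrow> \<bar>h\<bar> \<le> 2 * dist \<xi> (t + h *\<^sub>R N t)"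
proof -
  have *: "0 < sep \<and> (\<forall>h. \<bar>h\<bar> < sep \<longrightarrow> t + h *\<^sub>R N t \<in> near \<and>
     (\<forall>\<xi>\<in>\<Gamma>. dist \<xi> t \<le> 2 * dist \<xi> (t + h *\<^sub>R N t) \<and> \<bar>h\<bar> \<le> 2 * dist \<xi> (t + h *\<^sub>R N t)))"
    unfolding sep_def by (rule someI_ex) (rule separation)
  show "0 < sep" using * by blast
  show "t + h *\<^sub>R N t \<in> near" if "\<bar>h\<bar> < sep" using * that by blast
  show "dist \<xi> t \<le> 2 * dist \<xi> (t + h *\<^sub>R N t)" if "\<bar>h\<bar> < sep" "\<xi> \<in> \<Gamma>" using * that by blast
  show "\<bar>h\<bar> \<le> 2 * dist \<xi> (t + h *\<^sub>R N t)" if "\<bar>h\<bar> < sep" "\<xi> \<in> \<Gamma>" using * that by blast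
qed

section \<open>Differentiating the potential off the surface\<close>

lemma layer_has_derivative:
  assumes h: "0 < \<bar>h\<bar>" "\<bar>h\<bar> < sep"
  shows "((\<lambda>\<eta>. simple_layer K \<alpha> \<Gamma> \<rho> (t + h *\<^sub>R N t + \<eta> *\<^sub>R N t)) has_real_derivative
      (\<integral>\<xi>. \<rho> \<xi> * kernel_grad (N t) \<xi> (t + h *\<^sub>R N t) \<partial>\<mu>)) (at 0)"
    and "integrable \<mu> (\<lambda>\<xi>. \<rho> \<xi> * kernel_grad (N t) \<xi> (t + h *\<^sub>R N t))"
proof -
  \<comment> \<open>The displaced height stays at least \<open>\<bar>h\<bar> / 2\<close> in absolute
    value and below \<open>sep\<close>.\<close>
  define e where "e = min (\<bar>h\<bar> / 2) (sep - \<bar>h\<bar>)"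
  have e: "0 < e" using h by (simp add: e_def)
  define X where "X \<eta> = t + h *\<^sub>R N t + \<eta> *\<^sub>R N t" for \<eta>
  have X_eq: "X \<eta> = t + (h + \<eta>) *\<^sub>R N t" for \<eta> by (simp add: X_def scaleR_add_left)
  \<comment> \<open>The height is at least \<open>\<bar>h\<bar> / 2\<close>, and
    \<open>sep_height\<close> loses another factor 2. All kernels are bounded at this distance, so
    constants dominate.\<close>
  define r0 where "r0 = \<bar>h\<bar> / 4"
  have r0: "0 < r0" using h by (simp add: r0_def)
  have hb: "\<bar>h + \<eta>\<bar> < sep" "\<bar>h\<bar> / 2 \<le> \<bar>h + \<eta>\<bar>" if "\<bar>\<eta>\<bar> < e" for \<eta>
    using that unfolding e_def by linarith+
  have near: "X \<eta> \<in> near" if "\<bar>\<eta>\<bar> < e" for \<eta> unfolding X_eq by (rule sep_near[OF hb(1)[OF that]])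
  have far: "r0 \<le> dist \<xi> (X \<eta>)" "\<xi> \<noteq> X \<eta>" if "\<bar>\<eta>\<bar> < e" "\<xi> \<in> \<Gamma>" for \<eta> \<xi>
  proof -
    show "r0 \<le> dist \<xi> (X \<eta>)"
      using sep_height[OF hb(1)[OF that(1)] that(2)] hb(2)[OF that(1)] unfolding X_eq r0_def by linarith
    then show "\<xi> \<noteq> X \<eta>" using r0 by auto
  qed
  obtain B where B: "0 \<le> B" and Bk: "\<And>\<nu> \<xi> x. norm \<nu> = 1 \<Longrightarrow> \<xi> \<in> points \<Longrightarrow> x \<in> near \<Longrightarrow> \<xi> \<noteq> x \<Longrightarrow>
     \<bar>kernel_main \<xi> x\<bar> \<le> B * dist \<xi> x powr (- real CARD('m)) \<and>
     \<bar>kernel_rest \<nu> \<xi> x\<bar> \<le> B * dist \<xi> x powr (2 - real CARD('m))"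
    using kernel_parts_bound by blast
  obtain D where D: "0 \<le> D" "\<And>\<xi>. \<xi> \<in> \<Gamma> \<Longrightarrow> \<bar>\<rho> \<xi>\<bar> \<le> D" using rho_bounded by blast
  define G where "G = \<bar>kernel_const K \<alpha>\<bar> * (2 * (2 * M) * (B * r0 powr (- real CARD('m))) + B * r0 powr (2 - real CARD('m)))"
  have grad: "\<bar>kernel_grad (N t) \<xi> (X \<eta>)\<bar> \<le> G" if \<eta>: "\<bar>\<eta>\<bar> < e" and \<xi>: "\<xi> \<in> \<Gamma>" for \<eta> \<xi>
  proof -
    have \<xi>p: "\<xi> \<in> points" using \<xi> Gamma_points by blast
    let ?r = "dist \<xi> (X \<eta>)"
    note k = Bk[OF norm_Nt \<xi>p near[OF \<eta>] far(2)[OF \<eta> \<xi>]]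
    have "?r powr (- real CARD('m)) \<le> r0 powr (- real CARD('m))"
      using far(1)[OF \<eta> \<xi>] r0 by (intro powr_mono2') auto
    then have k1: "\<bar>kernel_main \<xi> (X \<eta>)\<bar> \<le> B * r0 powr (- real CARD('m))"
      using conjunct1[OF k] B by (meson mult_left_mono order_trans)
    have "?r powr (2 - real CARD('m)) \<le> r0 powr (2 - real CARD('m))"
      using far(1)[OF \<eta> \<xi>] r0 card_gt2 by (intro powr_mono2') auto
    then have k2: "\<bar>kernel_rest (N t) \<xi> (X \<eta>)\<bar> \<le> B * r0 powr (2 - real CARD('m))"
      using conjunct2[OF k] B by (meson mult_left_mono order_trans)
    have "norm (\<xi> - X \<eta>) \<le> 2 * M"
      using norm_triangle_ineq4[of \<xi> "X \<eta>"] near_le[OF near[OF \<eta>]] \<xi>p by (simp add: points_def)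
    then have ip: "\<bar>(\<xi> - X \<eta>) \<bullet> N t\<bar> \<le> 2 * M"
      using Cauchy_Schwarz_ineq2[of "\<xi> - X \<eta>" "N t"] norm_Nt by simp
    have "\<bar>2 * ((\<xi> - X \<eta>) \<bullet> N t) * kernel_main \<xi> (X \<eta>) + kernel_rest (N t) \<xi> (X \<eta>)\<bar> \<le>
        \<bar>2 * ((\<xi> - X \<eta>) \<bullet> N t) * kernel_main \<xi> (X \<eta>)\<bar> + \<bar>kernel_rest (N t) \<xi> (X \<eta>)\<bar>" by (rule abs_triangle_ineq)
    also have "\<bar>2 * ((\<xi> - X \<eta>) \<bullet> N t) * kernel_main \<xi> (X \<eta>)\<bar> = 2 * \<bar>(\<xi> - X \<eta>) \<bullet> N t\<bar> * \<bar>kernel_main \<xi> (X \<eta>)\<bar>"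
      by (simp add: abs_mult)
    also have "2 * \<bar>(\<xi> - X \<eta>) \<bullet> N t\<bar> * \<bar>kernel_main \<xi> (X \<eta>)\<bar> + \<bar>kernel_rest (N t) \<xi> (X \<eta>)\<bar> \<le>
        2 * (2 * M) * (B * r0 powr (- real CARD('m))) + B * r0 powr (2 - real CARD('m))"
      using k1 k2 ip M_pos by (intro add_mono mult_mono) auto
    finally show ?thesis
      unfolding kernel_grad_def G_def abs_mult[of "kernel_const K \<alpha>"] by (intro mult_left_mono) auto
  qed
  have G0: "0 \<le> G" using grad[of 0 t] e t_Gamma by auto
  have qeq: "q_n K \<alpha> \<xi> (X \<eta>) = kernel_const K \<alpha> * heat_integral (real CARD('m) / 2 - 2) (heat_prod K \<alpha> \<xi> (X \<eta>)) ((dist \<xi> (X \<eta>))\<^sup>2)"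
    if \<eta>: "\<bar>\<eta>\<bar> < e" and \<xi>: "\<xi> \<in> \<Gamma>" for \<eta> \<xi>
    unfolding heat_integral_def
    using q_n_heat[OF _ _ far(2)[OF \<eta> \<xi>]] near[OF \<eta>] near_orthant \<xi> Gamma_orthant by blast
  define H where "H = \<bar>kernel_const K \<alpha>\<bar> * (prod_bound * (Gamma (real CARD('m) / 2 - 2 + 1) / (r0\<^sup>2 / 2) powr (real CARD('m) / 2 - 2 + 1)))"
  have qbound: "\<bar>q_n K \<alpha> \<xi> (X \<eta>)\<bar> \<le> H" if \<eta>: "\<bar>\<eta>\<bar> < e" and \<xi>: "\<xi> \<in> \<Gamma>" for \<eta> \<xi>
  proof -
    let ?p = "real CARD('m) / 2 - 2 + 1"
    have r: "r0\<^sup>2 / 2 \<le> (dist \<xi> (X \<eta>))\<^sup>2 / 2" using far(1)[OF \<eta> \<xi>] r0 by (simp add: power_mono)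
    have gp: "0 < Gamma ?p" using half_dim_gt by (intro Gamma_real_pos) simp
    have "\<bar>heat_integral (real CARD('m) / 2 - 2) (heat_prod K \<alpha> \<xi> (X \<eta>)) ((dist \<xi> (X \<eta>))\<^sup>2)\<bar> \<le>
        prod_bound * (Gamma ?p / ((dist \<xi> (X \<eta>))\<^sup>2 / 2) powr ?p)"
      using half_dim_gt far[OF \<eta> \<xi>] near[OF \<eta>] \<xi> Gamma_points
      by (intro heat_integral_bound(2) heat_prod_meas heat_prod_abs_le) auto
    also have "\<dots> \<le> prod_bound * (Gamma ?p / (r0\<^sup>2 / 2) powr ?p)"
      using r r0 gp prod_bound_nonneg half_dim_gt
      by (intro mult_left_mono divide_left_mono powr_mono2 mult_pos_pos) auto
    finally show ?thesis unfolding qeq[OF \<eta> \<xi>] H_def abs_mult by (intro mult_left_mono) auto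
  qed
  have qmeas: "(\<lambda>\<xi>. q_n K \<alpha> \<xi> (X \<eta>)) \<in> borel_measurable \<mu>" if \<eta>: "\<bar>\<eta>\<bar> < e" for \<eta>
  proof -
    have [measurable]: "(\<lambda>\<xi>. heat_integral (real CARD('m) / 2 - 2) (heat_prod K \<alpha> \<xi> (X \<eta>)) ((dist \<xi> (X \<eta>))\<^sup>2)) \<in> borel_measurable \<mu>"
      by (intro measurable_mu borel_measurable_heat_integral) measurable
    have "(\<lambda>\<xi>. kernel_const K \<alpha> * heat_integral (real CARD('m) / 2 - 2) (heat_prod K \<alpha> \<xi> (X \<eta>)) ((dist \<xi> (X \<eta>))\<^sup>2)) \<in> borel_measurable \<mu>"
      by measurable
    then show ?thesis by (subst measurable_cong[OF qeq[OF \<eta>]]) auto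
  qed
  have "((\<lambda>\<eta>. \<integral>\<xi>. \<rho> \<xi> * q_n K \<alpha> \<xi> (X \<eta>) \<partial>\<mu>) has_real_derivative (\<integral>\<xi>. \<rho> \<xi> * kernel_grad (N t) \<xi> (X 0) \<partial>\<mu>)) (at 0)"
  proof (rule has_real_derivative_integral[OF e, where f = "\<lambda>\<xi> \<eta>. \<rho> \<xi> * q_n K \<alpha> \<xi> (X \<eta>)"
        and f' = "\<lambda>\<xi> \<eta>. \<rho> \<xi> * kernel_grad (N t) \<xi> (X \<eta>)" and g = "\<lambda>_. D * G"])
    show "integrable \<mu> (\<lambda>_. D * G)" by simp
    fix \<eta> assume \<eta>: "\<bar>\<eta>\<bar> < e"
    show "integrable \<mu> (\<lambda>\<xi>. \<rho> \<xi> * q_n K \<alpha> \<xi> (X \<eta>))"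
    proof (rule density.integrable_const_bound[where B = "D * H"])
      show "AE \<xi> in \<mu>. norm (\<rho> \<xi> * q_n K \<alpha> \<xi> (X \<eta>)) \<le> D * H"
        using D qbound[OF \<eta>] by (intro AE_I2) (auto simp: abs_mult intro!: mult_mono)
      show "(\<lambda>\<xi>. \<rho> \<xi> * q_n K \<alpha> \<xi> (X \<eta>)) \<in> borel_measurable \<mu>" using qmeas[OF \<eta>] by measurable
    qed
    fix \<xi> assume "\<xi> \<in> space \<mu>"
    then have \<xi>: "\<xi> \<in> \<Gamma>" by simp
    have "((\<lambda>\<eta>'. q_n K \<alpha> \<xi> (X \<eta> + \<eta>' *\<^sub>R N t)) has_real_derivative kernel_grad (N t) \<xi> (X \<eta>)) (at 0)"
      using norm_Nt \<xi> Gamma_points near[OF \<eta>] far(2)[OF \<eta> \<xi>] by (intro q_n_has_derivative) auto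
    moreover have "X \<eta> + \<eta>' *\<^sub>R N t = X (\<eta>' + \<eta>)" for \<eta>' by (simp add: X_def scaleR_add_left)
    ultimately have "((\<lambda>\<eta>'. q_n K \<alpha> \<xi> (X (\<eta>' + \<eta>))) has_real_derivative kernel_grad (N t) \<xi> (X \<eta>)) (at 0)" by simp
    then have "((\<lambda>\<eta>. q_n K \<alpha> \<xi> (X \<eta>)) has_real_derivative kernel_grad (N t) \<xi> (X \<eta>)) (at \<eta>)"
      using DERIV_shift[of "\<lambda>\<eta>. q_n K \<alpha> \<xi> (X \<eta>)" _ 0 \<eta>] by simp
    then show "((\<lambda>\<eta>. \<rho> \<xi> * q_n K \<alpha> \<xi> (X \<eta>)) has_real_derivative \<rho> \<xi> * kernel_grad (N t) \<xi> (X \<eta>)) (at \<eta>)"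
      by (rule DERIV_cmult)
    show "\<bar>\<rho> \<xi> * kernel_grad (N t) \<xi> (X \<eta>)\<bar> \<le> D * G"
      unfolding abs_mult using D grad[OF \<eta> \<xi>] \<xi> by (intro mult_mono) auto
  qed
  then show "((\<lambda>\<eta>. simple_layer K \<alpha> \<Gamma> \<rho> (t + h *\<^sub>R N t + \<eta> *\<^sub>R N t)) has_real_derivative
      (\<integral>\<xi>. \<rho> \<xi> * kernel_grad (N t) \<xi> (t + h *\<^sub>R N t) \<partial>\<mu>)) (at 0)"
    unfolding simple_layer_def set_integral_mu X_def by simp
  show "integrable \<mu> (\<lambda>\<xi>. \<rho> \<xi> * kernel_grad (N t) \<xi> (t + h *\<^sub>R N t))"
  proof (rule density.integrable_const_bound[where B = "D * G"])
    show "AE \<xi> in \<mu>. norm (\<rho> \<xi> * kernel_grad (N t) \<xi> (t + h *\<^sub>R N t)) \<le> D * G"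
      using D grad[of 0] e by (intro AE_I2) (auto simp: abs_mult X_def intro!: mult_mono)
    show "(\<lambda>\<xi>. \<rho> \<xi> * kernel_grad (N t) \<xi> (t + h *\<^sub>R N t)) \<in> borel_measurable \<mu>"
      using kernel_grad_measurable by measurable
  qed
qed

section \<open>Splitting into a regular part and a Poisson part\<close>

abbreviation shifted :: "real \<Rightarrow> real \<Rightarrow> real^'m" where
  "shifted \<sigma> h \<equiv> t + (\<sigma> * h) *\<^sub>R N t"

text \<open>The weighted derivative of the kernel at \<open>x\<close>, except that the inner product
  is taken from \<open>t\<close> instead of \<open>x\<close>. At \<open>x = t\<close> it is
  \<open>K_n\<close>; otherwise the difference is the Poisson term proportional to the
  height.\<close>

definition regular_part :: "real^'m \<Rightarrow> real^'m \<Rightarrow> real" where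
  "regular_part \<xi> x = weight x * (kernel_const K \<alpha> * (2 * ((\<xi> - t) \<bullet> N t) * kernel_main \<xi> x + kernel_rest (N t) \<xi> x))"

lemma regular_part_measurable: "(\<lambda>\<xi>. regular_part \<xi> x) \<in> borel_measurable \<mu>"
  unfolding regular_part_def
  by (intro measurable_mu borel_measurable_times borel_measurable_add borel_measurable_const kernel_main_measurable
      kernel_rest_measurable borel_measurable_inner borel_measurable_diff) measurable

text \<open>Flatness improves the main term from order \<open>R powr (1 - m)\<close> to
  \<open>R powr (1 + \<kappa> - m)\<close>, and the rest is of order \<open>R powr (2 - m)\<close>.
  By \<open>sep_dist\<close> both hold uniformly in the height and are integrable over the
  surface.\<close>

lemma regular_part_bound:
  "\<exists>g. integrable \<mu> g \<and> (\<forall>\<xi>\<in>\<Gamma>. \<forall>h. \<xi> \<noteq> t \<longrightarrow> \<bar>h\<bar> < sep \<longrightarrow> \<bar>regular_part \<xi> (t + h *\<^sub>R N t)\<bar> \<le> g \<xi>)"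
proof -
  let ?m = "real CARD('m)"
  \<comment> \<open>Capping the exponent at 1 lets one power dominate both terms and keeps
    \<open>p\<close> positive; the surplus powers of \<open>R\<close> are bounded by powers of
    \<open>2 * M\<close>.\<close>
  define k' where "k' = min \<kappa> 1"
  have k': "0 < k'" "k' \<le> 1" "k' \<le> \<kappa>" using kappa_pos by (auto simp: k'_def)
  define p where "p = (?m - 1 - k') / 2"
  have m3: "3 \<le> ?m" using card_gt2 by simp
  have p: "0 < p" "p < real (CARD('m) - 1) / 2" unfolding real_k using k' m3 by (auto simp: p_def)
  obtain B where B: "0 \<le> B" and Bk: "\<And>\<nu> \<xi> x. norm \<nu> = 1 \<Longrightarrow> \<xi> \<in> points \<Longrightarrow> x \<in> near \<Longrightarrow> \<xi> \<noteq> x \<Longrightarrow>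
     \<bar>kernel_main \<xi> x\<bar> \<le> B * dist \<xi> x powr (- ?m) \<and> \<bar>kernel_rest \<nu> \<xi> x\<bar> \<le> B * dist \<xi> x powr (2 - ?m)"
    using kernel_parts_bound by blast
  obtain W where W: "0 \<le> W" "\<And>x. x \<in> near \<Longrightarrow> \<bar>weight x\<bar> \<le> W" using weight_bound by blast
  define c1 where "c1 = 2 * (a * 2 powr \<kappa>) * (2 * M) powr (\<kappa> - k') * (B * 2 powr ?m)"
  define c2 where "c2 = B * 2 powr (?m - 2) * (2 * M) powr (1 - k')"
  define C where "C = W * (\<bar>kernel_const K \<alpha>\<bar> * (c1 + c2))"
  show ?thesis
  proof (intro exI[of _ "\<lambda>\<xi>. C * ((dist \<xi> t)\<^sup>2) powr (- p)"] conjI ballI allI impI)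
    show "integrable \<mu> (\<lambda>\<xi>. C * ((dist \<xi> t)\<^sup>2) powr (- p))"
      by (intro integrable_mult_right density.integrable_powr p)
    fix \<xi> h assume \<xi>: "\<xi> \<in> \<Gamma>" "\<xi> \<noteq> t" and h: "\<bar>h\<bar> < sep"
    define x where "x = t + h *\<^sub>R N t"
    define R where "R = dist \<xi> t"
    define r where "r = dist \<xi> x"
    have R: "0 < R" using \<xi> by (simp add: R_def)
    have rR: "R / 2 \<le> r" using sep_dist[OF h \<xi>(1)] by (simp add: R_def r_def x_def)
    then have r: "0 < r" using R by simp
    have x: "x \<in> near" unfolding x_def by (rule sep_near[OF h])
    have \<xi>p: "\<xi> \<in> points" using \<xi> Gamma_points by blast
    have RM: "R \<le> 2 * M"
    proof -
      have "norm \<xi> \<le> M" "norm t \<le> M" using \<xi>p near_le[OF t_near] by (auto simp: points_def)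
      then show ?thesis using norm_triangle_ineq4[of \<xi> t] by (simp add: R_def dist_norm)
    qed
    have half: "(R / 2) powr (- q) = 2 powr q * R powr (- q)" for q
      using R by (simp add: powr_divide powr_minus field_simps)
    have ne: "\<xi> \<noteq> x" using r by (auto simp: r_def)
    have k: "\<bar>kernel_main \<xi> x\<bar> \<le> B * r powr (- ?m) \<and> \<bar>kernel_rest (N t) \<xi> x\<bar> \<le> B * r powr (2 - ?m)"
      unfolding r_def by (rule Bk[OF norm_Nt \<xi>p x ne])
    have "r powr (- ?m) \<le> (R / 2) powr (- ?m)" using rR R by (intro powr_mono2') auto
    then have km: "\<bar>kernel_main \<xi> x\<bar> \<le> B * (2 powr ?m * R powr (- ?m))"
      using conjunct1[OF k] B unfolding half by (meson mult_left_mono order_trans)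
    have "r powr (2 - ?m) \<le> (R / 2) powr (2 - ?m)" using rR R m3 by (intro powr_mono2') auto
    then have "\<bar>kernel_rest (N t) \<xi> x\<bar> \<le> B * (R / 2) powr (2 - ?m)"
      using conjunct2[OF k] B by (meson mult_left_mono order_trans)
    then have kr: "\<bar>kernel_rest (N t) \<xi> x\<bar> \<le> B * (2 powr (?m - 2) * R powr (- (?m - 2)))"
      using half[of "?m - 2"] by simp
    define z where "z = R powr (k' + 1 - ?m)"
    have zz: "((dist \<xi> t)\<^sup>2) powr (- p) = z"
    proof -
      have e: "2 * - p = k' + 1 - ?m" by (simp add: p_def field_simps)
      have "(R\<^sup>2) powr (- p) = (R powr 2) powr (- p)" using R by simp
      then show ?thesis unfolding powr_powr e R_def[symmetric] z_def .
    qed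
    have T2: "B * (2 powr (?m - 2) * R powr (- (?m - 2))) \<le> c2 * z"
    proof -
      have "R powr (- (?m - 2)) = R powr ((1 - k') + (k' + 1 - ?m))" by (simp add: algebra_simps)
      also have "\<dots> = R powr (1 - k') * z" unfolding z_def by (rule powr_add)
      also have "\<dots> \<le> (2 * M) powr (1 - k') * z"
        using R RM k' by (intro mult_right_mono powr_mono2) (auto simp: z_def)
      finally have "B * 2 powr (?m - 2) * R powr (- (?m - 2)) \<le> B * 2 powr (?m - 2) * ((2 * M) powr (1 - k') * z)"
        using B by (intro mult_left_mono) auto
      then show ?thesis by (simp only: c2_def mult.assoc)
    qed
    have dev: "\<bar>(\<xi> - t) \<bullet> N t\<bar> \<le> a * (2 * R) powr \<kappa> * R"
      unfolding R_def by (rule tangent_deviation[OF t_Gamma \<xi>(1)])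
    have T1: "2 * (a * (2 * R) powr \<kappa> * R) * (B * (2 powr ?m * R powr (- ?m))) \<le> c1 * z"
    proof -
      have "(2 * R) powr \<kappa> = 2 powr \<kappa> * R powr \<kappa>" using R by (simp add: powr_mult)
      moreover have "R powr \<kappa> * R * R powr (- ?m) = R powr (\<kappa> - k') * z"
      proof -
        have "R powr \<kappa> * R * R powr (- ?m) = R powr \<kappa> * R powr 1 * R powr (- ?m)" using R by simp
        also have "\<dots> = R powr ((\<kappa> - k') + (k' + 1 - ?m))" unfolding powr_add[symmetric] by (simp add: algebra_simps)
        also have "\<dots> = R powr (\<kappa> - k') * z" unfolding z_def by (rule powr_add)
        finally show ?thesis .
      qed
      moreover have "2 * (a * (2 powr \<kappa> * R powr \<kappa>) * R) * (B * (2 powr ?m * R powr (- ?m))) =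
          2 * (a * 2 powr \<kappa>) * (B * 2 powr ?m) * (R powr \<kappa> * R * R powr (- ?m))"
        by (simp only: mult_ac)
      ultimately have "2 * (a * (2 * R) powr \<kappa> * R) * (B * (2 powr ?m * R powr (- ?m))) =
          2 * (a * 2 powr \<kappa>) * (B * 2 powr ?m) * (R powr (\<kappa> - k') * z)"
        by (simp only:)
      also have "\<dots> \<le> 2 * (a * 2 powr \<kappa>) * (B * 2 powr ?m) * ((2 * M) powr (\<kappa> - k') * z)"
        using R RM k' B a_pos by (intro mult_left_mono mult_right_mono powr_mono2) (auto simp: z_def)
      finally show ?thesis by (simp only: c1_def mult_ac)
    qed
    have "\<bar>2 * ((\<xi> - t) \<bullet> N t) * kernel_main \<xi> x + kernel_rest (N t) \<xi> x\<bar> \<le>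
        \<bar>2 * ((\<xi> - t) \<bullet> N t) * kernel_main \<xi> x\<bar> + \<bar>kernel_rest (N t) \<xi> x\<bar>" by (rule abs_triangle_ineq)
    also have "\<bar>2 * ((\<xi> - t) \<bullet> N t) * kernel_main \<xi> x\<bar> = 2 * \<bar>(\<xi> - t) \<bullet> N t\<bar> * \<bar>kernel_main \<xi> x\<bar>" by (simp add: abs_mult)
    also have "\<dots> \<le> 2 * (a * (2 * R) powr \<kappa> * R) * (B * (2 powr ?m * R powr (- ?m)))"
      using dev km a_pos R by (intro mult_mono) auto
    finally have "\<bar>2 * ((\<xi> - t) \<bullet> N t) * kernel_main \<xi> x + kernel_rest (N t) \<xi> x\<bar> \<le> (c1 + c2) * z"
      using T1 T2 kr unfolding distrib_right by linarith
    then have "\<bar>regular_part \<xi> x\<bar> \<le> W * (\<bar>kernel_const K \<alpha>\<bar> * ((c1 + c2) * z))"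
      unfolding regular_part_def abs_mult[of "weight x"] abs_mult[of "kernel_const K \<alpha>"]
      using W(1) W(2)[OF x] by (intro mult_mono) auto
    then show "\<bar>regular_part \<xi> (t + h *\<^sub>R N t)\<bar> \<le> C * ((dist \<xi> t)\<^sup>2) powr (- p)"
      unfolding zz x_def[symmetric] C_def by (simp only: mult.assoc)
  qed
qed

lemma regular_part_tendsto:
  assumes \<sigma>: "\<bar>\<sigma>\<bar> = 1"
  shows "((\<lambda>h. \<integral>\<xi>. \<rho> \<xi> * regular_part \<xi> (shifted \<sigma> h) \<partial>\<mu>) \<longlongrightarrow> (\<integral>\<xi>. \<rho> \<xi> * regular_part \<xi> t \<partial>\<mu>)) (at_right 0)"
proof (subst tendsto_at_iff_sequentially, intro allI impI)
  fix X :: "nat \<Rightarrow> real" assume X0: "\<forall>i. X i \<in> {0<..} - {0}" and X: "X \<longlonglongrightarrow> 0"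
  from tendstoD[OF X sep_pos] obtain n0 where n0: "\<And>n. n0 \<le> n \<Longrightarrow> \<bar>X n\<bar> < sep"
    by (auto simp: eventually_sequentially)
  define u where "u n = shifted \<sigma> (X (n + n0))" for n
  have "(\<lambda>n. shifted \<sigma> (X n)) \<longlonglongrightarrow> t + (\<sigma> * 0) *\<^sub>R N t" by (intro tendsto_intros X)
  then have u: "u \<longlonglongrightarrow> t" unfolding u_def by (intro LIMSEQ_ignore_initial_segment) simp
  obtain g where g: "integrable \<mu> g" "\<And>\<xi> h. \<xi> \<in> \<Gamma> \<Longrightarrow> \<xi> \<noteq> t \<Longrightarrow> \<bar>h\<bar> < sep \<Longrightarrow> \<bar>regular_part \<xi> (t + h *\<^sub>R N t)\<bar> \<le> g \<xi>"
    using regular_part_bound by blast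
  obtain D where D: "0 \<le> D" "\<And>\<xi>. \<xi> \<in> \<Gamma> \<Longrightarrow> \<bar>\<rho> \<xi>\<bar> \<le> D" using rho_bounded by blast
  have "(\<lambda>n. \<integral>\<xi>. \<rho> \<xi> * regular_part \<xi> (u n) \<partial>\<mu>) \<longlonglongrightarrow> (\<integral>\<xi>. \<rho> \<xi> * regular_part \<xi> t \<partial>\<mu>)"
  proof (rule integral_dominated_convergence[where w = "\<lambda>\<xi>. D * g \<xi>"])
    show "integrable \<mu> (\<lambda>\<xi>. D * g \<xi>)" by (intro integrable_mult_right g)
    show "(\<lambda>\<xi>. \<rho> \<xi> * regular_part \<xi> t) \<in> borel_measurable \<mu>" using regular_part_measurable by measurable
    show "(\<lambda>\<xi>. \<rho> \<xi> * regular_part \<xi> (u n)) \<in> borel_measurable \<mu>" for n using regular_part_measurable by measurable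
    show "AE \<xi> in \<mu>. (\<lambda>n. \<rho> \<xi> * regular_part \<xi> (u n)) \<longlonglongrightarrow> \<rho> \<xi> * regular_part \<xi> t"
      using null_t AE_space
    proof eventually_elim
      case (elim \<xi>)
      then have "\<xi> \<in> points" "\<xi> \<noteq> t" using Gamma_points by auto
      then show ?case unfolding regular_part_def
        by (intro tendsto_mult tendsto_add tendsto_const weight_tendsto[OF u] kernel_main_tendsto[OF _ _ u]
            kernel_rest_tendsto[OF norm_Nt _ _ u])
    qed
    show "AE \<xi> in \<mu>. norm (\<rho> \<xi> * regular_part \<xi> (u n)) \<le> D * g \<xi>" for n
      using null_t AE_space
    proof eventually_elim
      case (elim \<xi>)
      have "\<bar>\<sigma> * X (n + n0)\<bar> < sep" using n0[of "n + n0"] \<sigma> by (simp add: abs_mult)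
      then have "\<bar>regular_part \<xi> (u n)\<bar> \<le> g \<xi>" unfolding u_def using elim by (intro g(2)) auto
      then show ?case using D elim by (auto simp: abs_mult intro!: mult_mono)
    qed
  qed
  then have "(\<lambda>n. ((\<lambda>h. \<integral>\<xi>. \<rho> \<xi> * regular_part \<xi> (shifted \<sigma> h) \<partial>\<mu>) \<circ> X) (n + n0)) \<longlonglongrightarrow> (\<integral>\<xi>. \<rho> \<xi> * regular_part \<xi> t \<partial>\<mu>)"
    by (simp add: u_def comp_def)
  then show "((\<lambda>h. \<integral>\<xi>. \<rho> \<xi> * regular_part \<xi> (shifted \<sigma> h) \<partial>\<mu>) \<circ> X) \<longlonglongrightarrow> (\<integral>\<xi>. \<rho> \<xi> * regular_part \<xi> t \<partial>\<mu>)"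
    by (rule LIMSEQ_offset)
qed

text \<open>The Poisson term divided by
  \<open>h * ((dist \<xi> t)\<^sup>2 + h\<^sup>2) powr (- m / 2)\<close>. The quotient is bounded
  and has a joint limit at \<open>t\<close>, as \<open>approximate_identity\<close> demands.\<close>

definition poisson_factor :: "real \<Rightarrow> real^'m \<Rightarrow> real \<Rightarrow> real" where
  "poisson_factor \<sigma> \<xi> h = \<rho> \<xi> * (2 * kernel_const K \<alpha> * weight (shifted \<sigma> h) * kernel_main \<xi> (shifted \<sigma> h)) *
     ((dist \<xi> t)\<^sup>2 + h\<^sup>2) powr (real CARD('m) / 2)"

lemma poisson_factor_measurable: "(\<lambda>\<xi>. poisson_factor \<sigma> \<xi> h) \<in> borel_measurable \<mu>"
proof -
  have [measurable]: "(\<lambda>\<xi>. kernel_main \<xi> (shifted \<sigma> h)) \<in> borel_measurable \<mu>" by (intro measurable_mu kernel_main_measurable)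
  have [measurable]: "(\<lambda>\<xi>. ((dist \<xi> t)\<^sup>2 + h\<^sup>2) powr (real CARD('m) / 2)) \<in> borel_measurable \<mu>" by (intro measurable_mu) measurable
  show ?thesis unfolding poisson_factor_def by measurable
qed

lemma poisson_factor_bound:
  assumes \<sigma>: "\<bar>\<sigma>\<bar> = 1"
  shows "\<exists>B. \<forall>\<xi>\<in>\<Gamma>. \<forall>h. 0 < h \<longrightarrow> h < sep \<longrightarrow> \<bar>poisson_factor \<sigma> \<xi> h\<bar> \<le> B"
proof -
  let ?m = "real CARD('m)"
  obtain B where B: "0 \<le> B" and Bk: "\<And>\<nu> \<xi> x. norm \<nu> = 1 \<Longrightarrow> \<xi> \<in> points \<Longrightarrow> x \<in> near \<Longrightarrow> \<xi> \<noteq> x \<Longrightarrow>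
     \<bar>kernel_main \<xi> x\<bar> \<le> B * dist \<xi> x powr (- ?m) \<and> \<bar>kernel_rest \<nu> \<xi> x\<bar> \<le> B * dist \<xi> x powr (2 - ?m)"
    using kernel_parts_bound by blast
  obtain W where W: "0 \<le> W" "\<And>x. x \<in> near \<Longrightarrow> \<bar>weight x\<bar> \<le> W" using weight_bound by blast
  obtain D where D: "0 \<le> D" "\<And>\<xi>. \<xi> \<in> \<Gamma> \<Longrightarrow> \<bar>\<rho> \<xi>\<bar> \<le> D" using rho_bounded by blast
  show ?thesis
  \<comment> \<open>The 8 comes from
    \<open>(dist \<xi> t)\<^sup>2 + h\<^sup>2 \<le> 8 * r\<^sup>2\<close>, since both distances are
    at most \<open>2 * r\<close>.\<close>
  proof (intro exI[of _ "D * (2 * \<bar>kernel_const K \<alpha>\<bar> * W) * (B * 8 powr (?m / 2))"] ballI allI impI)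
    fix \<xi> h assume \<xi>: "\<xi> \<in> \<Gamma>" and h: "0 < h" "h < sep"
    define x where "x = shifted \<sigma> h"
    define r where "r = dist \<xi> x"
    have hs: "\<bar>\<sigma> * h\<bar> < sep" "\<bar>\<sigma> * h\<bar> = h" using \<sigma> h by (auto simp: abs_mult)
    have R: "dist \<xi> t \<le> 2 * r" "h \<le> 2 * r"
      using sep_dist[OF hs(1) \<xi>] sep_height[OF hs(1) \<xi>] hs(2) by (auto simp: r_def x_def)
    have r: "0 < r" using R h by simp
    have ne: "\<xi> \<noteq> x" using r by (auto simp: r_def)
    have x: "x \<in> near" unfolding x_def by (rule sep_near[OF hs(1)])
    have "(dist \<xi> t)\<^sup>2 \<le> (2 * r)\<^sup>2" "h\<^sup>2 \<le> (2 * r)\<^sup>2" using R h by (intro power_mono; simp)+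
    then have "(dist \<xi> t)\<^sup>2 + h\<^sup>2 \<le> 8 * r\<^sup>2" by (simp add: power_mult_distrib)
    then have "((dist \<xi> t)\<^sup>2 + h\<^sup>2) powr (?m / 2) \<le> (8 * r\<^sup>2) powr (?m / 2)" by (intro powr_mono2) auto
    also have "\<dots> = 8 powr (?m / 2) * (r powr 2) powr (?m / 2)" using r by (simp add: powr_mult)
    also have "(r powr 2) powr (?m / 2) = r powr ?m" unfolding powr_powr by simp
    finally have Q: "((dist \<xi> t)\<^sup>2 + h\<^sup>2) powr (?m / 2) \<le> 8 powr (?m / 2) * r powr ?m" .
    have "\<bar>kernel_main \<xi> x\<bar> \<le> B * r powr (- ?m)"
      using Bk[OF norm_Nt _ x ne] \<xi> Gamma_points by (auto simp: r_def)
    then have "\<bar>kernel_main \<xi> x\<bar> * ((dist \<xi> t)\<^sup>2 + h\<^sup>2) powr (?m / 2) \<le> (B * r powr (- ?m)) * (8 powr (?m / 2) * r powr ?m)"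
      using Q B by (intro mult_mono) auto
    also have "\<dots> = B * 8 powr (?m / 2)" using r by (simp add: powr_minus field_simps)
    finally have kq: "\<bar>kernel_main \<xi> x\<bar> * ((dist \<xi> t)\<^sup>2 + h\<^sup>2) powr (?m / 2) \<le> B * 8 powr (?m / 2)" .
    have "\<bar>poisson_factor \<sigma> \<xi> h\<bar> = \<bar>\<rho> \<xi>\<bar> * (2 * \<bar>kernel_const K \<alpha>\<bar> * \<bar>weight x\<bar>) * (\<bar>kernel_main \<xi> x\<bar> * ((dist \<xi> t)\<^sup>2 + h\<^sup>2) powr (?m / 2))"
      unfolding poisson_factor_def x_def[symmetric] by (simp add: abs_mult)
    also have "\<dots> \<le> D * (2 * \<bar>kernel_const K \<alpha>\<bar> * W) * (B * 8 powr (?m / 2))"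
      by (rule mult_mono[OF mult_mono kq]) (use D W(1) W(2)[OF x] \<xi> B in \<open>auto intro!: mult_left_mono\<close>)
    finally show "\<bar>poisson_factor \<sigma> \<xi> h\<bar> \<le> D * (2 * \<bar>kernel_const K \<alpha>\<bar> * W) * (B * 8 powr (?m / 2))" .
  qed
qed

text \<open>The diagonal limit is normalized by the true distance \<open>r n\<close>, the Poisson
  kernel by \<open>R\<^sup>2 + h\<^sup>2\<close>. Their squares differ by twice the height times the
  deviation from the tangent plane, which is small against \<open>R\<^sup>2 + h\<^sup>2\<close> by
  \<open>tangent_deviation\<close>. The ratio tends to 1 whatever the relative speed of \<xi> and
  \<open>h\<close>.\<close>

lemma poisson_factor_sequence:
  assumes \<sigma>: "\<bar>\<sigma>\<bar> = 1" and \<xi>: "\<And>n. \<xi> n \<in> \<Gamma>" "\<xi> \<longlonglongrightarrow> t" and h: "\<And>n. 0 < h n" "\<And>n. h n < sep" "h \<longlonglongrightarrow> 0"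
  shows "(\<lambda>n. poisson_factor \<sigma> (\<xi> n) (h n)) \<longlonglongrightarrow> \<rho> t * (Gamma (real CARD('m) / 2) / (2 * pi powr (real CARD('m) / 2)))"
proof -
  let ?m = "real CARD('m)"
  define x where "x n = shifted \<sigma> (h n)" for n
  have "(\<lambda>n. shifted \<sigma> (h n)) \<longlonglongrightarrow> t + (\<sigma> * 0) *\<^sub>R N t" by (intro tendsto_intros h)
  then have x: "x \<longlonglongrightarrow> t" unfolding x_def by simp
  define R where "R n = dist (\<xi> n) t" for n
  define r where "r n = dist (\<xi> n) (x n)" for n
  have r: "0 < r n" for n
  proof -
    have "\<bar>\<sigma> * h n\<bar> < sep" "\<bar>\<sigma> * h n\<bar> = h n" using \<sigma> h(1)[of n] h(2)[of n] by (auto simp: abs_mult)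
    then have "h n \<le> 2 * r n" using sep_height[OF _ \<xi>(1)[of n], of "\<sigma> * h n"] by (simp add: r_def x_def)
    then show ?thesis using h(1)[of n] by linarith
  qed
  have ne: "\<xi> n \<noteq> x n" for n using r[of n] by (auto simp: r_def)
  have R0: "R \<longlonglongrightarrow> 0" unfolding R_def using \<xi>(2) by (rule iffD1[OF tendsto_dist_iff])
  define d where "d n = (\<xi> n - t) \<bullet> N t" for n
  define u where "u n = (r n)\<^sup>2 / ((R n)\<^sup>2 + (h n)\<^sup>2)" for n
  have den: "0 < (R n)\<^sup>2 + (h n)\<^sup>2" for n using h(1)[of n] by (simp add: add_nonneg_pos)
  have r2: "(r n)\<^sup>2 = (R n)\<^sup>2 - 2 * (\<sigma> * h n) * d n + (h n)\<^sup>2" for n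
  proof -
    have s2: "\<sigma> * \<sigma> = 1" using \<sigma> by (metis abs_mult_self_eq mult_1)
    have e: "\<xi> n - x n = (\<xi> n - t) - (\<sigma> * h n) *\<^sub>R N t" by (simp add: x_def)
    have "(r n)\<^sup>2 = (R n)\<^sup>2 - 2 * (\<sigma> * h n) * d n + (\<sigma> * h n) * (\<sigma> * h n)"
      unfolding r_def R_def d_def dist_norm power2_norm_eq_inner e
      using norm_Nt by (simp add: inner_diff_left inner_diff_right inner_commute norm_eq_1 algebra_simps)
    also have "(\<sigma> * h n) * (\<sigma> * h n) = (\<sigma> * \<sigma>) * (h n)\<^sup>2" by (simp add: power2_eq_square)
    finally show ?thesis unfolding s2 by simp
  qed
  have ub: "\<bar>u n - 1\<bar> \<le> a * (2 * R n) powr \<kappa>" for n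
  proof -
    have "u n - 1 = - (2 * (\<sigma> * h n) * d n) / ((R n)\<^sup>2 + (h n)\<^sup>2)"
    proof -
      define D where "D = (R n)\<^sup>2 + (h n)\<^sup>2"
      have "(r n)\<^sup>2 = D - 2 * (\<sigma> * h n) * d n" unfolding r2 D_def by simp
      moreover have "D \<noteq> 0" using den[of n] by (simp only: D_def)
      ultimately show ?thesis unfolding u_def D_def[symmetric] by (simp add: diff_divide_distrib)
    qed
    then have "\<bar>u n - 1\<bar> = 2 * h n * \<bar>d n\<bar> / ((R n)\<^sup>2 + (h n)\<^sup>2)"
      using den[of n] \<sigma> h(1)[of n] by (simp add: abs_mult)
    also have "\<dots> \<le> 2 * h n * (a * (2 * R n) powr \<kappa> * R n) / ((R n)\<^sup>2 + (h n)\<^sup>2)"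
      using tangent_deviation[OF t_Gamma \<xi>(1)[of n]] h(1)[of n] den[of n]
      unfolding d_def R_def by (intro divide_right_mono mult_left_mono) auto
    also have "\<dots> = a * (2 * R n) powr \<kappa> * (2 * R n * h n / ((R n)\<^sup>2 + (h n)\<^sup>2))" by simp
    also have "\<dots> \<le> a * (2 * R n) powr \<kappa> * 1"
      using sum_squares_bound[of "R n" "h n"] den[of n] a_pos by (intro mult_left_mono) auto
    finally show ?thesis by simp
  qed
  have Rnn: "0 \<le> R n" for n by (simp add: R_def)
  have "(\<lambda>n. a * (2 * R n) powr \<kappa>) \<longlonglongrightarrow> a * (2 * 0) powr \<kappa>"
    using kappa_pos Rnn by (intro tendsto_mult tendsto_const tendsto_powr' R0) auto
  then have "(\<lambda>n. u n - 1) \<longlonglongrightarrow> 0"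
    using ub by (intro Lim_null_comparison[of "\<lambda>n. u n - 1"]) auto
  then have u: "u \<longlonglongrightarrow> 1" by (simp add: LIM_zero_iff)
  have lim1: "(\<lambda>n. (1 / u n) powr (?m / 2)) \<longlonglongrightarrow> (1 / 1) powr (?m / 2)"
    by (intro tendsto_intros u) auto
  have lim2: "(\<lambda>n. r n ^ CARD('m) * kernel_main (\<xi> n) (x n)) \<longlonglongrightarrow>
      Gamma (?m / 2) * (\<Prod>k\<in>K. 4 powr (\<alpha> k - 1) * (t $ k * t $ k) powr (- \<alpha> k) * Gamma (1 - \<alpha> k))"
    using kernel_main_diagonal[OF \<xi>(2) x ne] unfolding r_def .
  have lim3: "(\<lambda>n. \<rho> (\<xi> n)) \<longlonglongrightarrow> \<rho> t"
    using \<xi> t_Gamma closure_subset[of \<Gamma>]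
    by (intro continuous_on_tendsto_compose[OF rho_cont \<xi>(2)]) (auto intro!: always_eventually)
  have lim4: "(\<lambda>n. weight (x n)) \<longlonglongrightarrow> weight t" by (rule weight_tendsto[OF x])
  have "(\<lambda>n. \<rho> (\<xi> n) * (2 * kernel_const K \<alpha> * weight (x n) * (r n ^ CARD('m) * kernel_main (\<xi> n) (x n))) * (1 / u n) powr (?m / 2))
      \<longlonglongrightarrow> \<rho> t * (2 * kernel_const K \<alpha> * weight t * (Gamma (?m / 2) * (\<Prod>k\<in>K. 4 powr (\<alpha> k - 1) * (t $ k * t $ k) powr (- \<alpha> k) * Gamma (1 - \<alpha> k)))) * (1 / 1) powr (?m / 2)"
    by (intro tendsto_mult tendsto_const lim1 lim2 lim3 lim4)
  also have "\<rho> t * (2 * kernel_const K \<alpha> * weight t * (Gamma (?m / 2) * (\<Prod>k\<in>K. 4 powr (\<alpha> k - 1) * (t $ k * t $ k) powr (- \<alpha> k) * Gamma (1 - \<alpha> k)))) * (1 / 1) powr (?m / 2)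
      = \<rho> t * (Gamma (?m / 2) / (2 * pi powr (?m / 2)))"
  proof -
    have "t \<in> orthant K" using t_Gamma Gamma_orthant by blast
    from kernel_constant[OF this] show ?thesis unfolding weight_def by simp
  qed
  finally show ?thesis
  proof (rule Lim_transform_eventually, intro always_eventually allI)
    fix n
    have "(r n)\<^sup>2 powr (?m / 2) = r n ^ CARD('m)"
    proof -
      have "(r n)\<^sup>2 powr (?m / 2) = (r n powr 2) powr (?m / 2)" using r[of n] by simp
      also have "\<dots> = r n powr ?m" unfolding powr_powr by simp
      also have "\<dots> = r n ^ CARD('m)" using r[of n] by (rule powr_realpow)
      finally show ?thesis .
    qed
    moreover have "(1 / u n) powr (?m / 2) = ((R n)\<^sup>2 + (h n)\<^sup>2) powr (?m / 2) / (r n)\<^sup>2 powr (?m / 2)"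
      unfolding u_def using den[of n] r[of n] by (simp add: powr_divide)
    ultimately have eqn: "r n ^ CARD('m) * (1 / u n) powr (?m / 2) = ((R n)\<^sup>2 + (h n)\<^sup>2) powr (?m / 2)"
      using r[of n] by simp
    show "\<rho> (\<xi> n) * (2 * kernel_const K \<alpha> * weight (x n) * (r n ^ CARD('m) * kernel_main (\<xi> n) (x n))) * (1 / u n) powr (?m / 2) = poisson_factor \<sigma> (\<xi> n) (h n)"
      unfolding poisson_factor_def x_def[symmetric] R_def[symmetric] eqn[symmetric] by (simp only: mult_ac)
  qed
qed

text \<open>Turns the sequential limit into the uniform form used by
  \<open>approximate_identity\<close>, by contradiction.\<close>

lemma poisson_factor_limit:
  assumes \<sigma>: "\<bar>\<sigma>\<bar> = 1" and \<epsilon>': "0 < \<epsilon>'"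
  shows "\<exists>\<delta>>0. \<forall>\<xi>\<in>space \<mu>. \<forall>h. (dist \<xi> t)\<^sup>2 < \<delta> \<longrightarrow> 0 < h \<longrightarrow> h < \<delta> \<longrightarrow>
    \<bar>poisson_factor \<sigma> \<xi> h - \<rho> t * (Gamma (real CARD('m) / 2) / (2 * pi powr (real CARD('m) / 2)))\<bar> < \<epsilon>'"
proof (rule ccontr)
  let ?f = "\<rho> t * (Gamma (real CARD('m) / 2) / (2 * pi powr (real CARD('m) / 2)))"
  assume neg: "\<not> ?thesis"
  define \<delta> where "\<delta> n = min (1 / real (Suc n)) sep" for n
  have \<delta>: "0 < \<delta> n" for n using sep_pos by (simp add: \<delta>_def)
  have "\<exists>\<xi> h. \<xi> \<in> \<Gamma> \<and> (dist \<xi> t)\<^sup>2 < \<delta> n \<and> 0 < h \<and> h < \<delta> n \<and> \<not> \<bar>poisson_factor \<sigma> \<xi> h - ?f\<bar> < \<epsilon>'" for n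
    using neg \<delta>[of n] unfolding space_mu by blast
  then obtain \<xi> h where \<xi>h: "\<And>n. \<xi> n \<in> \<Gamma> \<and> (dist (\<xi> n) t)\<^sup>2 < \<delta> n \<and> 0 < h n \<and> h n < \<delta> n \<and> \<not> \<bar>poisson_factor \<sigma> (\<xi> n) (h n) - ?f\<bar> < \<epsilon>'"
    by metis
  have lim: "(\<lambda>n. 1 / real (Suc n)) \<longlonglongrightarrow> 0" using LIMSEQ_inverse_real_of_nat by (simp add: inverse_eq_divide)
  have h0: "h \<longlonglongrightarrow> 0"
  proof (rule tendsto_sandwich[OF _ _ tendsto_const lim])
    show "\<forall>\<^sub>F n in sequentially. 0 \<le> h n" using \<xi>h by (intro always_eventually allI) (meson less_imp_le)
    show "\<forall>\<^sub>F n in sequentially. h n \<le> 1 / real (Suc n)"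
    proof (intro always_eventually allI)
      fix n show "h n \<le> 1 / real (Suc n)" using \<xi>h[of n] unfolding \<delta>_def by linarith
    qed
  qed
  have "(\<lambda>n. (dist (\<xi> n) t)\<^sup>2) \<longlonglongrightarrow> 0"
  proof (rule tendsto_sandwich[OF _ _ tendsto_const lim])
    show "\<forall>\<^sub>F n in sequentially. (dist (\<xi> n) t)\<^sup>2 \<le> 1 / real (Suc n)"
    proof (intro always_eventually allI)
      fix n show "(dist (\<xi> n) t)\<^sup>2 \<le> 1 / real (Suc n)" using \<xi>h[of n] unfolding \<delta>_def by linarith
    qed
  qed auto
  then have "(\<lambda>n. sqrt ((dist (\<xi> n) t)\<^sup>2)) \<longlonglongrightarrow> sqrt 0" by (rule tendsto_real_sqrt)
  then have "\<xi> \<longlonglongrightarrow> t" by (subst tendsto_dist_iff) simp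
  moreover have "h n < sep" for n using \<xi>h[of n] unfolding \<delta>_def by linarith
  ultimately have "(\<lambda>n. poisson_factor \<sigma> (\<xi> n) (h n)) \<longlonglongrightarrow> ?f"
    using \<xi>h h0 by (intro poisson_factor_sequence \<sigma>) blast+
  from tendstoD[OF this \<epsilon>'] obtain n where "\<bar>poisson_factor \<sigma> (\<xi> n) (h n) - ?f\<bar> < \<epsilon>'"
    by (auto simp: eventually_sequentially dist_real_def)
  then show False using \<xi>h[of n] by blast
qed

text \<open>The limiting mass \<pi>^(m/2) / \<Gamma>(m/2) meets the diagonal constant \<Gamma>(m/2)
  / (2 \<pi>^(m/2)), and their product is the 1/2 of the jump.\<close>

lemma singular_part_tendsto:
  assumes \<sigma>: "\<bar>\<sigma>\<bar> = 1"
  shows "((\<lambda>h. \<integral>\<xi>. h * ((dist \<xi> t)\<^sup>2 + h\<^sup>2) powr (- (real CARD('m) / 2)) * poisson_factor \<sigma> \<xi> h \<partial>\<mu>) \<longlongrightarrow> \<rho> t / 2) (at_right 0)"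
proof -
  obtain B where B: "\<And>\<xi> h. \<xi> \<in> \<Gamma> \<Longrightarrow> 0 < h \<Longrightarrow> h < sep \<Longrightarrow> \<bar>poisson_factor \<sigma> \<xi> h\<bar> \<le> B"
    using poisson_factor_bound[OF \<sigma>] by blast
  have e: "(real (CARD('m) - 1) + 1) / 2 = real CARD('m) / 2" unfolding real_k by simp
  have "((\<lambda>h. \<integral>\<xi>. h * ((dist \<xi> t)\<^sup>2 + h\<^sup>2) powr (- ((real (CARD('m) - 1) + 1) / 2)) * poisson_factor \<sigma> \<xi> h \<partial>\<mu>) \<longlongrightarrow>
      density.poisson_const * (\<rho> t * (Gamma (real CARD('m) / 2) / (2 * pi powr (real CARD('m) / 2))))) (at_right 0)"
    by (rule density.approximate_identity[OF sep_pos poisson_factor_measurable, where B = B])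
       (use B poisson_factor_limit[OF \<sigma>] in auto)
  moreover have "density.poisson_const * (\<rho> t * (Gamma (real CARD('m) / 2) / (2 * pi powr (real CARD('m) / 2)))) = \<rho> t / 2"
  proof -
    have "0 < Gamma (real CARD('m) / 2)" using half_dim_gt by (intro Gamma_real_pos) simp
    moreover have "0 < pi powr (real CARD('m) / 2)" by simp
    moreover have "(P / G) * (c * (G / (2 * P))) = c / 2" if "0 < G" "0 < P" for P G c :: real
      using that by simp
    ultimately show ?thesis unfolding poisson_const_eq by blast
  qed
  ultimately show ?thesis by (simp only: e)
qed

text \<open>The inner products of \<xi> - x and of \<xi> - t with the normal differ by
  \<open>\<sigma> * h\<close>. This is the only place where the side of approach enters.\<close>

lemma conormal_layer_eq:
  assumes \<sigma>: "\<bar>\<sigma>\<bar> = 1" and h: "0 < h" "h < sep"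
  shows "conormal K \<alpha> (N t) (simple_layer K \<alpha> \<Gamma> \<rho>) (shifted \<sigma> h) =
    (\<integral>\<xi>. \<rho> \<xi> * regular_part \<xi> (shifted \<sigma> h) \<partial>\<mu>) -
    \<sigma> * (\<integral>\<xi>. h * ((dist \<xi> t)\<^sup>2 + h\<^sup>2) powr (- (real CARD('m) / 2)) * poisson_factor \<sigma> \<xi> h \<partial>\<mu>)"
proof -
  let ?x = "shifted \<sigma> h"
  let ?P = "\<lambda>\<xi>. h * ((dist \<xi> t)\<^sup>2 + h\<^sup>2) powr (- (real CARD('m) / 2)) * poisson_factor \<sigma> \<xi> h"
  have hs: "0 < \<bar>\<sigma> * h\<bar>" "\<bar>\<sigma> * h\<bar> < sep" using \<sigma> h by (auto simp: abs_mult)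
  note der = layer_has_derivative[OF hs]
  have "conormal K \<alpha> (N t) (simple_layer K \<alpha> \<Gamma> \<rho>) ?x = weight ?x * (\<integral>\<xi>. \<rho> \<xi> * kernel_grad (N t) \<xi> ?x \<partial>\<mu>)"
    unfolding conormal_def weight_def using DERIV_imp_deriv[OF der(1)] by simp
  also have "\<dots> = (\<integral>\<xi>. weight ?x * (\<rho> \<xi> * kernel_grad (N t) \<xi> ?x) \<partial>\<mu>)" by simp
  finally have c: "conormal K \<alpha> (N t) (simple_layer K \<alpha> \<Gamma> \<rho>) ?x = (\<integral>\<xi>. weight ?x * (\<rho> \<xi> * kernel_grad (N t) \<xi> ?x) \<partial>\<mu>)" .
  have int1: "integrable \<mu> (\<lambda>\<xi>. weight ?x * (\<rho> \<xi> * kernel_grad (N t) \<xi> ?x))" by (intro integrable_mult_right der(2))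
  obtain B where B: "\<And>\<xi>. \<xi> \<in> \<Gamma> \<Longrightarrow> \<bar>poisson_factor \<sigma> \<xi> h\<bar> \<le> B"
    using poisson_factor_bound[OF \<sigma>] h by blast
  have int2: "integrable \<mu> ?P"
  proof (rule density.integrable_const_bound[where B = "h * (h\<^sup>2) powr (- (real CARD('m) / 2)) * B"])
    show "AE \<xi> in \<mu>. norm (?P \<xi>) \<le> h * (h\<^sup>2) powr (- (real CARD('m) / 2)) * B"
    proof (intro AE_I2)
      fix \<xi> assume \<xi>: "\<xi> \<in> space \<mu>"
      have "((dist \<xi> t)\<^sup>2 + h\<^sup>2) powr (- (real CARD('m) / 2)) \<le> (h\<^sup>2) powr (- (real CARD('m) / 2))"
        using h by (intro powr_mono2') auto
      then have "h * ((dist \<xi> t)\<^sup>2 + h\<^sup>2) powr (- (real CARD('m) / 2)) \<le> h * (h\<^sup>2) powr (- (real CARD('m) / 2))"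
        using h by (intro mult_left_mono) auto
      from mult_mono[OF this B[of \<xi>]] show "norm (?P \<xi>) \<le> h * (h\<^sup>2) powr (- (real CARD('m) / 2)) * B"
        using \<xi> h by (simp add: abs_mult)
    qed
    have [measurable]: "(\<lambda>\<xi>. ((dist \<xi> t)\<^sup>2 + h\<^sup>2) powr (- (real CARD('m) / 2))) \<in> borel_measurable \<mu>"
      by (intro measurable_mu) measurable
    show "?P \<in> borel_measurable \<mu>" using poisson_factor_measurable by measurable
  qed
  have "\<rho> \<xi> * regular_part \<xi> ?x = weight ?x * (\<rho> \<xi> * kernel_grad (N t) \<xi> ?x) + \<sigma> * ?P \<xi>" for \<xi>
  proof -
    have pos: "0 < (dist \<xi> t)\<^sup>2 + h\<^sup>2" using h by (simp add: add_nonneg_pos)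
    have P: "?P \<xi> = h * (\<rho> \<xi> * (2 * kernel_const K \<alpha> * weight ?x * kernel_main \<xi> ?x))"
    proof -
      have "?P \<xi> = h * (\<rho> \<xi> * (2 * kernel_const K \<alpha> * weight ?x * kernel_main \<xi> ?x)) *
          (((dist \<xi> t)\<^sup>2 + h\<^sup>2) powr (- (real CARD('m) / 2)) * ((dist \<xi> t)\<^sup>2 + h\<^sup>2) powr (real CARD('m) / 2))"
        unfolding poisson_factor_def by (simp only: mult_ac)
      also have "((dist \<xi> t)\<^sup>2 + h\<^sup>2) powr (- (real CARD('m) / 2)) * ((dist \<xi> t)\<^sup>2 + h\<^sup>2) powr (real CARD('m) / 2) = 1"
        using pos powr_add[of "(dist \<xi> t)\<^sup>2 + h\<^sup>2" "- (real CARD('m) / 2)" "real CARD('m) / 2"]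
        by (simp only: add.left_inverse powr_zero_eq_one less_imp_neq[symmetric] if_False)
      finally show ?thesis by simp
    qed
    have ip: "(\<xi> - ?x) \<bullet> N t = (\<xi> - t) \<bullet> N t - \<sigma> * h"
    proof -
      have "\<xi> - ?x = (\<xi> - t) - (\<sigma> * h) *\<^sub>R N t" by simp
      then show ?thesis using norm_Nt[unfolded norm_eq_1] by (simp only: inner_diff_left inner_scaleR_left mult_1_right)
    qed
    define km where "km = kernel_main \<xi> ?x"
    define kr where "kr = kernel_rest (N t) \<xi> ?x"
    show ?thesis unfolding P kernel_grad_def regular_part_def ip km_def[symmetric] kr_def[symmetric] by algebra
  qed
  then have "(\<integral>\<xi>. \<rho> \<xi> * regular_part \<xi> ?x \<partial>\<mu>) = (\<integral>\<xi>. weight ?x * (\<rho> \<xi> * kernel_grad (N t) \<xi> ?x) + \<sigma> * ?P \<xi> \<partial>\<mu>)"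
    by (simp only:)
  also have "\<dots> = (\<integral>\<xi>. weight ?x * (\<rho> \<xi> * kernel_grad (N t) \<xi> ?x) \<partial>\<mu>) + (\<integral>\<xi>. \<sigma> * ?P \<xi> \<partial>\<mu>)"
    by (rule Bochner_Integration.integral_add[OF int1 integrable_mult_right[OF int2]])
  also have "(\<integral>\<xi>. \<sigma> * ?P \<xi> \<partial>\<mu>) = \<sigma> * (\<integral>\<xi>. ?P \<xi> \<partial>\<mu>)" by (rule integral_mult_right_zero)
  finally show ?thesis unfolding c by simp
qed

text \<open>Off the diagonal \<open>kernel_K\<close> is an honest derivative and equals
  \<open>regular_part\<close> at \<open>t\<close>; the single point \<open>t\<close> is null for the
  surface measure.\<close>

lemma integral_kernel_K:
  "(LINT s:\<Gamma>|surface_measure. \<rho> s * kernel_K K \<alpha> N s t) = (\<integral>\<xi>. \<rho> \<xi> * regular_part \<xi> t \<partial>\<mu>)"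
  unfolding set_integral_mu
proof (rule integral_cong_AE)
  have eq: "kernel_K K \<alpha> N \<xi> t = regular_part \<xi> t" if "\<xi> \<in> \<Gamma>" "\<xi> \<noteq> t" for \<xi>
  proof -
    have "((\<lambda>h. q_n K \<alpha> \<xi> (t + h *\<^sub>R N t)) has_real_derivative kernel_grad (N t) \<xi> t) (at 0)"
      using that Gamma_points t_near norm_Nt by (intro q_n_has_derivative) auto
    then show ?thesis
      unfolding kernel_K_def conormal_def regular_part_def weight_def kernel_grad_def
      by (simp only: DERIV_imp_deriv)
  qed
  show "AE \<xi> in \<mu>. \<rho> \<xi> * kernel_K K \<alpha> N \<xi> t = \<rho> \<xi> * regular_part \<xi> t"
    using null_t AE_space by eventually_elim (simp add: eq)
  show "(\<lambda>\<xi>. \<rho> \<xi> * regular_part \<xi> t) \<in> borel_measurable \<mu>" using regular_part_measurable by measurable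
  have "{\<xi> \<in> space \<mu>. \<xi> = t} = {t}" using t_Gamma by auto
  then have [measurable]: "Measurable.pred \<mu> (\<lambda>\<xi>. \<xi> = t)" unfolding pred_def using sets_t by simp
  \<comment> \<open>At \<open>t\<close> itself \<open>kernel_K\<close> is a \<open>deriv\<close> at
    the singularity, some unspecified number; changing a measurable function at one point keeps it
    measurable.\<close>
  have "(\<lambda>\<xi>. \<rho> \<xi> * (if \<xi> = t then kernel_K K \<alpha> N t t else regular_part \<xi> t)) \<in> borel_measurable \<mu>"
    using regular_part_measurable by measurable
  then show "(\<lambda>\<xi>. \<rho> \<xi> * kernel_K K \<alpha> N \<xi> t) \<in> borel_measurable \<mu>"
    by (rule measurable_cong[THEN iffD1, rotated]) (use eq in auto)
qed

lemma conormal_jump: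
  assumes \<sigma>: "\<bar>\<sigma>\<bar> = 1"
  shows "((\<lambda>h. conormal K \<alpha> (N t) (simple_layer K \<alpha> \<Gamma> \<rho>) (shifted \<sigma> h)) \<longlongrightarrow>
    - \<sigma> * \<rho> t / 2 + (LINT s:\<Gamma>|surface_measure. \<rho> s * kernel_K K \<alpha> N s t)) (at_right 0)"
proof -
  have "((\<lambda>h. (\<integral>\<xi>. \<rho> \<xi> * regular_part \<xi> (shifted \<sigma> h) \<partial>\<mu>) -
    \<sigma> * (\<integral>\<xi>. h * ((dist \<xi> t)\<^sup>2 + h\<^sup>2) powr (- (real CARD('m) / 2)) * poisson_factor \<sigma> \<xi> h \<partial>\<mu>)) \<longlongrightarrow>
     (\<integral>\<xi>. \<rho> \<xi> * regular_part \<xi> t \<partial>\<mu>) - \<sigma> * (\<rho> t / 2)) (at_right 0)"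
    by (intro tendsto_diff tendsto_mult tendsto_const regular_part_tendsto[OF \<sigma>] singular_part_tendsto[OF \<sigma>])
  moreover have "\<forall>\<^sub>F h in at_right 0. (\<integral>\<xi>. \<rho> \<xi> * regular_part \<xi> (shifted \<sigma> h) \<partial>\<mu>) -
    \<sigma> * (\<integral>\<xi>. h * ((dist \<xi> t)\<^sup>2 + h\<^sup>2) powr (- (real CARD('m) / 2)) * poisson_factor \<sigma> \<xi> h \<partial>\<mu>) =
    conormal K \<alpha> (N t) (simple_layer K \<alpha> \<Gamma> \<rho>) (shifted \<sigma> h)"
    using sep_pos conormal_layer_eq[OF \<sigma>] by (intro eventually_at_rightI[of 0 sep]) auto
  ultimately have "((\<lambda>h. conormal K \<alpha> (N t) (simple_layer K \<alpha> \<Gamma> \<rho>) (shifted \<sigma> h)) \<longlongrightarrow>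
     (\<integral>\<xi>. \<rho> \<xi> * regular_part \<xi> t \<partial>\<mu>) - \<sigma> * (\<rho> t / 2)) (at_right 0)"
    by (rule Lim_transform_eventually)
  then show ?thesis unfolding integral_kernel_K by (simp add: add.commute)
qed

end

theorem theorem4:
  fixes K :: "'m::finite set" and \<alpha> :: "'m \<Rightarrow> real"
    and \<Omega> \<Gamma> :: "(real^'m) set" and N :: "real^'m \<Rightarrow> real^'m"
    and \<rho> :: "real^'m \<Rightarrow> real" and t :: "real^'m"
  assumes m_gt2: "CARD('m) > 2"
    and K_ne: "K \<noteq> {}"
    and alpha: "\<forall>k\<in>K. 0 < 2 * \<alpha> k \<and> 2 * \<alpha> k < 1"
    and dom: "open \<Omega>" "connected \<Omega>" "bounded \<Omega>" "\<Omega> \<noteq> {}" "\<Omega> \<subseteq> orthant K"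
    and Gamma_def: "\<Gamma> = frontier \<Omega> \<inter> orthant K"
    and faces: "\<forall>k\<in>K. frontier \<Omega> \<inter> {x. x $ k = 0} \<noteq> {}"
    and normal: "\<forall>x\<in>\<Gamma>. outer_unit_normal \<Omega> \<Gamma> x (N x)"
    and lyapunov: "\<exists>a \<kappa>. a > 0 \<and> \<kappa> > 0 \<and>
                    (\<forall>x\<in>\<Gamma>. \<forall>\<xi>\<in>\<Gamma>. arccos (N x \<bullet> N \<xi>) \<le> a * dist x \<xi> powr \<kappa>)"
    and right_angle: "\<forall>y\<in>closure \<Gamma>. \<forall>k\<in>K. y $ k = 0 \<longrightarrow>
                        ((\<lambda>x. N x $ k) \<longlongrightarrow> 0) (at y within \<Gamma>)"
    and rho_cont: "continuous_on (closure \<Gamma>) \<rho>"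
    and t: "t \<in> \<Gamma>"
  shows "((\<lambda>h. conormal K \<alpha> (N t) (simple_layer K \<alpha> \<Gamma> \<rho>) (t - h *\<^sub>R N t))
            \<longlongrightarrow> \<rho> t / 2 + (LINT s:\<Gamma>|surface_measure. \<rho> s * kernel_K K \<alpha> N s t)) (at_right 0) \<and>
         ((\<lambda>h. conormal K \<alpha> (N t) (simple_layer K \<alpha> \<Gamma> \<rho>) (t + h *\<^sub>R N t))
            \<longlongrightarrow> - \<rho> t / 2 + (LINT s:\<Gamma>|surface_measure. \<rho> s * kernel_K K \<alpha> N s t)) (at_right 0)"
proof -
  obtain a \<kappa> where a: "0 < a" "0 < \<kappa>" "\<And>x y. x \<in> \<Gamma> \<Longrightarrow> y \<in> \<Gamma> \<Longrightarrow> arccos (N x \<bullet> N y) \<le> a * dist x y powr \<kappa>"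
    using lyapunov by blast
  interpret surf: lyapunov_surface K \<Omega> \<Gamma> N a \<kappa>
    by unfold_locales (use m_gt2 dom Gamma_def normal a in auto)
  \<comment> \<open>Half the least distance of \<open>t\<close> from the hyperplanes, so that
    \<open>2 * \<epsilon> \<le> t $ k\<close>.\<close>
  define \<epsilon> where "\<epsilon> = Min ((\<lambda>k. t $ k) ` K) / 2"
  have tk: "0 < t $ k" if "k \<in> K" for k using t that by (auto simp: Gamma_def orthant_def)
  have eps: "0 < \<epsilon>" using K_ne tk by (auto simp: \<epsilon>_def)
  have eps_le: "2 * \<epsilon> \<le> t $ k" if "k \<in> K" for k using that by (auto simp: \<epsilon>_def)
  obtain M0 where M0: "\<And>x. x \<in> \<Gamma> \<Longrightarrow> norm x \<le> M0" using surf.bounded_Gamma by (auto simp: bounded_iff)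
  define M where "M = max M0 (norm t + \<epsilon>)"
  interpret surface_layer K \<Omega> \<Gamma> N a \<kappa> \<alpha> t \<epsilon> M \<rho>
  proof unfold_locales
    show "\<Gamma> \<subseteq> cball 0 M" using M0 by (force simp: M_def)
  qed (use m_gt2 K_ne alpha eps eps_le t rho_cont in \<open>auto simp: M_def\<close>)
  show ?thesis
    \<comment> \<open>\<open>\<sigma> = - 1\<close> is the approach from inside and
      \<open>\<sigma> = 1\<close> the one from outside.\<close>
    using conormal_jump[of "- 1"] conormal_jump[of 1] by simp
qed

end
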